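(* Let $d\ge1$, $r,\sigma>0$, $c=r\sigma$, let $\nu\ge0$ (and $\nu>0$ if $d=1$), and let $\alpha\in(0,1)$. Then for any $\beta\in(0,1-\alpha)$ and any $\mu\in(0,\nu+\frac{d-1}{2})$ there exist constants $\kappa_1=\kappa_1(c,d,r,\sigma,\alpha,\beta)>0$ and $\kappa_2=\kappa_2(c,d,r,\sigma,\alpha,\nu,\mu)>0$, depending only on the indicated parameters, such that the reconstruction estimate (E) of the context holds with these constants and, with the same constants, the following holds. Let $v_1,v_2$ be functions on $\mathbb{R}^d$ such that $v_1-v_2\in L^2(\mathbb{R}^d)$, $\operatorname{supp}(v_1-v_2)\subset B_\sigma$ and $v_1-v_2\in\mathcal{H}^\nu(\mathbb{R}^d)$. Suppose that $\|\hat v_1-\hat v_2\|_r\le\delta N$ for some $\delta\in(0,1)$ and $N>0$. Then $$\|v_1-v_2\|_{\mathcal{H}^{-(d-1)/2}(\mathbb{R}^d)}\le\kappa_1N\delta^\beta+\kappa_2\|v_1-v_2\|_{\mathcal{H}^\nu(\mathbb{R}^d)}\left(\log\delta^{-1}\right)^{-\mu}.$$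
   Context: $B_\rho:=\{q\in\mathbb{R}^d:|q|<\rho\}$. Functions are complex-valued. Fourier transform: $\hat v(p):=\frac{1}{(2\pi)^d}\int_{\mathbb{R}^d}e^{ipq}v(q)\,dq$; $\hat v_1-\hat v_2$ is the Fourier transform of $v_1-v_2$. For real $\eta$, $\mathcal{H}^\eta(\mathbb{R}^d)$ is the space of distributions with finite norm $\|v\|_{\mathcal{H}^\eta(\mathbb{R}^d)}:=\left(\int_{\mathbb{R}^d}(1+|p|^2)^\eta|\hat v(p)|^2dp\right)^{1/2}$. $\mathcal{L}^2_r:=\{w\in L^2(B_r):\|w\|_r<\infty\}$, $\|w\|_r:=\left(\int_{B_r}|p|^{1-d}|w(p)|^2dp\right)^{1/2}$. For $c>0$, $\mathcal{F}_c[f](x):=\int_{-1}^1e^{icxy}f(y)\,dy$ on $L^2([-1,1])$. Let $\mathbb{N}=\{0,1,\ldots\}$. Its eigenfunctions $(\psi_{j,c})_{j\in\mathbb{N}}$ (prolate spheroidal wave functions) are real-valued and form an orthonormal basis of $L^2([-1,1])$; the corresponding eigenvalues $(\mu_{j,c})_{j\in\mathbb{N}}$ are simple and non-zero, ordered so that $0<|\mu_{j+1,c}|<|\mu_{j,c}|$. For $n\in\mathbb{N}$, $\mathcal{F}_{n,c}^{-1}[w](y):=\sum_{j=0}^n\frac{1}{\mu_{j,c}}\psi_{j,c}(y)\int_{-1}^1\psi_{j,c}(x)w(x)\,dx$. For $\alpha,\delta\in(0,1)$, $n^*=n^*(c,\alpha,\delta):=\left\lfloor3+\tau\frac{ec}{4}\right\rfloor$,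 where $\tau\ge1$ is the solution of $\tau\log\tau=\frac{4}{ec}\alpha\log(\delta^{-1})$. Inverse Radon transform: $\mathcal{R}^{-1}[u](q):=\frac{1}{(2\pi)^{d-1}}\int_{\mathbb{S}^{d-1}}\int_0^{+\infty}e^{-is\theta q}\hat u(s,\theta)s^{d-1}\,ds\,d\theta$ with $\hat u(s,\theta):=\frac{1}{2\pi}\int_{\mathbb{R}}e^{ist}u(t,\theta)\,dt$, i.e. the inverse Fourier transform of $p\mapsto(2\pi)^{1-d}\hat u(|p|,p/|p|)$ in polar coordinates, understood in the $L^2$/tempered distribution sense when the integral does not converge absolutely; for $d=1$, $\mathbb{S}^0=\{-1,1\}$ with counting measure. Reconstruction estimate (E): for every $v\in L^2(\mathbb{R}^d)\cap\mathcal{H}^\nu(\mathbb{R}^d)$ with $\operatorname{supp}v\subset B_\sigma$, every $\delta\in(0,1)$, $N>0$ and every $w\in\mathcal{L}^2_r$ with $\|w-\hat v\|_r\le\delta N$, one has $\|v-v^\delta\|_{\mathcal{H}^{-(d-1)/2}(\mathbb{R}^d)}\le\kappa_1N\delta^\beta+\kappa_2\|v\|_{\mathcal{H}^\nu(\mathbb{R}^d)}(\log\delta^{-1})^{-\mu}$, where $v^\delta(q):=\mathcal{R}^{-1}[u_{r,\sigma}](\sigma^{-1}q)$, $u_{r,\sigma}(y,\theta):=\mathcal{F}_{n^*,c}^{-1}[w_{r,\theta}](y)$ if $y\in[-1,1]$ and $0$ otherwise, and $w_{r,\theta}(x):=(2\pi/\sigma)^dw(rx\theta)$ for $x\in[-1,1]$,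 $\theta\in\mathbb{S}^{d-1}$. *)

theory Defs
  imports "HOL-Analysis.Analysis"
begin

text \<open>
  The space $R^d$ is a type of class \<open>euclidean_space\<close>, with $d$ = \<open>DIM('a)\<close>. All integrals
  and measurability conditions refer to Lebesgue (not only Borel) measurable functions.
\<close>

definition square_integrable :: "'a::euclidean_space set \<Rightarrow> ('a \<Rightarrow> complex) \<Rightarrow> bool" where
  "square_integrable S f \<longleftrightarrow>
     f \<in> borel_measurable (lebesgue_on S) \<and> integrable (lebesgue_on S) (\<lambda>x. (cmod (f x))\<^sup>2)"

text \<open>The support of a class of functions modulo null sets, i.e. the distributional support.\<close>

definition ess_support :: "('a::euclidean_space \<Rightarrow> complex) \<Rightarrow> 'a set" where
  "ess_support f = - \<Union>{U. open U \<and> (AE x in lebesgue. x \<in> U \<longrightarrow> f x = 0)}"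

definition fourier :: "('a::euclidean_space \<Rightarrow> complex) \<Rightarrow> 'a \<Rightarrow> complex" where
  "fourier f p = complex_of_real (1 / (2 * pi) ^ DIM('a)) * (LINT q|lebesgue. cis (p \<bullet> q) * f q)"

definition inv_fourier :: "('a::euclidean_space \<Rightarrow> complex) \<Rightarrow> 'a \<Rightarrow> complex" where
  "inv_fourier g q = (LINT p|lebesgue. cis (- (p \<bullet> q)) * g p)"

primrec iter_deriv :: "'a list \<Rightarrow> ('a::euclidean_space \<Rightarrow> complex) \<Rightarrow> 'a \<Rightarrow> complex" where
  "iter_deriv [] f = f"
| "iter_deriv (b # bs) f = (\<lambda>x. frechet_derivative (iter_deriv bs f) (at x) b)"

definition schwartz :: "('a::euclidean_space \<Rightarrow> complex) \<Rightarrow> bool" where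
  "schwartz f \<longleftrightarrow> (\<forall>bs. set bs \<subseteq> Basis \<longrightarrow>
     iter_deriv bs f differentiable_on UNIV \<and>
     (\<forall>k::nat. bounded (range (\<lambda>x. (1 + norm x) ^ k *\<^sub>R iter_deriv bs f x))))"

text \<open>An increasing sequence of norms generating the topology of the Schwartz space.\<close>

definition schwartz_norm :: "nat \<Rightarrow> ('a::euclidean_space \<Rightarrow> complex) \<Rightarrow> real" where
  "schwartz_norm k f =
     (SUP (bs, x) \<in> {bs. set bs \<subseteq> Basis \<and> length bs \<le> k} \<times> UNIV.
        (1 + norm x) ^ k * cmod (iter_deriv bs f x))"

text \<open>
  A distribution is a functional on functions; only its values on Schwartz functions matter.
\<close>

type_synonym 'a distribution = "('a \<Rightarrow> complex) \<Rightarrow> complex"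

definition tempered :: "'a::euclidean_space distribution \<Rightarrow> bool" where
  "tempered T \<longleftrightarrow>
     (\<forall>f g. schwartz f \<longrightarrow> schwartz g \<longrightarrow> T (\<lambda>x. f x + g x) = T f + T g) \<and>
     (\<forall>a f. schwartz f \<longrightarrow> T (\<lambda>x. a * f x) = a * T f) \<and>
     (\<exists>C k. \<forall>f. schwartz f \<longrightarrow> cmod (T f) \<le> C * schwartz_norm k f)"

definition dist_of :: "('a::euclidean_space \<Rightarrow> complex) \<Rightarrow> 'a distribution" where
  "dist_of f \<phi> = (LINT q|lebesgue. f q * \<phi> q)"

text \<open>
  The Fourier transforms are symmetric for the bilinear pairing \<^const>\<open>dist_of\<close>, hence extend
  to distributions by transposition. Likewise \<open>dilate_dist s T\<close> is $T(s^{-1} q)$ for $s > 0$.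
\<close>

definition fourier_dist :: "'a::euclidean_space distribution \<Rightarrow> 'a distribution" where
  "fourier_dist T \<phi> = T (fourier \<phi>)"

definition inv_fourier_dist :: "'a::euclidean_space distribution \<Rightarrow> 'a distribution" where
  "inv_fourier_dist T \<phi> = T (inv_fourier \<phi>)"

definition dilate_dist :: "real \<Rightarrow> 'a::euclidean_space distribution \<Rightarrow> 'a distribution" where
  "dilate_dist s T \<phi> = complex_of_real (s ^ DIM('a)) * T (\<lambda>q. \<phi> (s *\<^sub>R q))"

definition represents :: "('a::euclidean_space \<Rightarrow> complex) \<Rightarrow> 'a distribution \<Rightarrow> bool" where
  "represents g T \<longleftrightarrow> g \<in> borel_measurable lebesgue \<and>
     (\<forall>\<phi>. schwartz \<phi> \<longrightarrow> integrable lebesgue (\<lambda>p. g p * \<phi> p) \<and> T \<phi> = dist_of g \<phi>)"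

definition sobolev_space :: "real \<Rightarrow> 'a::euclidean_space distribution set" where
  "sobolev_space \<eta> = {T. tempered T \<and>
     (\<exists>g. represents g (fourier_dist T) \<and>
          integrable lebesgue (\<lambda>p. (1 + (norm p)\<^sup>2) powr \<eta> * (cmod (g p))\<^sup>2))}"

text \<open>
  Meaningful only for members of the corresponding space; the representing function is unique
  up to a null set.
\<close>

definition sobolev_norm :: "real \<Rightarrow> 'a::euclidean_space distribution \<Rightarrow> real" where
  "sobolev_norm \<eta> T =
     (let g = (SOME g. represents g (fourier_dist T))
      in sqrt (LINT p|lebesgue. (1 + (norm p)\<^sup>2) powr \<eta> * (cmod (g p))\<^sup>2))"

definition data_space :: "real \<Rightarrow> ('a::euclidean_space \<Rightarrow> complex) set" where
  "data_space r = {w. square_integrable (ball 0 r) w \<and>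
     integrable (lebesgue_on (ball 0 r)) (\<lambda>p. norm p powi (1 - int DIM('a)) * (cmod (w p))\<^sup>2)}"

definition data_norm :: "real \<Rightarrow> ('a::euclidean_space \<Rightarrow> complex) \<Rightarrow> real" where
  "data_norm r w =
     sqrt (LINT p|lebesgue_on (ball 0 r). norm p powi (1 - int DIM('a)) * (cmod (w p))\<^sup>2)"

definition pswf_op :: "real \<Rightarrow> (real \<Rightarrow> complex) \<Rightarrow> real \<Rightarrow> complex" where
  "pswf_op c f x = (LINT y|lebesgue_on {-1..1}. cis (c * x * y) * f y)"

text \<open>
  \<open>pswf_system c \<psi> ev\<close> says that \<open>\<psi>\<close> is the sequence of prolate spheroidal wave functions
  (determined up to signs and null sets) and \<open>ev\<close> the sequence of their eigenvalues. Simplicity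
  of the eigenvalues follows from the strict ordering and the basis property.
\<close>

definition pswf_system :: "real \<Rightarrow> (nat \<Rightarrow> real \<Rightarrow> real) \<Rightarrow> (nat \<Rightarrow> complex) \<Rightarrow> bool" where
  "pswf_system c \<psi> ev \<longleftrightarrow>
     (\<forall>j. square_integrable {-1..1} (\<lambda>x. complex_of_real (\<psi> j x))) \<and>
     (\<forall>j k. (LINT x|lebesgue_on {-1..1}. \<psi> j x * \<psi> k x) = (if j = k then 1 else 0)) \<and>
     (\<forall>f. square_integrable {-1..1} f \<longrightarrow>
        (\<lambda>n. LINT x|lebesgue_on {-1..1}. (cmod (f x - (\<Sum>j<n.
            (LINT y|lebesgue_on {-1..1}. complex_of_real (\<psi> j y) * f y) * complex_of_real (\<psi> j x))))\<^sup>2)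
          \<longlonglongrightarrow> 0) \<and>
     (\<forall>j. AE x in lebesgue_on {-1..1}.
        pswf_op c (\<lambda>y. complex_of_real (\<psi> j y)) x = ev j * complex_of_real (\<psi> j x)) \<and>
     (\<forall>j. 0 < cmod (ev (Suc j)) \<and> cmod (ev (Suc j)) < cmod (ev j))"

definition pswf_inv ::
    "(nat \<Rightarrow> real \<Rightarrow> real) \<Rightarrow> (nat \<Rightarrow> complex) \<Rightarrow> nat \<Rightarrow> (real \<Rightarrow> complex) \<Rightarrow> real \<Rightarrow> complex" where
  "pswf_inv \<psi> ev n w y =
     (\<Sum>j\<le>n. 1 / ev j * complex_of_real (\<psi> j y) *
        (LINT x|lebesgue_on {-1..1}. complex_of_real (\<psi> j x) * w x))"

definition cutoff_tau :: "real \<Rightarrow> real \<Rightarrow> real \<Rightarrow> real" where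
  "cutoff_tau c \<alpha> \<delta> = (THE \<tau>. \<tau> \<ge> 1 \<and> \<tau> * ln \<tau> = 4 / (exp 1 * c) * \<alpha> * ln (1 / \<delta>))"

definition cutoff_index :: "real \<Rightarrow> real \<Rightarrow> real \<Rightarrow> nat" where
  "cutoff_index c \<alpha> \<delta> = nat \<lfloor>3 + cutoff_tau c \<alpha> \<delta> * (exp 1 * c / 4)\<rfloor>"

text \<open>
  Functions on $R \times S^{d-1}$ are curried, the second argument being meant to be a unit
  vector. The inverse Radon transform is the inverse Fourier transform, in the sense of
  distributions, of a function given in polar coordinates; its value at the origin is immaterial.
\<close>

definition radial_fourier :: "(real \<Rightarrow> 'a \<Rightarrow> complex) \<Rightarrow> real \<Rightarrow> 'a \<Rightarrow> complex" where
  "radial_fourier u s \<theta> = complex_of_real (1 / (2 * pi)) * (LINT t|lebesgue. cis (s * t) * u t \<theta>)"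

definition inv_radon :: "(real \<Rightarrow> 'a::euclidean_space \<Rightarrow> complex) \<Rightarrow> 'a distribution" where
  "inv_radon u = inv_fourier_dist (dist_of (\<lambda>p.
     complex_of_real (1 / (2 * pi) ^ (DIM('a) - 1)) * radial_fourier u (norm p) (p /\<^sub>R norm p)))"

definition ray_data :: "real \<Rightarrow> real \<Rightarrow> ('a::euclidean_space \<Rightarrow> complex) \<Rightarrow> 'a \<Rightarrow> real \<Rightarrow> complex" where
  "ray_data r \<sigma> w \<theta> x = complex_of_real ((2 * pi / \<sigma>) ^ DIM('a)) * w ((r * x) *\<^sub>R \<theta>)"

definition radon_approx ::
    "(nat \<Rightarrow> real \<Rightarrow> real) \<Rightarrow> (nat \<Rightarrow> complex) \<Rightarrow> real \<Rightarrow> real \<Rightarrow> real \<Rightarrow> real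
       \<Rightarrow> ('a::euclidean_space \<Rightarrow> complex) \<Rightarrow> real \<Rightarrow> 'a \<Rightarrow> complex" where
  "radon_approx \<psi> ev r \<sigma> \<alpha> \<delta> w y \<theta> =
     (if y \<in> {-1..1}
      then pswf_inv \<psi> ev (cutoff_index (r * \<sigma>) \<alpha> \<delta>) (ray_data r \<sigma> w \<theta>) y
      else 0)"

definition reconstruction ::
    "(nat \<Rightarrow> real \<Rightarrow> real) \<Rightarrow> (nat \<Rightarrow> complex) \<Rightarrow> real \<Rightarrow> real \<Rightarrow> real \<Rightarrow> real
       \<Rightarrow> ('a::euclidean_space \<Rightarrow> complex) \<Rightarrow> 'a distribution" where
  "reconstruction \<psi> ev r \<sigma> \<alpha> \<delta> w = dilate_dist \<sigma> (inv_radon (radon_approx \<psi> ev r \<sigma> \<alpha> \<delta> w))"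

end

theory Submission
 imports Defs "HOL-Probability.Probability" "HOL-Computational_Algebra.Polynomial"
begin

text \<open>
 Let $V(p) = \int v(q) e^{i p q / \sigma} dq$. The weight of the norm of $H^{-(d-1)/2}$ is at most
 $|p|^{1-d}$, and $|p|^{1-d} dp$ is the product of arc length and a measure on directions. So both
 estimates reduce to $L^2$ bounds on lines: for almost every direction $\theta$ the function
 $s \mapsto V(s \theta)$ is the Fourier transform of the Radon projection of $v$, which lives on
 $[-1,1]$; it is observed with noise for $|s| \le c$.

 Let $n$ be the cutoff index and $S = \eta (n + 1)$ with a small constant $\eta$. Frequencies above
 $S$ contribute at most a multiple of $S^{-m}$, $m = \nu + (d-1)/2$, because $v$ is in $H^\nu$
 (\<open>high_frequency_le\<close>). Frequencies up to $S$ are reached by extrapolation, at the cost of a factor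
 $K^{n+1} (n+1)^n$ for the noise and with an exponentially small truncation error. The definition of
 the cutoff index makes that factor smaller than $\delta^{\beta-1}$ up to a constant
 (\<open>noise_asymptotics\<close>), while $n$ grows like $\log \delta^{-1} / \log \log \delta^{-1}$, whence
 $n^{-m}$ is bounded by any weaker power $-\mu$ of the logarithm (\<open>cutoff_index_powr_le\<close>).

 For the reconstruction the extrapolation is the expansion in prolate functions. Its noise factor
 is the inverse of the last eigenvalue in use. To bound it, pick a step function with $n+1$ steps
 orthogonal to the first $n$ eigenfunctions: its transform is, up to a harmless factor, a polynomial
 of degree $n$ on an arc of the unit circle, so it cannot be small (\<open>pswf_ev_lower\<close>). The
 truncation error consists of the later coefficients of the projection; they are seen by testing the
 tail of the expansion against itself on the Fourier side (\<open>tail_coefficients_le\<close>), where the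
 transforms of late eigenfunctions are tiny at low frequencies (\<open>pswf_G_decay\<close>).

 The stability estimate has to hold whether or not a system of eigenfunctions is given. It uses
 Lagrange interpolation with $n+1$ nodes in $[0,c]$ instead, averaged over shifts of the nodes so that
 only the $L^2$ size of the data matters (\<open>square_extrapolation_le\<close>, \<open>low_frequency_le\<close>). The
 noise factor has the same form, so the same cutoff serves, and the constants of the theorem are sums of
 those of the two estimates.

 It remains to pass from functions to distributions. The difference of $v$ and its reconstruction
 has an explicit Fourier transform $g$ with $\int |p|^{1-d} |g(p)|^2 dp$ finite; this alone makes it a
 tempered distribution, and $g$ is its only representative because modulated Gaussians separate
 functions (\<open>sobolev_spaceI\<close>, \<open>represents_unique\<close>).
\<close>

text \<open>The unqualified names denote facts about the gauge integral.\<close>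

lemmas L_integrable_add = Bochner_Integration.integrable_add
 and L_integrable_bound = Bochner_Integration.integrable_bound
 and L_integrable_cong = Bochner_Integration.integrable_cong
 and L_integrable_diff = Bochner_Integration.integrable_diff
 and L_integrable_sum = Bochner_Integration.integrable_sum
 and L_integral_add = Bochner_Integration.integral_add
 and L_integral_cnj = Bochner_Integration.integral_cnj
 and L_integral_cong = Bochner_Integration.integral_cong
 and L_integral_diff = Bochner_Integration.integral_diff
 and L_integral_nonneg = Bochner_Integration.integral_nonneg
 and L_integral_norm_bound_integral = Bochner_Integration.integral_norm_bound_integral
 and L_integral_sum = Bochner_Integration.integral_sum

abbreviation ind :: "'a set => 'a => 'b::zero_neq_one" where "ind == indicator"

abbreviation bm :: "('a::topological_space => 'b::topological_space) set" where "bm == borel_measurable borel"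

abbreviation l2mass :: "('a::euclidean_space => complex) => ennreal" where
 "l2mass f == \<integral>\<^sup>+q. ennreal ((cmod (f q))^2) \<partial>lborel"

abbreviation hmass :: "real => ('a::euclidean_space => complex) => ennreal" where
 "hmass \<nu> f == \<integral>\<^sup>+p. ennreal ((1 + (norm p)^2) powr \<nu> * (cmod (f p))^2) \<partial>lborel"

abbreviation cor :: "real \<Rightarrow> complex" where "cor \<equiv> complex_of_real"

section \<open>Gaussian regularisation of Fourier integrals\<close>

lemma cis_measurable [measurable]: "cis \<in> bm" by (intro borel_measurable_continuous_onI continuous_intros)

lemma cmod_integral_le_nn_integral:
 fixes f :: "'a => complex"
 shows "ennreal (cmod (integral\<^sup>L M f)) <= (\<integral>\<^sup>+x. ennreal (cmod (f x)) \<partial>M)"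
 by (cases "integrable M f") (auto intro: integral_norm_bound_ennreal simp: not_integrable_integral_eq)

lemma nn_integral_lborel_affine:
 fixes f :: "'a::euclidean_space => ennreal"
 assumes [measurable]: "f \<in> bm" and "c \<noteq> 0"
 shows "(\<integral>\<^sup>+x. f x \<partial>lborel) = ennreal (\<bar>c\<bar> ^ DIM('a)) * (\<integral>\<^sup>+x. f (t + c *\<^sub>R x) \<partial>lborel)"
 by (subst lborel_affine[OF \<open>c \<noteq> 0\<close>, of t])
   (simp add: nn_integral_density nn_integral_distr nn_integral_cmult)

lemma integrable_lborel_affine:
 fixes f :: "'a::euclidean_space => 'b::{banach, second_countable_topology}"
 assumes f: "integrable lborel f" and "c \<noteq> 0"
 shows "integrable lborel (\<lambda>x. f (t + c *\<^sub>R x))"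
proof -
 have [measurable]: "f \<in> bm" using f by auto
 show ?thesis using f assms unfolding integrable_iff_bounded by (subst (asm) nn_integral_lborel_affine[where c=c and t=t])
    (auto simp: ennreal_mult_less_top)
qed

lemma integral_lborel_affine:
 fixes f :: "'a::euclidean_space => 'b::{banach, second_countable_topology}"
 assumes [measurable]: "f \<in> bm" and "c \<noteq> 0"
 shows "(LINT x|lborel. f x) = \<bar>c\<bar> ^ DIM('a) *\<^sub>R (LINT x|lborel. f (t + c *\<^sub>R x))"
 by (subst lborel_affine[OF \<open>c \<noteq> 0\<close>, of t])
   (simp add: integral_density integral_distr)

definition gauss :: "'a::euclidean_space => real" where
 "gauss x = exp (- (norm x)\<^sup>2 / 2)"

lemma gauss_pos [simp]: "0 < gauss x" "0 <= gauss x" by (simp_all add: gauss_def)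

lemma gauss_le_1: "gauss x <= 1" by (simp add: gauss_def)

lemma gauss_measurable [measurable]: "gauss \<in> bm" unfolding gauss_def[abs_def] by measurable

lemma gauss_prod: "gauss x = (\<Prod>b\<in>Basis. exp (- (x \<bullet> b)\<^sup>2 / 2))" unfolding gauss_def by (subst exp_sum[symmetric])
   (simp_all add: norm_eq_sqrt_inner euclidean_inner[of x x] power2_eq_square
    sum_nonneg sum_divide_distrib sum_negf)

lemma integral_gauss_1:
 fixes t :: real
 shows "integrable lborel (\<lambda>x::real. cis (t * x) * cor (exp (- x\<^sup>2 / 2)))"
  and "(LINT x|lborel. cis (t * x) * cor (exp (- x\<^sup>2 / 2))) = cor (sqrt (2 * pi) * exp (- t\<^sup>2 / 2))"
proof -
 interpret prob_space std_normal_distribution by (rule real_dist_normal_dist[THEN real_distribution.axioms(1)])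
 have 1: "integrable std_normal_distribution (\<lambda>x. cis (t * x))" by (rule integrable_const_bound[of _ 1]) auto
 have eq: "cis (t * x) * cor (exp (- x\<^sup>2 / 2)) = sqrt (2 * pi) * (std_normal_density x *\<^sub>R cis (t * x))" for x
  by (simp add: std_normal_density_def scaleR_conv_of_real)
 have "integrable lborel (\<lambda>x. std_normal_density x *\<^sub>R cis (t * x))" using 1 by (subst (asm) integrable_density) auto
 then show "integrable lborel (\<lambda>x::real. cis (t * x) * cor (exp (- x\<^sup>2 / 2)))" unfolding eq by (rule integrable_mult_right)
 have "char std_normal_distribution t = (LINT x|lborel. std_normal_density x *\<^sub>R cis (t * x))"
  unfolding char_def by (subst integral_density) (auto simp: cis_conv_exp)
 then have "(LINT x|lborel. std_normal_density x *\<^sub>R cis (t * x)) = cor (exp (- t\<^sup>2 / 2))"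
  by (simp add: char_std_normal_distribution exp_of_real)
 then show "(LINT x|lborel. cis (t * x) * cor (exp (- x\<^sup>2 / 2))) = cor (sqrt (2 * pi) * exp (- t\<^sup>2 / 2))"
  unfolding eq by (subst integral_mult_right_zero) simp
qed

lemma lborel_integral_prod:
 fixes f :: "'a::euclidean_space => real => complex"
 assumes int: "\<And>b. b \<in> Basis ==> integrable lborel (f b)"
 shows "integrable lborel (\<lambda>x::'a. \<Prod>b\<in>Basis. f b (x \<bullet> b))"
  and "(LINT x::'a|lborel. (\<Prod>b\<in>Basis. f b (x \<bullet> b))) = (\<Prod>b\<in>Basis. (LINT x|lborel. f b x))"
proof -
 interpret product_sigma_finite "\<lambda>b::'a. lborel :: real measure"
  by (rule product_sigma_finite.intro) (rule lborel.sigma_finite_measure_axioms)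
 have [measurable]: "\<And>b. b \<in> Basis ==> f b \<in> bm" using int by (auto dest: borel_measurable_integrable)
 let ?T = "\<lambda>f. \<Sum>b\<in>Basis. f b *\<^sub>R b :: 'a"
 let ?P = "\<Pi>\<^sub>M b\<in>(Basis::'a set). (lborel::real measure)"
 have eq: "(\<Prod>b\<in>Basis. f b (?T x \<bullet> b)) = (\<Prod>b\<in>Basis. f b (x b))" for x
  by (rule prod.cong) (auto simp: inner_sum_left inner_Basis if_distrib cong: if_cong)
 have m[measurable]: "(\<lambda>x::'a. \<Prod>b\<in>Basis. f b (x \<bullet> b)) \<in> bm" by measurable
 show "integrable lborel (\<lambda>x::'a. \<Prod>b\<in>Basis. f b (x \<bullet> b))" by (subst lborel_eq, subst integrable_distr_eq)
    (simp_all add: eq product_integrable_prod int)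
 show "(LINT x::'a|lborel. (\<Prod>b\<in>Basis. f b (x \<bullet> b))) = (\<Prod>b\<in>Basis. (LINT x|lborel. f b x))"
  by (subst lborel_eq, subst integral_distr)
    (simp_all add: eq product_integral_prod int)
qed

lemma integral_gauss:
 fixes t :: "'a::euclidean_space"
 shows "integrable lborel (\<lambda>x. cis (t \<bullet> x) * gauss x)"
  and "(LINT x|lborel. cis (t \<bullet> x) * gauss x) = sqrt (2 * pi) ^ DIM('a) * gauss t"
proof -
 have cs: "cis (t \<bullet> x) = (\<Prod>b\<in>Basis. cis ((t \<bullet> b) * (x \<bullet> b)))" for x
  by (simp add: cis_conv_exp exp_sum[symmetric] sum_distrib_left[symmetric] euclidean_inner[of t x])
 have eq: "cis (t \<bullet> x) * gauss x
   = (\<Prod>b\<in>Basis. cis ((t \<bullet> b) * (x \<bullet> b)) * cor (exp (- (x \<bullet> b)\<^sup>2 / 2)))" for x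
  unfolding cs gauss_prod by (simp add: prod.distrib)
 show "integrable lborel (\<lambda>x. cis (t \<bullet> x) * gauss x)" unfolding eq by (intro lborel_integral_prod integral_gauss_1)
 show "(LINT x|lborel. cis (t \<bullet> x) * gauss x) = sqrt (2 * pi) ^ DIM('a) * gauss t" unfolding eq
  by (subst lborel_integral_prod(2)[OF integral_gauss_1(1)])
    (simp_all only: integral_gauss_1(2) prod.distrib gauss_prod[of t] prod_constant of_real_mult of_real_power of_real_prod)
qed

lemma integrable_gauss [simp]: "integrable lborel (gauss :: 'a::euclidean_space => real)"
 and integral_gauss_real: "(LINT x::'a|lborel. gauss x) = sqrt (2 * pi) ^ DIM('a)"
proof -
 have *: "integrable lborel (\<lambda>x::'a. cor (gauss x))" using integral_gauss(1)[of "0::'a"] by simp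
 then show "integrable lborel (gauss :: 'a => real)" by (auto dest: integrable_Re)
 have "cor (LINT x::'a|lborel. gauss x) = cor (sqrt (2 * pi) ^ DIM('a))"
  using integral_gauss(2)[of "0::'a"] by (simp add: integral_of_real gauss_def)
 then show "(LINT x::'a|lborel. gauss x) = sqrt (2 * pi) ^ DIM('a)" by (simp only: of_real_eq_iff)
qed

lemma integral_gauss_scaled:
 fixes x :: "'a::euclidean_space"
 assumes "\<epsilon> > 0"
 shows "integrable lborel (\<lambda>p. cis (p \<bullet> x) * gauss (\<epsilon> *\<^sub>R p))"
  and "(LINT p|lborel. cis (p \<bullet> x) * gauss (\<epsilon> *\<^sub>R p))
   = (sqrt (2 * pi) / \<epsilon>) ^ DIM('a) * gauss (x /\<^sub>R \<epsilon>)"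
proof -
 have eq: "cis (p \<bullet> x) * gauss (\<epsilon> *\<^sub>R p)
   = (\<lambda>q. cis ((x /\<^sub>R \<epsilon>) \<bullet> q) * gauss q) (0 + \<epsilon> *\<^sub>R p)" for p
  using assms by (simp add: inner_commute field_simps)
 show "integrable lborel (\<lambda>p. cis (p \<bullet> x) * gauss (\<epsilon> *\<^sub>R p))"
  unfolding eq by (rule integrable_lborel_affine[OF integral_gauss(1)]) (use assms in auto)
 have "(LINT q|lborel. cis ((x /\<^sub>R \<epsilon>) \<bullet> q) * gauss q)
   = \<epsilon> ^ DIM('a) * (LINT p|lborel. cis (p \<bullet> x) * gauss (\<epsilon> *\<^sub>R p))" unfolding eq using assms
  by (subst integral_lborel_affine[of _ \<epsilon> 0]) (auto simp: scaleR_conv_of_real)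
 then show "(LINT p|lborel. cis (p \<bullet> x) * gauss (\<epsilon> *\<^sub>R p))
   = (sqrt (2 * pi) / \<epsilon>) ^ DIM('a) * gauss (x /\<^sub>R \<epsilon>)" unfolding integral_gauss(2) using assms by (simp add: field_simps)
qed

lemma (in pair_sigma_finite) integrable_product_bound:
 fixes f :: "'a \<times> 'b => 'c::{banach, second_countable_topology}" and g h :: "_ => real"
 assumes [measurable]: "f \<in> borel_measurable (M1 \<Otimes>\<^sub>M M2)"
  and g: "integrable M1 g" and h: "integrable M2 h"
  and le: "\<And>x y. norm (f (x, y)) <= g x * h y"
  and nn: "\<And>x. 0 <= g x" "\<And>y. 0 <= h y"
 shows "integrable (M1 \<Otimes>\<^sub>M M2) f" unfolding integrable_iff_bounded
proof
 have [measurable]: "g \<in> borel_measurable M1" "h \<in> borel_measurable M2" using g h by auto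
 have "(\<integral>\<^sup>+z. norm (f z) \<partial>(M1 \<Otimes>\<^sub>M M2)) <= (\<integral>\<^sup>+z. ennreal (g (fst z)) * ennreal (h (snd z)) \<partial>(M1 \<Otimes>\<^sub>M M2))"
  using le nn by (intro nn_integral_mono) (auto simp: ennreal_mult[symmetric] intro!: ennreal_leI)
 also have "... = (\<integral>\<^sup>+x. ennreal (g x) \<partial>M1) * (\<integral>\<^sup>+y. ennreal (h y) \<partial>M2)"
  by (subst M2.nn_integral_fst[symmetric])
    (simp_all add: nn_integral_cmult nn_integral_multc)
 also have "... < \<infinity>" using g h nn unfolding integrable_iff_bounded by (simp add: ennreal_mult_less_top)
 finally show "(\<integral>\<^sup>+z. norm (f z) \<partial>(M1 \<Otimes>\<^sub>M M2)) < \<infinity>" .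
qed simp

definition ft :: "('a::euclidean_space => complex) => 'a => complex" where
 "ft f p = (LINT q|lborel. cis (p \<bullet> q) * f q)"

lemma ft_measurable [measurable]:
 assumes [measurable]: "f \<in> bm"
 shows "ft f \<in> bm" unfolding ft_def[abs_def] by measurable

lemma integrable_cis_mult:
 fixes f :: "'a => complex"
 assumes "integrable M f" and [measurable]: "g \<in> borel_measurable M"
 shows "integrable M (\<lambda>x. cis (g x) * f x)" "integrable M (\<lambda>x. f x * cis (g x))"
 by (rule L_integrable_bound[OF assms(1)]; use assms in \<open>auto simp: norm_mult\<close>)+

lemma cmod_ft_le:
 assumes "integrable lborel f"
 shows "cmod (ft f p) <= (LINT q|lborel. cmod (f q))" unfolding ft_def by (rule order_trans[OF integral_norm_bound]) (simp add: norm_mult)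

lemma integrable_gauss_scaled:
 assumes "\<epsilon> > 0" shows "integrable lborel (\<lambda>p::'a::euclidean_space. gauss (\<epsilon> *\<^sub>R p))"
 using integrable_lborel_affine[OF integrable_gauss, of \<epsilon> 0] assms by simp

text \<open>
 Fubini and the known transform of a Gaussian: inserting a Gaussian factor into the inversion integral
 amounts to mollifying the function.
\<close>

lemma gauss_regularised_inversion:
 fixes \<xi> :: "'b::euclidean_space => complex"
 assumes \<xi>: "integrable lborel \<xi>" and \<epsilon>: "\<epsilon> > 0"
 shows "(LINT p|lborel. gauss (\<epsilon> *\<^sub>R p) * (ft \<xi> p * cis (- (p \<bullet> x))))
   = sqrt (2 * pi) ^ DIM('b) * (LINT z|lborel. gauss z * \<xi> (x + \<epsilon> *\<^sub>R z))"
proof -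
 have [measurable]: "\<xi> \<in> bm" using \<xi> by auto
 have int: "integrable (lborel \<Otimes>\<^sub>M lborel)
   (\<lambda>(p, y). gauss (\<epsilon> *\<^sub>R p) * (cis (p \<bullet> (y - x)) * \<xi> y))"
  by (rule lborel_pair.integrable_product_bound[where g="\<lambda>p. gauss (\<epsilon> *\<^sub>R p)" and h="\<lambda>y. cmod (\<xi> y)"])
    (use \<xi> \<epsilon> in \<open>auto simp: norm_mult intro: integrable_gauss_scaled\<close>)
 have "gauss (\<epsilon> *\<^sub>R p) * (ft \<xi> p * cis (- (p \<bullet> x)))
   = (LINT y|lborel. gauss (\<epsilon> *\<^sub>R p) * (cis (p \<bullet> (y - x)) * \<xi> y))" for p proof -
  have e: "cis (p \<bullet> (y - x)) * \<xi> y = cis (p \<bullet> y) * \<xi> y * cis (- (p \<bullet> x))" for y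
   by (simp add: inner_diff_right cis_mult)
  show ?thesis unfolding e ft_def by simp
 qed
 then have "(LINT p|lborel. gauss (\<epsilon> *\<^sub>R p) * (ft \<xi> p * cis (- (p \<bullet> x))))
   = (LINT p|lborel. LINT y|lborel. gauss (\<epsilon> *\<^sub>R p) * (cis (p \<bullet> (y - x)) * \<xi> y))" by (simp only:)
 also have "... = (LINT y|lborel. LINT p|lborel. gauss (\<epsilon> *\<^sub>R p) * (cis (p \<bullet> (y - x)) * \<xi> y))"
  using lborel_pair.Fubini_integral[OF int] by simp
 also have "... = (LINT y|lborel. \<xi> y * (LINT p|lborel. cis (p \<bullet> (y - x)) * gauss (\<epsilon> *\<^sub>R p)))"
  by (intro L_integral_cong refl)
    (subst integral_mult_right_zero[symmetric], simp only: mult_ac)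
 also have "... = (LINT y|lborel. \<xi> y * ((sqrt (2 * pi) / \<epsilon>) ^ DIM('b) * gauss ((y - x) /\<^sub>R \<epsilon>)))"
  by (simp add: integral_gauss_scaled[OF \<epsilon>])
 also have "... = \<bar>\<epsilon>\<bar> ^ DIM('b) *\<^sub>R (LINT z|lborel. \<xi> (x + \<epsilon> *\<^sub>R z) *
   ((sqrt (2 * pi) / \<epsilon>) ^ DIM('b) * gauss ((x + \<epsilon> *\<^sub>R z - x) /\<^sub>R \<epsilon>)))"
  by (rule integral_lborel_affine) (use \<epsilon> in auto)
 also have "... = (LINT z|lborel. sqrt (2 * pi) ^ DIM('b) * (gauss z * \<xi> (x + \<epsilon> *\<^sub>R z)))"
  using \<epsilon> by (subst integral_scaleR_right[symmetric]; intro L_integral_cong refl)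
    (simp add: scaleR_conv_of_real field_simps)
 finally show ?thesis by simp
qed

lemma gauss_regularised_pairing:
 fixes v :: "'a::euclidean_space => complex" and \<xi> :: "'b::euclidean_space => complex"
 assumes v: "integrable lborel v" and \<xi>: "integrable lborel \<xi>"
  and [measurable]: "L \<in> bm" and \<epsilon>: "\<epsilon> > 0"
 shows "(LINT p|lborel. gauss (\<epsilon> *\<^sub>R p) * (ft \<xi> p * (LINT q|lborel. v q * cis (- (p \<bullet> L q)))))
  = sqrt (2 * pi) ^ DIM('b) * (LINT q|lborel. v q * (LINT z|lborel. gauss z * \<xi> (L q + \<epsilon> *\<^sub>R z)))"
proof -
 have [measurable]: "v \<in> bm" "\<xi> \<in> bm" using v \<xi> by auto
 note inner = gauss_regularised_inversion[OF \<xi> \<epsilon>]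
 have int: "integrable (lborel \<Otimes>\<^sub>M lborel)
   (\<lambda>(p, q). gauss (\<epsilon> *\<^sub>R p) * (ft \<xi> p * (v q * cis (- (p \<bullet> L q)))))"
  by (rule lborel_pair.integrable_product_bound[where
     g="\<lambda>p. gauss (\<epsilon> *\<^sub>R p) * (LINT q|lborel. cmod (\<xi> q))" and h="\<lambda>y. cmod (v y)"])
    (use \<xi> v \<epsilon> in \<open>auto simp: norm_mult mult.assoc[symmetric] intro!: integrable_gauss_scaled mult_mono cmod_ft_le\<close>)
 have "(LINT p|lborel. gauss (\<epsilon> *\<^sub>R p) * (ft \<xi> p * (LINT q|lborel. v q * cis (- (p \<bullet> L q)))))
   = (LINT p|lborel. LINT q|lborel. gauss (\<epsilon> *\<^sub>R p) * (ft \<xi> p * (v q * cis (- (p \<bullet> L q)))))" by simp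
 also have "... = (LINT q|lborel. LINT p|lborel. gauss (\<epsilon> *\<^sub>R p) * (ft \<xi> p * (v q * cis (- (p \<bullet> L q)))))"
  using lborel_pair.Fubini_integral[OF int] by simp
 also have "... = (LINT q|lborel. v q * (LINT p|lborel. gauss (\<epsilon> *\<^sub>R p) * (ft \<xi> p * cis (- (p \<bullet> L q)))))"
  by (intro L_integral_cong refl)
    (subst integral_mult_right_zero[symmetric], simp only: mult_ac)
 also have "... = (LINT q|lborel. sqrt (2 * pi) ^ DIM('b) * (v q * (LINT z|lborel. gauss z * \<xi> (L q + \<epsilon> *\<^sub>R z))))"
  unfolding inner by (simp only: mult_ac)
 finally show ?thesis by simp
qed

lemma gauss_regularisation_tendsto:
 fixes \<xi> :: "'b::euclidean_space => complex"
 assumes [measurable]: "\<xi> \<in> bm" and B: "\<And>x. cmod (\<xi> x) <= B"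
  and c: "isCont \<xi> x"
 shows "(\<lambda>n. LINT z|lborel. gauss z * \<xi> (x + (1 / Suc n) *\<^sub>R z)) \<longlonglongrightarrow> sqrt (2 * pi) ^ DIM('b) * \<xi> x"
proof -
 have "(\<lambda>n. LINT z|lborel. gauss z * \<xi> (x + (1 / Suc n) *\<^sub>R z)) \<longlonglongrightarrow> (LINT z::'b|lborel. gauss z * \<xi> x)"
 proof (rule integral_dominated_convergence[where w="\<lambda>z::'b. gauss z * B"])
  show "AE z in lborel. (\<lambda>n. gauss z * \<xi> (x + (1 / Suc n) *\<^sub>R z)) \<longlonglongrightarrow> gauss z * \<xi> x" proof (rule AE_I2)
   fix z :: 'b
   have "(\<lambda>n. x + (1 / Suc n) *\<^sub>R z) \<longlonglongrightarrow> x + 0 *\<^sub>R z" using LIMSEQ_inverse_real_of_nat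
    by (intro tendsto_intros) (simp add: inverse_eq_divide)
   then have "(\<lambda>n. \<xi> (x + (1 / Suc n) *\<^sub>R z)) \<longlonglongrightarrow> \<xi> x" using c by (auto intro: isCont_tendsto_compose)
   then show "(\<lambda>n. gauss z * \<xi> (x + (1 / Suc n) *\<^sub>R z)) \<longlonglongrightarrow> gauss z * \<xi> x" by (rule tendsto_mult_left)
  qed
 qed (auto simp: norm_mult intro!: mult_left_mono B)
 moreover have "(LINT z::'b|lborel. gauss z * \<xi> x) = sqrt (2 * pi) ^ DIM('b) * \<xi> x" by (simp add: integral_gauss_real integral_of_real)
 ultimately show ?thesis by (simp only:)
qed

lemma cmod_gauss_regularisation_le:
 fixes \<xi> :: "'b::euclidean_space => complex"
 assumes B: "\<And>x. cmod (\<xi> x) <= B"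
 shows "cmod (LINT z|lborel. gauss z * \<xi> (x + \<epsilon> *\<^sub>R z)) <= sqrt (2 * pi) ^ DIM('b) * B"
proof (cases "integrable lborel (\<lambda>z. gauss z * \<xi> (x + \<epsilon> *\<^sub>R z))")
 case True
 have "cmod (LINT z|lborel. gauss z * \<xi> (x + \<epsilon> *\<^sub>R z)) <= (LINT z::'b|lborel. gauss z * B)"
  by (rule L_integral_norm_bound_integral[OF True]) (auto simp: norm_mult intro!: mult_left_mono B)
 then show ?thesis by (simp add: integral_gauss_real)
next
 case False
 have "0 <= B" by (rule order_trans[OF norm_ge_zero B])
 with False show ?thesis by (simp add: not_integrable_integral_eq)
qed

lemma sqrt_2pi_power: "sqrt (2 * pi) ^ n * sqrt (2 * pi) ^ n = (2 * pi) ^ n" by (simp only: power_mult_distrib[symmetric]) simp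

text \<open>
 A function $\xi$ that is continuous only where it is evaluated at the support of $v$ may be replaced by
 its Fourier integral: mollify $\xi$, use the regularised inversion formula and let the width of the
 Gaussian tend to zero. The map $L$ is a projection to a line or the identity.
\<close>

lemma cmod_pairing_le:
 fixes v :: "'a::euclidean_space => complex" and \<xi> :: "'b::euclidean_space => complex"
 assumes v: "integrable lborel v" and \<xi>: "integrable lborel \<xi>"
  and [measurable]: "L \<in> bm"
  and B: "\<And>x. cmod (\<xi> x) <= B"
  and c: "\<And>q. v q \<noteq> 0 ==> isCont \<xi> (L q)"
 shows "ennreal ((2 * pi) ^ DIM('b) * cmod (LINT q|lborel. v q * \<xi> (L q)))
  <= (\<integral>\<^sup>+p. ennreal (cmod (ft \<xi> p) * cmod (LINT q|lborel. v q * cis (- (p \<bullet> L q)))) \<partial>lborel)"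
  (is "_ <= ?R")
proof -
 have [measurable]: "v \<in> bm" "\<xi> \<in> bm" using v \<xi> by auto
 let ?Z = "sqrt (2 * pi) ^ DIM('b)"
 define I where "I n = (LINT q|lborel. v q * (LINT z|lborel. gauss z * \<xi> (L q + (1 / Suc n) *\<^sub>R z)))" for n
 have le: "ennreal (?Z * cmod (I n)) <= ?R" for n proof -
  have "?Z * cmod (I n) = cmod (?Z * I n)" by (simp add: norm_mult norm_power)
  also have "?Z * I n = (LINT p|lborel. gauss ((1 / Suc n) *\<^sub>R p) * (ft \<xi> p * (LINT q|lborel. v q * cis (- (p \<bullet> L q)))))"
   unfolding I_def by (subst gauss_regularised_pairing[OF v \<xi>]) auto
  also have "ennreal (cmod ...) <= (\<integral>\<^sup>+p. cmod (gauss ((1 / Suc n) *\<^sub>R p) * (ft \<xi> p * (LINT q|lborel. v q * cis (- (p \<bullet> L q))))) \<partial>lborel)"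
   by (rule cmod_integral_le_nn_integral)
  also have "... <= ?R" by (intro nn_integral_mono ennreal_leI) (auto simp: norm_mult intro!: mult_left_le_one_le gauss_le_1)
  finally show ?thesis .
 qed
 have "I \<longlonglongrightarrow> (LINT q|lborel. v q * (?Z * \<xi> (L q)))" unfolding I_def
 proof (rule integral_dominated_convergence[where w="\<lambda>q. cmod (v q) * (?Z * B)"])
  show "AE q in lborel. (\<lambda>n. v q * (LINT z|lborel. gauss z * \<xi> (L q + (1 / Suc n) *\<^sub>R z))) \<longlonglongrightarrow> v q * (?Z * \<xi> (L q))"
  proof (rule AE_I2)
   fix q
   show "(\<lambda>n. v q * (LINT z|lborel. gauss z * \<xi> (L q + (1 / Suc n) *\<^sub>R z))) \<longlonglongrightarrow> v q * (?Z * \<xi> (L q))"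
   proof (cases "v q = 0")
    case False
    then show ?thesis using gauss_regularisation_tendsto[OF _ B c] by (auto intro!: tendsto_mult_left)
   qed simp
  qed
 qed (use v in \<open>auto simp: norm_mult intro!: mult_left_mono cmod_gauss_regularisation_le B\<close>)
 then have lim: "(\<lambda>n. ennreal (?Z * cmod (I n))) \<longlonglongrightarrow> ennreal (?Z * cmod (LINT q|lborel. v q * (?Z * \<xi> (L q))))"
  by (intro tendsto_intros)
 have "ennreal (?Z * cmod (LINT q|lborel. v q * (?Z * \<xi> (L q)))) <= ?R" by (rule LIMSEQ_le_const2[OF lim]) (intro exI[of _ 0] allI impI le)
 moreover have "(LINT q|lborel. v q * (?Z * \<xi> (L q))) = ?Z * (LINT q|lborel. v q * \<xi> (L q))"
  by (subst integral_mult_right_zero[symmetric]) (simp only: mult_ac)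
 moreover have "?Z * cmod (cor ?Z * X) = (2 * pi) ^ DIM('b) * cmod X" for X proof -
  have "cmod (cor ?Z * X) = ?Z * cmod X" by (simp add: norm_mult norm_power)
  then show ?thesis by (simp only: mult.assoc[symmetric] sqrt_2pi_power)
 qed
 ultimately show ?thesis by (simp only:)
qed

lemma nn_integral_limit_le:
 fixes u :: "nat => 'a => ennreal"
 assumes "\<And>n. u n \<in> borel_measurable M" and lim: "\<And>x. x \<in> space M ==> (\<lambda>n. u n x) \<longlonglongrightarrow> f x"
  and le: "\<And>n. (\<integral>\<^sup>+x. u n x \<partial>M) <= C"
 shows "(\<integral>\<^sup>+x. f x \<partial>M) <= C"
proof -
 have "(\<integral>\<^sup>+x. f x \<partial>M) = (\<integral>\<^sup>+x. liminf (\<lambda>n. u n x) \<partial>M)"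
  by (intro nn_integral_cong) (metis lim lim_imp_Liminf sequentially_bot)
 also have "... <= liminf (\<lambda>n. \<integral>\<^sup>+x. u n x \<partial>M)" by (rule nn_integral_liminf) (use assms in auto)
 also have "... <= liminf (\<lambda>n. C)" by (rule Liminf_mono) (simp add: le)
 also have "... = C" by (simp add: Liminf_const)
 finally show ?thesis .
qed

lemma gauss_rescaled_tendsto: "(\<lambda>n. gauss ((1 / Suc n) *\<^sub>R p)) \<longlonglongrightarrow> 1"
proof -
 have "(\<lambda>n. exp (- (norm ((1 / Suc n) *\<^sub>R p))\<^sup>2 / 2)) \<longlonglongrightarrow> exp (- (norm ((0::real) *\<^sub>R p))\<^sup>2 / 2)"
  using LIMSEQ_inverse_real_of_nat by (intro tendsto_intros) (simp_all add: inverse_eq_divide)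
 then show ?thesis by (simp add: gauss_def)
qed

text \<open>
 Multiplying by a Gaussian makes all integrals converge; the inner double integral is then a mollified
 autocorrelation, which the Cauchy--Schwarz inequality bounds. Fatou removes the Gaussian.
\<close>

lemma plancherel_le:
 fixes f :: "'a::euclidean_space => complex"
 assumes f: "integrable lborel f"
 shows "(l2mass (ft f))
  <= ennreal ((2 * pi) ^ DIM('a)) * (l2mass f)"
proof (rule nn_integral_limit_le)
 have [measurable]: "f \<in> bm" using f by auto
 let ?Z = "sqrt (2 * pi) ^ DIM('a)"
 let ?F = "l2mass f"
 show "(\<lambda>p. ennreal (gauss ((1 / Suc n) *\<^sub>R p) * (cmod (ft f p))^2)) \<in> borel_measurable lborel" for n by measurable
 show "(\<lambda>n. ennreal (gauss ((1 / Suc n) *\<^sub>R p) * (cmod (ft f p))^2)) \<longlonglongrightarrow> ennreal ((cmod (ft f p))^2)" for p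
  using tendsto_mult_right[OF gauss_rescaled_tendsto, of p "(cmod (ft f p))^2"] by (intro tendsto_intros) simp
 fix n
 define \<epsilon> :: real where "\<epsilon> = 1 / Suc n"
 have \<epsilon>: "\<epsilon> > 0" by (simp add: \<epsilon>_def)
 have shift: "(\<integral>\<^sup>+q. ennreal (cmod (f q) * cmod (f (q + \<epsilon> *\<^sub>R z))) \<partial>lborel) <= ?F" for z proof -
  let ?G = "\<lambda>x. ennreal ((cmod (f x))^2 / 2)"
  have am: "a * b <= a^2 / 2 + b^2 / 2" for a b :: real using sum_squares_bound[of a b] by simp
  have "(\<integral>\<^sup>+q. ennreal (cmod (f q) * cmod (f (q + \<epsilon> *\<^sub>R z))) \<partial>lborel)
    <= (\<integral>\<^sup>+q. ?G q + ?G (q + \<epsilon> *\<^sub>R z) \<partial>lborel)"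
   by (intro nn_integral_mono) (simp add: ennreal_plus[symmetric] am del: ennreal_plus)
  also have "... = (\<integral>\<^sup>+q. ?G q \<partial>lborel) + (\<integral>\<^sup>+q. ?G (q + \<epsilon> *\<^sub>R z) \<partial>lborel)"
   by (intro nn_integral_add) auto
  also have "(\<integral>\<^sup>+q. ?G (q + \<epsilon> *\<^sub>R z) \<partial>lborel) = (\<integral>\<^sup>+q. ?G q \<partial>lborel)"
   by (subst (2) nn_integral_lborel_affine[of _ 1 "\<epsilon> *\<^sub>R z"]) (auto simp: add.commute)
  also have "(\<integral>\<^sup>+q. ?G q \<partial>lborel) + (\<integral>\<^sup>+q. ?G q \<partial>lborel) = ?F"
   by (subst nn_integral_add[symmetric]) (auto simp: ennreal_plus[symmetric] simp del: ennreal_plus)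
  finally show ?thesis .
 qed
 have swap: "(\<integral>\<^sup>+q. (\<integral>\<^sup>+z. ennreal (gauss z) * ennreal (cmod (f q) * cmod (f (q + \<epsilon> *\<^sub>R z))) \<partial>lborel) \<partial>lborel) <= ?Z * ?F"
 proof -
  have "(\<integral>\<^sup>+q. (\<integral>\<^sup>+z. ennreal (gauss z) * ennreal (cmod (f q) * cmod (f (q + \<epsilon> *\<^sub>R z))) \<partial>lborel) \<partial>lborel)
    = (\<integral>\<^sup>+z. (\<integral>\<^sup>+q. ennreal (gauss z) * ennreal (cmod (f q) * cmod (f (q + \<epsilon> *\<^sub>R z))) \<partial>lborel) \<partial>lborel)"
   by (rule lborel_pair.Fubini') measurable
  also have "... = (\<integral>\<^sup>+z. ennreal (gauss z) * (\<integral>\<^sup>+q. ennreal (cmod (f q) * cmod (f (q + \<epsilon> *\<^sub>R z))) \<partial>lborel) \<partial>lborel)"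
   by (intro nn_integral_cong nn_integral_cmult) measurable
  also have "... <= (\<integral>\<^sup>+z. ennreal (gauss (z::'a)) * ?F \<partial>lborel)"
   by (intro nn_integral_mono mult_left_mono shift) simp
  also have "... = ?Z * ?F" by (subst nn_integral_multc) (auto simp: nn_integral_eq_integral integral_gauss_real)
  finally show ?thesis .
 qed
 have cn: "(LINT q|lborel. cnj (f q) * cis (- (p \<bullet> q))) = cnj (ft f p)" for p
  unfolding ft_def by (subst L_integral_cnj[symmetric]) (simp add: cis_cnj mult.commute)
 have sq: "gauss (\<epsilon> *\<^sub>R p) * (ft f p * cnj (ft f p)) = cor (gauss (\<epsilon> *\<^sub>R p) * (cmod (ft f p))^2)" for p
  by (simp only: complex_norm_square[symmetric] of_real_mult)
 define C where "C = (LINT q|lborel. cmod (f q))"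
 have ge: "0 <= gauss (\<epsilon> *\<^sub>R p) * (cmod (ft f p))^2" for p by simp
 have int: "integrable lborel (\<lambda>p. gauss (\<epsilon> *\<^sub>R p) * (cmod (ft f p))^2)"
  by (rule L_integrable_bound[OF integrable_mult_left[OF integrable_gauss_scaled[OF \<epsilon>], of "C^2"]])
    (use cmod_ft_le[OF f] in \<open>auto simp: C_def intro!: mult_left_mono power_mono\<close>)
 have cf: "integrable lborel (\<lambda>x. cnj (f x))" using f by simp
 have "cor (LINT p|lborel. gauss (\<epsilon> *\<^sub>R p) * (cmod (ft f p))^2)
   = ?Z * (LINT q|lborel. cnj (f q) * (LINT z|lborel. gauss z * f (q + \<epsilon> *\<^sub>R z)))"
  using gauss_regularised_pairing[OF cf f measurable_ident \<epsilon>] unfolding id_def cn sq by (simp only: integral_complex_of_real)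
 then have "cmod (cor (LINT p|lborel. gauss (\<epsilon> *\<^sub>R p) * (cmod (ft f p))^2))
   = ?Z * cmod (LINT q|lborel. cnj (f q) * (LINT z|lborel. gauss z * f (q + \<epsilon> *\<^sub>R z)))" by (simp add: norm_mult norm_power)
 then have "(LINT p|lborel. gauss (\<epsilon> *\<^sub>R p) * (cmod (ft f p))^2)
   = ?Z * cmod (LINT q|lborel. cnj (f q) * (LINT z|lborel. gauss z * f (q + \<epsilon> *\<^sub>R z)))" by (simp add: integral_nonneg)
 then have "(\<integral>\<^sup>+p. ennreal (gauss (\<epsilon> *\<^sub>R p) * (cmod (ft f p))^2) \<partial>lborel)
   = ?Z * ennreal (cmod (LINT q|lborel. cnj (f q) * (LINT z|lborel. gauss z * f (q + \<epsilon> *\<^sub>R z))))"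
  using nn_integral_eq_integral[OF int] ge by (simp add: ennreal_mult)
 also have "... <= ?Z * (\<integral>\<^sup>+q. ennreal (cmod (cnj (f q) * (LINT z|lborel. gauss z * f (q + \<epsilon> *\<^sub>R z)))) \<partial>lborel)"
  by (intro mult_left_mono cmod_integral_le_nn_integral) simp
 also have "... <= ?Z * (\<integral>\<^sup>+q. (\<integral>\<^sup>+z. ennreal (gauss z) * ennreal (cmod (f q) * cmod (f (q + \<epsilon> *\<^sub>R z))) \<partial>lborel) \<partial>lborel)"
 proof (intro mult_left_mono nn_integral_mono)
  fix q
  have "ennreal (cmod (cnj (f q) * (LINT z|lborel. gauss z * f (q + \<epsilon> *\<^sub>R z))))
   = cmod (f q) * ennreal (cmod (LINT z|lborel. gauss z * f (q + \<epsilon> *\<^sub>R z)))" by (simp add: norm_mult ennreal_mult)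
  also have "... <= cmod (f q) * (\<integral>\<^sup>+z. ennreal (cmod (gauss z * f (q + \<epsilon> *\<^sub>R z))) \<partial>lborel)"
   by (intro mult_left_mono cmod_integral_le_nn_integral) simp
  also have "... = (\<integral>\<^sup>+z. ennreal (gauss z) * ennreal (cmod (f q) * cmod (f (q + \<epsilon> *\<^sub>R z))) \<partial>lborel)"
   by (subst nn_integral_cmult[symmetric])
     (auto simp: norm_mult ennreal_mult mult_ac intro!: nn_integral_cong)
  finally show "ennreal (cmod (cnj (f q) * (LINT z|lborel. gauss z * f (q + \<epsilon> *\<^sub>R z))))
   <= (\<integral>\<^sup>+z. ennreal (gauss z) * ennreal (cmod (f q) * cmod (f (q + \<epsilon> *\<^sub>R z))) \<partial>lborel)" .
 qed simp
 also have "... <= ennreal ?Z * (ennreal ?Z * ?F)" by (intro mult_left_mono swap) simp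
 also have "ennreal ?Z * (ennreal ?Z * ?F) = ennreal ((2 * pi) ^ DIM('a)) * ?F"
  by (simp only: mult.assoc[symmetric] sqrt_2pi_power ennreal_mult[symmetric] zero_le_power real_sqrt_ge_zero pi_ge_zero zero_le_numeral mult_nonneg_nonneg)
 finally show "(\<integral>\<^sup>+p. ennreal (gauss ((1 / Suc n) *\<^sub>R p) * (cmod (ft f p))^2) \<partial>lborel)
   <= ennreal ((2 * pi) ^ DIM('a)) * ?F" by (simp only: \<epsilon>_def)
qed

text \<open>Both sides are limits of the regularised inversion formula.\<close>

lemma fourier_inversion:
 fixes \<xi> :: "'b::euclidean_space => complex"
 assumes \<xi>: "integrable lborel \<xi>" and B: "\<And>x. cmod (\<xi> x) <= B" and c: "isCont \<xi> x"
  and ft: "integrable lborel (ft \<xi>)"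
 shows "(LINT p|lborel. ft \<xi> p * cis (- (p \<bullet> x))) = cor ((2 * pi) ^ DIM('b)) * \<xi> x"
proof (rule LIMSEQ_unique)
 have [measurable]: "\<xi> \<in> bm" using \<xi> by auto
 let ?Z = "cor (sqrt (2 * pi) ^ DIM('b))"
 show "(\<lambda>n. LINT p|lborel. gauss ((1 / Suc n) *\<^sub>R p) * (ft \<xi> p * cis (- (p \<bullet> x))))
   \<longlonglongrightarrow> (LINT p|lborel. ft \<xi> p * cis (- (p \<bullet> x)))"
 proof (rule integral_dominated_convergence[where w="\<lambda>p. cmod (ft \<xi> p)"])
  show "AE p in lborel. (\<lambda>n. gauss ((1 / Suc n) *\<^sub>R p) * (ft \<xi> p * cis (- (p \<bullet> x))))
    \<longlonglongrightarrow> ft \<xi> p * cis (- (p \<bullet> x))" proof (rule AE_I2)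
   fix p
   have "(\<lambda>n. cor (gauss ((1 / Suc n) *\<^sub>R p)) * (ft \<xi> p * cis (- (p \<bullet> x))))
    \<longlonglongrightarrow> cor 1 * (ft \<xi> p * cis (- (p \<bullet> x)))" by (intro tendsto_intros gauss_rescaled_tendsto)
   then show "(\<lambda>n. gauss ((1 / Suc n) *\<^sub>R p) * (ft \<xi> p * cis (- (p \<bullet> x))))
    \<longlonglongrightarrow> ft \<xi> p * cis (- (p \<bullet> x))" by (simp only: of_real_1 mult_1_left)
  qed
 qed (use ft in \<open>auto simp: norm_mult intro!: mult_left_le_one_le gauss_le_1\<close>)
 have "(\<lambda>n. ?Z * (LINT z|lborel. gauss z * \<xi> (x + (1 / Suc n) *\<^sub>R z))) \<longlonglongrightarrow> ?Z * (?Z * \<xi> x)"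
  using gauss_regularisation_tendsto[OF _ B c] by (intro tendsto_mult_left) simp
 moreover have "(LINT p|lborel. gauss ((1 / Suc n) *\<^sub>R p) * (ft \<xi> p * cis (- (p \<bullet> x))))
   = ?Z * (LINT z|lborel. gauss z * \<xi> (x + (1 / Suc n) *\<^sub>R z))" for n by (subst gauss_regularised_inversion[OF \<xi>]) auto
 moreover have "?Z * (?Z * \<xi> x) = cor ((2 * pi) ^ DIM('b)) * \<xi> x"
  by (simp only: mult.assoc[symmetric] of_real_mult[symmetric] sqrt_2pi_power)
 ultimately show "(\<lambda>n. LINT p|lborel. gauss ((1 / Suc n) *\<^sub>R p) * (ft \<xi> p * cis (- (p \<bullet> x))))
   \<longlonglongrightarrow> cor ((2 * pi) ^ DIM('b)) * \<xi> x" by (simp only:)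
qed

text \<open>
 Positive and negative part are densities of two finite measures that agree on boxes, and boxes form an
 intersection-stable generator.
\<close>

lemma integral_box_zero_imp_AE_zero:
 fixes g :: "'a::euclidean_space => real"
 assumes g: "integrable lborel g" and z: "\<And>a b. (LINT x|lborel. g x * ind (box a b) x) = 0"
 shows "AE x in lborel. g x = 0"
proof -
 have [measurable]: "g \<in> bm" using g by auto
 let ?p = "\<lambda>x. ennreal (max 0 (g x))" and ?n = "\<lambda>x. ennreal (max 0 (- g x))"
 have gp: "integrable lborel (\<lambda>x. max 0 (g x))" "integrable lborel (\<lambda>x. max 0 (- g x))" using g by auto
 have fin: "(\<integral>\<^sup>+x. ?p x \<partial>lborel) \<noteq> \<infinity>" using gp(1) by (subst nn_integral_eq_integral) auto
 have box: "emeasure (density lborel ?p) (box a b) = emeasure (density lborel ?n) (box a b)" for a b proof -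
  have i: "integrable lborel (\<lambda>x. max 0 (g x) * ind (box a b) x)"
    "integrable lborel (\<lambda>x. max 0 (- g x) * ind (box a b) x)" using gp by (auto intro!: integrable_real_mult_indicator)
  have "(LINT x|lborel. max 0 (g x) * ind (box a b) x) - (LINT x|lborel. max 0 (- g x) * ind (box a b) x)
    = (LINT x|lborel. max 0 (g x) * ind (box a b) x - max 0 (- g x) * ind (box a b) x)" using i by simp
  also have "... = (LINT x|lborel. g x * ind (box a b) x)" by (intro L_integral_cong) (auto simp: indicator_def)
  finally have eq: "(LINT x|lborel. max 0 (g x) * ind (box a b) x) = (LINT x|lborel. max 0 (- g x) * ind (box a b) x)" using z by simp
  have e: "emeasure (density lborel (\<lambda>x. ennreal (h x))) (box a b) = ennreal (LINT x|lborel. h x * ind (box a b) x)"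
   if "integrable lborel (\<lambda>x. h x * ind (box a b) x)" "\<And>x. 0 <= h x" "h \<in> bm" for h proof -
   have "emeasure (density lborel (\<lambda>x. ennreal (h x))) (box a b) = (\<integral>\<^sup>+x. ennreal (h x * ind (box a b) x) \<partial>lborel)"
    using that by (subst emeasure_density) (auto intro!: nn_integral_cong simp: indicator_def)
   also have "... = ennreal (LINT x|lborel. h x * ind (box a b) x)" using that by (intro nn_integral_eq_integral) auto
   finally show ?thesis .
  qed
  show ?thesis using e[OF i(1)] e[OF i(2)] eq by simp
 qed
 have "density lborel ?p = density lborel ?n" proof (rule measure_eqI_generator_eq)
  let ?E = "range (\<lambda>(a, b). box a b::'a set)"
  show "Int_stable ?E" by (auto simp: Int_stable_def box_Int_box)
  show "?E \<subseteq> Pow UNIV" "sets (density lborel ?p) = sigma_sets UNIV ?E" "sets (density lborel ?n) = sigma_sets UNIV ?E"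
   by (simp_all add: borel_eq_box)
  let ?A = "\<lambda>n::nat. box (- (real n *\<^sub>R One)) (real n *\<^sub>R One) :: 'a set"
  show "range ?A \<subseteq> ?E" "(\<Union>i. ?A i) = UNIV" unfolding UN_box_eq_UNIV by auto
  show "emeasure (density lborel ?p) (?A i) \<noteq> \<infinity>" for i proof -
   have "emeasure (density lborel ?p) (?A i) <= emeasure (density lborel ?p) (space (density lborel ?p))" by (rule emeasure_space)
   also have "... = (\<integral>\<^sup>+x. ?p x \<partial>lborel)" by (simp add: emeasure_density)
   finally show ?thesis using fin by (auto simp: top_unique)
  qed
  show "\<And>X. X \<in> ?E ==> emeasure (density lborel ?p) X = emeasure (density lborel ?n) X" using box by auto
 qed
 then have "AE x in lborel. ?p x = ?n x" using fin by (intro finite_density_unique[THEN iffD1]) auto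
 then show ?thesis proof (rule AE_mp, intro AE_I2 impI)
  fix x assume "?p x = ?n x"
  then have "max 0 (g x) = max 0 (- g x)" by (subst (asm) ennreal_inj) auto
  then show "g x = 0" by (auto simp: max_def split: if_splits)
 qed
qed

text \<open>
 Pairing with the indicator of a box is bounded by the Fourier transform, hence zero; the frontier,
 where the indicator is discontinuous, is a null set.
\<close>

lemma ft_eq_0_imp_AE_zero:
 fixes h :: "'a::euclidean_space => complex"
 assumes h: "integrable lborel h" and ft: "\<And>p. ft h p = 0"
 shows "AE x in lborel. h x = 0"
proof -
 have [measurable]: "h \<in> bm" using h by auto
 have box: "(LINT x|lborel. h x * cor (ind (box a b) x)) = 0" for a b proof -
  define v where "v x = (if x \<in> frontier (box a b) then 0 else h x)" for x
  have [measurable]: "frontier (box a b) \<in> sets borel" by (intro borel_closed frontier_closed)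
  then have [measurable]: "v \<in> bm" unfolding v_def[abs_def] by measurable
  have "frontier (box a b) \<in> null_sets lebesgue" using negligible_convex_frontier[OF convex_box(2)] by (simp add: negligible_iff_null_sets)
  then have "frontier (box a b) \<in> null_sets lborel" by (simp add: null_sets_completion_iff)
  then have AE: "AE x in lborel. v x = h x" by (rule AE_I'[where N="frontier (box a b)"]) (auto simp: v_def)
  have v: "integrable lborel v" using h by (subst integrable_cong_AE[OF _ _ AE]) auto
  have i: "integrable lborel (\<lambda>x. cor (ind (box a b) x))"
   by (intro integrable_of_real integrable_real_indicator) (auto simp: emeasure_lborel_box_finite[unfolded infinity_ennreal_def])
  have zero: "(LINT q|lborel. v q * cis (- (p \<bullet> q))) = 0" for p proof -
   have "(LINT q|lborel. v q * cis (- (p \<bullet> q))) = (LINT q|lborel. cis ((- p) \<bullet> q) * h q)"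
    by (rule integral_cong_AE) (use AE in \<open>auto elim: AE_mp\<close>)
   then show ?thesis using ft[of "- p"] by (simp add: ft_def)
  qed
  have "ennreal ((2 * pi) ^ DIM('a) * cmod (LINT q|lborel. v q * cor (ind (box a b) q)))
   <= (\<integral>\<^sup>+p. ennreal (cmod (ft (\<lambda>x. cor (ind (box a b) x)) p) * cmod (LINT q|lborel. v q * cis (- (p \<bullet> q)))) \<partial>lborel)"
  proof (rule cmod_pairing_le[OF v i, where B=1])
   fix q assume "v q \<noteq> 0"
   then have "q \<notin> frontier (box a b)" by (auto simp: v_def split: if_splits)
   then have "isCont (ind (box a b) :: 'a => real) q" by (simp add: isCont_indicator)
   then show "isCont (\<lambda>x. cor (ind (box a b) x)) q" by (intro continuous_intros)
  qed (auto simp: indicator_def)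
  then have "(LINT q|lborel. v q * cor (ind (box a b) q)) = 0" by (simp add: zero)
  moreover have "(LINT q|lborel. v q * cor (ind (box a b) q)) = (LINT q|lborel. h q * cor (ind (box a b) q))"
   by (rule integral_cong_AE) (use AE in \<open>auto elim: AE_mp\<close>)
  ultimately show ?thesis by simp
 qed
 have i: "integrable lborel (\<lambda>x. h x * cor (ind (box a b) x))" for a b by (rule L_integrable_bound[OF h]) (auto simp: indicator_def)
 have "(LINT x|lborel. Re (h x) * ind (box a b) x) = 0" for a b using arg_cong[OF box[of a b], of Re] by (simp add: integral_Re[OF i, symmetric])
 moreover have "(LINT x|lborel. Im (h x) * ind (box a b) x) = 0" for a b
  using arg_cong[OF box[of a b], of Im] by (simp add: integral_Im[OF i, symmetric])
 ultimately have "AE x in lborel. Re (h x) = 0" "AE x in lborel. Im (h x) = 0" using h by (auto intro!: integral_box_zero_imp_AE_zero)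
 then show ?thesis by eventually_elim (simp add: complex_eq_iff)
qed

definition cutoff :: "real => 'a::euclidean_space => real" where
 "cutoff \<sigma> x = max 0 (min 1 (2 - norm x / \<sigma>))"

text \<open>
 A function supported in a fixed ball equals its product with a continuous cutoff. Hence pairing it
 with a bounded function is pairing it with a function in L2, and the Cauchy--Schwarz inequality on
 the Fourier side needs only the easy half of the Plancherel theorem.
\<close>

lemma bounded_pairing_le:
 fixes \<sigma> :: real
 assumes \<sigma>: "\<sigma> > 0"
 obtains C where "C \<ge> 0" and "\<And>(v :: 'a::euclidean_space => complex) m B. integrable lborel v ==>
   (\<And>x. x \<notin> ball 0 \<sigma> ==> v x = 0) ==> continuous_on UNIV m ==> (\<And>x. x \<in> cball 0 (2 * \<sigma>) ==> cmod (m x) <= B) ==>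
   ennreal ((cmod (LINT q|lborel. v q * m q))^2) <= ennreal (C * B^2) * (l2mass (ft v))"
proof -
 let ?K = "\<integral>\<^sup>+x. ennreal ((cutoff \<sigma> (x::'a))^2) \<partial>lborel"
 have cut: "0 <= cutoff \<sigma> x" "cutoff \<sigma> x <= 1" for x :: 'a by (auto simp: cutoff_def)
 have cut0: "cutoff \<sigma> x = 0" if "x \<notin> cball 0 (2 * \<sigma>)" for x :: 'a proof -
  have "2 * \<sigma> < norm x" using that by simp
  then have "2 < norm x / \<sigma>" using \<sigma> by (simp add: pos_less_divide_eq)
  then show ?thesis by (simp add: cutoff_def)
 qed
 have cut1: "cutoff \<sigma> x = 1" if "x \<in> ball 0 \<sigma>" for x :: 'a proof -
  have "norm x / \<sigma> < 1" using that \<sigma> by (simp add: pos_divide_less_eq)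
  then show ?thesis by (simp add: cutoff_def)
 qed
 have cont: "continuous_on UNIV (cutoff \<sigma> :: 'a => real)"
  unfolding cutoff_def[abs_def] using \<sigma> by (intro continuous_intros) auto
 then have [measurable]: "(cutoff \<sigma> :: 'a => real) \<in> bm" by (rule borel_measurable_continuous_onI)
 have ind: "integrable lborel (ind (cball 0 (2 * \<sigma>)) :: 'a => real)"
  by (rule integrable_real_indicator) (auto simp: emeasure_lborel_cball_finite[unfolded infinity_ennreal_def])
 have Kfin: "?K < \<infinity>" proof -
  have "?K <= (\<integral>\<^sup>+x. ind (cball 0 (2 * \<sigma>)) (x::'a) \<partial>lborel)" proof (intro nn_integral_mono)
   fix x :: 'a
   have "(cutoff \<sigma> x)^2 <= 1" using cut[of x] by (simp add: power_le_one)
   then show "ennreal ((cutoff \<sigma> x)^2) <= ind (cball 0 (2 * \<sigma>)) x"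
    using cut0[of x] by (auto simp: indicator_def simp del: mem_cball)
  qed
  also have "... < \<infinity>" by (simp add: emeasure_lborel_cball_finite[unfolded infinity_ennreal_def])
  finally show ?thesis .
 qed
 define C where "C = (2 * pi) ^ DIM('a) * enn2real ?K"
 have "ennreal ((cmod (LINT q|lborel. v q * m q))^2) <= ennreal (C * B^2) * (l2mass (ft v))"
  if v: "integrable lborel v" and supp: "\<And>x. x \<notin> ball 0 \<sigma> ==> v x = 0"
   and m: "continuous_on UNIV m" and B: "\<And>x. x \<in> cball 0 (2 * \<sigma>) ==> cmod (m x) <= B" for v m :: "'a => complex" and B
 proof -
  have "cmod (m 0) <= B" using \<sigma> by (intro B) simp
  then have B0: "0 <= B" by (rule order_trans[OF norm_ge_zero])
  have [measurable]: "m \<in> bm" by (rule borel_measurable_continuous_onI[OF m])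
  have [measurable]: "v \<in> bm" using v by auto
  let ?V = "l2mass (ft v)"
  define \<xi> where "\<xi> x = m x * cor (cutoff \<sigma> x)" for x
  have [measurable]: "\<xi> \<in> bm" unfolding \<xi>_def[abs_def] by measurable
  have bound: "cmod (\<xi> x) <= B * ind (cball 0 (2 * \<sigma>)) x" "cmod (\<xi> x) <= B * cutoff \<sigma> x" for x proof -
   show "cmod (\<xi> x) <= B * cutoff \<sigma> x"
    using cut[of x] cut0[of x] B[of x] by (cases "x \<in> cball 0 (2 * \<sigma>)") (auto simp: \<xi>_def norm_mult intro!: mult_right_mono simp del: mem_cball)
   also have "... <= B * ind (cball 0 (2 * \<sigma>)) x"
    using cut[of x] cut0[of x] B0 by (intro mult_left_mono) (auto simp: indicator_def simp del: mem_cball)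
   finally show "cmod (\<xi> x) <= B * ind (cball 0 (2 * \<sigma>)) x" .
  qed
  have \<xi>: "integrable lborel \<xi>" proof (rule L_integrable_bound)
   show "integrable lborel (\<lambda>x::'a. B * (ind (cball 0 (2 * \<sigma>)) x :: real))" using ind by simp
   show "AE x in lborel. norm (\<xi> x) <= norm (B * (ind (cball 0 (2 * \<sigma>)) (x::'a) :: real))"
    using bound by (auto intro: order_trans[OF _ abs_ge_self])
  qed simp
  have "continuous_on UNIV \<xi>" unfolding \<xi>_def[abs_def] by (intro continuous_intros cont m)
  then have isc: "isCont \<xi> x" for x by (simp add: continuous_on_eq_continuous_at)
  have p: "ennreal ((2 * pi) ^ DIM('a) * cmod (LINT q|lborel. v q * \<xi> q))
   <= (\<integral>\<^sup>+q. ennreal (cmod (ft \<xi> q) * cmod (LINT x|lborel. v x * cis (- (q \<bullet> x)))) \<partial>lborel)"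
  proof (intro cmod_pairing_le[OF v \<xi>, where B=B])
   show "cmod (\<xi> x) <= B" for x using mult_left_mono[OF cut(2)[of x] B0] bound(2)[of x] by simp
  qed (auto simp: isc)
  let ?I = "LINT q|lborel. v q * m q"
  have e1: "(LINT q|lborel. v q * \<xi> q) = ?I" proof (intro L_integral_cong refl)
   fix q show "v q * \<xi> q = v q * m q"
    using supp[of q] cut1[of q] by (cases "q \<in> ball 0 \<sigma>") (auto simp: \<xi>_def simp del: mem_ball)
  qed
  have e2: "(LINT x|lborel. v x * cis (- (q \<bullet> x))) = ft v (- q)" for q by (simp add: ft_def mult.commute)
  have le: "ennreal ((2 * pi) ^ DIM('a) * cmod (?I))
   <= (\<integral>\<^sup>+q. ennreal (cmod (ft \<xi> q)) * ennreal (cmod (ft v (- q))) \<partial>lborel)"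
   using p unfolding e1 e2 by (simp only: ennreal_mult norm_ge_zero)
  have one: "1 <= (2 * pi) ^ DIM('a)" using pi_ge_two by (intro one_le_power) simp
  have "ennreal ((cmod (?I))^2) = (ennreal (cmod (?I)))^2" by (simp add: ennreal_power)
  also have "... <= (ennreal ((2 * pi) ^ DIM('a) * cmod (?I)))^2"
   using mult_right_mono[OF one norm_ge_zero[of "?I"]] by (intro power_mono_ennreal ennreal_leI) simp
  also have "... <= (\<integral>\<^sup>+q. ennreal (cmod (ft \<xi> q)) * ennreal (cmod (ft v (- q))) \<partial>lborel)^2"
   by (rule power_mono_ennreal[OF le])
  also have "... <= (\<integral>\<^sup>+q. (ennreal (cmod (ft \<xi> q)))^2 \<partial>lborel) * (\<integral>\<^sup>+q. (ennreal (cmod (ft v (- q))))^2 \<partial>lborel)"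
   by (rule Cauchy_Schwarz_nn_integral) measurable
  also have "... = (l2mass (ft \<xi>)) * (l2mass (\<lambda>q. ft v (- q)))"
   by (simp add: ennreal_power)
  also have "(l2mass (\<lambda>q. ft v (- q))) = ?V"
   by (subst (2) nn_integral_lborel_affine[of _ "-1" 0]) auto
  also have "(l2mass (ft \<xi>)) * ?V
    <= ennreal ((2 * pi) ^ DIM('a)) * (l2mass \<xi>) * ?V"
   by (intro mult_right_mono plancherel_le[OF \<xi>]) simp
  also have "(l2mass \<xi>) <= (\<integral>\<^sup>+x. ennreal (B^2) * ennreal ((cutoff \<sigma> (x::'a))^2) \<partial>lborel)"
  proof (intro nn_integral_mono)
   fix x :: 'a
   have "(cmod (\<xi> x))^2 <= (B * cutoff \<sigma> x)^2" by (rule power_mono[OF bound(2)]) simp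
   then show "ennreal ((cmod (\<xi> x))^2) <= ennreal (B^2) * ennreal ((cutoff \<sigma> x)^2)"
    by (simp add: ennreal_mult[symmetric] power_mult_distrib ennreal_leI)
  qed
  also have "... = ennreal (B^2) * ?K" by (rule nn_integral_cmult) measurable
  also have "ennreal ((2 * pi) ^ DIM('a)) * (ennreal (B^2) * ?K) = ennreal (C * B^2)"
   using Kfin by (simp add: C_def ennreal_mult less_top mult_ac)
  finally show ?thesis by (simp add: mult_left_mono mult_right_mono)
 qed
 then show thesis by (intro that[of C]) (auto simp: C_def)
qed

lemma ft_sup_bound:
 fixes \<sigma> :: real
 assumes \<sigma>: "\<sigma> > 0"
 obtains C where "C \<ge> 0" and "\<And>(v :: 'a::euclidean_space => complex) p. integrable lborel v ==>
   (\<And>x. x \<notin> ball 0 \<sigma> ==> v x = 0) ==>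
   ennreal ((cmod (ft v p))^2) <= ennreal C * (l2mass (ft v))"
proof (rule bounded_pairing_le[OF \<sigma>, where ?'a='a])
 fix C assume "C \<ge> 0" and *: "\<And>(v :: 'a::euclidean_space => complex) m B. integrable lborel v ==>
   (\<And>x. x \<notin> ball 0 \<sigma> ==> v x = 0) ==> continuous_on UNIV m ==> (\<And>x. x \<in> cball 0 (2 * \<sigma>) ==> cmod (m x) <= B) ==>
   ennreal ((cmod (LINT q|lborel. v q * m q))^2) <= ennreal (C * B^2) * (l2mass (ft v))"
 have "ennreal ((cmod (ft v p))^2) <= ennreal C * (l2mass (ft v))"
  if "integrable lborel v" "\<And>x. x \<notin> ball 0 \<sigma> ==> v x = 0" for v :: "'a => complex" and p
  using *[OF that, where m="\<lambda>q. cis (p \<bullet> q)" and B=1] by (simp add: ft_def mult.commute continuous_intros)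
 with \<open>C \<ge> 0\<close> show thesis by (rule that)
qed

section \<open>Linear systems, interpolation and exponentials\<close>

text \<open>
 Elimination: one equation is used to solve for one unknown, the other equations lose it.
\<close>

lemma nontrivial_kernel:
 fixes A :: "nat => nat => 'a::field"
 shows "\<exists>a. (\<exists>k\<le>n. a k \<noteq> 0) \<and> (\<forall>m<n. (\<Sum>k\<le>n. a k * A m k) = 0)"
proof (induction n arbitrary: A)
 case 0
 show ?case by (intro exI[of _ "\<lambda>_. 1"]) auto
next
 case (Suc n)
 show ?case proof (cases "\<forall>m<Suc n. A m (Suc n) = 0")
  case True
  then show ?thesis
   by (intro exI[of _ "\<lambda>k. if k = Suc n then 1 else 0"]) (auto simp: if_distrib[of "\<lambda>x. x * _"] sum.delta cong: if_cong)
 next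
  case False
  then obtain r where r: "r < Suc n" "A r (Suc n) \<noteq> 0" by blast
  define s where "s m = (if m = r then n else m)" for m
  define B where "B m k = A (s m) k - A (s m) (Suc n) / A r (Suc n) * A r k" for m k
  obtain a where a: "\<exists>k\<le>n. a k \<noteq> 0" "\<forall>m<n. (\<Sum>k\<le>n. a k * B m k) = 0" using Suc.IH[of B] by blast
  define t where "t = - (\<Sum>k\<le>n. a k * A r k) / A r (Suc n)"
  define a' where "a' = a(Suc n := t)"
  have split: "(\<Sum>k\<le>Suc n. a' k * A m k) = (\<Sum>k\<le>n. a k * A m k) + t * A m (Suc n)" for m by (simp add: a'_def)
  have "(\<Sum>k\<le>Suc n. a' k * A m k) = 0" if m: "m < Suc n" for m proof (cases "m = r")
   case True
   then show ?thesis using r unfolding split t_def by simp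
  next
   case False
   obtain m' where m': "m' < n" "s m' = m" proof (cases "m = n")
    case True
    with False r have "r < n" by simp
    then show ?thesis using that[of r] True by (simp add: s_def)
   next
    case neq: False
    then show ?thesis using that[of m] m False by (simp add: s_def)
   qed
   have "0 = (\<Sum>k\<le>n. a k * B m' k)" using a(2) m'(1) by simp
   also have "... = (\<Sum>k\<le>n. a k * A m k) - A m (Suc n) / A r (Suc n) * (\<Sum>k\<le>n. a k * A r k)"
    unfolding B_def m'(2) by (simp add: algebra_simps sum_subtractf sum_distrib_left)
   also have "... = (\<Sum>k\<le>Suc n. a' k * A m k)" unfolding split t_def by simp
   finally show ?thesis by simp
  qed
  moreover have "\<exists>k\<le>Suc n. a' k \<noteq> 0" proof -
   obtain k where "k <= n" "a k \<noteq> 0" using a(1) by blast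
   then have "k <= Suc n" "a' k \<noteq> 0" by (simp_all add: a'_def)
   then show ?thesis by blast
  qed
  ultimately show ?thesis by blast
 qed
qed

definition lagrange_basis :: "(nat => 'a::field) => nat => nat => 'a poly" where
 "lagrange_basis z J l = smult (1 / (\<Prod>m\<in>{..<J} - {l}. z l - z m)) (\<Prod>m\<in>{..<J} - {l}. [:- z m, 1:])"

lemma degree_prod_linear_le: "finite A ==> degree (\<Prod>m\<in>A. [:- z m, 1::'a::field:]) <= card A"
 using degree_prod_sum_le[of A "\<lambda>m. [:- z m, 1:]"] by simp

lemma lagrange_interpolation:
 fixes p :: "'a::field poly"
 assumes deg: "degree p < J" and inj: "inj_on z {..<J}"
 shows "p = (\<Sum>l<J. smult (poly p (z l)) (lagrange_basis z J l))"
proof -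
 define q where "q = (\<Sum>l<J. smult (poly p (z l)) (lagrange_basis z J l))"
 have basis: "poly (lagrange_basis z J l) (z k) = (if k = l then 1 else 0)" if "l < J" "k < J" for l k proof (cases "k = l")
  case True
  have "(\<Prod>m\<in>{..<J} - {l}. z l - z m) \<noteq> 0" using inj that by (auto simp: inj_on_def)
  then show ?thesis using True by (simp add: lagrange_basis_def poly_prod)
 next
  case False
  then have "(\<Prod>m\<in>{..<J} - {l}. z k - z m) = 0" using that by (intro prod_zero) auto
  then show ?thesis using False by (simp add: lagrange_basis_def poly_prod)
 qed
 have "poly q (z k) = poly p (z k)" if k: "k < J" for k proof -
  have "poly q (z k) = (\<Sum>l<J. poly p (z l) * (if k = l then 1 else 0))" unfolding q_def poly_sum using k by (intro sum.cong) (auto simp: basis)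
  then show ?thesis using k by (simp add: if_distrib sum.delta' cong: if_cong)
 qed
 then have sub: "z ` {..<J} \<subseteq> {x. poly (p - q) x = 0}" by auto
 have "degree q <= J - 1" unfolding q_def proof (intro degree_sum_le)
  fix l assume l: "l \<in> {..<J}"
  have "degree (\<Prod>m\<in>{..<J} - {l}. [:- z m, 1:]) <= card ({..<J} - {l})" by (rule degree_prod_linear_le) simp
  also have "... = J - 1" using l by simp
  finally show "degree (smult (poly p (z l)) (lagrange_basis z J l)) <= J - 1"
   unfolding lagrange_basis_def by (intro order_trans[OF degree_smult_le]) 
 qed simp
 then have deg': "degree (p - q) < J" using deg by (intro le_less_trans[OF degree_diff_le_max]) auto
 have "p - q = 0" proof (rule ccontr)
  assume nz: "p - q \<noteq> 0"
  have "J = card (z ` {..<J})" using inj by (simp add: card_image)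
  also have "... <= card {x. poly (p - q) x = 0}" by (rule card_mono[OF poly_roots_finite[OF nz] sub])
  also have "... <= degree (p - q)" by (rule card_poly_roots_bound[OF nz])
  finally show False using deg' by simp
 qed
 then show ?thesis by (simp add: q_def)
qed

lemma cmod_coeff_prod_linear_le:
 fixes z :: "'b => complex"
 assumes "finite A" "\<And>m. m \<in> A ==> cmod (z m) <= 1"
 shows "cmod (coeff (\<Prod>m\<in>A. [:- z m, 1:]) k) <= 2 ^ card A" using assms
proof (induction A arbitrary: k rule: finite_induct)
 case empty
 then show ?case by (simp add: coeff_1)
next
 case (insert x A)
 let ?P = "\<Prod>m\<in>A. [:- z m, 1:]"
 have IH: "cmod (coeff ?P k) <= 2 ^ card A" for k using insert by auto
 have "(\<Prod>m\<in>insert x A. [:- z m, 1:]) = smult (- z x) ?P + pCons 0 ?P" using insert by simp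
 then have "coeff (\<Prod>m\<in>insert x A. [:- z m, 1:]) k = - z x * coeff ?P k + coeff (pCons 0 ?P) k" by simp
 also have "cmod ... <= cmod (z x) * cmod (coeff ?P k) + cmod (coeff (pCons 0 ?P) k)"
  by (intro order_trans[OF norm_triangle_ineq]) (simp add: norm_mult)
 also have "... <= 1 * 2 ^ card A + 2 ^ card A" using IH insert.prems by (intro add_mono mult_mono) (auto simp: coeff_pCons split: nat.split)
 finally show ?case using insert by simp
qed

text \<open>The product is $l! (J-1-l)!$, and a binomial coefficient is at most a power of two.\<close>

lemma prod_node_distances_ge:
 assumes "l < J"
 shows "fact (J - 1) / 2 ^ (J - 1) <= (\<Prod>m\<in>{..<J} - {l}. \<bar>real l - real m\<bar>)"
proof -
 have split: "{..<J} - {l} = {..<l} \<union> {Suc l..<J}" using assms by auto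
 have "(\<Prod>m\<in>{..<J} - {l}. \<bar>real l - real m\<bar>)
   = (\<Prod>m<l. \<bar>real l - real m\<bar>) * (\<Prod>m\<in>{Suc l..<J}. \<bar>real l - real m\<bar>)"
  unfolding split by (rule prod.union_disjoint) auto
 also have "(\<Prod>m<l. \<bar>real l - real m\<bar>) = fact l" proof -
  have "(\<Prod>m<l. \<bar>real l - real m\<bar>) = (\<Prod>m<l. real (Suc (l - Suc m)))" by (intro prod.cong) (auto simp: of_nat_diff)
  also have "... = (\<Prod>i<l. real (Suc i))" by (rule prod.nat_diff_reindex)
  also have "... = fact l" by (induction l) (auto simp: field_simps)
  finally show ?thesis .
 qed
 also have "(\<Prod>m\<in>{Suc l..<J}. \<bar>real l - real m\<bar>) = fact (J - 1 - l)" proof -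
  have "(\<Prod>m\<in>{Suc l..<J}. \<bar>real l - real m\<bar>) = (\<Prod>i<J - Suc l. real (Suc i))"
   by (rule prod.reindex_bij_witness[of _ "\<lambda>i. i + Suc l" "\<lambda>m. m - Suc l"]) (auto simp: of_nat_diff)
  also have "... = fact (J - Suc l)"
   by (induction "J - Suc l") (auto simp: field_simps fact_prod_Suc prod.atLeast0_lessThan_Suc lessThan_atLeast0)
  finally show ?thesis by simp
 qed
 finally have eq: "(\<Prod>m\<in>{..<J} - {l}. \<bar>real l - real m\<bar>) = fact l * fact (J - 1 - l)" .
 have "fact (J - 1) = fact l * fact (J - 1 - l) * real ((J - 1) choose l)"
  using arg_cong[OF binomial_fact_lemma[of l "J - 1"], of real] assms by simp
 also have "... <= fact l * fact (J - 1 - l) * 2 ^ (J - 1)" proof (intro mult_left_mono)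
  have "real ((J - 1) choose l) <= real (2 ^ (J - 1))" by (simp only: of_nat_le_iff binomial_le_pow2)
  then show "real ((J - 1) choose l) <= 2 ^ (J - 1)" by simp
 qed simp
 finally show ?thesis unfolding eq by (simp add: field_simps)
qed

lemma power_div_fact_le_exp:
 fixes x :: real
 assumes "x \<ge> 0"
 shows "x ^ n / fact n <= exp x"
proof -
 have "(\<Sum>k\<in>{n}. x ^ k /\<^sub>R fact k) <= (\<Sum>k. x ^ k /\<^sub>R fact k)"
  using assms by (intro sum_le_suminf summable_exp_generic) auto
 then show ?thesis by (simp add: exp_def divide_inverse mult.commute)
qed

lemma fact_ge_power: "(real n / exp 1) ^ n <= fact n"
 using power_div_fact_le_exp[of "real n" n] by (simp add: field_simps power_divide exp_of_nat_mult[symmetric])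

lemma cis_taylor: "cmod (cis t - (\<Sum>k<n. (\<i> * t) ^ k / fact k)) <= \<bar>t\<bar> ^ n / fact n"
proof (cases n)
 case (Suc m)
 show ?thesis using iexp_approx1[of t m] unfolding Suc by (simp add: cis_conv_exp lessThan_Suc_atMost)
qed simp

lemma cmod_cis_diff_le: "cmod (cis a - cis b) <= \<bar>a - b\<bar>"
proof -
 have "cis a - cis b = cis b * (cis (a - b) - 1)" by (simp add: cis_mult algebra_simps)
 then show ?thesis using cis_taylor[of "a - b" 1] by (simp add: norm_mult)
qed

lemma cmod_cis_diff_ge:
 assumes "\<bar>a - b\<bar> <= 1"
 shows "\<bar>a - b\<bar> / 2 <= cmod (cis a - cis b)"
proof -
 define t where "t = a - b"
 have "cis a - cis b = cis b * (cis t - 1)" by (simp add: t_def cis_mult algebra_simps)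
 then have eq: "cmod (cis a - cis b) = cmod (cis t - 1)" by (simp add: norm_mult)
 have "cmod (cis t - (1 + \<i> * t)) <= t^2 / 2" using cis_taylor[of t 2] by (simp add: numeral_2_eq_2)
 moreover have "cmod (\<i> * cor t) <= cmod (cis t - 1) + cmod (cis t - (1 + \<i> * t))"
  using norm_triangle_ineq4[of "cis t - 1" "cis t - (1 + \<i> * t)"] by simp
 moreover have "cmod (\<i> * cor t) = \<bar>t\<bar>" by (simp only: norm_mult norm_of_real) simp
 moreover have "t^2 <= \<bar>t\<bar>" using mult_left_mono[OF assms abs_ge_zero[of t]]
  by (simp only: t_def[symmetric] power2_eq_square abs_mult_self_eq mult_1_right)
 ultimately show ?thesis unfolding eq t_def[symmetric] by linarith
qed

lemma cos_ge_half:
 fixes t :: real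
 assumes "\<bar>t\<bar> <= 1" shows "1 / 2 <= cos t"
proof -
 have "\<bar>Re (cis t - (1 + \<i> * t))\<bar> <= t^2 / 2"
  using order_trans[OF abs_Re_le_cmod cis_taylor[of t 2]] by (simp add: numeral_2_eq_2)
 moreover have "t^2 <= 1" using assms by (simp add: abs_square_le_1)
 ultimately show ?thesis by simp
qed

text \<open>
 The function is close to a polynomial of degree less than $J$ both at the nodes and at the point $s$,
 and the polynomial is determined by its values at the nodes. The nodes divide an interval of length $c$
 evenly; the shift $t$ is there to be averaged over.
\<close>

lemma lagrange_extrapolation_le:
 fixes h :: "real => complex" and m :: "nat => complex"
 assumes c: "0 < c" and J: "0 < J" and s: "\<bar>s\<bar> <= S" and R: "0 <= R" and t: "0 <= t" "t <= c / J"
  and rem: "\<And>u. cmod (h u - (\<Sum>k<J. (\<i> * cor u) ^ k / fact k * m k)) <= R * \<bar>u\<bar> ^ J"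
 shows "cmod (h s) <= R * S ^ J
  + (2 * (S + c) * J / c) ^ (J - 1) / fact (J - 1) * (\<Sum>l<J. R * c ^ J + cmod (h (t + c * real l / J)))"
proof -
 define P where "P = (\<Sum>k<J. monom (\<i> ^ k / fact k * m k) k)"
 have polyP: "poly P (cor u) = (\<Sum>k<J. (\<i> * cor u) ^ k / fact k * m k)" for u
  unfolding P_def by (simp add: poly_sum poly_monom power_mult_distrib mult_ac)
 have rem: "cmod (h u - poly P (cor u)) <= R * U ^ J" if u: "\<bar>u\<bar> <= U" for u U proof -
  have "R * \<bar>u\<bar> ^ J <= R * U ^ J" using u R by (intro mult_left_mono power_mono) auto
  then show ?thesis unfolding polyP using rem[of u] by (rule order_trans[rotated])
 qed
 have node: "0 <= t + c * l / J" "t + c * l / J <= c" if "l < J" for l proof -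
  show "0 <= t + c * l / J" using t c by simp
  have "t + c * l / J <= c / J + c * l / J" using t by simp
  also have "... = c * ((real l + 1) / J)" by (simp add: field_simps add_divide_distrib)
  also have "... <= c * 1" using c that by (intro mult_left_mono) auto
  finally show "t + c * l / J <= c" by simp
 qed
 have "degree P <= J - 1" unfolding P_def using J by (intro degree_sum_le) (auto intro!: order_trans[OF degree_monom_le])
 then have degP: "degree P < J" using J by simp
 define z where "z l = cor (t + c * l / J)" for l :: nat
 have zdiff: "cmod (z l - z m) = c / J * \<bar>real l - real m\<bar>" for l m proof -
  have "c / J * (real l - real m) = (t + c * l / J) - (t + c * m / J)" by (simp add: diff_divide_distrib right_diff_distrib)
  then have "z l - z m = cor (c / J * (real l - real m))" by (simp only: z_def of_real_diff)
  then show ?thesis using c by (simp only: norm_of_real abs_mult) simp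
 qed
 have inj: "inj_on z {..<J}" using c J by (auto simp: inj_on_def z_def)
 let ?L = "(2 * (S + c) * J / c) ^ (J - 1) / fact (J - 1)"
 have basis: "cmod (poly (lagrange_basis z J l) (cor s)) <= ?L" if l: "l < J" for l proof -
  have card: "card ({..<J} - {l}) = J - 1" using l by simp
  have num: "(\<Prod>m\<in>{..<J} - {l}. cmod (cor s - z m)) <= (S + c) ^ (J - 1)" proof -
   have "cmod (cor s - z m) <= S + c" if "m \<in> {..<J} - {l}" for m proof -
    have "0 <= t + c * m / J" "t + c * m / J <= c" using node[of m] that by auto
    moreover have "cmod (cor s - z m) = \<bar>s - (t + c * m / J)\<bar>" unfolding z_def by (simp only: of_real_diff[symmetric] norm_of_real)
    ultimately show ?thesis using s by linarith
   qed
   then have "(\<Prod>m\<in>{..<J} - {l}. cmod (cor s - z m)) <= (\<Prod>m\<in>{..<J} - {l}. S + c)" by (intro prod_mono) auto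
   then show ?thesis by (simp add: card)
  qed
  have "(c / J) ^ (J - 1) * (fact (J - 1) / 2 ^ (J - 1)) <= (c / J) ^ (J - 1) * (\<Prod>m\<in>{..<J} - {l}. \<bar>real l - real m\<bar>)"
   using c by (intro mult_left_mono prod_node_distances_ge[OF l]) auto
  also have "... = (\<Prod>m\<in>{..<J} - {l}. cmod (z l - z m))" unfolding zdiff prod.distrib by (simp add: card)
  finally have den: "(c / J) ^ (J - 1) * (fact (J - 1) / 2 ^ (J - 1)) <= (\<Prod>m\<in>{..<J} - {l}. cmod (z l - z m))" .
  have denpos: "0 < (c / J) ^ (J - 1) * (fact (J - 1) / 2 ^ (J - 1) :: real)" using c J by simp
  have "cmod (poly (lagrange_basis z J l) (cor s))
    = (\<Prod>m\<in>{..<J} - {l}. cmod (cor s - z m)) / (\<Prod>m\<in>{..<J} - {l}. cmod (z l - z m))"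
   by (simp add: lagrange_basis_def poly_prod norm_mult norm_divide prod_norm)
  also have "... <= (S + c) ^ (J - 1) / ((c / J) ^ (J - 1) * (fact (J - 1) / 2 ^ (J - 1)))"
   by (rule frac_le[OF _ num denpos den]) (use s c in auto)
  also have "... = (2 * ((S + c) / (c / J))) ^ (J - 1) / fact (J - 1)" by (simp only: power_mult_distrib power_divide) simp
  also have "2 * ((S + c) / (c / J)) = 2 * (S + c) * J / c" by simp
  finally show ?thesis .
 qed
 have L0: "0 <= ?L" using s c by simp
 have "poly P (cor s) = (\<Sum>l<J. poly P (z l) * poly (lagrange_basis z J l) (cor s))"
  by (subst lagrange_interpolation[OF degP inj]) (simp add: poly_sum)
 also have "cmod ... <= (\<Sum>l<J. cmod (poly P (z l)) * cmod (poly (lagrange_basis z J l) (cor s)))"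
  by (rule order_trans[OF norm_sum]) (simp add: norm_mult)
 also have "... <= (\<Sum>l<J. (R * c ^ J + cmod (h (t + c * real l / J))) * ?L)" proof (intro sum_mono mult_mono)
  fix l assume l: "l \<in> {..<J}"
  have le: "\<bar>t + c * l / J\<bar> <= c" using node[of l] l by auto
  have "cmod (poly P (z l)) <= cmod (h (t + c * l / J) - poly P (z l)) + cmod (h (t + c * real l / J))"
   by (metis norm_minus_commute norm_triangle_sub add.commute)
  also have "... <= R * c ^ J + cmod (h (t + c * real l / J))" using rem[OF le] by (intro add_mono) (auto simp: z_def)
  finally show "cmod (poly P (z l)) <= R * c ^ J + cmod (h (t + c * real l / J))" .
  show "0 <= R * c ^ J + cmod (h (t + c * real l / J))" using c R by simp
  show "cmod (poly (lagrange_basis z J l) (cor s)) <= ?L" using l by (intro basis) simp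
 qed simp
 also have "... = ?L * (\<Sum>l<J. R * c ^ J + cmod (h (t + c * real l / J)))" by (simp only: sum_distrib_right[symmetric] mult.commute)
 finally have "cmod (poly P (cor s)) <= ?L * (\<Sum>l<J. R * c ^ J + cmod (h (t + c * real l / J)))" .
 moreover have "cmod (h s) <= cmod (h s - poly P (cor s)) + cmod (poly P (cor s))" by (metis norm_triangle_sub add.commute)
 ultimately show ?thesis using rem[OF s] by linarith
qed

section \<open>Prolate spheroidal wave functions\<close>

abbreviation I1 :: "real measure" where "I1 \<equiv> restrict_space lborel {-1..1}"

lemma space_I1 [simp]: "space I1 = {-1..1}" by (simp add: space_restrict_space)

lemma measurable_I1: "f \<in> bm ==> f \<in> borel_measurable I1" by (rule measurable_restrict_space1) simp

interpretation I1: finite_measure I1 by (rule finite_measureI) (simp add: emeasure_restrict_space)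

lemma measure_I1 [simp]: "measure I1 {-1..1} = 2" by (simp add: measure_restrict_space)

lemma integral_I1_const [simp]: "(LINT x|I1. c) = 2 *\<^sub>R (c :: 'b::{banach, second_countable_topology})" by (simp add: measure_restrict_space)

lemma measurable_pair_I1:
 assumes "h \<in> borel_measurable (borel \<Otimes>\<^sub>M borel)"
 shows "h \<in> borel_measurable (borel \<Otimes>\<^sub>M I1)" "h \<in> borel_measurable (I1 \<Otimes>\<^sub>M I1)"
proof -
 have i: "(\<lambda>x. x) \<in> measurable I1 borel" by (rule measurable_I1) simp
 have "(\<lambda>z. (fst z, snd z)) \<in> measurable (borel \<Otimes>\<^sub>M I1) (borel \<Otimes>\<^sub>M borel)"
  by (intro measurable_Pair measurable_compose[OF measurable_snd i] measurable_fst)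
 from measurable_compose[OF this assms] show "h \<in> borel_measurable (borel \<Otimes>\<^sub>M I1)" by simp
 have "(\<lambda>z. (fst z, snd z)) \<in> measurable (I1 \<Otimes>\<^sub>M I1) (borel \<Otimes>\<^sub>M borel)"
  by (intro measurable_Pair measurable_compose[OF measurable_snd i] measurable_compose[OF measurable_fst i])
 from measurable_compose[OF this assms] show "h \<in> borel_measurable (I1 \<Otimes>\<^sub>M I1)" by simp
qed

interpretation lborel_I1: pair_sigma_finite lborel I1 ..

interpretation I1_I1: pair_sigma_finite I1 I1 ..

lemma integrable_I1_bounded:
 fixes f :: "real => 'b::{banach, second_countable_topology}"
 assumes "f \<in> borel_measurable I1" "\<And>x. x \<in> {-1..1} ==> norm (f x) <= B"
 shows "integrable I1 f" by (rule I1.integrable_const_bound[of _ B]) (use assms in \<open>auto intro!: AE_I2\<close>)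

definition l2 :: "(real => complex) => bool" where
 "l2 f \<longleftrightarrow> f \<in> borel_measurable I1 \<and> integrable I1 (\<lambda>x. (cmod (f x))^2)"

definition sq :: "(real => complex) => real" where
 "sq f = (LINT x|I1. (cmod (f x))^2)"

lemma sq_nonneg [simp]: "0 <= sq f" unfolding sq_def by simp

lemma l2_measurable: "l2 f ==> f \<in> borel_measurable I1" by (simp add: l2_def)

lemma l2_square_integrable: "l2 f ==> integrable I1 (\<lambda>x. (cmod (f x))^2)" by (simp add: l2_def)

lemma l2_integrable_mult:
 assumes "l2 f" "l2 g"
 shows "integrable I1 (\<lambda>x. f x * g x)"
proof (rule L_integrable_bound)
 show "integrable I1 (\<lambda>x. (cmod (f x))^2 + (cmod (g x))^2)" using assms by (auto simp: l2_def)
 show "(\<lambda>x. f x * g x) \<in> borel_measurable I1" using assms by (auto simp: l2_def)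
 have "a * b <= a^2 + b^2" if "0 <= a" "0 <= b" for a b :: real
  using sum_squares_bound[of a b] mult_nonneg_nonneg[OF that] by linarith
 then show "AE x in I1. norm (f x * g x) <= norm ((cmod (f x))^2 + (cmod (g x))^2)" by (auto simp: norm_mult)
qed

lemma l2_bounded:
 assumes "f \<in> borel_measurable I1" "\<And>x. x \<in> {-1..1} ==> cmod (f x) <= B"
 shows "l2 f" unfolding l2_def
proof
 show "integrable I1 (\<lambda>x. (cmod (f x))^2)"
  by (rule integrable_I1_bounded[of _ "B^2"]) (use assms in \<open>auto intro: power_mono\<close>)
qed fact

lemma l2_integrable: "l2 f ==> integrable I1 f" using l2_integrable_mult[of f "\<lambda>_. 1"] l2_bounded[of "\<lambda>_. 1" 1] by simp

lemma l2_cmult: "l2 f ==> l2 (\<lambda>x. a * f x)" by (auto simp: l2_def norm_mult power_mult_distrib)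

lemma l2_add:
 assumes "l2 f" "l2 g"
 shows "l2 (\<lambda>x. f x + g x)"
proof -
 have m: "(\<lambda>x. f x + g x) \<in> borel_measurable I1" using assms by (auto simp: l2_def)
 moreover have "integrable I1 (\<lambda>x. (cmod (f x + g x))^2)" proof (rule L_integrable_bound)
  show "integrable I1 (\<lambda>x. 2 * (cmod (f x))^2 + 2 * (cmod (g x))^2)" using assms by (auto simp: l2_def)
  have "(cmod (f x + g x))^2 <= 2 * (cmod (f x))^2 + 2 * (cmod (g x))^2" for x proof -
   have "(cmod (f x + g x))^2 <= (cmod (f x) + cmod (g x))^2" by (intro power_mono norm_triangle_ineq) simp
   also have "... <= 2 * (cmod (f x))^2 + 2 * (cmod (g x))^2"
    using sum_squares_bound[of "cmod (f x)" "cmod (g x)"] by (simp add: power2_sum)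
   finally show ?thesis .
  qed
  then show "AE x in I1. norm ((cmod (f x + g x))^2) <= norm (2 * (cmod (f x))^2 + 2 * (cmod (g x))^2)" by auto
  show "(\<lambda>x. (cmod (f x + g x))^2) \<in> borel_measurable I1" using m by measurable
 qed
 ultimately show ?thesis by (simp add: l2_def)
qed

lemma l2_diff: "l2 f ==> l2 g ==> l2 (\<lambda>x. f x - g x)"
 using l2_add[of f "\<lambda>x. (-1) * g x"] l2_cmult[of g "-1"] by simp

lemma l2_sum:
 assumes "finite A" "\<And>j. j \<in> A ==> l2 (f j)"
 shows "l2 (\<lambda>x. \<Sum>j\<in>A. f j x)"
 using assms by (induction A rule: finite_induct) (auto intro: l2_add simp: l2_bounded[of "\<lambda>_. 0" 0])

lemma l1_le_l2:
 assumes f: "l2 f"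
 shows "(LINT x|I1. cmod (f x))^2 <= 2 * sq f"
proof -
 define m where "m = (LINT x|I1. cmod (f x)) / 2"
 have i: "integrable I1 (\<lambda>x. cmod (f x))" "integrable I1 (\<lambda>x. (cmod (f x))^2)"
  using l2_integrable[OF f] l2_square_integrable[OF f] by auto
 have "0 <= (LINT x|I1. (cmod (f x) - m)^2)" by simp
 also have "... = (LINT x|I1. (cmod (f x))^2 - 2 * m * cmod (f x) + m^2)" by (simp add: power2_diff algebra_simps)
 also have "... = sq f - 2 * m * (LINT x|I1. cmod (f x)) + 2 * m^2" using i by (simp add: sq_def)
 also have "... = sq f - (LINT x|I1. cmod (f x))^2 / 2" by (simp add: m_def power2_eq_square field_simps)
 finally show ?thesis by simp
qed

locale pswf =
 fixes c :: real and \<psi> :: "nat => real => real" and ev :: "nat => complex"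
 assumes c: "0 < c"
  and cont: "continuous_on UNIV (\<psi> j)"
  and orth: "(LINT x|I1. \<psi> j x * \<psi> k x) = (if j = k then 1 else 0)"
  and complete: "l2 f ==> (\<lambda>n. sq (\<lambda>x. f x - (\<Sum>j<n. (LINT y|I1. cor (\<psi> j y) * f y) * cor (\<psi> j x)))) \<longlonglongrightarrow> 0"
  and eigen: "x \<in> {-1..1} ==> (LINT y|I1. cis (c * x * y) * cor (\<psi> j y)) = ev j * cor (\<psi> j x)"
  and ev_pos: "0 < cmod (ev j)"
  and ev_dec: "cmod (ev (Suc j)) < cmod (ev j)"
begin

lemma psi_measurable [measurable]: "\<psi> j \<in> bm" by (rule borel_measurable_continuous_onI[OF cont])

lemma psi_measurable_I1 [measurable]: "\<psi> j \<in> borel_measurable I1" by (rule measurable_I1) simp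

lemma psi_bounded: "\<exists>B\<ge>0. \<forall>x\<in>{-1..1}. \<bar>\<psi> j x\<bar> <= B"
proof -
 have "compact (\<psi> j ` {-1..1})" by (intro compact_continuous_image continuous_on_subset[OF cont]) auto
 then have "bounded (\<psi> j ` {-1..1})" by (rule compact_imp_bounded)
 then obtain B where B: "\<forall>y\<in>\<psi> j ` {-1..1}. norm y <= B" unfolding bounded_iff by (elim exE)
 show ?thesis proof (intro exI[of _ "max 0 B"] conjI ballI)
  fix x :: real assume "x \<in> {-1..1}"
  then have "norm (\<psi> j x) <= B" using B by (rule_tac bspec[OF B]) simp
  then show "\<bar>\<psi> j x\<bar> <= max 0 B" by simp
 qed simp
qed

lemma l2_psi: "l2 (\<lambda>x. \<psi> j x)"
proof -
 obtain B where B: "\<forall>x\<in>{-1..1}. \<bar>\<psi> j x\<bar> <= B" using psi_bounded[of j] by (elim exE conjE)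
 then show ?thesis by (intro l2_bounded[of _ B]) auto
qed

lemma ev_antimono: "j <= k ==> cmod (ev k) <= cmod (ev j)"
 by (rule lift_Suc_antimono_le[of "\<lambda>j. cmod (ev j)"]) (simp_all add: less_imp_le[OF ev_dec])

definition coef :: "(real => complex) => nat => complex" where
 "coef f j = (LINT y|I1. cor (\<psi> j y) * f y)"

lemma coef_integrable: "l2 f ==> integrable I1 (\<lambda>y. cor (\<psi> j y) * f y)" by (rule l2_integrable_mult[OF l2_psi])

lemma coef_psi: "coef (\<lambda>x. \<psi> k x) j = (if j = k then 1 else 0)"
proof -
 have "coef (\<lambda>x. \<psi> k x) j = cor (LINT y|I1. \<psi> j y * \<psi> k y)" unfolding coef_def by (simp flip: integral_complex_of_real)
 then show ?thesis by (simp add: orth)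
qed

lemma coef_diff: "l2 f ==> l2 g ==> coef (\<lambda>x. f x - g x) j = coef f j - coef g j"
 unfolding coef_def using coef_integrable by (simp add: algebra_simps)

lemma coef_cmult: fixes a :: complex shows "coef (\<lambda>x. a * f x) j = a * coef f j" unfolding coef_def by (simp add: mult.left_commute)

lemma coef_sum:
 assumes "finite A" "\<And>k. k \<in> A ==> l2 (f k)"
 shows "coef (\<lambda>x. \<Sum>k\<in>A. f k x) j = (\<Sum>k\<in>A. coef (f k) j)"
 unfolding coef_def using assms coef_integrable by (simp add: sum_distrib_left)

lemma l2_comb:
 fixes a :: "nat => complex"
 shows "finite A ==> l2 (\<lambda>x. \<Sum>k\<in>A. a k * \<psi> k x)" by (intro l2_sum l2_cmult l2_psi)

lemma coef_comb:
 fixes a :: "nat => complex"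
 assumes "finite A"
 shows "coef (\<lambda>x. \<Sum>k\<in>A. a k * \<psi> k x) j = (if j \<in> A then a j else 0)" using assms
 by (subst coef_sum) (auto intro: l2_cmult l2_psi simp: coef_cmult coef_psi if_distrib sum.delta cong: if_cong)

lemma sq_diff_psi:
 fixes a :: complex
 assumes f: "l2 f"
 shows "sq (\<lambda>x. f x - a * \<psi> j x) = sq f - 2 * Re (cnj a * coef f j) + (cmod a)^2"
proof -
 have pw: "(cmod (f x - a * \<psi> j x))^2
   = (cmod (f x))^2 - 2 * Re (cnj a * (\<psi> j x * f x)) + (cmod a)^2 * (\<psi> j x * \<psi> j x)" for x
  unfolding cmod_power2 by (simp add: power2_eq_square algebra_simps)
 have "integrable I1 (\<lambda>x. Re (cor (\<psi> j x) * cor (\<psi> j x)))" by (intro integrable_Re l2_integrable_mult l2_psi)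
 then have i: "integrable I1 (\<lambda>x. (cmod (f x))^2)" "integrable I1 (\<lambda>x. cnj a * (\<psi> j x * f x))"
   "integrable I1 (\<lambda>x. \<psi> j x * \<psi> j x)" using l2_square_integrable[OF f] coef_integrable[OF f] by auto
 have lin: "(LINT x|I1. A x - 2 * B x + k * C x) = (LINT x|I1. A x) - 2 * (LINT x|I1. B x) + k * (LINT x|I1. C x)"
  if "integrable I1 A" "integrable I1 B" "integrable I1 C" for A B C :: "real => real" and k using that by simp
 have re: "(LINT x|I1. Re (cnj a * (\<psi> j x * f x))) = Re (cnj a * coef f j)"
  by (subst integral_Re[OF i(2)]) (simp only: coef_def integral_mult_right_zero)
 show ?thesis unfolding sq_def pw lin[OF i(1) integrable_Re[OF i(2)] i(3)] re by (simp add: orth)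
qed

lemma sq_projection:
 assumes f: "l2 f"
 shows "sq (\<lambda>x. f x - (\<Sum>j<n. coef f j * \<psi> j x)) = sq f - (\<Sum>j<n. (cmod (coef f j))^2)"
proof (induction n)
 case (Suc n)
 let ?r = "\<lambda>x. f x - (\<Sum>j<n. coef f j * \<psi> j x)"
 have r: "l2 ?r" by (intro l2_diff f l2_comb) simp
 have cr: "coef ?r n = coef f n" by (subst coef_diff[OF f l2_comb]) (auto simp: coef_comb)
 have "sq (\<lambda>x. f x - (\<Sum>j<Suc n. coef f j * \<psi> j x)) = sq (\<lambda>x. ?r x - coef f n * \<psi> n x)" by (simp add: algebra_simps)
 also have "... = sq ?r - 2 * Re (cnj (coef f n) * coef f n) + (cmod (coef f n))^2" using sq_diff_psi[OF r, of "coef f n" n] unfolding cr .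
 also have "Re (cnj (coef f n) * coef f n) = (cmod (coef f n))^2" unfolding cmod_power2 by (simp add: power2_eq_square)
 finally show ?case using Suc by simp
qed simp

lemma bessel: "l2 f ==> (\<Sum>j<n. (cmod (coef f j))^2) <= sq f"
 using sq_projection[of f n] sq_nonneg[of "\<lambda>x. f x - (\<Sum>j<n. coef f j * \<psi> j x)"] by simp

lemma projection_tendsto:
 "l2 f ==> (\<lambda>n. sq (\<lambda>x. f x - (\<Sum>j<n. coef f j * \<psi> j x))) \<longlonglongrightarrow> 0"
 using complete[of f] unfolding coef_def .

lemma parseval: "l2 f ==> (\<lambda>n. \<Sum>j<n. (cmod (coef f j))^2) \<longlonglongrightarrow> sq f"
proof -
 assume f: "l2 f"
 have "(\<lambda>n. sq f - sq (\<lambda>x. f x - (\<Sum>j<n. coef f j * \<psi> j x))) \<longlonglongrightarrow> sq f - 0"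
  by (intro tendsto_diff tendsto_const projection_tendsto f)
 then show ?thesis by (simp add: sq_projection[OF f])
qed

lemma sq_comb:
 fixes a :: "nat => complex"
 assumes "finite A"
 shows "sq (\<lambda>x. \<Sum>k\<in>A. a k * \<psi> k x) = (\<Sum>k\<in>A. (cmod (a k))^2)"
proof -
 let ?F = "\<lambda>x. \<Sum>k\<in>A. a k * \<psi> k x"
 obtain n where n: "A \<subseteq> {..<n}" using assms finite_nat_iff_bounded by blast
 have "(\<Sum>j<n. coef ?F j * \<psi> j x) = ?F x" for x
  using n by (simp add: coef_comb[OF assms] if_distrib[of "\<lambda>u. u * _"] sum.If_cases Int_absorb1 cong: if_cong)
 then have "0 = sq ?F - (\<Sum>j<n. (cmod (coef ?F j))^2)" using sq_projection[OF l2_comb[OF assms], of a n] by (simp add: sq_def)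
 also have "(\<Sum>j<n. (cmod (coef ?F j))^2) = (\<Sum>k\<in>A. (cmod (a k))^2)"
  using n by (simp add: coef_comb[OF assms] if_distrib[of "\<lambda>u. cmod u"] if_distrib[of "\<lambda>u. u^2"] sum.If_cases Int_absorb1 cong: if_cong)
 finally show ?thesis by simp
qed

definition G :: "nat => real => complex" where
 "G j s = (LINT y|I1. cis (s * y) * \<psi> j y)"

lemma G_eigen: "x \<in> {-1..1} ==> G j (c * x) = ev j * \<psi> j x" using eigen by (simp add: G_def mult.assoc)

lemma G_eq_coef: "G j s = coef (\<lambda>y. cis (s * y)) j" by (simp add: G_def coef_def mult.commute)

lemma l2_cis: "l2 (\<lambda>y. cis (s * y))" by (rule l2_bounded[of _ 1]) (auto intro: measurable_I1)

lemma l1_psi_le: "(LINT y|I1. \<bar>\<psi> j y\<bar>) <= 2"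
proof -
 have "sq (\<lambda>x. \<psi> j x) = 1" using sq_comb[of "{j}" "\<lambda>_. 1"] by simp
 then have "(LINT y|I1. \<bar>\<psi> j y\<bar>)^2 <= 2^2" using l1_le_l2[OF l2_psi[of j]] by simp
 then show ?thesis by (rule power2_le_imp_le) simp
qed

lemma integrable_psi_mult:
 assumes "f \<in> borel_measurable I1" "\<And>y. y \<in> {-1..1} ==> cmod (f y) <= B"
 shows "integrable I1 (\<lambda>y. f y * \<psi> j y)" by (intro l2_integrable_mult l2_psi l2_bounded[OF assms])

lemma cmod_pairing_psi_le:
 assumes f: "f \<in> borel_measurable I1" "\<And>y. y \<in> {-1..1} ==> cmod (f y) <= B" and B: "0 <= B"
 shows "cmod (LINT y|I1. f y * \<psi> j y) <= 2 * B"
proof -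
 have "cmod (LINT y|I1. f y * \<psi> j y) <= (LINT y|I1. cmod (f y * \<psi> j y))" by (rule integral_norm_bound)
 also have "... <= (LINT y|I1. B * \<bar>\<psi> j y\<bar>)" proof (rule integral_mono)
  show "integrable I1 (\<lambda>y. cmod (f y * \<psi> j y))" by (intro integrable_norm integrable_psi_mult[OF f])
  have "integrable I1 (\<lambda>y. cmod (cor (\<psi> j y)))" by (intro integrable_norm l2_integrable l2_psi)
  then show "integrable I1 (\<lambda>y. B * \<bar>\<psi> j y\<bar>)" by simp
 qed (auto simp: norm_mult intro!: mult_right_mono f)
 also have "... = B * (LINT y|I1. \<bar>\<psi> j y\<bar>)" by simp
 also have "... <= B * 2" by (intro mult_left_mono l1_psi_le B)
 finally show ?thesis by simp
qed

lemma G_lipschitz: "cmod (G j s - G j t) <= 2 * \<bar>s - t\<bar>"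
proof -
 have m: "(\<lambda>y. cis (u * y)) \<in> borel_measurable I1" for u by (rule measurable_I1) measurable
 have "G j s - G j t = (LINT y|I1. (cis (s * y) - cis (t * y)) * \<psi> j y)" unfolding G_def left_diff_distrib by (subst L_integral_diff)
    (auto intro!: integrable_psi_mult[where B=1] m)
 also have "cmod ... <= 2 * \<bar>s - t\<bar>" proof (rule cmod_pairing_psi_le)
  fix y :: real assume y: "y \<in> {-1..1}"
  have "cmod (cis (s * y) - cis (t * y)) <= \<bar>(s - t) * y\<bar>" using cmod_cis_diff_le[of "s * y" "t * y"] by (simp add: left_diff_distrib)
  also have "... <= \<bar>s - t\<bar>" using y by (auto simp: abs_mult intro!: mult_left_le)
  finally show "cmod (cis (s * y) - cis (t * y)) <= \<bar>s - t\<bar>" .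
 qed (auto intro!: borel_measurable_diff m)
 finally show ?thesis .
qed

lemma continuous_G: "continuous_on UNIV (G j)" proof (rule lipschitz_on_continuous_on)
 show "2-lipschitz_on UNIV (G j)" by (rule lipschitz_onI) (use G_lipschitz in \<open>auto simp: dist_norm\<close>)
qed

lemma G_measurable [measurable]: "G j \<in> bm" by (rule borel_measurable_continuous_onI[OF continuous_G])

definition F :: "(real => complex) => real => complex" where
 "F f x = (LINT y|I1. cis (c * x * y) * f y)"

lemma F_bounded:
 assumes f: "l2 f"
 shows "cmod (F f x) <= (LINT y|I1. cmod (f y))" unfolding F_def by (rule order_trans[OF integral_norm_bound]) (simp add: norm_mult)

lemma l2_F:
 assumes f: "l2 f"
 shows "l2 (F f)"
proof -
 have [measurable]: "f \<in> borel_measurable I1" by (rule l2_measurable[OF f])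
 have [measurable]: "(\<lambda>z. cis (c * fst z * snd z)) \<in> borel_measurable (borel \<Otimes>\<^sub>M I1)"
  by (rule measurable_pair_I1) measurable
 have "(\<lambda>z. cis (c * fst z * snd z) * f (snd z)) \<in> borel_measurable (borel \<Otimes>\<^sub>M I1)" by measurable
 then have "F f \<in> bm" unfolding F_def[abs_def] by (intro I1.borel_measurable_lebesgue_integral) (simp add: split_beta')
 then show ?thesis by (intro l2_bounded[OF measurable_I1 F_bounded[OF f]])
qed

lemma coef_F:
 assumes f: "l2 f"
 shows "coef (F f) j = ev j * coef f j"
proof -
 have [measurable]: "f \<in> borel_measurable I1" by (rule l2_measurable[OF f])
 have [measurable]: "(\<lambda>z. cis (c * fst z * snd z)) \<in> borel_measurable (I1 \<Otimes>\<^sub>M I1)" by (rule measurable_pair_I1) measurable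
 have m: "(\<lambda>z. \<psi> j (fst z) * (cis (c * fst z * snd z) * f (snd z))) \<in> borel_measurable (I1 \<Otimes>\<^sub>M I1)" by measurable
 have int: "integrable (I1 \<Otimes>\<^sub>M I1) (\<lambda>(x, y). \<psi> j x * (cis (c * x * y) * f y))"
 proof (rule I1_I1.integrable_product_bound[where g="\<lambda>x. cmod (\<psi> j x)" and h="\<lambda>y. cmod (f y)"])
  show "integrable I1 (\<lambda>x. cmod (\<psi> j x))" "integrable I1 (\<lambda>x. cmod (f x))" by (intro integrable_norm l2_integrable l2_psi f)+
 qed (use m in \<open>auto simp: norm_mult split_beta'\<close>)
 have "coef (F f) j = (LINT x|I1. LINT y|I1. \<psi> j x * (cis (c * x * y) * f y))" unfolding coef_def F_def by simp
 also have "... = (LINT y|I1. LINT x|I1. \<psi> j x * (cis (c * x * y) * f y))" using I1_I1.Fubini_integral[OF int] by simp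
 also have "... = (LINT y|I1. ev j * \<psi> j y * f y)" proof (rule L_integral_cong[OF refl])
  fix y assume "y \<in> space I1"
  then have y: "y \<in> {-1..1}" by simp
  have e: "\<psi> j x * (cis (c * x * y) * f y) = (cis (c * y * x) * \<psi> j x) * f y" for x by (simp add: mult_ac)
  show "(LINT x|I1. \<psi> j x * (cis (c * x * y) * f y)) = ev j * \<psi> j y * f y"
   unfolding e by (subst integral_mult_left_zero) (simp add: eigen[OF y])
 qed
 also have "... = ev j * coef f j" unfolding coef_def by (simp add: mult.assoc)
 finally show ?thesis .
qed

end

section \<open>Extrapolation of band-limited functions\<close>

lemma nn_integral_consecutive_intervals:
 fixes F :: "real => ennreal"
 assumes [measurable]: "F \<in> bm" and a: "0 <= a"
 shows "(\<Sum>l<k. \<integral>\<^sup>+t. ind {0<..a} t * F (t + a * real l) \<partial>lborel) = (\<integral>\<^sup>+t. ind {0<..a * real k} t * F t \<partial>lborel)"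
proof (induction k)
 case (Suc k)
 have "(\<integral>\<^sup>+t. ind {a * real k<..a * real (Suc k)} t * F t \<partial>lborel)
  = (\<integral>\<^sup>+t. ind {a * real k<..a * real (Suc k)} (a * real k + 1 *\<^sub>R t) * F (a * real k + 1 *\<^sub>R t) \<partial>lborel)"
  by (subst nn_integral_lborel_affine[of _ 1 "a * real k"]) auto
 also have "... = (\<integral>\<^sup>+t. ind {0<..a} t * F (t + a * real k) \<partial>lborel)"
  by (intro nn_integral_cong) (auto simp: indicator_def algebra_simps)
 finally have "(\<Sum>l<Suc k. \<integral>\<^sup>+t. ind {0<..a} t * F (t + a * real l) \<partial>lborel)
  = (\<integral>\<^sup>+t. ind {0<..a * real k} t * F t \<partial>lborel) + (\<integral>\<^sup>+t. ind {a * real k<..a * real (Suc k)} t * F t \<partial>lborel)"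
  by (simp only: sum.lessThan_Suc Suc.IH)
 also have "... = (\<integral>\<^sup>+t. ind {0<..a * real k} t * F t + ind {a * real k<..a * real (Suc k)} t * F t \<partial>lborel)"
  by (rule nn_integral_add[symmetric]) measurable
 also have "... = (\<integral>\<^sup>+t. ind {0<..a * real (Suc k)} t * F t \<partial>lborel)" proof (rule nn_integral_cong)
  fix t
  have "0 <= a * real k" "a * real k <= a * real (Suc k)" using a by (auto intro: mult_left_mono)
  then show "ind {0<..a * real k} t * F t + ind {a * real k<..a * real (Suc k)} t * F t = ind {0<..a * real (Suc k)} t * F t"
   by (auto simp: indicator_def simp del: of_nat_Suc)
 qed
 finally show ?case .
qed simp

text \<open>
 Averaging the extrapolation inequality over the shift of the nodes turns the sum of point values into
 an integral over $[0,c]$, so square integrable data suffice.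
\<close>

lemma square_extrapolation_le:
 fixes h :: "real => complex" and m :: "nat => complex"
 assumes c: "0 < c" and J: "0 < J" and s: "\<bar>s\<bar> <= S" and R: "0 <= R" and h[measurable]: "h \<in> bm"
  and rem: "\<And>u. cmod (h u - (\<Sum>k<J. (\<i> * cor u) ^ k / fact k * m k)) <= R * \<bar>u\<bar> ^ J"
  and \<Lambda>: "\<Lambda> = real J * ((2 * (S + c) * J / c) ^ (J - 1) / fact (J - 1))"
 shows "ennreal ((cmod (h s))^2) <= ennreal (2 * (R * (S ^ J + \<Lambda> * c ^ J))^2)
  + ennreal (2 * \<Lambda>^2 / c) * (\<integral>\<^sup>+x. ind {0<..c} x * ennreal ((cmod (h x))^2) \<partial>lborel)"
  (is "_ <= ennreal (2 * ?X^2) + _ * ?I")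
proof -
 define L where "L = (2 * (S + c) * J / c) ^ (J - 1) / fact (J - 1)"
 have L: "0 <= L" "\<Lambda> = real J * L" using s c by (auto simp: L_def \<Lambda>)
 let ?F = "\<lambda>x. ennreal ((cmod (h x))^2)"
 let ?a = "c / real J"
 have a: "0 < ?a" using c J by simp
 have pt: "(cmod (h s))^2 <= 2 * ?X^2 + 2 * L^2 * J * (\<Sum>l<J. (cmod (h (t + ?a * real l)))^2)"
  if t: "0 <= t" "t <= ?a" for t proof -
  let ?s = "\<Sum>l<J. cmod (h (t + ?a * real l))"
  have "cmod (h s) <= R * S ^ J + L * (\<Sum>l<J. R * c ^ J + cmod (h (t + c * real l / J)))"
   unfolding L_def by (rule lagrange_extrapolation_le[OF c J s R t rem])
  also have "... = ?X + L * ?s" by (simp add: L sum.distrib algebra_simps)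
  finally have le: "cmod (h s) <= ?X + L * ?s" .
  have "?s^2 <= real J * (\<Sum>l<J. (cmod (h (t + ?a * real l)))^2)"
   using Cauchy_Schwarz_ineq_sum[of "\<lambda>_. 1" "\<lambda>l. cmod (h (t + ?a * real l))" "{..<J}"] by simp
  then have "L^2 * ?s^2 <= L^2 * (real J * (\<Sum>l<J. (cmod (h (t + ?a * real l)))^2))" by (rule mult_left_mono) simp
  moreover have "(cmod (h s))^2 <= (?X + L * ?s)^2" by (rule power_mono[OF le]) simp
  moreover have "(?X + L * ?s)^2 <= 2 * ?X^2 + 2 * (L * ?s)^2"
   using sum_squares_bound[of ?X "L * ?s"] by (simp only: power2_sum)
  moreover have "(L * ?s)^2 = L^2 * ?s^2" by (rule power_mult_distrib)
  ultimately show ?thesis by linarith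
 qed
 have "ennreal ?a * ?F s = (\<integral>\<^sup>+t. ?F s * ind {0<..?a} t \<partial>lborel)"
  using a by (subst nn_integral_cmult_indicator) (auto simp: mult.commute)
 also have "... <= (\<integral>\<^sup>+t. ennreal (2 * ?X^2) * ind {0<..?a} t
   + ennreal (2 * L^2 * J) * (\<Sum>l<J. ind {0<..?a} t * ?F (t + ?a * real l)) \<partial>lborel)" proof (rule nn_integral_mono)
  fix t :: real
  show "?F s * ind {0<..?a} t <= ennreal (2 * ?X^2) * ind {0<..?a} t
   + ennreal (2 * L^2 * J) * (\<Sum>l<J. ind {0<..?a} t * ?F (t + ?a * real l))" proof (cases "t \<in> {0<..?a}")
   case True
   have "?F s <= ennreal (2 * ?X^2 + 2 * L^2 * J * (\<Sum>l<J. (cmod (h (t + ?a * real l)))^2))"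
    using True by (intro ennreal_leI pt) auto
   also have "... = ennreal (2 * ?X^2) + ennreal (2 * L^2 * J) * ennreal (\<Sum>l<J. (cmod (h (t + ?a * real l)))^2)"
    by (simp add: ennreal_plus ennreal_mult[symmetric] sum_nonneg)
   also have "ennreal (\<Sum>l<J. (cmod (h (t + ?a * real l)))^2) = (\<Sum>l<J. ?F (t + ?a * real l))" by (rule sum_ennreal[symmetric]) simp
   finally show ?thesis using True by simp
  qed simp
 qed
 also have "... = (\<integral>\<^sup>+t. ennreal (2 * ?X^2) * ind {0<..?a} t \<partial>lborel)
   + (\<integral>\<^sup>+t. ennreal (2 * L^2 * J) * (\<Sum>l<J. ind {0<..?a} t * ?F (t + ?a * real l)) \<partial>lborel)"
  by (rule nn_integral_add) measurable
 also have "(\<integral>\<^sup>+t. ennreal (2 * L^2 * J) * (\<Sum>l<J. ind {0<..?a} t * ?F (t + ?a * real l)) \<partial>lborel)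
   = ennreal (2 * L^2 * J) * (\<integral>\<^sup>+t. (\<Sum>l<J. ind {0<..?a} t * ?F (t + ?a * real l)) \<partial>lborel)"
  by (rule nn_integral_cmult) measurable
 also have "(\<integral>\<^sup>+t. (\<Sum>l<J. ind {0<..?a} t * ?F (t + ?a * real l)) \<partial>lborel)
   = (\<Sum>l<J. \<integral>\<^sup>+t. ind {0<..?a} t * ?F (t + ?a * real l) \<partial>lborel)" by (rule nn_integral_sum) measurable
 also have "(\<integral>\<^sup>+t. ennreal (2 * ?X^2) * ind {0<..?a} t \<partial>lborel) = ennreal ?a * ennreal (2 * ?X^2)"
  using a by (subst nn_integral_cmult_indicator) (auto simp: mult.commute)
 also have "(\<Sum>l<J. \<integral>\<^sup>+t. ind {0<..?a} t * ?F (t + ?a * real l) \<partial>lborel) = ?I"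
  using nn_integral_consecutive_intervals[of ?F ?a J] a J by simp
 finally have *: "ennreal ?a * ?F s <= ennreal ?a * ennreal (2 * ?X^2) + ennreal (2 * L^2 * J) * ?I" .
 have ra: "ennreal (J / c) * ennreal ?a = 1" using c J by (simp add: ennreal_mult[symmetric])
 have "?F s = ennreal (J / c) * (ennreal ?a * ?F s)" by (simp only: mult.assoc[symmetric] ra mult_1_left)
 also have "... <= ennreal (J / c) * (ennreal ?a * ennreal (2 * ?X^2) + ennreal (2 * L^2 * J) * ?I)"
  by (rule mult_left_mono[OF *]) simp
 also have "... = ennreal (2 * ?X^2) + ennreal (J / c) * ennreal (2 * L^2 * J) * ?I"
  by (simp only: distrib_left mult.assoc[symmetric] ra mult_1_left)
 also have "ennreal (J / c) * ennreal (2 * L^2 * J) = ennreal (2 * \<Lambda>^2 / c)"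
  using c by (simp add: ennreal_mult[symmetric] L power2_eq_square mult_ac)
 finally show ?thesis .
qed

text \<open>
 The noise factor grows like $J^{J-1}$ apart from an exponential, since $S$ is proportional to $J$ and
 $J^J / J!$ is at most $e^J$. The proportionality constant $\eta = 1 / (16 e^2)$ makes $8 e^2 \eta =
 1/2$ the base of the error.
\<close>

lemma extrapolation_constants:
 fixes c :: real
 assumes c: "0 < c"
 obtains K C \<eta> :: real where "1 <= K" "0 < C" "0 < \<eta>"
  "\<And>J S \<Lambda>. 0 < J ==> S = \<eta> * real J ==> \<Lambda> = real J * ((2 * (S + c) * J / c) ^ (J - 1) / fact (J - 1)) ==>
   S * (2 * \<Lambda>^2 / c) <= (K ^ J * real J ^ (J - 1))^2"
  "\<And>J S \<Lambda>. 0 < J ==> S = \<eta> * real J ==> \<Lambda> = real J * ((2 * (S + c) * J / c) ^ (J - 1) / fact (J - 1)) ==>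
   2 ^ J / fact J * (S ^ J + \<Lambda> * c ^ J) <= C * (1 / 2) ^ J"
proof -
 define e :: real where "e = exp 1"
 have e: "1 <= e" unfolding e_def by simp
 define \<eta> where "\<eta> = 1 / (16 * e^2)"
 have eta: "0 < \<eta>" "8 * e^2 * \<eta> = 1 / 2" using e by (auto simp: \<eta>_def)
 have eta2: "2 * \<eta> * e <= 1 / 2" proof -
  have "e * 1 <= e * e" using e by (intro mult_left_mono) auto
  then show ?thesis using e by (simp add: \<eta>_def power2_eq_square field_simps)
 qed
 define b0 where "b0 = 2 * (\<eta> / c + 1)"
 have b0: "1 <= b0" using eta c by (simp add: b0_def add_increasing)
 define K where "K = 2 * e * b0 * (2 * (1 + 2 * \<eta> / c))"
 have fact_le: "1 / fact n <= (e / n) ^ n" if "0 < n" for n :: nat using fact_ge_power[of n] that e unfolding e_def[symmetric]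
  by (simp add: power_divide field_simps)
 have J2: "real J <= 2 ^ J" for J :: nat using less_exp[of J] by (metis less_imp_le of_nat_le_iff of_nat_numeral of_nat_power)
 have L: "0 <= \<Lambda>" "\<Lambda> <= (2 * e) ^ J * b ^ (J - 1)"
  if J: "0 < J" and S: "S = \<eta> * real J" and \<Lambda>: "\<Lambda> = real J * ((2 * (S + c) * J / c) ^ (J - 1) / fact (J - 1))"
   and b: "b = 2 * (S + c) / c" for J S \<Lambda> b proof -
  have b0': "0 <= b" using S c eta b by simp
  obtain i where i: "J = Suc i" using J by (cases J) auto
  have e1: "2 * (S + c) * J / c = b * real J" by (simp add: b)
  show "0 <= \<Lambda>" unfolding \<Lambda> e1 using b0' by simp
  have "\<Lambda> = b ^ i * (real J * (real J ^ i * real J / fact J))" unfolding \<Lambda> e1 using J by (simp add: power_mult_distrib i)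
  also have "real J ^ i * real J = real J ^ J" by (simp add: i)
  also have "b ^ i * (real J * (real J ^ J / fact J)) <= b ^ i * (2 ^ J * e ^ J)" proof (intro mult_left_mono mult_mono)
   have "real J ^ J / fact J <= exp (real J)" by (rule power_div_fact_le_exp) simp
   also have "exp (real J) = e ^ J" by (simp add: e_def exp_of_nat_mult[symmetric])
   finally show "real J ^ J / fact J <= e ^ J" .
  qed (use b0' e J2 in auto)
  finally show "\<Lambda> <= (2 * e) ^ J * b ^ (J - 1)" by (simp add: power_mult_distrib i mult_ac)
 qed
 show thesis proof (rule that[of K "1 + exp (c / \<eta>)" \<eta>])
  have K1: "1 * 1 <= (2 * e * b0) * (2 * (1 + 2 * \<eta> / c))" proof (rule mult_mono)
   have "1 * 1 <= (2 * e) * b0" using e b0 by (intro mult_mono) auto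
   then show "1 <= 2 * e * b0" by simp
   show "1 <= 2 * (1 + 2 * \<eta> / c)" using eta c by simp
  qed (use e b0 in auto)
  then show "1 <= K" by (simp add: K_def mult_ac)
  show "0 < 1 + exp (c / \<eta>)" by (simp add: add_pos_pos)
  show "0 < \<eta>" by (rule eta(1))
  fix J :: nat and S \<Lambda> :: real
  assume J: "0 < J" and S: "S = \<eta> * real J" and \<Lambda>: "\<Lambda> = real J * ((2 * (S + c) * J / c) ^ (J - 1) / fact (J - 1))"
  define b where "b = 2 * (S + c) / c"
  note L' = L[OF J S \<Lambda> b_def]
  have b1: "2 <= b" unfolding b_def S using eta c by (simp add: field_simps)
  have bJ: "b <= b0 * real J" proof -
   have "b = 2 * (\<eta> / c * real J + 1)" using c by (simp add: b_def S field_simps)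
   also have "... <= 2 * (\<eta> / c * real J + real J)" using J by simp
   finally show ?thesis by (simp add: b0_def algebra_simps)
  qed
  show "S * (2 * \<Lambda>^2 / c) <= (K ^ J * real J ^ (J - 1))^2" proof -
   let ?g = "2 * (1 + 2 * \<eta> / c)"
   have g: "1 <= ?g" using eta c by simp
   have "\<Lambda> <= (2 * e * b0) ^ J * real J ^ (J - 1)" proof -
    have "\<Lambda> <= (2 * e) ^ J * (b0 * real J) ^ (J - 1)"
     using L'(2) by (rule order_trans) (use bJ b1 e in \<open>auto intro!: mult_left_mono power_mono\<close>)
    also have "... = (2 * e) ^ J * (b0 ^ (J - 1) * real J ^ (J - 1))" by (simp only: power_mult_distrib)
    also have "... <= (2 * e) ^ J * (b0 ^ J * real J ^ (J - 1))" using e b0 by (intro mult_left_mono mult_right_mono power_increasing) auto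
    finally show ?thesis by (simp only: power_mult_distrib mult.assoc)
   qed
   then have l2: "\<Lambda>^2 <= ((2 * e * b0) ^ J * real J ^ (J - 1))^2" using L'(1) by (rule power_mono)
   have "S * (2 * \<Lambda>^2 / c) = (2 * \<eta> / c * real J) * \<Lambda>^2" by (simp add: S)
   also have "... <= (?g ^ J)^2 * ((2 * e * b0) ^ J * real J ^ (J - 1))^2" proof (rule mult_mono[OF _ l2])
    have "2 * \<eta> / c * real J <= (1 + 2 * \<eta> / c) ^ J * 2 ^ J" proof (rule mult_mono[OF _ J2])
     have "2 * \<eta> / c <= (1 + 2 * \<eta> / c) ^ 1" by simp
     also have "... <= (1 + 2 * \<eta> / c) ^ J" using J eta c by (intro power_increasing) auto
     finally show "2 * \<eta> / c <= (1 + 2 * \<eta> / c) ^ J" .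
    qed (use eta c in auto)
    also have "... = ?g ^ J" by (simp only: power_mult_distrib mult.commute)
    also have "... <= ?g ^ J * ?g ^ J" using one_le_power[OF g, of J] mult_left_mono[of 1 "?g ^ J" "?g ^ J"] by simp
    finally show "2 * \<eta> / c * real J <= (?g ^ J)^2" by (simp only: power2_eq_square)
   qed auto
   also have "... = (K ^ J * real J ^ (J - 1))^2" unfolding K_def by (simp only: power_mult_distrib mult_ac)
   finally show ?thesis .
  qed
  show "2 ^ J / fact J * (S ^ J + \<Lambda> * c ^ J) <= (1 + exp (c / \<eta>)) * (1 / 2) ^ J" proof -
   have f: "2 ^ J / fact J <= (2 * e / J) ^ J" using mult_left_mono[OF fact_le[OF J], of "2 ^ J"] by (simp add: power_mult_distrib power_divide)
   have "2 ^ J / fact J * S ^ J <= (2 * e / J) ^ J * S ^ J" using S eta by (intro mult_right_mono f) auto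
   also have "... = (2 * \<eta> * e) ^ J" using J by (simp add: S power_mult_distrib[symmetric] mult_ac)
   also have "... <= (1 / 2) ^ J" using eta2 eta e by (intro power_mono) auto
   finally have T1: "2 ^ J / fact J * S ^ J <= (1 / 2) ^ J" .
   have "\<Lambda> <= (2 * e) ^ J * b ^ J"
    using L'(2) by (rule order_trans) (use b1 e in \<open>auto intro!: mult_left_mono power_increasing\<close>)
   then have "2 ^ J / fact J * (\<Lambda> * c ^ J) <= (2 * e / J) ^ J * (((2 * e) ^ J * b ^ J) * c ^ J)"
    using f L'(1) b1 c e by (intro mult_mono) auto
   also have "... = ((2 * e / J) * (2 * e * b * c)) ^ J" by (simp only: power_mult_distrib)
   also have "(2 * e / J) * (2 * e * b * c) = (1 / 2) * (1 + c / \<eta> / J)" proof -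
    have "b * c = 2 * (\<eta> * J + c)" using c by (simp add: b_def S)
    then have "(2 * e / J) * (2 * e * b * c) = (8 * e^2) * ((\<eta> * J + c) / J)" by (simp add: power2_eq_square)
    also have "(\<eta> * J + c) / J = \<eta> * (1 + c / \<eta> / J)" using J eta(1) by (simp add: field_simps)
    finally show ?thesis using eta(2) by (simp add: mult.assoc[symmetric])
   qed
   also have "((1 / 2) * (1 + c / \<eta> / J)) ^ J = (1 + c / \<eta> / J) ^ J * (1 / 2) ^ J" by (simp only: power_mult_distrib mult.commute)
   also have "... <= exp (c / \<eta>) * (1 / 2) ^ J" proof (intro mult_right_mono)
    have "(1 + c / \<eta> / J) ^ J <= exp (c / \<eta> / J) ^ J" using exp_ge_add_one_self[of "c / \<eta> / J"] c eta by (intro power_mono) auto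
    also have "... = exp (c / \<eta>)" using J by (simp add: exp_of_nat_mult[symmetric])
    finally show "(1 + c / \<eta> / J) ^ J <= exp (c / \<eta>)" .
   qed simp
   finally have T2: "2 ^ J / fact J * (\<Lambda> * c ^ J) <= exp (c / \<eta>) * (1 / 2) ^ J" .
   show ?thesis unfolding distrib_left distrib_right using T1 T2 by simp
  qed
 qed
qed

section \<open>Bounds for the eigenvalues and the Fourier transforms of the eigenfunctions\<close>

lemma nn_integral_sq:
 assumes "l2 f"
 shows "(\<integral>\<^sup>+x. ennreal ((cmod (f x))^2) * ind {-1..1} x \<partial>lborel) = ennreal (sq f)"
proof -
 have "(\<integral>\<^sup>+x. ennreal ((cmod (f x))^2) * ind {-1..1} x \<partial>lborel) = (\<integral>\<^sup>+x. ennreal ((cmod (f x))^2) \<partial>I1)"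
  by (rule nn_integral_restrict_space[symmetric]) simp
 also have "... = ennreal (sq f)" unfolding sq_def by (rule nn_integral_eq_integral[OF l2_square_integrable[OF assms]]) simp
 finally show ?thesis .
qed

lemma sq_cong: "(\<And>x. x \<in> {-1..1} ==> cmod (f x) = cmod (g x)) ==> sq f = sq g"
 unfolding sq_def by (intro L_integral_cong) auto

lemma sq_le_bound:
 assumes "g \<in> borel_measurable I1" "\<And>x. x \<in> {-1..1} ==> cmod (g x) <= B"
 shows "sq g <= 2 * B^2"
proof -
 have "sq g <= (LINT x|I1. B^2)" unfolding sq_def
  by (rule integral_mono) (use assms l2_bounded[OF assms] in \<open>auto simp: l2_def intro: power_mono\<close>)
 then show ?thesis by simp
qed

lemma sq_cmult: "sq (\<lambda>x. a * f x) = (cmod a)^2 * sq f" unfolding sq_def by (simp add: norm_mult power_mult_distrib)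

text \<open>Taylor's formula for the exponential under the integral.\<close>

lemma moment_expansion:
 fixes f :: "real => complex"
 assumes f: "l2 f"
 shows "cmod ((LINT y|I1. cis (s * y) * f y)
   - (\<Sum>k<J. (\<i> * cor s) ^ k / fact k * (LINT y|I1. cor (y ^ k) * f y)))
  <= \<bar>s\<bar> ^ J / fact J * (LINT y|I1. cmod (f y))"
proof -
 have m: "l2 (\<lambda>y. cor (y ^ k))" for k by (rule l2_bounded[OF measurable_I1, of _ 1]) (auto simp: norm_power intro: power_le_one)
 have cs: "l2 (\<lambda>y. cis (s * y))" by (rule l2_bounded[OF measurable_I1, of _ 1]) auto
 have i1: "integrable I1 (\<lambda>y. cis (s * y) * f y)" by (rule l2_integrable_mult[OF cs f])
 have i2: "integrable I1 (\<lambda>y. (\<i> * cor s) ^ k / fact k * (cor (y ^ k) * f y))" for k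
  by (intro integrable_mult_right l2_integrable_mult[OF m f])
 have e: "(\<i> * cor (s * y)) ^ k / fact k * f y
   = (\<i> * cor s) ^ k / fact k * (cor (y ^ k) * f y)" for y k by (simp add: power_mult_distrib)
 have i3: "integrable I1 (\<lambda>y. \<Sum>k<J. (\<i> * cor (s * y)) ^ k / fact k * f y)" unfolding e by (intro L_integrable_sum i2)
 have "(LINT y|I1. cis (s * y) * f y)
   - (\<Sum>k<J. (\<i> * cor s) ^ k / fact k * (LINT y|I1. cor (y ^ k) * f y))
   = (LINT y|I1. cis (s * y) * f y) - (LINT y|I1. (\<Sum>k<J. (\<i> * cor (s * y)) ^ k / fact k * f y))"
  unfolding e by (subst L_integral_sum[OF i2]) (simp only: integral_mult_right_zero)
 also have "... = (LINT y|I1. cis (s * y) * f y - (\<Sum>k<J. (\<i> * cor (s * y)) ^ k / fact k * f y))"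
  by (rule L_integral_diff[symmetric, OF i1 i3])
 also have "... = (LINT y|I1. (cis (s * y) - (\<Sum>k<J. (\<i> * cor (s * y)) ^ k / fact k)) * f y)"
  by (simp only: left_diff_distrib sum_distrib_right)
 also have "cmod ... <= (LINT y|I1. \<bar>s\<bar> ^ J / fact J * cmod (f y))" proof (rule L_integral_norm_bound_integral)
  show "integrable I1 (\<lambda>y. (cis (s * y) - (\<Sum>k<J. (\<i> * cor (s * y)) ^ k / fact k)) * f y)"
   using L_integrable_diff[OF i1 i3] by (simp only: left_diff_distrib sum_distrib_right)
  show "integrable I1 (\<lambda>y. \<bar>s\<bar> ^ J / fact J * cmod (f y))" using l2_integrable[OF f] by simp
  fix y assume "y \<in> space I1"
  then have y: "\<bar>y\<bar> <= 1" by auto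
  have "cmod (cis (s * y) - (\<Sum>k<J. (\<i> * cor (s * y)) ^ k / fact k)) <= \<bar>s * y\<bar> ^ J / fact J" by (rule cis_taylor)
  also have "... <= \<bar>s\<bar> ^ J / fact J" using y by (intro divide_right_mono power_mono) (auto simp: abs_mult intro: mult_left_le)
  finally show "cmod ((cis (s * y) - (\<Sum>k<J. (\<i> * cor (s * y)) ^ k / fact k)) * f y)
    <= \<bar>s\<bar> ^ J / fact J * cmod (f y)" unfolding norm_mult by (intro mult_right_mono) auto
 qed
 finally show ?thesis by simp
qed

context pswf
begin

lemma F_comb:
 fixes a :: "nat => complex"
 assumes "finite A" "x \<in> {-1..1}"
 shows "F (\<lambda>y. \<Sum>k\<in>A. a k * \<psi> k y) x = (\<Sum>k\<in>A. (a k * ev k) * \<psi> k x)"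
proof -
 have "F (\<lambda>y. \<Sum>k\<in>A. a k * \<psi> k y) x = (LINT y|I1. (\<Sum>k\<in>A. a k * (cis (c * x * y) * \<psi> k y)))"
  unfolding F_def by (simp only: sum_distrib_left mult.left_commute)
 also have "... = (\<Sum>k\<in>A. (LINT y|I1. a k * (cis (c * x * y) * \<psi> k y)))"
  by (intro L_integral_sum integrable_mult_right l2_integrable_mult l2_psi l2_cis)
 also have "... = (\<Sum>k\<in>A. a k * (ev k * \<psi> k x))" by (simp only: integral_mult_right_zero eigen[OF assms(2)])
 finally show ?thesis by (simp only: mult.assoc)
qed

text \<open>
 Among the combinations of the first $j+1$ eigenfunctions there is a nonzero one whose moments of order
 less than $j$ vanish. The Taylor expansion of its transform starts at order $j$, while the transform
 multiplies its norm by at least the last eigenvalue.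
\<close>

lemma ev_upper: "cmod (ev j) <= 2 * (c ^ j / fact j)"
proof -
 define A where "A m k = (LINT y|I1. cor (y ^ m) * \<psi> k y)" for m k
 obtain a where a: "\<exists>k\<le>j. a k \<noteq> 0" "\<forall>m<j. (\<Sum>k\<le>j. a k * A m k) = 0" using nontrivial_kernel[of j A] by blast
 define f where "f y = (\<Sum>k\<le>j. a k * \<psi> k y)" for y
 have f: "l2 f" unfolding f_def[abs_def] by (rule l2_comb) simp
 have pw: "l2 (\<lambda>y. cor (y ^ k))" for k by (rule l2_bounded[OF measurable_I1, of _ 1]) (auto simp: norm_power intro: power_le_one)
 have mom: "(LINT y|I1. cor (y ^ m) * f y) = 0" if "m < j" for m proof -
  have "(LINT y|I1. cor (y ^ m) * f y) = (LINT y|I1. (\<Sum>k\<le>j. a k * (cor (y ^ m) * \<psi> k y)))"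
   unfolding f_def by (simp only: sum_distrib_left mult.left_commute)
  also have "... = (\<Sum>k\<le>j. LINT y|I1. a k * (cor (y ^ m) * \<psi> k y))"
   by (intro L_integral_sum integrable_mult_right l2_integrable_mult l2_psi pw)
  also have "... = (\<Sum>k\<le>j. a k * A m k)" unfolding A_def by (simp only: integral_mult_right_zero)
  finally show ?thesis using a(2) that by simp
 qed
 let ?B = "c ^ j / fact j * (LINT y|I1. cmod (f y))"
 have Fb: "cmod (F f x) <= ?B" if x: "x \<in> {-1..1}" for x proof -
  have "cmod (F f x) <= \<bar>c * x\<bar> ^ j / fact j * (LINT y|I1. cmod (f y))" proof -
   have z: "(\<Sum>k<j. (\<i> * cor (c * x)) ^ k / fact k * (LINT y|I1. cor (y ^ k) * f y)) = 0"
    by (intro sum.neutral ballI) (simp only: mom lessThan_iff mult_zero_right)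
   show ?thesis using moment_expansion[OF f, of "c * x" j] unfolding z by (simp add: F_def)
  qed
  also have "... <= ?B" using x c by (intro mult_right_mono divide_right_mono power_mono)
    (auto simp: abs_mult intro!: mult_left_le)
  finally show ?thesis .
 qed
 have S: "sq f = (\<Sum>k\<le>j. (cmod (a k))^2)" unfolding f_def[abs_def] by (rule sq_comb) simp
 have pos: "0 < sq f" proof -
  obtain k where k: "k <= j" "a k \<noteq> 0" using a(1) by blast
  have "(cmod (a k))^2 <= sq f" unfolding S using k by (intro member_le_sum) auto
  moreover have "0 < (cmod (a k))^2" using k by simp
  ultimately show ?thesis by linarith
 qed
 have "(cmod (ev j))^2 * sq f = (\<Sum>k\<le>j. (cmod (a k))^2 * (cmod (ev j))^2)"
  unfolding S by (simp add: sum_distrib_left mult.commute)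
 also have "... <= (\<Sum>k\<le>j. (cmod (a k))^2 * (cmod (ev k))^2)"
  by (intro sum_mono mult_left_mono power_mono ev_antimono) auto
 also have "... = (\<Sum>k\<le>j. (cmod (a k * ev k))^2)" by (simp add: norm_mult power_mult_distrib)
 also have "... = sq (\<lambda>x. \<Sum>k\<le>j. (a k * ev k) * \<psi> k x)" by (rule sq_comb[symmetric]) simp
 also have "... = sq (F f)" unfolding f_def[abs_def] by (rule sq_cong) (simp add: F_comb)
 also have "... <= 2 * ?B^2" by (rule sq_le_bound) (use l2_F[OF f] Fb in \<open>auto simp: l2_def\<close>)
 also have "... = 2 * (c ^ j / fact j)^2 * (LINT y|I1. cmod (f y))^2" by (simp only: power_mult_distrib mult.assoc)
 also have "... <= 2 * (c ^ j / fact j)^2 * (2 * sq f)" by (intro mult_left_mono l1_le_l2 f) auto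
 also have "... = (2 * (c ^ j / fact j))^2 * sq f" by (simp only: power_mult_distrib) simp
 finally have "(cmod (ev j))^2 <= (2 * (c ^ j / fact j))^2" using pos by (rule mult_right_le_imp_le)
 then show ?thesis by (rule power2_le_imp_le) (use c in simp)
qed

text \<open>
 On $[-c,c]$ the transform of an eigenfunction is the eigenvalue times the eigenfunction, which is
 small; extrapolate from there.
\<close>

lemma G_extrapolation:
 assumes J: "0 < J" and s: "\<bar>s\<bar> <= S" and \<Lambda>: "\<Lambda> = real J * ((2 * (S + c) * J / c) ^ (J - 1) / fact (J - 1))"
 shows "cmod (G j s) <= 2 * (2 / fact J * (S ^ J + \<Lambda> * c ^ J) + \<Lambda> * cmod (ev j))"
proof -
 let ?X = "2 / fact J * (S ^ J + \<Lambda> * c ^ J)" and ?Y = "\<Lambda> * cmod (ev j)"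
 have L0: "0 <= \<Lambda>" unfolding \<Lambda> using s c by simp
 have nn: "0 <= ?X" "0 <= ?Y" using L0 s c by auto
 have "(\<integral>\<^sup>+x. ind {0<..c} x * ennreal ((cmod (G j x))^2) \<partial>lborel)
  = ennreal \<bar>c\<bar> * (\<integral>\<^sup>+y. ind {0<..c} (c * y) * ennreal ((cmod (G j (c * y)))^2) \<partial>lborel)"
  using c by (subst nn_integral_lborel_affine[of _ c 0]) simp_all
 also have "... <= ennreal c * (\<integral>\<^sup>+y. ennreal ((cmod (ev j * cor (\<psi> j y)))^2) * ind {-1..1} y \<partial>lborel)"
 proof -
  have "ind {0<..c} (c * y) * ennreal ((cmod (G j (c * y)))^2)
   <= ennreal ((cmod (ev j * cor (\<psi> j y)))^2) * ind {-1..1} y" for y proof (cases "0 < c * y \<and> c * y <= c")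
   case True
   then have "y \<in> {-1..1}" using c by (auto simp: zero_less_mult_iff)
   then show ?thesis using True G_eigen[of y j] by simp
  qed (auto simp: indicator_def)
  then show ?thesis using c by (simp add: mult_left_mono nn_integral_mono)
 qed
 also have "... = ennreal c * ennreal ((cmod (ev j))^2)"
  using sq_comb[of "{j}" "\<lambda>_. 1"] by (subst nn_integral_sq[OF l2_cmult[OF l2_psi]]) (simp add: sq_cmult)
 finally have I: "(\<integral>\<^sup>+x. ind {0<..c} x * ennreal ((cmod (G j x))^2) \<partial>lborel) <= ennreal (c * (cmod (ev j))^2)"
  using c by (simp add: ennreal_mult)
 have "ennreal ((cmod (G j s))^2) <= ennreal (2 * ?X^2)
  + ennreal (2 * \<Lambda>^2 / c) * (\<integral>\<^sup>+x. ind {0<..c} x * ennreal ((cmod (G j x))^2) \<partial>lborel)"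
 proof (rule square_extrapolation_le[OF c J s _ G_measurable _ \<Lambda>])
  fix u :: real
  have "cmod (G j u - (\<Sum>k<J. (\<i> * cor u) ^ k / fact k * (LINT y|I1. cor (y ^ k) * \<psi> j y)))
    <= \<bar>u\<bar> ^ J / fact J * (LINT y|I1. cmod (\<psi> j y))" unfolding G_def by (rule moment_expansion[OF l2_psi])
  also have "... <= \<bar>u\<bar> ^ J / fact J * 2" using l1_psi_le[of j] by (intro mult_left_mono) auto
  finally show "cmod (G j u - (\<Sum>k<J. (\<i> * cor u) ^ k / fact k * (LINT y|I1. cor (y ^ k) * \<psi> j y)))
    <= 2 / fact J * \<bar>u\<bar> ^ J" by (simp only: times_divide_eq_left times_divide_eq_right mult.commute)
 qed simp
 also have "... <= ennreal (2 * ?X^2) + ennreal (2 * \<Lambda>^2 / c) * ennreal (c * (cmod (ev j))^2)"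
  by (intro add_left_mono mult_left_mono I) simp
 also have "... = ennreal (2 * ?X^2 + 2 * ?Y^2)" proof -
  have "2 * \<Lambda>^2 / c * (c * (cmod (ev j))^2) = 2 * ?Y^2" using c by (simp add: power_mult_distrib)
  moreover have "ennreal (2 * \<Lambda>^2 / c) * ennreal (c * (cmod (ev j))^2) = ennreal (2 * \<Lambda>^2 / c * (c * (cmod (ev j))^2))"
   using c by (intro ennreal_mult[symmetric]) auto
  ultimately show ?thesis by simp
 qed
 also have "... <= ennreal ((2 * (?X + ?Y))^2)" proof (rule ennreal_leI)
  have "2 * a^2 + 2 * b^2 <= (2 * (a + b))^2" if "0 <= a" "0 <= b" for a b :: real
   using that by (simp add: power2_eq_square algebra_simps)
  from this[OF nn] show "2 * ?X^2 + 2 * ?Y^2 <= (2 * (?X + ?Y))^2" .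
 qed
 finally have "(cmod (G j s))^2 <= (2 * (?X + ?Y))^2" by simp
 then show ?thesis by (rule power2_le_imp_le) (rule mult_nonneg_nonneg[OF _ add_nonneg_nonneg[OF nn]], simp)
qed

end

text \<open>
 Take half as many nodes as the index of the eigenfunction: then the eigenvalue, of size $c^j / j!$ with
 $j \ge 2 J$, beats the growth $J^J$ of the extrapolation factor.
\<close>

lemma pswf_G_decay:
 fixes c :: real
 assumes c: "0 < c"
 obtains C \<eta> q :: real where "0 < C" "0 < \<eta>" "0 < q" "q < 1"
  "\<And>\<psi> ev j s. pswf c \<psi> ev ==> 2 <= j ==> \<bar>s\<bar> <= \<eta> * real j ==> cmod (pswf.G \<psi> j s) <= C * q ^ j"
proof (rule extrapolation_constants[OF c], goal_cases)
 case (1 K C \<eta>)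
 note K = 1(2) and C = 1(3) and \<eta> = 1(4) and amp = 1(5) and small = 1(6)
 define q where "q = sqrt (1 / 2)"
 have q: "0 < q" "q < 1" "q^2 = 1 / 2" unfolding q_def by (simp_all add: real_sqrt_pow2)
 define g where "g = sqrt (c / (2 * \<eta>))"
 define B where "B = K * (c * exp 1 / 2)^2"
 have g: "0 <= g" "g^2 = c / (2 * \<eta>)" using c \<eta> by (auto simp: g_def)
 have B: "0 <= B" using K by (simp add: B_def)
 define C' where "C' = 2 * (2 * C + 2 * g * max 1 c * exp (2 * B))"
 have C': "0 < C'" using C g by (simp add: C'_def add_pos_nonneg)
 show thesis proof (rule 1(1)[of "C' / q" "\<eta> / 3" q])
  show "0 < C' / q" "0 < \<eta> / 3" "0 < q" "q < 1" using C' \<eta> q by auto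
  fix \<psi> :: "nat => real => real" and ev :: "nat => complex" and j :: nat and s :: real
  assume P: "pswf c \<psi> ev" and j: "2 <= j" and s: "\<bar>s\<bar> <= \<eta> / 3 * real j"
  interpret pswf c \<psi> ev by (rule P)
  define J where "J = j div 2"
  have J: "2 * J <= j" "j = 2 * J \<or> j = Suc (2 * J)" "0 < J" using j by (auto simp: J_def)
  have J1: "1 <= real J" using J by simp
  define S where "S = \<eta> * real J"
  define \<Lambda> where "\<Lambda> = real J * ((2 * (S + c) * J / c) ^ (J - 1) / fact (J - 1))"
  have S: "0 < S" using \<eta> J by (simp add: S_def)
  have L0: "0 <= \<Lambda>" unfolding \<Lambda>_def using S c by simp
  have "\<eta> / 3 * real j <= \<eta> / 3 * (3 * real J)" using J \<eta> by (intro mult_left_mono) auto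
  with s have sS: "\<bar>s\<bar> <= S" by (simp add: S_def)
  have X: "2 / fact J * (S ^ J + \<Lambda> * c ^ J) <= 2 * C * (1 / 2) ^ J" proof -
   have "2 / fact J * (S ^ J + \<Lambda> * c ^ J) <= 2 * (2 ^ J / fact J * (S ^ J + \<Lambda> * c ^ J))"
    unfolding mult.assoc[symmetric] using S L0 c by (intro mult_right_mono) (auto intro: divide_right_mono)
   also have "... <= 2 * (C * (1 / 2) ^ J)" by (intro mult_left_mono small[OF J(3) S_def \<Lambda>_def]) simp
   finally show ?thesis by (simp only: mult.assoc)
  qed
  have L: "\<Lambda> <= g * (K * J) ^ J" proof (rule power2_le_imp_le)
   have "K ^ J * real J ^ (J - 1) <= K ^ J * real J ^ J" using K J1 by (intro mult_left_mono power_increasing) auto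
   then have "(K ^ J * real J ^ (J - 1))^2 <= ((K * J) ^ J)^2"
    using K unfolding power_mult_distrib[of K "real J" J] by (intro power_mono) auto
   with amp[OF J(3) S_def \<Lambda>_def] have "S * (2 * \<Lambda>^2 / c) <= ((K * J) ^ J)^2" by linarith
   moreover have "\<eta> * (2 * \<Lambda>^2 / c) <= S * (2 * \<Lambda>^2 / c)"
    unfolding S_def using \<eta> J1 c by (intro mult_right_mono) auto
   ultimately have "\<eta> * (2 * \<Lambda>^2 / c) <= ((K * J) ^ J)^2" by linarith
   then have "\<Lambda>^2 <= c / (2 * \<eta>) * ((K * J) ^ J)^2" using c \<eta> by (simp add: field_simps)
   then show "\<Lambda>^2 <= (g * (K * J) ^ J)^2" by (simp only: power_mult_distrib[of g] g(2))
  qed (use g K in simp)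
  have E: "cmod (ev j) <= 2 * (max 1 c * ((c * exp 1 / (2 * J))^2) ^ J)" proof -
   have cj: "c ^ j <= max 1 c * c ^ (2 * J)" using J(2) c by (elim disjE) (simp_all add: mult_right_mono)
   have "(real (2 * J) / exp 1) ^ (2 * J) <= fact (2 * J)" by (rule fact_ge_power)
   also have "... <= (fact j :: real)" using J(1) by (rule fact_mono)
   finally have f: "(real (2 * J) / exp 1) ^ (2 * J) <= fact j" .
   have "c ^ j / fact j <= (max 1 c * c ^ (2 * J)) / (real (2 * J) / exp 1) ^ (2 * J)" using c J by (intro frac_le cj f) auto
   also have "... = max 1 c * (c * exp 1 / (2 * J)) ^ (2 * J)" by (simp add: power_divide power_mult_distrib)
   also have "... = max 1 c * ((c * exp 1 / (2 * J))^2) ^ J" by (simp only: power_mult)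
   finally show ?thesis using ev_upper[of j] by simp
  qed
  have "\<Lambda> * cmod (ev j) <= (g * (K * J) ^ J) * (2 * (max 1 c * ((c * exp 1 / (2 * J))^2) ^ J))"
   using L E L0 g K by (intro mult_mono) auto
  also have "... = 2 * g * max 1 c * ((K * J) * (c * exp 1 / (2 * J))^2) ^ J"
   unfolding power_mult_distrib[of "K * J" "(c * exp 1 / (2 * J))^2" J] by (simp only: mult_ac)
  also have "(K * J) * (c * exp 1 / (2 * J))^2 = (2 * B / J) * (1 / 2)" using J1 by (simp add: B_def power2_eq_square)
  also have "((2 * B / J) * (1 / 2)) ^ J = (2 * B / J) ^ J * (1 / 2) ^ J" by (rule power_mult_distrib)
  also have "(2 * B / J) ^ J <= exp (2 * B)" proof -
   have "(fact J :: real) <= real J ^ J" using fact_le_power[of J] by simp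
   then have "(2 * B) ^ J / real J ^ J <= (2 * B) ^ J / fact J" using B J1 by (intro divide_left_mono) auto
   also have "... <= exp (2 * B)" using B by (intro power_div_fact_le_exp) simp
   finally show ?thesis by (simp only: power_divide)
  qed
  finally have Y: "\<Lambda> * cmod (ev j) <= 2 * g * max 1 c * (exp (2 * B) * (1 / 2) ^ J)"
   using g by (simp add: mult_left_mono mult_right_mono)
  have "cmod (G j s) <= 2 * (2 / fact J * (S ^ J + \<Lambda> * c ^ J) + \<Lambda> * cmod (ev j))"
   by (rule G_extrapolation[OF J(3) sS \<Lambda>_def])
  also have "... <= 2 * (2 * C * (1 / 2) ^ J + 2 * g * max 1 c * (exp (2 * B) * (1 / 2) ^ J))" by (intro mult_left_mono add_mono X Y) simp
  also have "... = C' * (1 / 2) ^ J" unfolding C'_def by (simp only: distrib_left distrib_right mult.assoc)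
  also have "... <= C' * (q ^ j / q)" proof (intro mult_left_mono)
   have "q ^ (2 * J) = (1 / 2) ^ J" by (simp only: power_mult q(3))
   then have "(1 / 2) ^ J * q = q ^ Suc (2 * J)" by simp
   also have "... <= q ^ j" using J q by (intro power_decreasing) auto
   finally show "(1 / 2) ^ J <= q ^ j / q" using q by (simp add: pos_le_divide_eq)
  qed (use C' in simp)
  finally show "cmod (G j s) <= C' / q * q ^ j" by simp
 qed
qed

context pswf
begin

text \<open>
 Orthogonality to the first $n$ eigenfunctions leaves only eigenvalues that are at most the one of index
 $n$.
\<close>

lemma sq_F_le:
 assumes f: "l2 f" and z: "\<And>j. j < n ==> coef f j = 0"
 shows "sq (F f) <= (cmod (ev n))^2 * sq f"
proof (rule LIMSEQ_le_const2[OF parseval[OF l2_F[OF f]]], intro exI allI impI)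
 fix N
 have "(\<Sum>j<N. (cmod (coef (F f) j))^2) <= (\<Sum>j<N. (cmod (ev n))^2 * (cmod (coef f j))^2)" proof (rule sum_mono)
  fix j
  show "(cmod (coef (F f) j))^2 <= (cmod (ev n))^2 * (cmod (coef f j))^2" proof (cases "j < n")
   case False
   then have "(cmod (ev j))^2 <= (cmod (ev n))^2" by (intro power_mono ev_antimono) auto
   then show ?thesis by (simp add: coef_F[OF f] norm_mult power_mult_distrib mult_right_mono)
  qed (simp add: coef_F[OF f] z)
 qed
 also have "... = (cmod (ev n))^2 * (\<Sum>j<N. (cmod (coef f j))^2)" by (simp only: sum_distrib_left)
 also have "... <= (cmod (ev n))^2 * sq f" by (intro mult_left_mono bessel f) auto
 finally show "(\<Sum>j<N. (cmod (coef (F f) j))^2) <= (cmod (ev n))^2 * sq f" .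
qed

end

text \<open>
 On a short arc of the unit circle a polynomial of degree \<open>n\<close> cannot be small without having small
 coefficients, since the coefficients are recovered from the values at \<open>n + 1\<close> nodes.
\<close>

lemma sum_coeff_squares_le:
 fixes a :: "nat => complex" and w :: "nat => real"
 assumes g: "0 < g" and dist: "\<And>l m. l <= n ==> m <= n ==> g * \<bar>real l - real m\<bar> <= cmod (cis (w l) - cis (w m))"
 shows "(\<Sum>k\<le>n. (cmod (a k))^2)
  <= (real n + 1)^2 * (4 ^ n / (g ^ n * fact n))^2 * (\<Sum>l\<le>n. (cmod (\<Sum>k\<le>n. a k * cis (w l) ^ k))^2)"
proof -
 define P where "P = (\<Sum>k\<le>n. monom (a k) k)"
 define z where "z l = cis (w l)" for l
 let ?\<Lambda> = "4 ^ n / (g ^ n * fact n)"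
 have coeffP: "coeff P k = a k" if "k <= n" for k using that by (simp add: P_def coeff_sum if_distrib sum.delta' cong: if_cong)
 have polyP: "poly P (z l) = (\<Sum>k\<le>n. a k * cis (w l) ^ k)" for l by (simp add: P_def poly_sum poly_monom z_def)
 have "degree P <= n" unfolding P_def by (intro degree_sum_le) (auto intro: order_trans[OF degree_monom_le])
 then have deg: "degree P < Suc n" by simp
 have inj: "inj_on z {..<Suc n}" proof (rule inj_onI)
  fix l m assume lm: "l \<in> {..<Suc n}" "m \<in> {..<Suc n}" "z l = z m"
  then have "g * \<bar>real l - real m\<bar> <= 0" using dist[of l m] by (simp add: z_def)
  then show "l = m" using g by (simp add: mult_le_0_iff)
 qed
 have basis: "cmod (coeff (lagrange_basis z (Suc n) l) k) <= ?\<Lambda>" if l: "l <= n" for l k proof -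
  have card: "card ({..<Suc n} - {l}) = n" using l by simp
  have num: "cmod (coeff (\<Prod>m\<in>{..<Suc n} - {l}. [:- z m, 1:]) k) <= 2 ^ n"
   using cmod_coeff_prod_linear_le[of "{..<Suc n} - {l}" z k] by (simp add: card z_def)
  have "g ^ n * (fact n / 2 ^ n) <= g ^ n * (\<Prod>m\<in>{..<Suc n} - {l}. \<bar>real l - real m\<bar>)"
   using g prod_node_distances_ge[of l "Suc n"] l by (intro mult_left_mono) auto
  also have "... = (\<Prod>m\<in>{..<Suc n} - {l}. g * \<bar>real l - real m\<bar>)" by (simp add: prod.distrib card)
  also have "... <= (\<Prod>m\<in>{..<Suc n} - {l}. cmod (z l - z m))" using g dist l by (intro prod_mono) (auto simp: z_def)
  finally have den: "g ^ n * (fact n / 2 ^ n) <= (\<Prod>m\<in>{..<Suc n} - {l}. cmod (z l - z m))" .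
  have "cmod (coeff (lagrange_basis z (Suc n) l) k)
    = cmod (coeff (\<Prod>m\<in>{..<Suc n} - {l}. [:- z m, 1:]) k) / (\<Prod>m\<in>{..<Suc n} - {l}. cmod (z l - z m))"
   by (simp add: lagrange_basis_def norm_divide prod_norm del: lessThan_Suc)
  also have "... <= 2 ^ n / (g ^ n * (fact n / 2 ^ n))" by (rule frac_le[OF _ num _ den]) (use g in auto)
  also have "... = ?\<Lambda>" by (simp add: power_mult_distrib[symmetric])
  finally show ?thesis .
 qed
 have L0: "0 <= ?\<Lambda>" using g by simp
 have ak: "(cmod (a k))^2 <= (real n + 1) * ?\<Lambda>^2 * (\<Sum>l\<le>n. (cmod (poly P (z l)))^2)" if k: "k <= n" for k
 proof -
  have "a k = coeff P k" by (simp add: coeffP[OF k])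
  also have "... = (\<Sum>l<Suc n. poly P (z l) * coeff (lagrange_basis z (Suc n) l) k)"
   by (subst lagrange_interpolation[OF deg inj]) (simp add: coeff_sum del: sum.lessThan_Suc)
  finally have "cmod (a k) <= (\<Sum>l<Suc n. cmod (poly P (z l) * coeff (lagrange_basis z (Suc n) l) k))" by (simp only: norm_sum)
  also have "... <= (\<Sum>l<Suc n. cmod (poly P (z l)) * ?\<Lambda>)" unfolding norm_mult by (intro sum_mono mult_left_mono basis) auto
  also have "... = ?\<Lambda> * (\<Sum>l\<le>n. cmod (poly P (z l)))"
   by (simp only: sum_distrib_right[symmetric] lessThan_Suc_atMost mult.commute)
  finally have "(cmod (a k))^2 <= (?\<Lambda> * (\<Sum>l\<le>n. cmod (poly P (z l))))^2" by (rule power_mono) simp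
  also have "... = ?\<Lambda>^2 * (\<Sum>l\<le>n. cmod (poly P (z l)) * 1)^2" by (simp only: power_mult_distrib mult_1_right)
  also have "... <= ?\<Lambda>^2 * ((\<Sum>l\<le>n. (cmod (poly P (z l)))^2) * (\<Sum>l\<le>n. 1^2))"
   by (intro mult_left_mono Cauchy_Schwarz_ineq_sum) auto
  finally show ?thesis by (simp add: mult_ac add.commute)
 qed
 have "(\<Sum>k\<le>n. (cmod (a k))^2) <= (\<Sum>k\<le>n. (real n + 1) * ?\<Lambda>^2 * (\<Sum>l\<le>n. (cmod (poly P (z l)))^2))"
  by (intro sum_mono ak) simp
 also have "... = (real n + 1) * ((real n + 1) * ?\<Lambda>^2 * (\<Sum>l\<le>n. (cmod (poly P (z l)))^2))" by simp
 finally show ?thesis unfolding polyP by (simp only: power2_eq_square[of "real n + 1"] mult.assoc)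
qed

lemma integral_I1_interval:
 fixes f :: "real => 'b::{banach, second_countable_topology}"
 assumes "S \<in> sets borel" "S \<subseteq> {-1..1}"
 shows "(LINT y|I1. ind S y *\<^sub>R f y) = (LINT y|lborel. ind S y *\<^sub>R f y)"
proof -
 have e: "ind {-1..1} y *\<^sub>R (ind S y *\<^sub>R f y) = ind S y *\<^sub>R f y" for y :: real using assms(2) by (auto simp: indicator_def)
 show ?thesis by (subst integral_restrict_space) (simp_all only: e, simp)
qed

text \<open>
 The test function is the step function with $n+1$ steps of length $h$ orthogonal to the first $n$
 eigenfunctions. Its transform at $x$ is the transform of one step times a polynomial in $e^{i c x h}$
 whose coefficients are the step heights; \<open>sum_coeff_squares_le\<close> recovers them from values
 at $n+1$ shifted nodes, and integrating over the shift gives the $L^2$ norm of the transform.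
\<close>

lemma (in pswf) ev_lower:
 defines "X \<equiv> min 1 (1 / c)"
 shows "X / 2 <= 4 * (real n + 1) ^ 4 * (4 ^ n / ((c * X / (4 * (real n + 1)^2)) ^ n * fact n))^2 * (cmod (ev n))^2"
proof -
 have X: "0 < X" "X <= 1" "c * X <= 1" using c unfolding X_def by (auto simp: min_def field_simps)
 (* On |x| <= X the phase c x stays at most one, so the nodes exp(i c x h) lie on a short arc and the transform of a single step stays away from zero. *)
 define h where "h = 1 / (real n + 1)"
 have h: "0 < h" "h <= 1" "(real n + 1) * h = 1" by (auto simp: h_def)
 define U where "U k = {real k * h..<real k * h + h}" for k :: nat
 have U_sub: "U k \<subseteq> {-1..1}" if "k <= n" for k proof -
  have "real k * h + h = (real k + 1) * h" by (simp add: distrib_right)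
  also have "... <= (real n + 1) * h" using that h by (intro mult_right_mono) auto
  finally have le: "real k * h + h <= 1" using h by simp
  have ge: "0 <= real k * h" using h by simp
  show ?thesis proof
   fix x assume "x \<in> U k"
   then have "real k * h <= x" "x < real k * h + h" by (auto simp: U_def)
   then have "-1 <= x" "x <= 1" using le ge by linarith+
   then show "x \<in> {-1..1}" by simp
  qed
 qed
 have U_disj: "k = m" if "y \<in> U k" "y \<in> U m" for y k m proof -
  have "real k * h < real m * h + h" "real m * h < real k * h + h" using that by (auto simp: U_def)
  then have "real k * h < (real m + 1) * h" "real m * h < (real k + 1) * h" by (auto simp: distrib_right)
  then have "real k < real m + 1" "real m < real k + 1" using h by (auto simp: mult_less_cancel_right)
  then show ?thesis by linarith
 qed
 define ch where "ch k y = cor (ind (U k) y)" for k y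
 have [measurable]: "ch k \<in> bm" for k unfolding ch_def[abs_def] U_def by measurable
 have ch: "l2 (ch k)" for k by (rule l2_bounded[OF measurable_I1, of _ 1]) (auto simp: ch_def indicator_def)
 obtain a where a: "\<exists>k\<le>n. a k \<noteq> 0" "\<forall>m<n. (\<Sum>k\<le>n. a k * coef (ch k) m) = 0"
  using nontrivial_kernel[of n "\<lambda>m k. coef (ch k) m"] by blast
 define f where "f y = (\<Sum>k\<le>n. a k * ch k y)" for y
 define A where "A = (\<Sum>k\<le>n. (cmod (a k))^2)"
 have f: "l2 f" unfolding f_def[abs_def] by (intro l2_sum l2_cmult ch) simp
 have zero: "coef f m = 0" if "m < n" for m unfolding f_def using that a(2) by (subst coef_sum) (auto intro: l2_cmult ch simp: coef_cmult)
 have A: "0 < A" proof -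
  obtain k where k: "k <= n" "a k \<noteq> 0" using a(1) by blast
  have "(cmod (a k))^2 <= A" unfolding A_def using k by (intro member_le_sum) auto
  moreover have "0 < (cmod (a k))^2" using k by simp
  ultimately show ?thesis by linarith
 qed
 have sqf: "sq f = h * A" proof -
  have pw: "(cmod (f y))^2 = (\<Sum>k\<le>n. (cmod (a k))^2 * ind (U k) y)" for y proof (cases "\<exists>k\<le>n. y \<in> U k")
   case True
   then obtain k where k: "k <= n" "y \<in> U k" by blast
   have ind: "ind (U m) y = (if m = k then 1 else 0 :: real)" for m proof (cases "m = k")
    case True
    then show ?thesis using k by simp
   next
    case False
    then have "y \<notin> U m" using U_disj[OF _ k(2), of m] by blast
    then show ?thesis using False by simp
   qed
   show ?thesis unfolding f_def ch_def ind using k by (simp add: if_distrib[of cor] if_distrib[of "\<lambda>x. _ * x"] sum.delta cong: if_cong)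
  next
   case False
   then show ?thesis unfolding f_def ch_def by (auto simp: indicator_def intro!: sum.neutral)
  qed
  have meas: "measure I1 (U k) = h" if "k <= n" for k using U_sub[OF that] h by (simp add: measure_restrict_space U_def)
  have i: "integrable I1 (\<lambda>y. (cmod (a k))^2 * ind (U k) y)" for k
   by (rule integrable_I1_bounded[OF measurable_I1, of _ "(cmod (a k))^2"]) (auto simp: indicator_def U_def)
  have "sq f = (\<Sum>k\<le>n. LINT y|I1. (cmod (a k))^2 * ind (U k) y)" unfolding sq_def pw by (rule L_integral_sum[OF i])
  also have "... = (\<Sum>k\<le>n. (cmod (a k))^2 * h)" proof (rule sum.cong[OF refl])
   fix k assume "k \<in> {..n}"
   then have "k <= n" by simp
   then show "(LINT y|I1. (cmod (a k))^2 * ind (U k) y) = (cmod (a k))^2 * h"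
    using U_sub[of k] meas[of k] by (simp add: Int_absorb1 Int_absorb2)
  qed
  finally show ?thesis by (simp add: A_def sum_distrib_left mult.commute)
 qed
 define D where "D x = (LINT y|lborel. ind {0..<h} y *\<^sub>R cis (c * x * y))" for x
 define P where "P x = (\<Sum>k\<le>n. a k * cis (c * h * x) ^ k)" for x
 have Ff: "F f x = P x * D x" for x proof -
  have ik: "(LINT y|I1. cis (c * x * y) * ch k y) = cis (c * h * x) ^ k * D x" if k: "k <= n" for k proof -
   have "(LINT y|I1. cis (c * x * y) * ch k y) = (LINT y|I1. ind (U k) y *\<^sub>R cis (c * x * y))"
    by (simp add: ch_def scaleR_conv_of_real mult.commute)
   also have "... = (LINT y|lborel. ind (U k) y *\<^sub>R cis (c * x * y))"
    by (rule integral_I1_interval) (use U_sub[OF k] in \<open>auto simp: U_def\<close>)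
   also have "... = \<bar>1\<bar> ^ DIM(real) *\<^sub>R (LINT y|lborel. ind (U k) (real k * h + 1 *\<^sub>R y) *\<^sub>R cis (c * x * (real k * h + 1 *\<^sub>R y)))"
    by (rule integral_lborel_affine) (auto simp: U_def)
   also have "... = (LINT y|lborel. cis (c * h * x) ^ k * (ind {0..<h} y *\<^sub>R cis (c * x * y)))" proof -
    have e: "cis (c * x * (real k * h + y)) = cis (c * h * x) ^ k * cis (c * x * y)" for y
     unfolding Complex.DeMoivre cis_mult by (rule arg_cong[of _ _ cis]) (simp add: algebra_simps)
    have "ind (U k) (real k * h + 1 *\<^sub>R y) *\<^sub>R cis (c * x * (real k * h + 1 *\<^sub>R y))
      = cis (c * h * x) ^ k * (ind {0..<h} y *\<^sub>R cis (c * x * y))" for y unfolding scaleR_one e by (simp add: U_def indicator_def)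
    then show ?thesis by simp
   qed
   finally show ?thesis by (simp only: D_def integral_mult_right_zero)
  qed
  have "F f x = (LINT y|I1. (\<Sum>k\<le>n. a k * (cis (c * x * y) * ch k y)))"
   unfolding F_def f_def by (simp only: sum_distrib_left mult.left_commute)
  also have "... = (\<Sum>k\<le>n. LINT y|I1. a k * (cis (c * x * y) * ch k y))"
   by (intro L_integral_sum integrable_mult_right l2_integrable_mult ch l2_cis)
  also have "... = (\<Sum>k\<le>n. a k * (cis (c * h * x) ^ k * D x))"
   by (intro sum.cong refl) (simp only: integral_mult_right_zero ik atMost_iff)
  finally show ?thesis by (simp add: P_def sum_distrib_right mult.assoc)
 qed
 have D_ge: "h / 2 <= cmod (D x)" if x: "x \<in> {0..X}" for x proof -
  have i: "integrable lborel (\<lambda>y. ind {0..<h} y *\<^sub>R cis (c * x * y))"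
   by (rule integrableI_bounded_set_indicator[where B=1]) (use h in auto)
  have "h / 2 = (LINT y|lborel. (1 / 2) * ind {0..<h} y)" using h by simp
  also have "... <= (LINT y|lborel. Re (ind {0..<h} y *\<^sub>R cis (c * x * y)))" proof (rule integral_mono)
   show "integrable lborel (\<lambda>y. (1 / 2) * ind {0..<h} y :: real)" using h by (intro integrable_mult_right integrable_real_indicator) auto
   fix y :: real
   show "(1 / 2) * ind {0..<h} y <= Re (ind {0..<h} y *\<^sub>R cis (c * x * y))" proof (cases "y \<in> {0..<h}")
    case True
    have "c * x * y <= c * X * 1" using True x h c X by (intro mult_mono) auto
    moreover have "0 <= c * x * y" using True x c by simp
    ultimately have "1 / 2 <= cos (c * x * y)" using X by (intro cos_ge_half) auto
    then show ?thesis using True by simp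
   qed simp
  qed (use i in \<open>rule integrable_Re\<close>)
  also have "... = Re (D x)" unfolding D_def by (rule integral_Re[OF i])
  also have "... <= cmod (D x)" by (rule complex_Re_le_cmod)
  finally show ?thesis .
 qed
 have P_meas [measurable]: "P \<in> bm" unfolding P_def[abs_def] by measurable
 have low: "(\<integral>\<^sup>+x. ennreal ((cmod (P x))^2) * ind {0..X} x \<partial>lborel) <= ennreal (4 / h^2 * sq (F f))" proof -
  have i: "integrable I1 (\<lambda>x. 4 / h^2 * (cmod (F f x))^2)" using l2_square_integrable[OF l2_F[OF f]] by simp
  have "(\<integral>\<^sup>+x. ennreal ((cmod (P x))^2) * ind {0..X} x \<partial>lborel)
    <= (\<integral>\<^sup>+x. ennreal (4 / h^2 * (cmod (F f x))^2) * ind {-1..1} x \<partial>lborel)" proof (rule nn_integral_mono)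
   fix x :: real
   show "ennreal ((cmod (P x))^2) * ind {0..X} x <= ennreal (4 / h^2 * (cmod (F f x))^2) * ind {-1..1} x"
   proof (cases "x \<in> {0..X}")
    case True
    have "1 <= 2 / h * cmod (D x)" using D_ge[OF True] h by (simp add: field_simps)
    then have "1^2 <= (2 / h * cmod (D x))^2" by (intro power_mono) auto
    then have "(cmod (P x))^2 * 1 <= (cmod (P x))^2 * (2 / h * cmod (D x))^2" by (intro mult_left_mono) auto
    also have "... = 4 / h^2 * (cmod (F f x))^2" unfolding Ff norm_mult by (simp add: power_mult_distrib power_divide)
    finally have "(cmod (P x))^2 <= 4 / h^2 * (cmod (F f x))^2" by simp
    moreover have "x \<in> {-1..1}" using True X by auto
    ultimately show ?thesis using True by (simp add: ennreal_leI)
   qed simp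
  qed
  also have "... = (\<integral>\<^sup>+x. ennreal (4 / h^2 * (cmod (F f x))^2) \<partial>I1)"
   by (rule nn_integral_restrict_space[symmetric]) simp
  also have "... = ennreal (4 / h^2 * sq (F f))" using nn_integral_eq_integral[OF i] by (simp add: sq_def)
  finally show ?thesis .
 qed
 define g where "g = c * X / (4 * (real n + 1)^2)"
 have g: "0 < g" using c X by (simp add: g_def)
 let ?B = "(real n + 1)^2 * (4 ^ n / (g ^ n * fact n))^2"
 define \<delta> where "\<delta> l = X * real l / (2 * (real n + 1))" for l :: nat
 have d: "0 <= \<delta> l" "\<delta> l <= X / 2" if "l <= n" for l proof -
  have "\<delta> l = X / 2 * (real l / (real n + 1))" by (simp add: \<delta>_def)
  also have "... <= X / 2 * 1" using that X by (intro mult_left_mono) auto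
  finally show "\<delta> l <= X / 2" by simp
  show "0 <= \<delta> l" using X by (simp add: \<delta>_def)
 qed
 have point: "A <= ?B * (\<Sum>l\<le>n. (cmod (P (t + \<delta> l)))^2)" for t unfolding A_def P_def proof (rule sum_coeff_squares_le[OF g])
  fix l m assume lm: "l <= n" "m <= n"
  have eq: "c * h * (\<delta> l - \<delta> m) = 2 * g * (real l - real m)" proof -
   define D where "D = real n + 1"
   have "D \<noteq> 0" by (simp add: D_def)
   then show ?thesis unfolding \<delta>_def g_def h_def D_def[symmetric] by (simp add: field_simps power2_eq_square)
  qed
  have "\<bar>\<delta> l - \<delta> m\<bar> <= X" using d[OF lm(1)] d[OF lm(2)] X by linarith
  then have "c * h * \<bar>\<delta> l - \<delta> m\<bar> <= c * 1 * X" using c h X by (intro mult_mono) auto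
  also have "... <= 1" using X by simp
  finally have le: "c * h * \<bar>\<delta> l - \<delta> m\<bar> <= 1" .
  have eq2: "c * h * (t + \<delta> l) - c * h * (t + \<delta> m) = c * h * (\<delta> l - \<delta> m)" by (simp add: algebra_simps)
  have "\<bar>c * h * (t + \<delta> l) - c * h * (t + \<delta> m)\<bar> <= 1" using le c h unfolding eq2 abs_mult by simp
  from cmod_cis_diff_ge[OF this]
  show "g * \<bar>real l - real m\<bar> <= cmod (cis (c * h * (t + \<delta> l)) - cis (c * h * (t + \<delta> m)))"
   unfolding eq2 eq using g by (simp add: abs_mult)
 qed
 have shifted: "(\<integral>\<^sup>+t. ennreal ((cmod (P (t + \<delta> l)))^2) * ind {0..X / 2} t \<partial>lborel) <= ennreal (4 / h^2 * sq (F f))"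
  if l: "l <= n" for l proof -
  have "(\<integral>\<^sup>+t. ennreal ((cmod (P (t + \<delta> l)))^2) * ind {0..X / 2} t \<partial>lborel)
   <= (\<integral>\<^sup>+t. ennreal ((cmod (P (\<delta> l + 1 *\<^sub>R t)))^2) * ind {0..X} (\<delta> l + 1 *\<^sub>R t) \<partial>lborel)"
   using d[OF l] by (intro nn_integral_mono) (auto simp: indicator_def add.commute)
  also have "... = (\<integral>\<^sup>+x. ennreal ((cmod (P x))^2) * ind {0..X} x \<partial>lborel)"
   by (subst (2) nn_integral_lborel_affine[of _ 1 "\<delta> l"]) auto
  finally show ?thesis using low by (rule order_trans)
 qed
 have "ennreal (X / 2 * A) = (\<integral>\<^sup>+t. ennreal A * ind {0..X / 2} t \<partial>lborel)"
  using X A by (subst nn_integral_cmult_indicator) (auto simp: ennreal_mult[symmetric] mult.commute)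
 also have "... <= (\<integral>\<^sup>+t. ennreal ?B * (\<Sum>l\<le>n. ennreal ((cmod (P (t + \<delta> l)))^2) * ind {0..X / 2} t) \<partial>lborel)"
 proof (rule nn_integral_mono)
  fix t :: real
  have B0: "0 <= ?B" by simp
  have "ennreal A <= ennreal ?B * (\<Sum>l\<le>n. ennreal ((cmod (P (t + \<delta> l)))^2))"
   using point[of t] by (simp add: ennreal_mult[OF B0, symmetric] sum_nonneg ennreal_leI)
  then show "ennreal A * ind {0..X / 2} t
   <= ennreal ?B * (\<Sum>l\<le>n. ennreal ((cmod (P (t + \<delta> l)))^2) * ind {0..X / 2} t)" by (auto simp: indicator_def)
 qed
 also have "... = ennreal ?B * (\<Sum>l\<le>n. \<integral>\<^sup>+t. ennreal ((cmod (P (t + \<delta> l)))^2) * ind {0..X / 2} t \<partial>lborel)"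
 proof -
  have "(\<integral>\<^sup>+t. (\<Sum>l\<le>n. ennreal ((cmod (P (t + \<delta> l)))^2) * ind {0..X / 2} t) \<partial>lborel)
   = (\<Sum>l\<le>n. \<integral>\<^sup>+t. ennreal ((cmod (P (t + \<delta> l)))^2) * ind {0..X / 2} t \<partial>lborel)"
   by (rule nn_integral_sum) measurable
  then show ?thesis by (subst nn_integral_cmult) simp_all
 qed
 also have "... <= ennreal ?B * (\<Sum>l\<le>n. ennreal (4 / h^2 * sq (F f)))" by (intro mult_left_mono sum_mono shifted) auto
 also have "... = ennreal (?B * ((real n + 1) * (4 / h^2 * sq (F f))))" proof -
  let ?Y = "4 / h^2 * sq (F f)"
  have "(\<Sum>l\<le>n. ennreal ?Y) = ennreal (\<Sum>l\<le>n. ?Y)" by (rule sum_ennreal) simp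
  also have "(\<Sum>l\<le>n. ?Y) = (real n + 1) * ?Y" by simp
  finally have e: "(\<Sum>l\<le>n. ennreal ?Y) = ennreal ((real n + 1) * ?Y)" .
  show ?thesis unfolding e by (rule ennreal_mult[symmetric]) simp_all
 qed
 finally have "X / 2 * A <= ?B * ((real n + 1) * (4 / h^2 * sq (F f)))" using g by (subst (asm) ennreal_le_iff) auto
 also have "... <= ?B * ((real n + 1) * (4 / h^2 * ((cmod (ev n))^2 * (h * A))))"
  using sq_F_le[OF f zero] unfolding sqf by (intro mult_left_mono) auto
 also have "... = (4 * (real n + 1) ^ 4 * (4 ^ n / (g ^ n * fact n))^2 * (cmod (ev n))^2) * A"
  by (simp add: h_def power2_eq_square eval_nat_numeral)
 finally have "X / 2 <= 4 * (real n + 1) ^ 4 * (4 ^ n / (g ^ n * fact n))^2 * (cmod (ev n))^2" using A by (rule mult_right_le_imp_le)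
 then show ?thesis unfolding g_def .
qed

text \<open>
 An elementary form of Stirling's formula turns the factorial into the power $n^n$; everything else is
 exponential in $n$.
\<close>

lemma pswf_ev_lower:
 fixes c :: real
 assumes c: "0 < c"
 obtains K :: real where "1 <= K" "\<And>\<psi> ev n. pswf c \<psi> ev ==> 1 / cmod (ev n) <= K ^ (n + 1) * (real n + 1) ^ n"
proof -
 define X where "X = min 1 (1 / c)"
 have X: "0 < X" using c by (simp add: X_def)
 define a where "a = 16 / (c * X)"
 define b where "b = sqrt (8 / X)"
 have ab: "0 < a" "0 <= b" using c X by (auto simp: a_def b_def)
 define K where "K = (1 + b) * (4 * (exp 1 * (1 + a)))"
 have e: "1 <= exp (1::real)" by simp
 show thesis proof (rule that[of K])
  have "1 * 1 <= exp 1 * (1 + a)" using ab e by (intro mult_mono) auto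
  then have "1 * 1 <= (1 + b) * (4 * (exp 1 * (1 + a)))" using ab by (intro mult_mono) auto
  then show "1 <= K" by (simp add: K_def)
  fix \<psi> ev n assume P: "pswf c \<psi> ev"
  interpret pswf c \<psi> ev by (rule P)
  let ?\<Lambda> = "4 ^ n / ((c * X / (4 * (real n + 1)^2)) ^ n * fact n)"
  have L: "0 < ?\<Lambda>" using c X by simp
  have "X / 2 <= 4 * (real n + 1) ^ 4 * ?\<Lambda>^2 * (cmod (ev n))^2" using ev_lower[of n] unfolding X_def[symmetric] .
  have "(1 / cmod (ev n))^2 <= (8 / X) * ((real n + 1) ^ 4 * ?\<Lambda>^2)" proof -
   have gen: "1 / u <= (8 / Y) * W" if "Y / 2 <= 4 * W * u" "0 < u" "0 < Y" for u W Y :: real using that by (simp add: field_simps)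
   show ?thesis unfolding power_one_over by (rule gen) (use ev_pos[of n] X \<open>X / 2 <= _\<close> in \<open>simp_all add: mult.assoc\<close>)
  qed
  also have "... = (b * ((real n + 1)^2 * ?\<Lambda>))^2" proof -
   have b2: "b^2 = 8 / X" using X by (simp add: b_def)
   have "(b * (D^2 * L))^2 = (8 / X) * (D ^ 4 * L^2)" for D L :: real
    by (simp only: power_mult_distrib b2 power_mult[symmetric]) simp
   then show ?thesis by (simp only:)
  qed
  finally have "1 / cmod (ev n) <= b * ((real n + 1)^2 * ?\<Lambda>)"
   by (rule power2_le_imp_le) (intro mult_nonneg_nonneg ab(2) zero_le_power2 less_imp_le[OF L])
  also have "?\<Lambda> = a ^ n * ((real n + 1) ^ n * ((real n + 1) ^ n / fact n))" proof -
   have "4 ^ n / ((c * X / (4 * D^2)) ^ n * fact n) = a ^ n * (D ^ n * (D ^ n / fact n))" for D :: real proof -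
    have "4 ^ n / ((c * X / (4 * D^2)) ^ n * fact n) = (4 / (c * X / (4 * D^2))) ^ n / fact n"
     by (simp only: power_divide divide_divide_eq_left)
    also have "4 / (c * X / (4 * D^2)) = a * (D * D)" by (simp add: a_def power2_eq_square)
    finally show ?thesis by (simp add: power_mult_distrib)
   qed
   then show ?thesis by (simp only:)
  qed
  also have "b * ((real n + 1)^2 * (a ^ n * ((real n + 1) ^ n * ((real n + 1) ^ n / fact n))))
   <= (1 + b) ^ (n + 1) * (4 ^ (n + 1) * ((1 + a) ^ (n + 1) * ((real n + 1) ^ n * exp 1 ^ (n + 1))))" proof (intro mult_mono)
   show "b <= (1 + b) ^ (n + 1)" proof -
    have "(1 + b) ^ 1 <= (1 + b) ^ (n + 1)" using ab by (intro power_increasing) auto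
    then show ?thesis unfolding power_one_right by linarith
   qed
   have "real n + 1 <= 2 ^ (n + 1)"
    using less_exp[of "n + 1"] by (metis less_imp_le of_nat_1 of_nat_add of_nat_le_iff of_nat_numeral of_nat_power)
   then have "(real n + 1)^2 <= (2 ^ (n + 1))^2" by (intro power_mono) auto
   also have "(2 ^ (n + 1))^2 = (4::real) ^ (n + 1)" by (simp add: power2_eq_square power_mult_distrib[symmetric])
   finally show "(real n + 1)^2 <= 4 ^ (n + 1)" .
   have "a ^ n <= (1 + a) ^ n" using ab by (intro power_mono) auto
   also have "... <= (1 + a) ^ (n + 1)" using ab by (intro power_increasing) auto
   finally show "a ^ n <= (1 + a) ^ (n + 1)" .
   have "(real n + 1) ^ n / fact n <= exp (real n + 1)" by (rule power_div_fact_le_exp) simp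
   also have "... = exp 1 ^ (n + 1)" by (simp add: exp_add exp_of_nat_mult[symmetric])
   finally show "(real n + 1) ^ n / fact n <= exp 1 ^ (n + 1)" .
  qed (use ab in auto)
  also have "... = K ^ (n + 1) * (real n + 1) ^ n" by (simp add: K_def power_mult_distrib)
  finally show "1 / cmod (ev n) <= K ^ (n + 1) * (real n + 1) ^ n" .
 qed
qed

section \<open>Integration over lines and in polar coordinates\<close>

lemma ball_borel [measurable]: "ball x r \<in> sets borel" "cball x r \<in> sets borel" by auto

text \<open>
 Averaging over translations in the direction \<open>\<theta>\<close> shows that the image of Lebesgue measure on a
 ball under \<open>q \<mapsto> \<theta> \<bullet> q\<close> has a bounded density.
\<close>

lemma ridge_integral_le:
 fixes \<theta> :: "'a::euclidean_space" and f :: "real => ennreal"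
 assumes [measurable]: "f \<in> bm" and \<theta>: "norm \<theta> = 1" and \<sigma>: "0 < \<sigma>"
 shows "(\<integral>\<^sup>+q. ind (ball 0 \<sigma>) q * f (\<theta> \<bullet> q / \<sigma>) \<partial>lborel)
  <= emeasure lborel (ball (0::'a) (2 * \<sigma>)) * (\<integral>\<^sup>+x. f x * ind {-1..1} x \<partial>lborel)"
proof -
 let ?I = "\<integral>\<^sup>+q. ind (ball 0 \<sigma>) q * f (\<theta> \<bullet> q / \<sigma>) \<partial>lborel"
 let ?J = "\<integral>\<^sup>+x. f x * ind {-1..1} x \<partial>lborel"
 have tt: "\<theta> \<bullet> \<theta> = 1" using \<theta> by (simp add: norm_eq_1)
 have shift: "?I = (\<integral>\<^sup>+q. ind (ball 0 \<sigma>) (q - (t * \<sigma>) *\<^sub>R \<theta>) * f (\<theta> \<bullet> q / \<sigma> - t) \<partial>lborel)" for t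
 proof -
  have "(\<lambda>q. ind (ball 0 \<sigma>) q * f (\<theta> \<bullet> q / \<sigma>)) \<in> bm" by measurable
  from nn_integral_lborel_affine[OF this, of 1 "- ((t * \<sigma>) *\<^sub>R \<theta>)"] show ?thesis
   using \<sigma> by (simp add: inner_diff_right tt diff_divide_distrib add.commute)
 qed
 have pt: "ind {0..1} t * (ind (ball 0 \<sigma>) (q - (t * \<sigma>) *\<^sub>R \<theta>) * f (\<theta> \<bullet> q / \<sigma> - t))
   <= ind (ball 0 (2 * \<sigma>)) q * (f (\<theta> \<bullet> q / \<sigma> - t) * ind {-1..1} (\<theta> \<bullet> q / \<sigma> - t))" for t q
 proof (cases "t \<in> {0..1} \<and> q - (t * \<sigma>) *\<^sub>R \<theta> \<in> ball 0 \<sigma>")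
  case True
  let ?q = "q - (t * \<sigma>) *\<^sub>R \<theta>"
  have n: "norm ?q < \<sigma>" using True by simp
  have "norm q <= norm ?q + norm ((t * \<sigma>) *\<^sub>R \<theta>)" using norm_triangle_ineq[of ?q "(t * \<sigma>) *\<^sub>R \<theta>"] by simp
  also have "norm ((t * \<sigma>) *\<^sub>R \<theta>) <= \<sigma>" using True \<theta> \<sigma> by (simp add: mult_left_le_one_le)
  finally have "norm q < 2 * \<sigma>" using n by linarith
  moreover have "\<bar>\<theta> \<bullet> ?q\<bar> <= norm ?q" using Cauchy_Schwarz_ineq2[of \<theta> ?q] \<theta> by simp
  then have "\<bar>\<theta> \<bullet> ?q\<bar> / \<sigma> < 1" using n \<sigma> by simp
  moreover have "\<theta> \<bullet> q / \<sigma> - t = (\<theta> \<bullet> ?q) / \<sigma>" using \<sigma> by (simp add: inner_diff_right tt diff_divide_distrib)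
  then have "\<bar>\<theta> \<bullet> q / \<sigma> - t\<bar> = \<bar>\<theta> \<bullet> ?q\<bar> / \<sigma>" using \<sigma> by (simp only: abs_divide abs_of_pos)
  ultimately have "norm q < 2 * \<sigma>" "\<bar>\<theta> \<bullet> q / \<sigma> - t\<bar> < 1" by auto
  then show ?thesis using True by (auto simp: indicator_def)
 qed (auto simp: indicator_def)
 have "?I = (\<integral>\<^sup>+t. ind {0..1::real} t * ?I \<partial>lborel)" by (subst nn_integral_multc) auto
 also have "... = (\<integral>\<^sup>+t. (\<integral>\<^sup>+q. ind {0..1::real} t * (ind (ball 0 \<sigma>) (q - (t * \<sigma>) *\<^sub>R \<theta>) * f (\<theta> \<bullet> q / \<sigma> - t)) \<partial>lborel) \<partial>lborel)"
 proof (rule nn_integral_cong)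
  fix t :: real
  show "ind {0..1::real} t * ?I
   = (\<integral>\<^sup>+q. ind {0..1::real} t * (ind (ball 0 \<sigma>) (q - (t * \<sigma>) *\<^sub>R \<theta>) * f (\<theta> \<bullet> q / \<sigma> - t)) \<partial>lborel)"
   by (subst shift[of t], rule nn_integral_cmult[symmetric]) measurable
 qed
 also have "... <= (\<integral>\<^sup>+t. (\<integral>\<^sup>+q. ind (ball 0 (2 * \<sigma>)) q * (f (\<theta> \<bullet> q / \<sigma> - t) * ind {-1..1} (\<theta> \<bullet> q / \<sigma> - t)) \<partial>lborel) \<partial>lborel)"
  by (intro nn_integral_mono pt)
 also have "... = (\<integral>\<^sup>+q. (\<integral>\<^sup>+t. ind (ball 0 (2 * \<sigma>)) q * (f (\<theta> \<bullet> q / \<sigma> - t) * ind {-1..1} (\<theta> \<bullet> q / \<sigma> - t)) \<partial>lborel) \<partial>lborel)"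
  by (rule lborel_pair.Fubini') measurable
 also have "... = (\<integral>\<^sup>+q. ind (ball 0 (2 * \<sigma>)) (q::'a) * ?J \<partial>lborel)" proof (rule nn_integral_cong)
  fix q :: 'a
  have "?J = (\<integral>\<^sup>+t. f (\<theta> \<bullet> q / \<sigma> - t) * ind {-1..1} (\<theta> \<bullet> q / \<sigma> - t) \<partial>lborel)"
   by (subst nn_integral_lborel_affine[of _ "-1" "\<theta> \<bullet> q / \<sigma>"]) auto
  then show "(\<integral>\<^sup>+t. ind (ball 0 (2 * \<sigma>)) q * (f (\<theta> \<bullet> q / \<sigma> - t) * ind {-1..1} (\<theta> \<bullet> q / \<sigma> - t)) \<partial>lborel)
    = ind (ball 0 (2 * \<sigma>)) q * ?J" by (subst nn_integral_cmult) auto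
 qed
 also have "... = emeasure lborel (ball (0::'a) (2 * \<sigma>)) * ?J" by (subst nn_integral_multc) auto
 finally show ?thesis .
qed

text \<open>
 Directions are averaged with respect to the cone measure: the direction \<open>sgn p\<close> of a random point \<open>p\<close> of
 the unit ball. This avoids surface measure on the sphere.
\<close>

definition dirint :: "('a::euclidean_space => ennreal) => ennreal" where
 "dirint \<Phi> = (\<integral>\<^sup>+p. ind (cball 0 1) p * \<Phi> (sgn p) \<partial>lborel)"

lemma sgn_measurable [measurable]: "sgn \<in> borel_measurable (borel :: 'a::euclidean_space measure)" unfolding sgn_div_norm[abs_def] by measurable

lemma dirint_mono: "(\<And>\<theta>. norm \<theta> = 1 ==> \<Phi> \<theta> <= \<Psi> \<theta>) ==> dirint \<Phi> <= dirint (\<Psi> :: 'a::euclidean_space => ennreal)"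
proof -
 assume *: "\<And>\<theta>. norm \<theta> = 1 ==> \<Phi> \<theta> <= \<Psi> \<theta>"
 have "AE p in lborel. p \<noteq> (0::'a)" by (rule AE_lborel_singleton)
 then show ?thesis unfolding dirint_def by (intro nn_integral_mono_AE) (auto elim!: eventually_mono intro!: mult_left_mono * simp: norm_sgn)
qed

lemma dirint_add:
 assumes [measurable]: "\<Phi> \<in> bm" "\<Psi> \<in> bm"
 shows "dirint (\<lambda>\<theta>. \<Phi> \<theta> + \<Psi> \<theta>) = dirint \<Phi> + dirint \<Psi>"
 unfolding dirint_def by (subst nn_integral_add[symmetric]) (auto simp: distrib_left)

lemma dirint_cmult:
 assumes [measurable]: "\<Phi> \<in> bm"
 shows "dirint (\<lambda>\<theta>. a * \<Phi> \<theta>) = a * dirint \<Phi>"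
 unfolding dirint_def by (subst nn_integral_cmult[symmetric]) (auto simp: mult_ac)

lemma dirint_const: "dirint (\<lambda>\<theta>::'a::euclidean_space. a) = emeasure lborel (cball (0::'a) 1) * a"
 unfolding dirint_def by (subst nn_integral_multc) auto

lemma dirint_uminus:
 assumes [measurable]: "\<Phi> \<in> borel_measurable (borel :: 'a::euclidean_space measure)"
 shows "dirint (\<lambda>\<theta>. \<Phi> (- \<theta>)) = dirint \<Phi>" unfolding dirint_def
 by (subst (2) nn_integral_lborel_affine[of _ "-1" 0]) (auto simp: sgn_div_norm indicator_def)

lemma nn_integral_inverse_power_tail:
 fixes a :: real and d :: nat
 assumes a: "0 < a" and d: "0 < d"
 shows "(\<integral>\<^sup>+t. ennreal (1 / t ^ Suc d) * ind {a..} t \<partial>lborel) = ennreal (1 / (real d * a ^ d))"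
proof -
 have "(\<integral>\<^sup>+t. ennreal (1 / t ^ Suc d) * ind {a..} t \<partial>lborel) = 0 - (- (1 / (real d * a ^ d)))"
 proof (rule nn_integral_FTC_atLeast)
  fix t assume t: "a <= t"
  then have t0: "0 < t" using a by simp
  have p: "t ^ (d - 1) * t ^ Suc d = t ^ d * t ^ d" by (simp only: power_add[symmetric]) (use d in simp)
  have "((\<lambda>t. inverse (t ^ d)) has_field_derivative - (real d * t ^ (d - 1) * inverse ((t ^ d) ^ Suc (Suc 0)))) (at t)"
   by (rule DERIV_inverse_fun) (use t0 in \<open>auto intro!: derivative_eq_intros\<close>)
  from DERIV_cmult[OF this, of "- (1 / real d)"]
  have "((\<lambda>t. - (1 / real d) * inverse (t ^ d)) has_field_derivative
    - (1 / real d) * - (real d * t ^ (d - 1) * inverse ((t ^ d) ^ Suc (Suc 0)))) (at t)" .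
  also have "- (1 / real d) * - (real d * t ^ (d - 1) * inverse ((t ^ d) ^ Suc (Suc 0))) = t ^ (d - 1) / (t ^ d * t ^ d)"
   using d by (simp add: divide_inverse)
  also have "... = 1 / t ^ Suc d" using t0 p by (simp add: frac_eq_eq del: power_Suc)
  also have "(\<lambda>t. - (1 / real d) * inverse (t ^ d)) = (\<lambda>t. - (1 / (real d * t ^ d)))" by (simp add: divide_inverse fun_eq_iff)
  finally show "((\<lambda>t. - (1 / (real d * t ^ d))) has_real_derivative 1 / t ^ Suc d) (at t)" .
  show "0 <= 1 / t ^ Suc d" using t0 by simp
 next
  have "filterlim (\<lambda>t::real. real d * t ^ d) at_top at_top"
   using d by (intro filterlim_tendsto_pos_mult_at_top[OF tendsto_const] filterlim_pow_at_top filterlim_ident) auto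
  then have "((\<lambda>t::real. 1 / (real d * t ^ d)) \<longlongrightarrow> 0) at_top"
   by (intro tendsto_divide_0[OF tendsto_const] filterlim_at_top_imp_at_infinity)
  then show "((\<lambda>t::real. - (1 / (real d * t ^ d))) \<longlongrightarrow> 0) at_top" using tendsto_minus by fastforce
 qed simp
 then show ?thesis by simp
qed

lemma power_int_dim: "x powi (1 - int DIM('a::euclidean_space)) = inverse (x ^ (DIM('a) - 1))" for x :: real
proof -
 have "1 - int DIM('a) = - int (DIM('a) - 1)" using DIM_positive[where 'a='a] by linarith
 then show ?thesis by (simp only: power_int_minus power_int_of_nat)
qed

lemma power_int_dim_measurable [measurable]:
 "(\<lambda>q::'a::euclidean_space. norm q powi (1 - int DIM('a))) \<in> bm" unfolding power_int_dim by measurable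

text \<open>Lebesgue measure in polar coordinates, without the factor $|q|^{d-1}$.\<close>

abbreviation wint :: "('a::euclidean_space => ennreal) => ennreal" where
 "wint H \<equiv> \<integral>\<^sup>+q. ennreal (norm q powi (1 - int DIM('a))) * H q \<partial>lborel"

text \<open>
 Tonelli: integrate over the ball first, scale, and carry out the radial integral of an inverse power.
\<close>

lemma polar_half_line:
 fixes H :: "'a::euclidean_space => ennreal"
 assumes [measurable]: "H \<in> bm"
 shows "dirint (\<lambda>\<theta>. \<integral>\<^sup>+s. ind {0<..} s * H (s *\<^sub>R \<theta>) \<partial>lborel)
  = ennreal (1 / DIM('a)) * (wint H)"
proof -
 let ?d = "DIM('a)"
 have ray: "(\<integral>\<^sup>+s. ind {0<..} s * H (s *\<^sub>R sgn p) \<partial>lborel)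
   = ennreal (norm p) * (\<integral>\<^sup>+t. ind {0<..} t * H (t *\<^sub>R p) \<partial>lborel)" if "p \<noteq> 0" for p proof -
  have "(\<integral>\<^sup>+s. ind {0<..} s * H (s *\<^sub>R sgn p) \<partial>lborel)
   = ennreal (\<bar>norm p\<bar> ^ DIM(real)) * (\<integral>\<^sup>+t. ind {0<..} (0 + norm p *\<^sub>R t) * H ((0 + norm p *\<^sub>R t) *\<^sub>R sgn p) \<partial>lborel)"
   by (rule nn_integral_lborel_affine) (use that in auto)
  also have "(\<integral>\<^sup>+t. ind {0<..} (0 + norm p *\<^sub>R t) * H ((0 + norm p *\<^sub>R t) *\<^sub>R sgn p) \<partial>lborel)
   = (\<integral>\<^sup>+t. ind {0<..} t * H (t *\<^sub>R p) \<partial>lborel)" proof (rule nn_integral_cong)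
   fix t :: real
   have "norm p * t * inverse (norm p) = t" using that by (simp add: field_simps)
   then have "(0 + norm p *\<^sub>R t) *\<^sub>R sgn p = t *\<^sub>R p" by (simp add: sgn_div_norm)
   moreover have "ind {0<..} (0 + norm p *\<^sub>R t) = (ind {0<..} t :: ennreal)" using that by (simp add: indicator_def zero_less_mult_iff)
   ultimately show "ind {0<..} (0 + norm p *\<^sub>R t) * H ((0 + norm p *\<^sub>R t) *\<^sub>R sgn p)
    = ind {0<..} t * H (t *\<^sub>R p)" by (simp only:)
  qed
  finally show ?thesis by simp
 qed
 have scale: "(\<integral>\<^sup>+p. ind (cball 0 1) p * (ennreal (norm p) * H (t *\<^sub>R p)) \<partial>lborel)
   = (\<integral>\<^sup>+q. ind (cball 0 t) q * (ennreal (norm q * (1 / t ^ Suc ?d)) * H q) \<partial>lborel)" if t: "0 < t" for t proof -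
  have "(\<integral>\<^sup>+q. ind (cball 0 t) q * (ennreal (norm q * (1 / t ^ Suc ?d)) * H q) \<partial>lborel)
   = ennreal (\<bar>t\<bar> ^ ?d) * (\<integral>\<^sup>+p. ind (cball 0 t) (0 + t *\<^sub>R p) * (ennreal (norm (0 + t *\<^sub>R p) * (1 / t ^ Suc ?d)) * H (0 + t *\<^sub>R p)) \<partial>lborel)"
   by (rule nn_integral_lborel_affine) (use t in auto)
  also have "... = (\<integral>\<^sup>+p. ennreal (\<bar>t\<bar> ^ ?d) * (ind (cball 0 t) (0 + t *\<^sub>R p) * (ennreal (norm (0 + t *\<^sub>R p) * (1 / t ^ Suc ?d)) * H (0 + t *\<^sub>R p))) \<partial>lborel)"
   by (rule nn_integral_cmult[symmetric]) measurable
  also have "... = (\<integral>\<^sup>+p. ind (cball 0 1) p * (ennreal (norm p) * H (t *\<^sub>R p)) \<partial>lborel)"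
  proof (rule nn_integral_cong)
   fix p :: 'a
   have 1: "ind (cball 0 t) (0 + t *\<^sub>R p) = (ind (cball 0 1) p :: ennreal)" using t by (auto simp: indicator_def)
   have 2: "ennreal (\<bar>t\<bar> ^ ?d) * ennreal (norm (0 + t *\<^sub>R p) * (1 / t ^ Suc ?d)) = ennreal (norm p)"
    using t by (subst ennreal_mult[symmetric]) (auto simp: field_simps)
   show "ennreal (\<bar>t\<bar> ^ ?d) * (ind (cball 0 t) (0 + t *\<^sub>R p) * (ennreal (norm (0 + t *\<^sub>R p) * (1 / t ^ Suc ?d)) * H (0 + t *\<^sub>R p)))
    = ind (cball 0 1) p * (ennreal (norm p) * H (t *\<^sub>R p))" unfolding 1 2[symmetric] by (simp add: mult_ac)
  qed
  finally show ?thesis by simp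
 qed
 have "dirint (\<lambda>\<theta>. \<integral>\<^sup>+s. ind {0<..} s * H (s *\<^sub>R \<theta>) \<partial>lborel)
  = (\<integral>\<^sup>+p. ind (cball 0 1) p * (ennreal (norm p) * (\<integral>\<^sup>+t. ind {0<..} t * H (t *\<^sub>R p) \<partial>lborel)) \<partial>lborel)"
  unfolding dirint_def by (intro nn_integral_cong_AE, use AE_lborel_singleton[of "0::'a"] in eventually_elim) (simp add: ray)
 also have "... = (\<integral>\<^sup>+p. (\<integral>\<^sup>+t. ind {0<..} t * (ind (cball 0 1) p * (ennreal (norm p) * H (t *\<^sub>R p))) \<partial>lborel) \<partial>lborel)"
 proof (rule nn_integral_cong)
  fix p :: 'a
  show "ind (cball 0 1) p * (ennreal (norm p) * (\<integral>\<^sup>+t. ind {0<..} t * H (t *\<^sub>R p) \<partial>lborel))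
   = (\<integral>\<^sup>+t. ind {0<..} t * (ind (cball 0 1) p * (ennreal (norm p) * H (t *\<^sub>R p))) \<partial>lborel)"
   by (simp only: mult.assoc[symmetric]) (subst nn_integral_cmult[symmetric], measurable, simp add: mult_ac)
 qed
 also have "... = (\<integral>\<^sup>+t. (\<integral>\<^sup>+p. ind {0<..} t * (ind (cball 0 1) p * (ennreal (norm p) * H (t *\<^sub>R p))) \<partial>lborel) \<partial>lborel)"
  by (rule lborel_pair.Fubini'[symmetric]) measurable
 also have "... = (\<integral>\<^sup>+t. (\<integral>\<^sup>+q. ind {0<..} t * (ind (cball 0 t) q * (ennreal (norm q * (1 / t ^ Suc ?d)) * H q)) \<partial>lborel) \<partial>lborel)"
 proof (rule nn_integral_cong)
  fix t :: real
  show "(\<integral>\<^sup>+p. ind {0<..} t * (ind (cball 0 1) p * (ennreal (norm p) * H (t *\<^sub>R p))) \<partial>lborel)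
   = (\<integral>\<^sup>+q. ind {0<..} t * (ind (cball 0 t) q * (ennreal (norm q * (1 / t ^ Suc ?d)) * H q)) \<partial>lborel)"
   by (cases "0 < t") (auto simp: scale)
 qed
 also have "... = (\<integral>\<^sup>+q. (\<integral>\<^sup>+t. ind {0<..} t * (ind {norm q..} t * (ennreal (norm q * (1 / t ^ Suc ?d)) * H q)) \<partial>lborel) \<partial>lborel)"
 proof -
  have "(\<lambda>(t, q). ind {0<..} t * (ind {z. norm (snd z) <= fst z} (t, q) * (ennreal (norm q * (1 / t ^ Suc ?d)) * H q)))
    \<in> borel_measurable (lborel \<Otimes>\<^sub>M lborel)" by measurable
  also have "?this \<longleftrightarrow> (\<lambda>(t, q). ind {0<..} t * (ind (cball 0 t) q * (ennreal (norm q * (1 / t ^ Suc ?d)) * H q)))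
    \<in> borel_measurable (lborel \<Otimes>\<^sub>M lborel)" by (rule measurable_cong) (auto simp: indicator_def)
  finally have "(\<integral>\<^sup>+t. (\<integral>\<^sup>+q. ind {0<..} t * (ind (cball 0 t) q * (ennreal (norm q * (1 / t ^ Suc ?d)) * H q)) \<partial>lborel) \<partial>lborel)
   = (\<integral>\<^sup>+q. (\<integral>\<^sup>+t. ind {0<..} t * (ind (cball 0 t) q * (ennreal (norm q * (1 / t ^ Suc ?d)) * H q)) \<partial>lborel) \<partial>lborel)"
   by (rule lborel_pair.Fubini'[symmetric])
  moreover have "ind (cball 0 t) q = (ind {norm q..} t :: ennreal)" for t and q :: 'a by (simp add: indicator_def)
  ultimately show ?thesis by (simp only:)
 qed
 also have "... = (\<integral>\<^sup>+q. ennreal (1 / ?d) * (ennreal (norm q powi (1 - int ?d)) * H q) \<partial>lborel)"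
 proof (intro nn_integral_cong_AE, use AE_lborel_singleton[of "0::'a"] in eventually_elim)
  fix q :: 'a assume q: "q \<noteq> 0"
  have "(\<integral>\<^sup>+t. ind {0<..} t * (ind {norm q..} t * (ennreal (norm q * (1 / t ^ Suc ?d)) * H q)) \<partial>lborel)
   = (\<integral>\<^sup>+t. (ennreal (norm q) * H q) * (ennreal (1 / t ^ Suc ?d) * ind {norm q..} t) \<partial>lborel)"
  proof (rule nn_integral_cong)
   fix t :: real
   show "ind {0<..} t * (ind {norm q..} t * (ennreal (norm q * (1 / t ^ Suc ?d)) * H q))
    = (ennreal (norm q) * H q) * (ennreal (1 / t ^ Suc ?d) * ind {norm q..} t)" proof (cases "norm q <= t")
    case True
    then have "0 < t" using q by (meson less_le_trans zero_less_norm_iff)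
    then have "ennreal (norm q * (1 / t ^ Suc ?d)) = ennreal (norm q) * ennreal (1 / t ^ Suc ?d)" by (intro ennreal_mult) auto
    then show ?thesis using True \<open>0 < t\<close>
     by (simp only: indicator_simps greaterThan_iff atLeast_iff mult_1_left mult_1_right) (simp only: mult_ac)
   qed simp
  qed
  also have "... = (ennreal (norm q) * H q) * ennreal (1 / (real ?d * norm q ^ ?d))" proof -
   have m: "(\<lambda>t. ennreal (1 / t ^ Suc ?d) * ind {norm q..} t) \<in> borel_measurable lborel" by measurable
   show ?thesis unfolding nn_integral_cmult[OF m] using q nn_integral_inverse_power_tail[of "norm q" ?d] by simp
  qed
  also have "... = ennreal (norm q) * ennreal (1 / (real ?d * norm q ^ ?d)) * H q" by (simp only: mult_ac)
  also have "ennreal (norm q) * ennreal (1 / (real ?d * norm q ^ ?d)) = ennreal (1 / ?d) * ennreal (norm q powi (1 - int ?d))"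
   using q by (simp add: ennreal_mult[symmetric] power_int_diff)
  finally show "(\<integral>\<^sup>+t. ind {0<..} t * (ind {norm q..} t * (ennreal (norm q * (1 / t ^ Suc ?d)) * H q)) \<partial>lborel)
   = ennreal (1 / ?d) * (ennreal (norm q powi (1 - int ?d)) * H q)" by (simp only: mult.assoc)
 qed
 also have "... = ennreal (1 / ?d) * (\<integral>\<^sup>+q. ennreal (norm q powi (1 - int ?d)) * H q \<partial>lborel)"
 proof (rule nn_integral_cmult)
  show "(\<lambda>q. ennreal (norm q powi (1 - int ?d)) * H q) \<in> borel_measurable lborel" by measurable
 qed
 finally show ?thesis .
qed

text \<open>
 A line through the origin consists of two half lines, and directions are averaged symmetrically.
\<close>

lemma polar_line:
 fixes H :: "'a::euclidean_space => ennreal"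
 assumes [measurable]: "H \<in> bm"
 shows "dirint (\<lambda>\<theta>. \<integral>\<^sup>+s. H (s *\<^sub>R \<theta>) \<partial>lborel)
  = ennreal (2 / DIM('a)) * (wint H)"
proof -
 let ?h = "\<lambda>\<theta>. \<integral>\<^sup>+s. ind {0<..} s * H (s *\<^sub>R \<theta>) \<partial>lborel"
 have m1: "?h \<in> bm" by measurable
 have m2: "(\<lambda>\<theta>. ?h (- \<theta>)) \<in> bm" by (rule measurable_compose[OF _ m1]) simp
 have "(\<integral>\<^sup>+s. H (s *\<^sub>R \<theta>) \<partial>lborel) = ?h \<theta> + ?h (- \<theta>)" for \<theta> :: 'a proof -
  have "(\<integral>\<^sup>+s. H (s *\<^sub>R \<theta>) \<partial>lborel)
   = (\<integral>\<^sup>+s. ind {0<..} s * H (s *\<^sub>R \<theta>) + ind {..<0} s * H (s *\<^sub>R \<theta>) \<partial>lborel)"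
   by (intro nn_integral_cong_AE, use AE_lborel_singleton[of "0::real"] in eventually_elim) (auto simp: indicator_def)
  also have "... = ?h \<theta> + (\<integral>\<^sup>+s. ind {..<0} s * H (s *\<^sub>R \<theta>) \<partial>lborel)"
   by (rule nn_integral_add) auto
  also have "(\<integral>\<^sup>+s. ind {..<0} s * H (s *\<^sub>R \<theta>) \<partial>lborel) = ?h (- \<theta>)"
   by (subst nn_integral_lborel_affine[of _ "-1" 0]) (auto intro!: nn_integral_cong simp: indicator_def)
  finally show ?thesis .
 qed
 then have "dirint (\<lambda>\<theta>. \<integral>\<^sup>+s. H (s *\<^sub>R \<theta>) \<partial>lborel) = dirint ?h + dirint ?h"
  by (simp only: dirint_add[OF m1 m2] dirint_uminus[OF m1])
 also have "... = 2 * dirint ?h" by (simp add: mult_2)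
 also have "2 * dirint ?h = ennreal 2 * ennreal (1 / DIM('a)) * (wint H)" unfolding polar_half_line[OF assms] by (simp add: mult.assoc)
 also have "ennreal 2 * ennreal (1 / DIM('a)) = ennreal (2 / DIM('a))" by (subst ennreal_mult[symmetric]) auto
 finally show ?thesis .
qed

section \<open>Schwartz functions\<close>

lemma iter_deriv_append: "iter_deriv cs (iter_deriv bs f) = iter_deriv (cs @ bs) f" by (induction cs) auto

lemma schwartz_iter_deriv:
 assumes "schwartz f" "set bs \<subseteq> Basis"
 shows "schwartz (iter_deriv bs f)" using assms unfolding schwartz_def iter_deriv_append by auto

lemma schwartz_differentiable:
 assumes "schwartz f"
 shows "f differentiable (at x)"
proof -
 have "iter_deriv [] f differentiable_on UNIV" using assms unfolding schwartz_def by (metis empty_set empty_subsetI)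
 then show ?thesis by (simp add: differentiable_on_def)
qed

lemma schwartz_continuous: "schwartz f ==> isCont f x" by (rule differentiable_imp_continuous_within[OF schwartz_differentiable])

lemma schwartz_measurable: "schwartz f ==> f \<in> bm"
 by (intro borel_measurable_continuous_onI continuous_at_imp_continuous_on ballI schwartz_continuous)

lemma schwartz_bdd_above:
 fixes f :: "'a::euclidean_space => complex"
 assumes "schwartz f"
 shows "bdd_above ((\<lambda>(bs, x). (1 + norm x) ^ k * cmod (iter_deriv bs f x)) `
  ({bs. set bs \<subseteq> Basis \<and> length bs <= k} \<times> UNIV))"
proof -
 let ?L = "{bs :: 'a list. set bs \<subseteq> Basis \<and> length bs <= k}"
 have fin: "finite ?L" by (rule finite_lists_length_le) simp
 have "\<exists>B. \<forall>x. (1 + norm x) ^ k * cmod (iter_deriv bs f x) <= B" if "bs \<in> ?L" for bs proof -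
  have "bounded (range (\<lambda>x. (1 + norm x) ^ k *\<^sub>R iter_deriv bs f x))" using assms that unfolding schwartz_def by blast
  then obtain B where "\<forall>x. norm ((1 + norm x) ^ k *\<^sub>R iter_deriv bs f x) <= B" unfolding bounded_iff by auto
  then show ?thesis by (intro exI[of _ B]) simp
 qed
 then obtain B where B: "\<And>bs x. bs \<in> ?L ==> (1 + norm x) ^ k * cmod (iter_deriv bs f x) <= B bs" by metis
 show ?thesis proof (rule bdd_aboveI2)
  fix z assume "z \<in> ?L \<times> (UNIV :: 'a set)"
  then obtain bs x where z: "z = (bs, x)" "bs \<in> ?L" by auto
  have "(1 + norm x) ^ k * cmod (iter_deriv bs f x) <= B bs" by (rule B[OF z(2)])
  also have "... <= \<bar>B bs\<bar>" by simp
  also have "... <= (\<Sum>bs\<in>?L. \<bar>B bs\<bar>)" using z(2) fin by (intro member_le_sum) auto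
  finally show "(case z of (bs, x) => (1 + norm x) ^ k * cmod (iter_deriv bs f x)) <= (\<Sum>bs\<in>?L. \<bar>B bs\<bar>)"
   by (simp add: z(1))
 qed
qed

lemma schwartz_norm_ge:
 fixes f :: "'a::euclidean_space => complex"
 assumes "schwartz f" "set bs \<subseteq> Basis" "length bs <= k"
 shows "(1 + norm x) ^ k * cmod (iter_deriv bs f x) <= schwartz_norm k f"
proof -
 have "(case (bs, x) of (bs, x) => (1 + norm x) ^ k * cmod (iter_deriv bs f x)) <= schwartz_norm k f" unfolding schwartz_norm_def
  by (rule cSUP_upper[OF _ schwartz_bdd_above[OF assms(1)]]) (use assms in auto)
 then show ?thesis by simp
qed

lemma schwartz_norm_nonneg: "schwartz f ==> 0 <= schwartz_norm k f"
 using schwartz_norm_ge[of f "[]" k 0] by (auto intro: order_trans[rotated])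

definition decay :: "'a::euclidean_space => real" where
 "decay x = inverse ((1 + norm x) ^ (DIM('a) + 1))"

lemma decay_measurable [measurable]: "decay \<in> bm" unfolding decay_def[abs_def] by measurable

lemma decay_pos: "0 < decay x" "0 <= decay x" by (simp_all add: decay_def add_pos_nonneg)

text \<open>
 In polar coordinates the factor $s^{d-1}$ cancels all but two of the powers, and an inverse square is
 integrable at infinity.
\<close>

lemma integrable_decay: "integrable lborel (decay :: 'a::euclidean_space => real)"
proof -
 let ?d = "DIM('a)"
 let ?H = "\<lambda>q::'a. ennreal (norm q ^ (?d - 1) * decay q)"
 have "(\<integral>\<^sup>+q. ennreal (decay (q::'a)) \<partial>lborel) = (\<integral>\<^sup>+q. ennreal (norm q powi (1 - int ?d)) * ?H q \<partial>lborel)"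
 proof (intro nn_integral_cong_AE, use AE_lborel_singleton[of "0::'a"] in eventually_elim)
  fix q :: 'a assume "q \<noteq> 0"
  then show "ennreal (decay q) = ennreal (norm q powi (1 - int ?d)) * ?H q"
   unfolding power_int_dim by (subst ennreal_mult[symmetric]) (auto simp: decay_pos)
 qed
 also have "... = ennreal ?d * (ennreal (1 / ?d) * (\<integral>\<^sup>+q. ennreal (norm q powi (1 - int ?d)) * ?H q \<partial>lborel))"
  by (simp add: mult.assoc[symmetric] ennreal_mult[symmetric])
 also have "... = ennreal ?d * dirint (\<lambda>\<theta>::'a. \<integral>\<^sup>+s. ind {0<..} s * ?H (s *\<^sub>R \<theta>) \<partial>lborel)"
  by (subst polar_half_line) auto
 also have "... <= ennreal ?d * dirint (\<lambda>\<theta>::'a. 1)" proof (intro mult_left_mono dirint_mono)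
  fix \<theta> :: 'a assume \<theta>: "norm \<theta> = 1"
  have "(\<integral>\<^sup>+s. ind {0<..} s * ?H (s *\<^sub>R \<theta>) \<partial>lborel)
   <= (\<integral>\<^sup>+s. ennreal (1 / (1 + 1 *\<^sub>R s) ^ Suc 1) * ind {1..} (1 + 1 *\<^sub>R s) \<partial>lborel)"
  proof (rule nn_integral_mono)
   fix s :: real
   show "ind {0<..} s * ?H (s *\<^sub>R \<theta>) <= ennreal (1 / (1 + 1 *\<^sub>R s) ^ Suc 1) * ind {1..} (1 + 1 *\<^sub>R s)"
   proof (cases "0 < s")
    case True
    have e: "(1 + s) ^ (?d + 1) = (1 + s) ^ (?d - 1) * (1 + s) ^ Suc 1"
     by (simp only: power_add[symmetric]) (use DIM_positive[where 'a='a] in \<open>auto intro!: arg_cong[of _ _ "(^) (1 + s)"]\<close>)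
    have "s ^ (?d - 1) * inverse ((1 + s) ^ (?d + 1)) <= (1 + s) ^ (?d - 1) * inverse ((1 + s) ^ (?d + 1))"
     using True by (intro mult_right_mono power_mono) auto
    also have "... = 1 / (1 + s) ^ Suc 1" unfolding e using True by (simp add: divide_inverse)
    finally have le: "s ^ (?d - 1) * inverse ((1 + s) ^ (?d + 1)) <= 1 / (1 + s) ^ Suc 1" .
    have "norm (s *\<^sub>R \<theta>) = s" using True \<theta> by simp
    then have "?H (s *\<^sub>R \<theta>) <= ennreal (1 / (1 + s) ^ Suc 1)" unfolding decay_def using le by (simp only: ennreal_leI)
    moreover have "ind {0<..} s = (1 :: ennreal)" "ind {1..} (1 + s) = (1 :: ennreal)" using True by simp_all
    ultimately show ?thesis by (simp only: real_scaleR_def mult_1_left mult_1_right)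
   qed simp
  qed
  also have "... = (\<integral>\<^sup>+t. ennreal (1 / t ^ Suc 1) * ind {1..} t \<partial>lborel)"
   by (subst (2) nn_integral_lborel_affine[of _ 1 1]) auto
  also have "... = 1" using nn_integral_inverse_power_tail[of 1 1] by simp
  finally show "(\<integral>\<^sup>+s. ind {0<..} s * ?H (s *\<^sub>R \<theta>) \<partial>lborel) <= 1" .
 qed simp
 also have "... < \<infinity>" using emeasure_lborel_cball_finite[of "0::'a" 1] by (simp add: dirint_const ennreal_mult_less_top)
 finally show ?thesis by (intro integrableI_bounded) (auto simp: decay_pos)
qed

lemma schwartz_le_decay:
 fixes f :: "'a::euclidean_space => complex"
 assumes f: "schwartz f" and bs: "set bs \<subseteq> Basis" and k: "length bs <= k" "DIM('a) + 1 <= k"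
 shows "cmod (iter_deriv bs f x) <= schwartz_norm k f * decay x"
proof -
 have "(1 + norm x) ^ (DIM('a) + 1) * cmod (iter_deriv bs f x) <= (1 + norm x) ^ k * cmod (iter_deriv bs f x)"
  using k by (intro mult_right_mono power_increasing) auto
 also have "... <= schwartz_norm k f" by (rule schwartz_norm_ge[OF f bs k(1)])
 finally show ?thesis by (simp add: decay_def divide_inverse[symmetric] pos_le_divide_eq add_pos_nonneg mult.commute)
qed

lemma schwartz_integrable:
 fixes f :: "'a::euclidean_space => complex"
 assumes f: "schwartz f"
 shows "integrable lborel f"
proof (rule L_integrable_bound)
 show "integrable lborel (\<lambda>x::'a. schwartz_norm (DIM('a) + 1) f * decay x)" by (intro integrable_mult_right integrable_decay)
 show "f \<in> borel_measurable lborel" using schwartz_measurable[OF f] by simp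
 show "AE x in lborel. norm (f x) <= norm (schwartz_norm (DIM('a) + 1) f * decay x)" proof (rule AE_I2)
  fix x
  have "cmod (f x) <= schwartz_norm (DIM('a) + 1) f * decay x" using schwartz_le_decay[OF f, of "[]" "DIM('a) + 1" x] by simp
  also have "... <= norm (schwartz_norm (DIM('a) + 1) f * decay x)" by simp
  finally show "norm (f x) <= norm (schwartz_norm (DIM('a) + 1) f * decay x)" .
 qed
qed

lemma schwartz_bounded:
 assumes f: "schwartz f"
 shows "cmod (f x) <= schwartz_norm 0 f" using schwartz_norm_ge[OF f, of "[]" 0] by simp

text \<open>
 The mean value theorem; moving the argument by at most one costs only a power of two in the decay.
\<close>

lemma schwartz_difference_bound:
 fixes f :: "'a::euclidean_space => complex"
 assumes f: "schwartz f" and b: "b \<in> Basis" and s: "0 < s" "s <= 1"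
 shows "cmod (f (q + s *\<^sub>R b) - f q) <= s * (schwartz_norm (DIM('a) + 1) f * 2 ^ (DIM('a) + 1) * decay q)"
proof -
 let ?g = "\<lambda>t. f (q + t *\<^sub>R b)"
 let ?B = "schwartz_norm (DIM('a) + 1) f * 2 ^ (DIM('a) + 1) * decay q"
 have n0: "0 <= schwartz_norm (DIM('a) + 1) f" by (rule schwartz_norm_nonneg[OF f])
 have der: "(?g has_derivative (\<lambda>h. frechet_derivative f (at (q + t *\<^sub>R b)) (h *\<^sub>R b))) (at t within {0..s})" for t proof -
  have "(f has_derivative frechet_derivative f (at (q + t *\<^sub>R b))) (at (q + t *\<^sub>R b))"
   using schwartz_differentiable[OF f] by (simp add: frechet_derivative_works)
  moreover have "((\<lambda>t. q + t *\<^sub>R b) has_derivative (\<lambda>h. h *\<^sub>R b)) (at t within {0..s})"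
   by (auto intro!: derivative_eq_intros)
  ultimately show ?thesis by (rule has_derivative_compose[rotated])
 qed
 have lin: "frechet_derivative f (at x) (h *\<^sub>R b) = h *\<^sub>R frechet_derivative f (at x) b" for x h
  using schwartz_differentiable[OF f, of x] by (intro linear_cmul linear_frechet_derivative)
 have "norm (?g s - ?g 0) <= ?B * norm (s - 0)" proof (rule differentiable_bound[OF _ der])
  fix t assume t: "t \<in> {0..s}"
  have "norm q <= norm (q + t *\<^sub>R b) + norm (t *\<^sub>R b)" using norm_triangle_ineq4[of "q + t *\<^sub>R b" "t *\<^sub>R b"] by simp
  moreover have "norm (t *\<^sub>R b) <= 1" using t s b by simp
  moreover have "1 + u <= 2 * (1 + w)" if "u <= w + m" "m <= 1" "0 <= w" for u w m :: real using that by (simp add: algebra_simps)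
  ultimately have le: "1 + norm q <= 2 * (1 + norm (q + t *\<^sub>R b))" using norm_ge_zero by blast
  have "(1 + norm q) ^ (DIM('a) + 1) <= (2 * (1 + norm (q + t *\<^sub>R b))) ^ (DIM('a) + 1)" by (rule power_mono[OF le]) simp
  then have "decay (q + t *\<^sub>R b) <= 2 ^ (DIM('a) + 1) * decay q" unfolding decay_def power_mult_distrib
   by (simp add: divide_inverse[symmetric] field_simps add_pos_nonneg del: power_Suc)
  then have dec: "schwartz_norm (DIM('a) + 1) f * decay (q + t *\<^sub>R b) <= ?B" unfolding mult.assoc using n0 by (intro mult_left_mono) auto
  have le': "cmod (frechet_derivative f (at (q + t *\<^sub>R b)) b) <= ?B"
   using schwartz_le_decay[OF f, of "[b]" "DIM('a) + 1" "q + t *\<^sub>R b"] b dec by simp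
  show "onorm (\<lambda>h. frechet_derivative f (at (q + t *\<^sub>R b)) (h *\<^sub>R b)) <= ?B" unfolding lin proof (rule onorm_le)
   fix h :: real
   have "norm h * cmod (frechet_derivative f (at (q + t *\<^sub>R b)) b) <= norm h * ?B" by (rule mult_left_mono[OF le']) simp
   then show "norm (h *\<^sub>R frechet_derivative f (at (q + t *\<^sub>R b)) b) <= ?B * norm h"
    by (simp only: norm_scaleR real_norm_def mult.commute)
  qed
 qed (use s in auto)
 then show ?thesis using s by (simp add: mult.commute)
qed

lemma difference_quotient_tendsto:
 fixes g :: "real => 'b::real_normed_vector"
 assumes "(g has_vector_derivative D) (at 0)"
 shows "((\<lambda>t. (g t - g 0) /\<^sub>R t) \<longlongrightarrow> D) (at 0)"
proof (rule LIM_zero_cancel, rule tendsto_norm_zero_cancel)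
 have "((\<lambda>t. norm (g t - g 0 - t *\<^sub>R D) / norm t) \<longlongrightarrow> 0) (at 0)"
  using assms unfolding has_vector_derivative_def has_derivative_iff_norm by simp
 moreover have "norm (g t - g 0 - t *\<^sub>R D) / norm t = norm ((g t - g 0) /\<^sub>R t - D)" if "t \<noteq> 0" for t proof -
  have "(g t - g 0) /\<^sub>R t - D = (g t - g 0 - t *\<^sub>R D) /\<^sub>R t" using that by (simp add: scaleR_diff_right)
  then show ?thesis by (simp add: divide_inverse mult.commute)
 qed
 then have "eventually (\<lambda>t. norm (g t - g 0 - t *\<^sub>R D) / norm t = norm ((g t - g 0) /\<^sub>R t - D)) (at 0)"
  by (auto simp: eventually_at intro!: exI[of _ 1])
 ultimately show "((\<lambda>t. norm ((g t - g 0) /\<^sub>R t - D)) \<longlongrightarrow> 0) (at 0)" by (rule Lim_transform_eventually)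
qed

text \<open>
 A difference quotient is a translation, whose transform is a modulation; dominated convergence.
\<close>

lemma ft_deriv:
 fixes f :: "'a::euclidean_space => complex"
 assumes f: "schwartz f" and b: "b \<in> Basis"
 shows "ft (\<lambda>x. frechet_derivative f (at x) b) p = - \<i> * (p \<bullet> b) * ft f p"
proof (rule LIMSEQ_unique)
 have [measurable]: "f \<in> bm" by (rule schwartz_measurable[OF f])
 have fi: "integrable lborel f" by (rule schwartz_integrable[OF f])
 have "schwartz (iter_deriv [b] f)" using f b by (intro schwartz_iter_deriv) auto
 then have [measurable]: "(\<lambda>x. frechet_derivative f (at x) b) \<in> bm" using schwartz_measurable by fastforce
 define s where "s n = 1 / real (Suc n)" for n
 have s: "0 < s n" "s n <= 1" for n by (auto simp: s_def)
 have s0: "s \<longlonglongrightarrow> 0" unfolding s_def using LIMSEQ_inverse_real_of_nat by (simp add: inverse_eq_divide)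
 have sat: "filterlim s (at 0) sequentially" using s0 s(1) by (auto simp: filterlim_at intro!: always_eventually) (metis less_irrefl)
 define D where "D n = (LINT q|lborel. cis (p \<bullet> q) * ((f (q + s n *\<^sub>R b) - f q) /\<^sub>R s n))" for n
 show "D \<longlonglongrightarrow> ft (\<lambda>x. frechet_derivative f (at x) b) p" unfolding D_def ft_def
 proof (rule integral_dominated_convergence[where w="\<lambda>q. schwartz_norm (DIM('a) + 1) f * 2 ^ (DIM('a) + 1) * decay q"])
  show "integrable lborel (\<lambda>q::'a. schwartz_norm (DIM('a) + 1) f * 2 ^ (DIM('a) + 1) * decay q)"
   by (intro integrable_mult_right integrable_decay)
  show "AE q in lborel. (\<lambda>n. cis (p \<bullet> q) * ((f (q + s n *\<^sub>R b) - f q) /\<^sub>R s n))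
    \<longlonglongrightarrow> cis (p \<bullet> q) * frechet_derivative f (at q) b" proof (intro AE_I2 tendsto_mult_left)
   fix q
   have "(f has_derivative frechet_derivative f (at q)) (at (q + 0 *\<^sub>R b))"
    using schwartz_differentiable[OF f] by (simp add: frechet_derivative_works)
   moreover have "((\<lambda>t. q + t *\<^sub>R b) has_derivative (\<lambda>h. h *\<^sub>R b)) (at 0)" by (auto intro!: derivative_eq_intros)
   ultimately have "((\<lambda>t. f (q + t *\<^sub>R b)) has_derivative (\<lambda>h. frechet_derivative f (at q) (h *\<^sub>R b))) (at 0)"
    by (rule has_derivative_compose[rotated])
   moreover have "frechet_derivative f (at q) (h *\<^sub>R b) = h *\<^sub>R frechet_derivative f (at q) b" for h
    using schwartz_differentiable[OF f, of q] by (intro linear_cmul linear_frechet_derivative)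
   ultimately have "((\<lambda>t. f (q + t *\<^sub>R b)) has_vector_derivative frechet_derivative f (at q) b) (at 0)"
    unfolding has_vector_derivative_def by (simp only:)
   then have "((\<lambda>t. (f (q + t *\<^sub>R b) - f (q + 0 *\<^sub>R b)) /\<^sub>R t) \<longlongrightarrow> frechet_derivative f (at q) b) (at 0)"
    using difference_quotient_tendsto by fastforce
   from filterlim_compose[OF this sat]
   show "(\<lambda>n. (f (q + s n *\<^sub>R b) - f q) /\<^sub>R s n) \<longlonglongrightarrow> frechet_derivative f (at q) b" by simp
  qed
  show "AE q in lborel. norm (cis (p \<bullet> q) * ((f (q + s n *\<^sub>R b) - f q) /\<^sub>R s n))
    <= schwartz_norm (DIM('a) + 1) f * 2 ^ (DIM('a) + 1) * decay q" for n proof (rule AE_I2)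
   fix q :: 'a
   let ?X = "schwartz_norm (DIM('a) + 1) f * 2 ^ (DIM('a) + 1) * decay q"
   have "norm (cis (p \<bullet> q) * ((f (q + s n *\<^sub>R b) - f q) /\<^sub>R s n)) = inverse (s n) * cmod (f (q + s n *\<^sub>R b) - f q)"
    using s(1)[of n] by (simp add: norm_mult)
   also have "... <= inverse (s n) * (s n * ?X)" using s(1)[of n] by (intro mult_left_mono schwartz_difference_bound[OF f b s]) simp
   also have "... = ?X" using s(1)[of n] by simp
   finally show "norm (cis (p \<bullet> q) * ((f (q + s n *\<^sub>R b) - f q) /\<^sub>R s n)) <= ?X" .
  qed
 qed measurable
 have D: "D n = ((cis (- (s n * (p \<bullet> b))) - 1) / s n) * ft f p" for n proof -
  have i1: "integrable lborel (\<lambda>q. cis (p \<bullet> q) * f q)" by (rule integrable_cis_mult[OF fi]) measurable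
  have i2: "integrable lborel (\<lambda>q. cis (p \<bullet> q) * f (q + s n *\<^sub>R b))"
   using integrable_lborel_affine[OF fi, of 1 "s n *\<^sub>R b"] by (intro integrable_cis_mult) (auto simp: add.commute)
  have "(LINT q|lborel. cis (p \<bullet> q) * f (q + s n *\<^sub>R b)) = (LINT q|lborel. cis (- (s n * (p \<bullet> b))) * (cis (p \<bullet> q) * f q))"
  proof -
   have "(LINT q|lborel. cis (- (s n * (p \<bullet> b))) * (cis (p \<bullet> q) * f q))
    = \<bar>1\<bar> ^ DIM('a) *\<^sub>R (LINT q|lborel. cis (- (s n * (p \<bullet> b))) * (cis (p \<bullet> (s n *\<^sub>R b + 1 *\<^sub>R q)) * f (s n *\<^sub>R b + 1 *\<^sub>R q)))"
    by (rule integral_lborel_affine) auto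
   also have "... = (LINT q|lborel. cis (p \<bullet> q) * f (q + s n *\<^sub>R b))"
    by (simp add: mult.assoc[symmetric] cis_mult inner_add_right add.commute)
   finally show ?thesis ..
  qed
  also have "... = cis (- (s n * (p \<bullet> b))) * ft f p" unfolding ft_def by (rule integral_mult_right_zero)
  finally have tr: "(LINT q|lborel. cis (p \<bullet> q) * f (q + s n *\<^sub>R b)) = cis (- (s n * (p \<bullet> b))) * ft f p" .
  have "D n = (LINT q|lborel. (cis (p \<bullet> q) * f (q + s n *\<^sub>R b) - cis (p \<bullet> q) * f q) /\<^sub>R s n)"
   unfolding D_def by (simp add: right_diff_distrib)
  also have "... = ((LINT q|lborel. cis (p \<bullet> q) * f (q + s n *\<^sub>R b)) - ft f p) /\<^sub>R s n" unfolding ft_def using i1 i2 by simp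
  finally show ?thesis unfolding tr by (simp add: scaleR_conv_of_real divide_inverse algebra_simps)
 qed
 have "((\<lambda>t. cis (- (t * (p \<bullet> b)))) has_vector_derivative (- (p \<bullet> b)) *\<^sub>R (\<i> * cis (- (0 * (p \<bullet> b))))) (at 0)"
  unfolding has_vector_derivative_def by (auto intro!: derivative_eq_intros)
 from difference_quotient_tendsto[OF this]
 have "((\<lambda>t. (cis (- (t * (p \<bullet> b))) - 1) / cor t) \<longlongrightarrow> - \<i> * (p \<bullet> b)) (at 0)"
  by (simp add: scaleR_conv_of_real divide_inverse mult.commute)
 from tendsto_mult_right[OF filterlim_compose[OF this sat], of "ft f p"]
 show "D \<longlonglongrightarrow> - \<i> * (p \<bullet> b) * ft f p" unfolding D[abs_def] by simp
qed


lemma schwartz_L1_le: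
 fixes f :: "'a::euclidean_space => complex"
 assumes f: "schwartz f" and bs: "set bs \<subseteq> Basis" and k: "length bs <= k" "DIM('a) + 1 <= k"
 shows "(LINT x|lborel. cmod (iter_deriv bs f x)) <= schwartz_norm k f * (LINT x::'a|lborel. decay x)"
proof -
 have "(LINT x|lborel. cmod (iter_deriv bs f x)) <= (LINT x::'a|lborel. schwartz_norm k f * decay x)"
  by (intro integral_mono integrable_norm schwartz_integrable schwartz_iter_deriv f bs
     integrable_mult_right integrable_decay schwartz_le_decay k)
 then show ?thesis by simp
qed

lemma ft_iter_deriv:
 fixes f :: "'a::euclidean_space => complex"
 assumes f: "schwartz f" and b: "b \<in> Basis"
 shows "ft (iter_deriv (replicate K b) f) p = (- \<i> * (p \<bullet> b)) ^ K * ft f p"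
proof (induction K)
 case (Suc K)
 have "schwartz (iter_deriv (replicate K b) f)" using b by (intro schwartz_iter_deriv f) auto
 from ft_deriv[OF this b, of p] show ?case by (simp add: Suc mult.assoc)
qed simp

text \<open>Derivatives become powers of the frequency, so transforms of Schwartz functions decay fast.\<close>

lemma ft_schwartz_decay:
 obtains C :: real where "0 <= C" "\<And>(f :: 'a::euclidean_space => complex) p. schwartz f ==>
  (1 + norm p) ^ K * cmod (ft f p) <= C * schwartz_norm (max K (DIM('a) + 1)) f"
proof -
 let ?k = "max K (DIM('a) + 1)"
 define W where "W = (LINT x::'a|lborel. decay x)"
 have W: "0 <= W" unfolding W_def by (intro L_integral_nonneg) (simp add: decay_pos)
 let ?d = "real DIM('a)"
 define C where "C = 2 ^ K * (1 + ?d ^ K) * W"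
 show thesis proof (rule that[of C])
  show "0 <= C" using W by (simp add: C_def)
  fix f :: "'a => complex" and p :: 'a
  assume f: "schwartz f"
  let ?N = "schwartz_norm ?k f"
  have N: "0 <= ?N" by (rule schwartz_norm_nonneg[OF f])
  have le: "\<bar>p \<bullet> b\<bar> ^ L * cmod (ft f p) <= W * ?N" if b: "b \<in> Basis" and L: "L <= K" for b L proof -
   have "\<bar>p \<bullet> b\<bar> ^ L * cmod (ft f p) = cmod (ft (iter_deriv (replicate L b) f) p)"
    unfolding ft_iter_deriv[OF f b] by (simp add: norm_mult norm_power)
   also have "... <= (LINT x|lborel. cmod (iter_deriv (replicate L b) f x))"
    using b by (intro cmod_ft_le schwartz_integrable schwartz_iter_deriv f) auto
   also have "... <= ?N * W" unfolding W_def using b L by (intro schwartz_L1_le f) auto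
   finally show ?thesis by (simp add: mult.commute)
  qed
  let ?f = "\<lambda>b. \<bar>p \<bullet> b\<bar>"
  have "Max (?f ` (Basis :: 'a set)) \<in> ?f ` Basis" by (rule Max_in) auto
  then obtain b where b': "b \<in> Basis" "Max (?f ` (Basis :: 'a set)) = \<bar>p \<bullet> b\<bar>" by blast
  have "\<bar>p \<bullet> b'\<bar> <= Max (?f ` (Basis :: 'a set))" if "b' \<in> Basis" for b' using that by (intro Max_ge) auto
  then have b: "b \<in> Basis" "\<And>b'. b' \<in> Basis ==> \<bar>p \<bullet> b'\<bar> <= \<bar>p \<bullet> b\<bar>"
   using b' by auto
  have "norm p <= (\<Sum>b'\<in>Basis. \<bar>p \<bullet> b'\<bar>)" by (rule norm_le_l1)
  also have "... <= (\<Sum>b'\<in>(Basis :: 'a set). \<bar>p \<bullet> b\<bar>)" by (intro sum_mono b)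
  finally have np: "norm p <= ?d * \<bar>p \<bullet> b\<bar>" by simp
  have "(1 + norm p) ^ K <= 2 ^ K * (1 + (?d * \<bar>p \<bullet> b\<bar>) ^ K)" proof (cases "?d * \<bar>p \<bullet> b\<bar> <= 1")
   case True
   then have "(1 + norm p) ^ K <= 2 ^ K" using np by (intro power_mono) auto
   also have "... <= 2 ^ K * (1 + (?d * \<bar>p \<bullet> b\<bar>) ^ K)" by simp
   finally show ?thesis .
  next
   case False
   then have "(1 + norm p) ^ K <= (2 * (?d * \<bar>p \<bullet> b\<bar>)) ^ K" using np by (intro power_mono) auto
   also have "... = 2 ^ K * (?d * \<bar>p \<bullet> b\<bar>) ^ K" by (rule power_mult_distrib)
   also have "... <= 2 ^ K * (1 + (?d * \<bar>p \<bullet> b\<bar>) ^ K)" by simp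
   finally show ?thesis .
  qed
  then have "(1 + norm p) ^ K * cmod (ft f p) <= 2 ^ K * (1 + (?d * \<bar>p \<bullet> b\<bar>) ^ K) * cmod (ft f p)"
   by (rule mult_right_mono) simp
  also have "... = 2 ^ K * (\<bar>p \<bullet> b\<bar> ^ 0 * cmod (ft f p) + ?d ^ K * (\<bar>p \<bullet> b\<bar> ^ K * cmod (ft f p)))"
   by (simp add: power_mult_distrib algebra_simps)
  also have "... <= 2 ^ K * (W * ?N + ?d ^ K * (W * ?N))" by (intro mult_left_mono add_mono le b) auto
  also have "... = C * ?N" by (simp add: C_def algebra_simps)
  finally show "(1 + norm p) ^ K * cmod (ft f p) <= C * ?N" .
 qed
qed

lemma ft_schwartz_integrable:
 fixes f :: "'a::euclidean_space => complex"
 assumes f: "schwartz f"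
 shows "integrable lborel (ft f)"
proof -
 obtain C where C: "\<And>p. (1 + norm p) ^ (DIM('a) + 1) * cmod (ft f p) <= C * schwartz_norm (max (DIM('a) + 1) (DIM('a) + 1)) f"
  using ft_schwartz_decay[of "DIM('a) + 1"] f by metis
 let ?B = "C * schwartz_norm (DIM('a) + 1) f"
 show ?thesis proof (rule L_integrable_bound)
  show "integrable lborel (\<lambda>x::'a. ?B * decay x)" by (intro integrable_mult_right integrable_decay)
  show "ft f \<in> borel_measurable lborel" using schwartz_measurable[OF f] by simp
  show "AE x in lborel. norm (ft f x) <= norm (?B * decay x)" proof (rule AE_I2)
   fix x :: 'a
   have p: "0 < (1 + norm x) ^ (DIM('a) + 1)" by (intro zero_less_power add_pos_nonneg) auto
   have "cmod (ft f x) <= ?B * decay x" unfolding decay_def divide_inverse[symmetric] pos_le_divide_eq[OF p]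
    using C[of x] by (simp only: mult.commute max.idem)
   also have "... <= norm (?B * decay x)" by simp
   finally show "norm (ft f x) <= norm (?B * decay x)" .
  qed
 qed
qed

lemma fourier_eq_ft: "f \<in> bm ==> fourier f p = cor (1 / (2 * pi) ^ DIM('a)) * ft f (p :: 'a::euclidean_space)"
 unfolding fourier_def ft_def by (subst integral_completion) auto

lemma inv_fourier_eq_ft: "f \<in> bm ==> inv_fourier f p = ft f (- p)"
 unfolding inv_fourier_def ft_def by (subst integral_completion) (auto simp: inner_commute)

lemma inv_fourier_fourier:
 fixes f :: "'a::euclidean_space => complex"
 assumes f: "schwartz f"
 shows "inv_fourier (fourier f) x = f x"
proof -
 have [measurable]: "f \<in> bm" by (rule schwartz_measurable[OF f])
 let ?K = "cor ((2 * pi) ^ DIM('a))"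
 have K: "?K \<noteq> 0" by simp
 have "fourier f = (\<lambda>p. cor (1 / (2 * pi) ^ DIM('a)) * ft f p)" by (rule ext) (rule fourier_eq_ft, measurable)
 then have "inv_fourier (fourier f) x = ft (\<lambda>p. cor (1 / (2 * pi) ^ DIM('a)) * ft f p) (- x)" by (simp add: inv_fourier_eq_ft)
 also have "... = cor (1 / (2 * pi) ^ DIM('a)) * (LINT p|lborel. ft f p * cis (- (p \<bullet> x)))"
  unfolding ft_def[of "\<lambda>p. cor (1 / (2 * pi) ^ DIM('a)) * ft f p"]
  by (subst integral_mult_right_zero[symmetric]) (simp only: mult_ac inner_minus_left inner_commute[of x])
 also have "(LINT p|lborel. ft f p * cis (- (p \<bullet> x))) = ?K * f x"
  by (rule fourier_inversion[OF schwartz_integrable[OF f] schwartz_bounded[OF f] schwartz_continuous[OF f] ft_schwartz_integrable[OF f]])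
 finally show ?thesis by (simp add: field_simps)
qed

section \<open>Uniqueness of representing functions\<close>

inductive_set polyfun :: "('a::euclidean_space => complex) set" where
 const: "(\<lambda>x. a) \<in> polyfun"
| inner: "(\<lambda>x. cor (x \<bullet> b)) \<in> polyfun"
| add: "P \<in> polyfun ==> Q \<in> polyfun ==> (\<lambda>x. P x + Q x) \<in> polyfun"
| mult: "P \<in> polyfun ==> Q \<in> polyfun ==> (\<lambda>x. P x * Q x) \<in> polyfun"

lemma polyfun_derivative:
 "P \<in> polyfun ==> \<exists>D. (\<forall>x. (P has_derivative D x) (at x)) \<and> (\<forall>b. (\<lambda>x. D x b) \<in> polyfun)"
proof (induction rule: polyfun.induct)
 case (const a)
 show ?case by (intro exI[of _ "\<lambda>x h. 0"]) (auto intro: polyfun.const)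
next
 case (inner b)
 show ?case by (intro exI[of _ "\<lambda>x h. cor (h \<bullet> b)"])
    (auto intro!: derivative_eq_intros polyfun.const)
next
 case (add P Q)
 then obtain D E where "\<forall>x. (P has_derivative D x) (at x)" "\<forall>b. (\<lambda>x. D x b) \<in> polyfun"
  "\<forall>x. (Q has_derivative E x) (at x)" "\<forall>b. (\<lambda>x. E x b) \<in> polyfun" by blast
 then show ?case by (intro exI[of _ "\<lambda>x h. D x h + E x h"]) (auto intro!: has_derivative_add polyfun.add)
next
 case (mult P Q)
 then obtain D E where "\<forall>x. (P has_derivative D x) (at x)" "\<forall>b. (\<lambda>x. D x b) \<in> polyfun"
  "\<forall>x. (Q has_derivative E x) (at x)" "\<forall>b. (\<lambda>x. E x b) \<in> polyfun" by blast
 then show ?case using mult.hyps by (intro exI[of _ "\<lambda>x h. P x * E x h + D x h * Q x"])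
    (auto intro!: has_derivative_mult polyfun.add polyfun.mult)
qed

lemma polyfun_growth: "P \<in> polyfun ==> \<exists>C n. 0 <= C \<and> (\<forall>x. cmod (P x) <= C * (1 + norm x) ^ n)"
proof (induction rule: polyfun.induct)
 case (const a)
 show ?case by (intro exI[of _ "cmod a"] exI[of _ 0]) auto
next
 case (inner b)
 have "cmod (cor (x \<bullet> b)) <= norm b * (1 + norm x) ^ 1" for x :: 'a proof -
  have "cmod (cor (x \<bullet> b)) <= norm x * norm b" by (simp add: Cauchy_Schwarz_ineq2)
  also have "... <= (1 + norm x) * norm b" by (intro mult_right_mono) auto
  finally show ?thesis by (simp add: mult.commute)
 qed
 then show ?case by (intro exI[of _ "norm b"] exI[of _ 1]) auto
next
 case (add P Q)
 then obtain C n D m where *: "0 <= C" "\<And>x. cmod (P x) <= C * (1 + norm x) ^ n"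
  "0 <= D" "\<And>x. cmod (Q x) <= D * (1 + norm x) ^ m" by metis
 have "cmod (P x + Q x) <= (C + D) * (1 + norm x) ^ (n + m)" for x proof -
  have "cmod (P x + Q x) <= C * (1 + norm x) ^ n + D * (1 + norm x) ^ m" by (rule order_trans[OF norm_triangle_ineq add_mono[OF *(2) *(4)]])
  also have "... <= C * (1 + norm x) ^ (n + m) + D * (1 + norm x) ^ (n + m)" using * by (intro add_mono mult_left_mono power_increasing) auto
  finally show ?thesis by (simp add: distrib_right)
 qed
 then show ?case using * by (intro exI[of _ "C + D"] exI[of _ "n + m"]) auto
next
 case (mult P Q)
 then obtain C n D m where *: "0 <= C" "\<And>x. cmod (P x) <= C * (1 + norm x) ^ n"
  "0 <= D" "\<And>x. cmod (Q x) <= D * (1 + norm x) ^ m" by metis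
 have "cmod (P x * Q x) <= (C * D) * (1 + norm x) ^ (n + m)" for x proof -
  have "cmod (P x * Q x) <= (C * (1 + norm x) ^ n) * (D * (1 + norm x) ^ m)" unfolding norm_mult using * by (intro mult_mono) auto
  then show ?thesis by (simp add: power_add mult_ac)
 qed
 then show ?case using * by (intro exI[of _ "C * D"] exI[of _ "n + m"]) auto
qed

lemma power_times_gauss_bounded:
 fixes x :: "'a::euclidean_space"
 shows "(1 + norm x) ^ n * gauss x <= fact n * exp 2"
proof -
 have "(1 + norm x) ^ n <= fact n * exp (1 + norm x)" using power_div_fact_le_exp[of "1 + norm x" n] by (simp add: field_simps)
 then have "(1 + norm x) ^ n * gauss x <= fact n * exp (1 + norm x) * exp (- (norm x)\<^sup>2 / 2)"
  unfolding gauss_def by (rule mult_right_mono) simp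
 also have "... = fact n * exp (1 + norm x + (- (norm x)\<^sup>2 / 2))" by (simp only: exp_add mult.assoc)
 also have "... <= fact n * exp 2" proof (intro mult_left_mono iffD2[OF exp_le_cancel_iff])
  have "0 <= (norm x - 1)^2" by simp
  then have "2 * norm x <= (norm x)^2 + 1" by (simp add: power2_diff)
  then show "1 + norm x + (- (norm x)\<^sup>2 / 2) <= 2" by simp
 qed simp
 finally show ?thesis .
qed

text \<open>Modulated Gaussians are sufficiently many test functions to separate functions.\<close>

lemma schwartz_modulated_gauss: "schwartz (\<lambda>x::'a::euclidean_space. gauss x * cis (q \<bullet> x))"
proof -
 define E where "E x = gauss x * cis (q \<bullet> x)" for x :: 'a
 have E_der: "(E has_derivative (\<lambda>h. (\<i> * cor (h \<bullet> q) - cor (x \<bullet> h)) * E x)) (at x)" for x proof -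
  have "(gauss has_derivative (\<lambda>h. - (x \<bullet> h) * gauss x)) (at x)" unfolding gauss_def[abs_def] power2_norm_eq_inner
   by (auto intro!: derivative_eq_intros simp: inner_commute)
  then show ?thesis unfolding E_def by (auto intro!: derivative_eq_intros simp: inner_commute scaleR_conv_of_real algebra_simps)
 qed
 have poly: "\<exists>P\<in>polyfun. iter_deriv bs E = (\<lambda>x. P x * E x)" for bs proof (induction bs)
  case Nil
  show ?case by (intro bexI[of _ "\<lambda>x. 1"]) (auto intro: polyfun.const)
 next
  case (Cons b bs)
  then obtain P where P: "P \<in> polyfun" "iter_deriv bs E = (\<lambda>x. P x * E x)" by blast
  obtain D where D: "\<And>x. (P has_derivative D x) (at x)" "\<And>b. (\<lambda>x. D x b) \<in> polyfun" using polyfun_derivative[OF P(1)] by blast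
  let ?Q = "\<lambda>x. P x * (\<i> * cor (b \<bullet> q) + (-1) * cor (x \<bullet> b)) + D x b"
  have "((\<lambda>x. P x * E x) has_derivative
    (\<lambda>h. P x * ((\<i> * cor (h \<bullet> q) - cor (x \<bullet> h)) * E x) + D x h * E x)) (at x)" for x
   by (rule has_derivative_mult[OF D(1) E_der])
  from frechet_derivative_at[OF this, symmetric]
  have "iter_deriv (b # bs) E = (\<lambda>x. ?Q x * E x)" by (simp add: P(2) fun_eq_iff algebra_simps)
  moreover have "?Q \<in> polyfun" by (intro polyfun.intros P D)
  ultimately show ?case by (rule bexI)
 qed
 show ?thesis unfolding schwartz_def proof (intro allI impI conjI)
  fix bs :: "'a list"
  obtain P where P: "P \<in> polyfun" "iter_deriv bs E = (\<lambda>x. P x * E x)" using poly by blast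
  have it: "iter_deriv bs (\<lambda>x. gauss x * cis (q \<bullet> x)) = (\<lambda>x. P x * E x)" using P(2) by (simp add: E_def[abs_def])
  obtain D where D: "\<And>x. (P has_derivative D x) (at x)" "\<And>b. (\<lambda>x. D x b) \<in> polyfun" using polyfun_derivative[OF P(1)] by blast
  show "iter_deriv bs (\<lambda>x. gauss x * cis (q \<bullet> x)) differentiable_on UNIV" unfolding it differentiable_on_def differentiable_def
   by (intro ballI exI) (rule has_derivative_mult[OF D(1) E_der])
  fix k :: nat
  obtain C n where C: "0 <= C" "\<And>x. cmod (P x) <= C * (1 + norm x) ^ n" using polyfun_growth[OF P(1)] by blast
  show "bounded (range (\<lambda>x. (1 + norm x) ^ k *\<^sub>R iter_deriv bs (\<lambda>x. gauss x * cis (q \<bullet> x)) x))"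
   unfolding bounded_iff it proof (intro exI ballI)
   fix y assume "y \<in> range (\<lambda>x. (1 + norm x) ^ k *\<^sub>R (P x * E x))"
   then obtain x where y: "y = (1 + norm x) ^ k *\<^sub>R (P x * E x)" by blast
   have "norm y = (1 + norm x) ^ k * (cmod (P x) * gauss x)" unfolding y by (simp add: norm_mult E_def)
   also have "... <= (1 + norm x) ^ k * ((C * (1 + norm x) ^ n) * gauss x)" by (intro mult_left_mono mult_right_mono C) auto
   also have "... = C * ((1 + norm x) ^ (k + n) * gauss x)" by (simp add: power_add mult_ac)
   also have "... <= C * (fact (k + n) * exp 2)" by (intro mult_left_mono power_times_gauss_bounded C)
   finally show "norm y <= C * (fact (k + n) * exp 2)" .
  qed
 qed
qed

lemma lebesgue_ex_borel:
 fixes g :: "'a::euclidean_space => complex"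
 assumes g: "g \<in> borel_measurable lebesgue"
 obtains g' where "g' \<in> bm" "AE x in lborel. g x = g' x"
proof -
 have "(\<lambda>x. Re (g x)) \<in> borel_measurable lebesgue" "(\<lambda>x. Im (g x)) \<in> borel_measurable lebesgue" using g by auto
 from this[THEN completion_ex_borel_measurable_real]
 obtain a b where ab: "a \<in> borel_measurable lborel" "AE x in lborel. Re (g x) = a x"
  "b \<in> borel_measurable lborel" "AE x in lborel. Im (g x) = b x" by blast
 show thesis proof (rule that)
  show "(\<lambda>x. Complex (a x) (b x)) \<in> bm" unfolding borel_measurable_complex_iff using ab by simp
  show "AE x in lborel. g x = Complex (a x) (b x)" using ab(2,4) by eventually_elim (simp add: complex_eq_iff)
 qed
qed

text \<open>
 The product of a representing function with a Gaussian is integrable, and pairing it with modulations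
 is its Fourier transform.
\<close>

lemma represents_unique:
 fixes g1 g2 :: "'a::euclidean_space => complex"
 assumes 1: "represents g1 T" and 2: "represents g2 T"
 shows "AE x in lborel. g1 x = g2 x"
proof -
 have "(\<lambda>x. g1 x - g2 x) \<in> borel_measurable lebesgue" using 1 2 unfolding represents_def by auto
 then obtain g where g: "g \<in> bm" "AE x in lborel. g1 x - g2 x = g x" by (rule lebesgue_ex_borel)
 note [measurable] = g(1)
 have test: "integrable lborel (\<lambda>x. g x * \<phi> x)" "(LINT x|lborel. g x * \<phi> x) = 0" if \<phi>: "schwartz \<phi>" for \<phi> proof -
  have [measurable]: "\<phi> \<in> bm" by (rule schwartz_measurable[OF \<phi>])
  have i: "integrable lebesgue (\<lambda>x. g1 x * \<phi> x)" "integrable lebesgue (\<lambda>x. g2 x * \<phi> x)"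
   and e: "(LINT x|lebesgue. g1 x * \<phi> x) = (LINT x|lebesgue. g2 x * \<phi> x)" using 1 2 \<phi> unfolding represents_def dist_of_def by metis+
  have ae: "AE x in lebesgue. g1 x * \<phi> x - g2 x * \<phi> x = g x * \<phi> x"
   using AE_completion[OF g(2)] by eventually_elim (simp add: left_diff_distrib[symmetric])
  have m: "(\<lambda>x. g x * \<phi> x) \<in> borel_measurable lebesgue" by (intro measurable_completion) simp
  have id: "integrable lebesgue (\<lambda>x. g1 x * \<phi> x - g2 x * \<phi> x)" using i by simp
  have "integrable lebesgue (\<lambda>x. g x * \<phi> x)" by (rule integrable_cong_AE_imp[OF id m]) (use ae in \<open>eventually_elim, simp\<close>)
  then show "integrable lborel (\<lambda>x. g x * \<phi> x)" by (subst (asm) integrable_completion) auto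
  have "(LINT x|lborel. g x * \<phi> x) = (LINT x|lebesgue. g x * \<phi> x)" by (subst integral_completion) auto
  also have "... = (LINT x|lebesgue. g1 x * \<phi> x - g2 x * \<phi> x)"
   using id m ae by (intro integral_cong_AE) (auto dest: borel_measurable_integrable)
  also have "... = 0" using i e by simp
  finally show "(LINT x|lborel. g x * \<phi> x) = 0" .
 qed
 have "AE x in lborel. g x * gauss x = 0" proof (rule ft_eq_0_imp_AE_zero)
  show "integrable lborel (\<lambda>x. g x * cor (gauss x))" using test(1)[OF schwartz_modulated_gauss[of 0]] by simp
  show "ft (\<lambda>x. g x * cor (gauss x)) p = 0" for p using test(2)[OF schwartz_modulated_gauss[of p]] by (simp add: ft_def mult_ac)
 qed
 with g(2) show ?thesis proof eventually_elim
  case (elim x)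
  have "gauss x \<noteq> 0" using gauss_pos(1)[of x] by linarith
  with elim show ?case by simp
 qed
qed

section \<open>Reconstruction on rays\<close>

lemma measurable_borel_pair_I1:
 assumes "h \<in> borel_measurable (borel \<Otimes>\<^sub>M borel)"
 shows "h \<in> borel_measurable (borel \<Otimes>\<^sub>M I1)"
proof -
 have i: "(\<lambda>x. x) \<in> measurable I1 borel" by (rule measurable_I1) simp
 have "(\<lambda>z. (fst z, snd z)) \<in> measurable (borel \<Otimes>\<^sub>M I1) (borel \<Otimes>\<^sub>M borel)"
  by (intro measurable_Pair measurable_compose[OF measurable_snd i] measurable_fst)
 from measurable_compose[OF this assms] show ?thesis by simp
qed

lemma l2_continuous:
 fixes f :: "real => complex"
 assumes "continuous_on UNIV f"
 shows "l2 f" and "\<exists>B\<ge>0. \<forall>x\<in>{-1..1}. cmod (f x) <= B"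
proof -
 have "compact (f ` {-1..1})" by (intro compact_continuous_image continuous_on_subset[OF assms]) auto
 then have "bounded (f ` {-1..1})" by (rule compact_imp_bounded)
 then obtain B where B: "\<forall>y\<in>f ` {-1..1}. norm y <= B" unfolding bounded_iff by (elim exE)
 show B': "\<exists>B\<ge>0. \<forall>x\<in>{-1..1}. cmod (f x) <= B" proof (intro exI[of _ "max 0 B"] conjI ballI)
  fix x :: real assume "x \<in> {-1..1}"
  then have "norm (f x) <= B" by (rule_tac bspec[OF B]) simp
  then show "cmod (f x) <= max 0 B" by simp
 qed simp
 then obtain B where "\<forall>x\<in>{-1..1}. cmod (f x) <= B" by blast
 then show "l2 f" by (intro l2_bounded[of _ B] measurable_I1 borel_measurable_continuous_onI[OF assms]) auto
qed

locale ball_function =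
 fixes v :: "'a::euclidean_space => complex" and \<sigma> :: real
 assumes \<sigma>: "0 < \<sigma>"
  and v: "integrable lborel v"
  and v2: "(l2mass v) < \<infinity>"
  and supp: "x \<notin> ball 0 \<sigma> ==> v x = 0"
begin

lemma v_measurable [measurable]: "v \<in> bm" using v by auto

lemma ridge_in_interval:
 assumes "v q \<noteq> 0" "norm \<theta> = 1"
 shows "\<bar>\<theta> \<bullet> q / \<sigma>\<bar> < 1"
proof -
 have "norm q < \<sigma>" using supp[of q] assms by auto
 then have "\<bar>\<theta> \<bullet> q\<bar> < \<sigma>" using Cauchy_Schwarz_ineq2[of \<theta> q] assms by simp
 then show ?thesis using \<sigma> by simp
qed

lemma ridge_mem:
 assumes "v q \<noteq> 0" "norm \<theta> = 1"
 shows "\<theta> \<bullet> q / \<sigma> \<in> {-1..1}" "\<theta> \<bullet> q / \<sigma> \<in> {-1<..<1}"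
proof -
 have "x \<in> {-1..1}" "x \<in> {-1<..<1}" if "\<bar>x\<bar> < 1" for x :: real using that by auto
 then show "\<theta> \<bullet> q / \<sigma> \<in> {-1..1}" "\<theta> \<bullet> q / \<sigma> \<in> {-1<..<1}"
  using ridge_in_interval[OF assms] by blast+
qed

lemma ridge_integrable:
 fixes h :: "real => complex"
 assumes "continuous_on UNIV h" "norm \<theta> = 1"
 shows "integrable lborel (\<lambda>q. v q * h (\<theta> \<bullet> q / \<sigma>))"
proof -
 obtain B where B: "B \<ge> 0" "\<forall>x\<in>{-1..1}. cmod (h x) <= B" using l2_continuous(2)[OF assms(1)] by blast
 have [measurable]: "h \<in> bm" by (rule borel_measurable_continuous_onI[OF assms(1)])
 show ?thesis proof (rule L_integrable_bound)
  show "integrable lborel (\<lambda>q. v q * cor B)" using v by simp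
  show "AE q in lborel. norm (v q * h (\<theta> \<bullet> q / \<sigma>)) <= norm (v q * cor B)" proof (rule AE_I2)
   fix q
   show "norm (v q * h (\<theta> \<bullet> q / \<sigma>)) <= norm (v q * cor B)" proof (cases "v q = 0")
    case False
    then have "\<theta> \<bullet> q / \<sigma> \<in> {-1..1}" using ridge_mem(1)[OF False assms(2)] by blast
    then show ?thesis using B by (auto simp: norm_mult intro!: mult_left_mono)
   qed simp
  qed
 qed measurable
qed

text \<open>
 Coefficients of the projection of $v$ along a direction are bounded by the $L^2$ norm on $[-1,1]$ of
 the test function, because ridge functions pull back with bounded density.
\<close>

lemma ridge_pairing_le:
 fixes h :: "real => complex"
 assumes h: "continuous_on UNIV h" and \<theta>: "norm \<theta> = 1"
 shows "ennreal ((cmod (LINT q|lborel. v q * h (\<theta> \<bullet> q / \<sigma>)))^2)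
  <= (l2mass v) * (emeasure lborel (ball (0::'a) (2 * \<sigma>)) * ennreal (sq h))"
proof -
 have [measurable]: "h \<in> bm" by (rule borel_measurable_continuous_onI[OF h])
 let ?h = "\<lambda>q. ind (ball 0 \<sigma>) q * ennreal (cmod (h (\<theta> \<bullet> q / \<sigma>)))"
 have "ennreal (cmod (LINT q|lborel. v q * h (\<theta> \<bullet> q / \<sigma>))) <= (\<integral>\<^sup>+q. ennreal (cmod (v q * h (\<theta> \<bullet> q / \<sigma>))) \<partial>lborel)"
  by (rule cmod_integral_le_nn_integral)
 also have "... = (\<integral>\<^sup>+q. ennreal (cmod (v q)) * ?h q \<partial>lborel)" proof (rule nn_integral_cong)
  fix q
  show "ennreal (cmod (v q * h (\<theta> \<bullet> q / \<sigma>))) = ennreal (cmod (v q)) * ?h q"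
   using supp[of q] by (cases "q \<in> ball 0 \<sigma>") (auto simp: norm_mult ennreal_mult simp del: mem_ball)
 qed
 finally have le: "ennreal (cmod (LINT q|lborel. v q * h (\<theta> \<bullet> q / \<sigma>))) <= (\<integral>\<^sup>+q. ennreal (cmod (v q)) * ?h q \<partial>lborel)" .
 have "ennreal ((cmod (LINT q|lborel. v q * h (\<theta> \<bullet> q / \<sigma>)))^2) = (ennreal (cmod (LINT q|lborel. v q * h (\<theta> \<bullet> q / \<sigma>))))^2"
  by (simp add: ennreal_power)
 also have "... <= (\<integral>\<^sup>+q. ennreal (cmod (v q)) * ?h q \<partial>lborel)^2" by (rule power_mono_ennreal[OF le])
 also have "... <= (\<integral>\<^sup>+q. (ennreal (cmod (v q)))^2 \<partial>lborel) * (\<integral>\<^sup>+q. (?h q)^2 \<partial>lborel)"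
  by (rule Cauchy_Schwarz_nn_integral) measurable
 also have "(\<integral>\<^sup>+q. (ennreal (cmod (v q)))^2 \<partial>lborel) = (l2mass v)"
  by (simp add: ennreal_power)
 also have "(\<integral>\<^sup>+q. (?h q)^2 \<partial>lborel) = (\<integral>\<^sup>+q. ind (ball 0 \<sigma>) q * ennreal ((cmod (h (\<theta> \<bullet> q / \<sigma>)))^2) \<partial>lborel)"
  by (intro nn_integral_cong) (auto simp: indicator_def ennreal_power)
 also have "(l2mass v) * ... <= (l2mass v) * (emeasure lborel (ball (0::'a) (2 * \<sigma>)) *
   (\<integral>\<^sup>+x. ennreal ((cmod (h x))^2) * ind {-1..1} x \<partial>lborel))"
  by (intro mult_left_mono ridge_integral_le \<theta> \<sigma>) auto
 also have "(\<integral>\<^sup>+x. ennreal ((cmod (h x))^2) * ind {-1..1} x \<partial>lborel) = ennreal (sq h)"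
  by (rule nn_integral_sq[OF l2_continuous(1)[OF h]])
 finally show ?thesis .
qed

definition V :: "'a => complex" where
 "V p = ft v (p /\<^sub>R \<sigma>)"

lemma V_measurable [measurable]: "V \<in> bm" unfolding V_def[abs_def] by measurable

lemma V_ray: "V (s *\<^sub>R \<theta>) = (LINT q|lborel. v q * cis (s * (\<theta> \<bullet> q / \<sigma>)))" unfolding V_def ft_def
 by (intro L_integral_cong refl) (simp add: divide_inverse mult_ac)

end

locale ray_reconstruction = pswf c \<psi> ev + ball_function v \<sigma>
 for c \<psi> ev and v :: "'a::euclidean_space => complex" and \<sigma>
begin

definition a :: "'a => nat => complex" where
 "a \<theta> j = (LINT q|lborel. v q * cor (\<psi> j (\<theta> \<bullet> q / \<sigma>)))"

lemma continuous_comb: "continuous_on UNIV (\<lambda>x. \<Sum>j\<in>A. b j * cor (\<psi> j x))" by (intro continuous_intros cont)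

lemma pairing_comb:
 assumes "finite A" and \<theta>: "norm \<theta> = 1"
 shows "(LINT q|lborel. v q * (\<Sum>j\<in>A. b j * cor (\<psi> j (\<theta> \<bullet> q / \<sigma>)))) = (\<Sum>j\<in>A. b j * a \<theta> j)"
proof -
 have i: "integrable lborel (\<lambda>q. v q * cor (\<psi> j (\<theta> \<bullet> q / \<sigma>)))" for j
  by (rule ridge_integrable[OF _ \<theta>]) (intro continuous_intros cont)
 have "(LINT q|lborel. v q * (\<Sum>j\<in>A. b j * cor (\<psi> j (\<theta> \<bullet> q / \<sigma>))))
  = (LINT q|lborel. (\<Sum>j\<in>A. b j * (v q * cor (\<psi> j (\<theta> \<bullet> q / \<sigma>)))))"
  by (simp only: sum_distrib_left mult.left_commute)
 also have "... = (\<Sum>j\<in>A. (LINT q|lborel. b j * (v q * cor (\<psi> j (\<theta> \<bullet> q / \<sigma>)))))"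
  by (intro L_integral_sum integrable_mult_right i)
 also have "... = (\<Sum>j\<in>A. b j * a \<theta> j)" unfolding a_def by (simp only: integral_mult_right_zero)
 finally show ?thesis .
qed

text \<open>
 Expand $y \mapsto e^{i s y}$ in the eigenfunctions; the projection of $v$ is a continuous functional in
 $L^2$ of $[-1,1]$.
\<close>

lemma V_series:
 assumes \<theta>: "norm \<theta> = 1"
 shows "(\<lambda>N. \<Sum>j<N. G j s * a \<theta> j) \<longlonglongrightarrow> V (s *\<^sub>R \<theta>)"
proof -
 let ?r = "\<lambda>N x. cis (s * x) - (\<Sum>j<N. G j s * cor (\<psi> j x))"
 have cr: "continuous_on UNIV (?r N)" for N by (intro continuous_intros cont)
 let ?K = "(l2mass v) * emeasure lborel (ball (0::'a) (2 * \<sigma>))"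
 have K: "?K < \<infinity>" using v2 emeasure_lborel_ball_finite[of "0::'a" "2 * \<sigma>"] by (simp add: ennreal_mult_less_top)
 have diff: "V (s *\<^sub>R \<theta>) - (\<Sum>j<N. G j s * a \<theta> j) = (LINT q|lborel. v q * ?r N (\<theta> \<bullet> q / \<sigma>))" for N
 proof -
  have "(LINT q|lborel. v q * ?r N (\<theta> \<bullet> q / \<sigma>))
   = (LINT q|lborel. v q * cis (s * (\<theta> \<bullet> q / \<sigma>)) - v q * (\<Sum>j<N. G j s * cor (\<psi> j (\<theta> \<bullet> q / \<sigma>))))"
   by (simp only: right_diff_distrib)
  also have "... = (LINT q|lborel. v q * cis (s * (\<theta> \<bullet> q / \<sigma>)))
    - (LINT q|lborel. v q * (\<Sum>j<N. G j s * cor (\<psi> j (\<theta> \<bullet> q / \<sigma>))))" proof (rule L_integral_diff)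
   show "integrable lborel (\<lambda>q. v q * cis (s * (\<theta> \<bullet> q / \<sigma>)))"
    by (rule ridge_integrable[OF _ \<theta>, of "\<lambda>x. cis (s * x)"]) (intro continuous_intros)
   show "integrable lborel (\<lambda>q. v q * (\<Sum>j<N. G j s * cor (\<psi> j (\<theta> \<bullet> q / \<sigma>))))"
    by (rule ridge_integrable[OF continuous_comb \<theta>])
  qed
  finally show ?thesis by (simp only: V_ray pairing_comb[OF finite_lessThan \<theta>])
 qed
 have "ennreal ((cmod (V (s *\<^sub>R \<theta>) - (\<Sum>j<N. G j s * a \<theta> j)))^2) <= ennreal (enn2real ?K * sq (?r N))" for N proof -
  have "ennreal ((cmod (V (s *\<^sub>R \<theta>) - (\<Sum>j<N. G j s * a \<theta> j)))^2) <= ?K * ennreal (sq (?r N))"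
   unfolding diff using ridge_pairing_le[OF cr \<theta>] by (simp only: mult.assoc)
  also have "?K = ennreal (enn2real ?K)" using K by (simp add: less_top)
  finally show ?thesis by (simp add: ennreal_mult)
 qed
 then have le: "(cmod (V (s *\<^sub>R \<theta>) - (\<Sum>j<N. G j s * a \<theta> j)))^2 <= enn2real ?K * sq (?r N)" for N
  by (simp add: ennreal_le_iff)
 have "(\<lambda>N. sq (\<lambda>x. cis (s * x) - (\<Sum>j<N. coef (\<lambda>y. cis (s * y)) j * \<psi> j x))) \<longlonglongrightarrow> 0"
  by (rule projection_tendsto[OF l2_cis])
 then have "(\<lambda>N. enn2real ?K * sq (?r N)) \<longlonglongrightarrow> 0" unfolding G_eq_coef[symmetric] by (rule tendsto_mult_right_zero)
 then have "(\<lambda>N. (cmod (V (s *\<^sub>R \<theta>) - (\<Sum>j<N. G j s * a \<theta> j)))^2) \<longlonglongrightarrow> 0"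
  by (rule tendsto_sandwich[OF _ _ tendsto_const, rotated -1]) (use le in \<open>auto intro!: always_eventually\<close>)
 from tendsto_real_sqrt[OF this]
 have "(\<lambda>N. cmod (V (s *\<^sub>R \<theta>) - (\<Sum>j<N. G j s * a \<theta> j))) \<longlonglongrightarrow> 0" by simp
 from tendsto_diff[OF tendsto_const tendsto_norm_zero_cancel[OF this], of "V (s *\<^sub>R \<theta>)"]
 show ?thesis by simp
qed

definition truncated :: "nat set => (nat => complex) => real => complex" where
 "truncated A b x = cor (ind {-1..1} x) * (\<Sum>j\<in>A. b j * cor (\<psi> j x))"

lemma truncated_measurable [measurable]: "truncated A b \<in> bm" unfolding truncated_def[abs_def] by measurable

lemma truncated_bounded: "\<exists>B. \<forall>x. cmod (truncated A b x) <= B"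
proof -
 obtain B where "B \<ge> 0" "\<forall>x\<in>{-1..1}. cmod (\<Sum>j\<in>A. b j * cor (\<psi> j x)) <= B"
  using l2_continuous(2)[OF continuous_comb] by blast
 then show ?thesis by (intro exI[of _ B]) (auto simp: truncated_def norm_mult indicator_def)
qed

lemma truncated_integrable: "integrable lborel (truncated A b)"
proof -
 obtain B where "\<forall>x. cmod (truncated A b x) <= B" using truncated_bounded by blast
 then have "integrable lborel (\<lambda>x. ind {-1..1} x *\<^sub>R truncated A b x)" by (intro integrableI_bounded_set_indicator[where B=B]) auto
 moreover have "ind {-1..1} x *\<^sub>R truncated A b x = truncated A b x" for x by (simp add: truncated_def indicator_def)
 ultimately show ?thesis by simp
qed

lemma ft_truncated:
 assumes "finite A"
 shows "ft (truncated A b) s = (\<Sum>j\<in>A. b j * G j s)"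
proof -
 have "ft (truncated A b) s = (LINT x|lborel. ind {-1..1} x *\<^sub>R (cis (s * x) * (\<Sum>j\<in>A. b j * cor (\<psi> j x))))"
  unfolding ft_def truncated_def by (intro L_integral_cong) (auto simp: scaleR_conv_of_real)
 also have "... = (LINT x|I1. cis (s * x) * (\<Sum>j\<in>A. b j * cor (\<psi> j x)))" by (rule integral_restrict_space[symmetric]) simp
 also have "... = (LINT x|I1. (\<Sum>j\<in>A. b j * (cis (s * x) * cor (\<psi> j x))))" by (simp only: sum_distrib_left mult.left_commute)
 also have "... = (\<Sum>j\<in>A. LINT x|I1. b j * (cis (s * x) * cor (\<psi> j x)))"
  by (intro L_integral_sum integrable_mult_right l2_integrable_mult l2_cis l2_psi)
 also have "... = (\<Sum>j\<in>A. b j * G j s)" unfolding G_def by (simp only: integral_mult_right_zero)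
 finally show ?thesis .
qed

text \<open>Orthonormality and the easy half of the Plancherel theorem.\<close>

lemma plancherel_comb:
 assumes "finite A"
 shows "(l2mass (\<lambda>s. \<Sum>j\<in>A. b j * G j s)) <= ennreal (2 * pi * (\<Sum>j\<in>A. (cmod (b j))^2))"
proof -
 have "(l2mass (\<lambda>s. ft (truncated A b) s))
  <= ennreal ((2 * pi) ^ DIM(real)) * (l2mass (\<lambda>x. truncated A b x))"
  by (rule plancherel_le[OF truncated_integrable])
 also have "(l2mass (\<lambda>x. truncated A b x))
  = (\<integral>\<^sup>+x. ennreal ((cmod (\<Sum>j\<in>A. b j * cor (\<psi> j x)))^2) * ind {-1..1} x \<partial>lborel)"
  by (intro nn_integral_cong) (auto simp: truncated_def indicator_def)
 also have "... = ennreal (\<Sum>j\<in>A. (cmod (b j))^2)" by (subst nn_integral_sq[OF l2_comb[OF assms]]) (simp add: sq_comb[OF assms])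
 also have "ennreal ((2 * pi) ^ DIM(real)) * ennreal (\<Sum>j\<in>A. (cmod (b j))^2) = ennreal (2 * pi * (\<Sum>j\<in>A. (cmod (b j))^2))"
  by (subst ennreal_mult) (auto simp: sum_nonneg)
 finally show ?thesis unfolding ft_truncated[OF assms] .
qed

text \<open>
 The tail of the coefficients is tested against itself. At low frequencies the transforms of the
 eigenfunctions are tiny, and the high frequencies of the function are small by smoothness.
\<close>

lemma tail_coefficients_le:
 assumes A: "finite A" and \<theta>: "norm \<theta> = 1" and S: "0 <= S"
  and \<rho>: "0 <= \<rho>" "\<And>s. \<bar>s\<bar> <= S ==> (\<Sum>j\<in>A. cmod (G j s)) <= \<rho>"
  and Vm: "0 <= Vm" "\<And>p. cmod (V p) <= Vm"
 shows "ennreal (\<Sum>j\<in>A. (cmod (a \<theta> j))^2)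
  <= ennreal ((2 * S * \<rho> * Vm)^2) + (\<integral>\<^sup>+s. ind {s. S < \<bar>s\<bar>} s * ennreal ((cmod (V (- s *\<^sub>R \<theta>)))^2) \<partial>lborel)"
  (is "ennreal ?A <= ennreal (?X^2) + ?Q")
proof (cases "?Q = \<infinity>")
 case False
 let ?b = "\<lambda>j. cnj (a \<theta> j)"
 (* With these conjugate coefficients the pairing of v with the ridge function is the sum of squares itself. *)
 let ?\<Phi> = "\<lambda>s. \<Sum>j\<in>A. ?b j * G j s"
 let ?R = "\<lambda>s. cmod (V (- s *\<^sub>R \<theta>))"
 obtain B where B: "\<And>x. cmod (truncated A ?b x) <= B" using truncated_bounded by blast
 define Q where "Q = enn2real ?Q"
 have Q: "?Q = ennreal Q" "0 <= Q" unfolding Q_def using False by (simp_all add: less_top)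
 have A0: "0 <= ?A" by (simp add: sum_nonneg)
 have "(LINT q|lborel. v q * truncated A ?b (\<theta> \<bullet> q / \<sigma>)) = (LINT q|lborel. v q * (\<Sum>j\<in>A. ?b j * cor (\<psi> j (\<theta> \<bullet> q / \<sigma>))))"
 proof (intro L_integral_cong refl)
  fix q
  show "v q * truncated A ?b (\<theta> \<bullet> q / \<sigma>) = v q * (\<Sum>j\<in>A. ?b j * cor (\<psi> j (\<theta> \<bullet> q / \<sigma>)))"
  proof (cases "v q = 0")
   case False
   then have "\<theta> \<bullet> q / \<sigma> \<in> {-1..1}" using ridge_mem(1)[OF False \<theta>] by blast
   then show ?thesis unfolding truncated_def by (simp only: indicator_simps of_real_1 mult_1_left)
  qed simp
 qed
 also have "... = (\<Sum>j\<in>A. ?b j * a \<theta> j)" by (rule pairing_comb[OF A \<theta>])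
 also have "... = cor ?A" unfolding of_real_sum by (intro sum.cong refl) (simp only: complex_norm_square mult.commute)
 finally have pair: "(LINT q|lborel. v q * truncated A ?b (\<theta> \<bullet> q / \<sigma>)) = cor ?A" .
 have "ennreal ((2 * pi) ^ DIM(real) * cmod (LINT q|lborel. v q * truncated A ?b (\<theta> \<bullet> q / \<sigma>)))
  <= (\<integral>\<^sup>+s. ennreal (cmod (ft (truncated A ?b) s) * cmod (LINT q|lborel. v q * cis (- (s \<bullet> (\<theta> \<bullet> q / \<sigma>))))) \<partial>lborel)"
 proof (rule cmod_pairing_le[OF v truncated_integrable _ B])
  fix q assume "v q \<noteq> 0"
  then have "\<theta> \<bullet> q / \<sigma> \<in> {-1<..<1}" using ridge_mem(2)[OF _ \<theta>, of q] by blast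
  moreover have "continuous_on {-1<..<1} (truncated A ?b)" proof -
   have "continuous_on {-1<..<1} (\<lambda>x. \<Sum>j\<in>A. ?b j * cor (\<psi> j x))" by (rule continuous_on_subset[OF continuous_comb]) simp
   then show ?thesis by (rule continuous_on_cong[THEN iffD1, rotated 2]) (auto simp: truncated_def)
  qed
  ultimately show "isCont (truncated A ?b) (\<theta> \<bullet> q / \<sigma>)" by (simp add: continuous_on_eq_continuous_at)
 qed measurable
 also have "(\<lambda>s. (LINT q|lborel. v q * cis (- (s \<bullet> (\<theta> \<bullet> q / \<sigma>))))) = (\<lambda>s. V (- s *\<^sub>R \<theta>))"
  unfolding V_ray by simp
 finally have main0: "ennreal ((2 * pi) ^ DIM(real) * cmod (LINT q|lborel. v q * truncated A ?b (\<theta> \<bullet> q / \<sigma>)))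
  <= (\<integral>\<^sup>+s. ennreal (cmod (ft (truncated A ?b) s) * ?R s) \<partial>lborel)" .
 have cm: "cmod (cor ?A) = ?A" using A0 by (simp only: norm_of_real abs_of_nonneg)
 have main: "ennreal (2 * pi * ?A) <= (\<integral>\<^sup>+s. ennreal (cmod (?\<Phi> s) * ?R s) \<partial>lborel)"
  using main0 unfolding pair ft_truncated[OF A] cm by (simp only: DIM_real power_one_right)
 have low: "cmod (?\<Phi> s) <= sqrt ?A * \<rho>" if s: "\<bar>s\<bar> <= S" for s proof -
  have "cmod (?\<Phi> s) <= (\<Sum>j\<in>A. cmod (a \<theta> j) * cmod (G j s))" by (rule order_trans[OF norm_sum]) (simp add: norm_mult)
  also have "... <= (\<Sum>j\<in>A. sqrt ?A * cmod (G j s))" proof (intro sum_mono mult_right_mono)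
   fix j assume "j \<in> A"
   then have "(cmod (a \<theta> j))^2 <= ?A" using A by (intro member_le_sum) auto
   then show "cmod (a \<theta> j) <= sqrt ?A" by (rule real_le_rsqrt)
  qed simp
  also have "... = sqrt ?A * (\<Sum>j\<in>A. cmod (G j s))" by (simp only: sum_distrib_left)
  also have "... <= sqrt ?A * \<rho>" using A0 by (intro mult_left_mono \<rho>(2)[OF s]) simp
  finally show ?thesis .
 qed
 let ?H = "ind {s. S < \<bar>s\<bar>} :: real => ennreal"
 have "(\<integral>\<^sup>+s. ennreal (cmod (?\<Phi> s) * ?R s) \<partial>lborel)
  <= (\<integral>\<^sup>+s. ennreal (sqrt ?A * \<rho> * Vm) * ind {-S..S} s + ennreal (cmod (?\<Phi> s)) * (?H s * ennreal (?R s)) \<partial>lborel)"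
 proof (rule nn_integral_mono)
  fix s
  show "ennreal (cmod (?\<Phi> s) * ?R s) <= ennreal (sqrt ?A * \<rho> * Vm) * ind {-S..S} s + ennreal (cmod (?\<Phi> s)) * (?H s * ennreal (?R s))"
  proof (cases "\<bar>s\<bar> <= S")
   case True
   have "cmod (?\<Phi> s) * ?R s <= (sqrt ?A * \<rho>) * Vm" using low[OF True] Vm A0 \<rho> by (intro mult_mono) auto
   then show ?thesis using True by (auto simp: indicator_def intro: ennreal_leI)
  qed (auto simp: indicator_def ennreal_mult)
 qed
 also have "... = (\<integral>\<^sup>+s. ennreal (sqrt ?A * \<rho> * Vm) * ind {-S..S} s \<partial>lborel) + (\<integral>\<^sup>+s. ennreal (cmod (?\<Phi> s)) * (?H s * ennreal (?R s)) \<partial>lborel)"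
  by (rule nn_integral_add) measurable
 also have "(\<integral>\<^sup>+s. ennreal (sqrt ?A * \<rho> * Vm) * ind {-S..S} s \<partial>lborel) = ennreal (sqrt ?A * ?X)"
  using S A0 \<rho> Vm by (subst nn_integral_cmult_indicator) (auto simp: ennreal_mult[symmetric] mult_ac)
 finally have "ennreal (2 * pi * ?A) <= ennreal (sqrt ?A * ?X) + (\<integral>\<^sup>+s. ennreal (cmod (?\<Phi> s)) * (?H s * ennreal (?R s)) \<partial>lborel)"
  using main by (rule order_trans[rotated])
 also have "(\<integral>\<^sup>+s. ennreal (cmod (?\<Phi> s)) * (?H s * ennreal (?R s)) \<partial>lborel) <= ennreal (sqrt (2 * pi * ?A * Q))"
 proof -
  let ?Y = "\<integral>\<^sup>+s. ennreal (cmod (?\<Phi> s)) * (?H s * ennreal (?R s)) \<partial>lborel"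
  have "?Y^2 <= (\<integral>\<^sup>+s. (ennreal (cmod (?\<Phi> s)))^2 \<partial>lborel) * (\<integral>\<^sup>+s. (?H s * ennreal (?R s))^2 \<partial>lborel)"
   by (rule Cauchy_Schwarz_nn_integral) measurable
  also have "(\<integral>\<^sup>+s. (ennreal (cmod (?\<Phi> s)))^2 \<partial>lborel) = (l2mass (\<lambda>s. ?\<Phi> s))"
   by (simp add: ennreal_power)
  also have "(\<integral>\<^sup>+s. (?H s * ennreal (?R s))^2 \<partial>lborel) = ?Q"
   by (intro nn_integral_cong) (auto simp: indicator_def ennreal_power)
  also have "(l2mass (\<lambda>s. ?\<Phi> s)) * ?Q <= ennreal (2 * pi * (\<Sum>j\<in>A. (cmod (?b j))^2)) * ?Q"
   by (intro mult_right_mono plancherel_comb A) simp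
  also have "... = ennreal (2 * pi * ?A * Q)" using A0 Q by (simp add: ennreal_mult)
  finally have Y2: "?Y^2 <= ennreal (2 * pi * ?A * Q)" .
  then have "?Y^2 < \<infinity>" by (rule le_less_trans) simp
  then have "?Y \<noteq> \<infinity>" by (auto simp: power2_eq_square)
  then obtain y where y: "?Y = ennreal y" "0 <= y" by (cases ?Y) auto
  have "y^2 <= 2 * pi * ?A * Q" using Y2 y A0 Q by (simp add: ennreal_power)
  then show ?thesis unfolding y(1) by (intro ennreal_leI real_le_rsqrt)
 qed
 finally have "ennreal (2 * pi * ?A) <= ennreal (sqrt ?A * ?X) + ennreal (sqrt (2 * pi * ?A * Q))" by (simp add: add_left_mono)
 then have en: "ennreal (2 * pi * ?A) <= ennreal (sqrt ?A * ?X + sqrt (2 * pi * ?A * Q))"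
  using A0 S \<rho>(1) Vm(1) Q(2) by (subst ennreal_plus) simp_all
 have fin: "2 * pi * ?A <= sqrt ?A * ?X + sqrt (2 * pi * ?A * Q)"
  by (rule ennreal_le_iff[THEN iffD1, OF _ en]) (use A0 S \<rho>(1) Vm(1) Q(2) in simp)
 define t where "t = sqrt ?A"
 have t: "0 <= t" "?A = t^2" using A0 by (auto simp: t_def)
 have sq2: "sqrt (2 * pi * t^2 * Q) = t * sqrt (2 * pi * Q)" using t(1) by (simp add: real_sqrt_mult)
 have X0: "0 <= ?X" using S \<rho> Vm by simp
 have "t^2 <= ?X^2 + Q" proof (cases "t = 0")
  case False
  then have tp: "0 < t" using t by simp
  have "t * (2 * pi * t) <= t * (?X + sqrt (2 * pi * Q))"
   using fin unfolding t_def[symmetric] t(2) sq2 using t(1) by (simp add: power2_eq_square algebra_simps)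
  then have "2 * pi * t <= ?X + sqrt (2 * pi * Q)" using tp by (simp only: mult_le_cancel_left_pos)
  then have "(2 * pi * t)^2 <= (?X + sqrt (2 * pi * Q))^2" using tp by (intro power_mono) auto
  also have "... <= 2 * ?X^2 + 2 * (sqrt (2 * pi * Q))^2"
   using sum_squares_bound[of ?X "sqrt (2 * pi * Q)"] by (simp add: power2_sum)
  also have "(sqrt (2 * pi * Q))^2 = 2 * pi * Q" using Q by simp
  finally have le: "(2 * pi * t)^2 <= 2 * ?X^2 + 4 * pi * Q" by simp
  have "4 * pi * (t^2) <= 4 * pi * pi * t^2" using pi_ge_two mult_right_mono[of 1 pi "4 * pi * t^2"] by (simp add: mult_ac)
  also have "... = (2 * pi * t)^2" by (simp add: power_mult_distrib power2_eq_square)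
  also have "... <= 2 * ?X^2 + 4 * pi * Q" by (rule le)
  also have "... <= 4 * pi * ?X^2 + 4 * pi * Q" using pi_ge_two by (intro add_right_mono mult_right_mono) auto
  also have "... = 4 * pi * (?X^2 + Q)" by (simp add: distrib_left)
  finally show ?thesis by (simp only: mult_le_cancel_left_pos pi_gt_zero zero_less_mult_iff zero_less_numeral simp_thms)
 qed (use Q in simp)
 then show ?thesis unfolding Q(1) t(2) using Q by (simp add: ennreal_plus[symmetric] ennreal_leI del: ennreal_plus)
qed simp

text \<open>
 Partial sums of the expansion have square norm at most $2 \pi$ times the sum of their squared
 coefficients; pass to the limit with Fatou.
\<close>

lemma ray_error_le:
 assumes \<theta>: "norm \<theta> = 1"
  and tail: "\<And>A. finite A ==> A \<subseteq> {n<..} ==> ennreal (\<Sum>j\<in>A. (cmod (a \<theta> j))^2) <= T"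
 shows "(l2mass (\<lambda>s. V (s *\<^sub>R \<theta>) - (\<Sum>j\<le>n. b j * G j s)))
  <= ennreal (2 * pi) * (ennreal (\<Sum>j\<le>n. (cmod (a \<theta> j - b j))^2) + T)"
proof (rule nn_integral_limit_le)
 define d where "d j = (if j <= n then a \<theta> j - b j else a \<theta> j)" for j
 let ?u = "\<lambda>N s. \<Sum>j<N + Suc n. d j * G j s"
 show "(\<lambda>s. ennreal ((cmod (?u N s))^2)) \<in> borel_measurable lborel" for N by measurable
 show "(\<lambda>N. ennreal ((cmod (?u N s))^2)) \<longlonglongrightarrow> ennreal ((cmod (V (s *\<^sub>R \<theta>) - (\<Sum>j\<le>n. b j * G j s)))^2)" for s
 proof -
  have split: "?u N s = (\<Sum>j<N + Suc n. G j s * a \<theta> j) - (\<Sum>j\<le>n. b j * G j s)" for N proof -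
   have "?u N s = (\<Sum>j<N + Suc n. G j s * a \<theta> j - (if j <= n then b j * G j s else 0))"
    by (intro sum.cong) (auto simp: d_def algebra_simps)
   also have "... = (\<Sum>j<N + Suc n. G j s * a \<theta> j) - (\<Sum>j<N + Suc n. if j <= n then b j * G j s else 0)"
    by (rule sum_subtractf)
   also have "(\<Sum>j<N + Suc n. if j <= n then b j * G j s else 0) = (\<Sum>j\<le>n. b j * G j s)"
    by (subst sum.inter_filter[symmetric]) (auto intro!: sum.cong)
   finally show ?thesis .
  qed
  have "(\<lambda>N. ?u N s) \<longlonglongrightarrow> V (s *\<^sub>R \<theta>) - (\<Sum>j\<le>n. b j * G j s)"
   unfolding split by (intro tendsto_diff tendsto_const LIMSEQ_ignore_initial_segment[OF V_series[OF \<theta>]])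
  then show ?thesis by (intro tendsto_intros)
 qed
 fix N
 let ?A = "{..<N + Suc n} - {..n}"
 have "(\<Sum>j<N + Suc n. (cmod (d j))^2) = (\<Sum>j\<le>n. (cmod (d j))^2) + (\<Sum>j\<in>?A. (cmod (d j))^2)"
  by (rule sum.subset_diff[THEN trans, OF _ _ add.commute]) auto
 also have "(\<Sum>j\<le>n. (cmod (d j))^2) = (\<Sum>j\<le>n. (cmod (a \<theta> j - b j))^2)" by (simp add: d_def)
 also have "(\<Sum>j\<in>?A. (cmod (d j))^2) = (\<Sum>j\<in>?A. (cmod (a \<theta> j))^2)" by (intro sum.cong) (auto simp: d_def)
 finally have e: "(\<Sum>j<N + Suc n. (cmod (d j))^2) = (\<Sum>j\<le>n. (cmod (a \<theta> j - b j))^2) + (\<Sum>j\<in>?A. (cmod (a \<theta> j))^2)" .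
 have "(l2mass (\<lambda>s. ?u N s)) <= ennreal (2 * pi * (\<Sum>j<N + Suc n. (cmod (d j))^2))"
  by (rule plancherel_comb) simp
 also have "... = ennreal (2 * pi) * (ennreal (\<Sum>j\<le>n. (cmod (a \<theta> j - b j))^2) + ennreal (\<Sum>j\<in>?A. (cmod (a \<theta> j))^2))"
  unfolding e by (simp add: ennreal_mult ennreal_plus sum_nonneg)
 also have "... <= ennreal (2 * pi) * (ennreal (\<Sum>j\<le>n. (cmod (a \<theta> j - b j))^2) + T)"
  by (intro mult_left_mono add_left_mono tail) auto
 finally show "(l2mass (\<lambda>s. ?u N s)) <= ennreal (2 * pi) * (ennreal (\<Sum>j\<le>n. (cmod (a \<theta> j - b j))^2) + T)" .
qed

text \<open>
 Fubini and the eigenvalue equation: data on $[-c,c]$ give the coefficients multiplied by the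
 eigenvalues.
\<close>

lemma coef_V:
 assumes \<theta>: "norm \<theta> = 1"
 shows "coef (\<lambda>x. V ((c * x) *\<^sub>R \<theta>)) j = ev j * a \<theta> j"
proof -
 let ?f = "\<lambda>z. cor (\<psi> j (snd z)) * (v (fst z) * cis (c * snd z * (\<theta> \<bullet> fst z / \<sigma>)))"
 have "?f \<in> borel_measurable (borel \<Otimes>\<^sub>M borel)" by measurable
 then have m: "?f \<in> borel_measurable (borel \<Otimes>\<^sub>M I1)" by (rule measurable_borel_pair_I1)
 have int: "integrable (lborel \<Otimes>\<^sub>M I1) (\<lambda>(q, x). cor (\<psi> j x) * (v q * cis (c * x * (\<theta> \<bullet> q / \<sigma>))))"
 proof (rule lborel_I1.integrable_product_bound[where g="\<lambda>q. cmod (v q)" and h="\<lambda>x. cmod (cor (\<psi> j x))"])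
  show "(\<lambda>(q, x). cor (\<psi> j x) * (v q * cis (c * x * (\<theta> \<bullet> q / \<sigma>)))) \<in> borel_measurable (lborel \<Otimes>\<^sub>M I1)"
   using m by (simp add: split_beta' measurable_cong_sets[OF sets_pair_measure_cong[OF sets_lborel refl] refl])
  show "integrable lborel (\<lambda>q. cmod (v q))" using v by simp
  show "integrable I1 (\<lambda>x. cmod (cor (\<psi> j x)))" by (intro integrable_norm l2_integrable l2_psi)
 qed (auto simp: norm_mult)
 have "coef (\<lambda>x. V ((c * x) *\<^sub>R \<theta>)) j = (LINT x|I1. LINT q|lborel. cor (\<psi> j x) * (v q * cis (c * x * (\<theta> \<bullet> q / \<sigma>))))"
  unfolding coef_def V_ray by simp
 also have "... = (LINT q|lborel. LINT x|I1. cor (\<psi> j x) * (v q * cis (c * x * (\<theta> \<bullet> q / \<sigma>))))"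
  using lborel_I1.Fubini_integral[OF int] by simp
 also have "... = (LINT q|lborel. ev j * (v q * cor (\<psi> j (\<theta> \<bullet> q / \<sigma>))))" proof (intro L_integral_cong refl)
  fix q
  show "(LINT x|I1. cor (\<psi> j x) * (v q * cis (c * x * (\<theta> \<bullet> q / \<sigma>)))) = ev j * (v q * cor (\<psi> j (\<theta> \<bullet> q / \<sigma>)))"
  proof (cases "v q = 0")
   case False
   let ?y = "\<theta> \<bullet> q / \<sigma>"
   have y: "?y \<in> {-1..1}" using ridge_mem(1)[OF False \<theta>] by blast
   have e: "cor (\<psi> j x) * (v q * cis (c * x * ?y)) = v q * (cis (c * ?y * x) * cor (\<psi> j x))" for x by (simp add: mult_ac)
   show ?thesis unfolding e by (simp only: integral_mult_right_zero eigen[OF y] mult.left_commute)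
  qed simp
 qed
 also have "... = ev j * a \<theta> j" unfolding a_def by (rule integral_mult_right_zero)
 finally show ?thesis .
qed

end

context ray_reconstruction
begin

lemma V_bounded: "cmod (V p) <= (LINT q|lborel. cmod (v q))" unfolding V_def by (rule cmod_ft_le[OF v])

end

locale ball_data = ray_reconstruction c \<psi> ev v \<sigma>
 for c \<psi> ev and v :: "'a::euclidean_space => complex" and \<sigma> +
 fixes r :: real and w :: "'a => complex"
 assumes r: "0 < r" and crs: "c = r * \<sigma>" and w_measurable [measurable]: "w \<in> bm"
begin

definition b :: "'a => nat => complex" where
 "b \<theta> j = 1 / ev j * coef (\<lambda>x. cor ((2 * pi) ^ DIM('a)) * w ((r * x) *\<^sub>R \<theta>)) j"

definition D :: "'a => complex" where
 "D p = w p - cor (1 / (2 * pi) ^ DIM('a)) * ft v p"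

lemma D_measurable [measurable]: "D \<in> bm" unfolding D_def[abs_def] by measurable

lemma b_measurable [measurable]: "(\<lambda>p. b p j) \<in> bm"
proof -
 have "(\<lambda>z. cor (\<psi> j (snd z)) * (cor ((2 * pi) ^ DIM('a)) * w ((r * snd z) *\<^sub>R fst z)))
   \<in> borel_measurable (borel \<Otimes>\<^sub>M borel)" by measurable
 then have "(\<lambda>z. cor (\<psi> j (snd z)) * (cor ((2 * pi) ^ DIM('a)) * w ((r * snd z) *\<^sub>R fst z)))
   \<in> borel_measurable (borel \<Otimes>\<^sub>M I1)" by (rule measurable_borel_pair_I1)
 then have "(\<lambda>p. coef (\<lambda>x. cor ((2 * pi) ^ DIM('a)) * w ((r * x) *\<^sub>R p)) j) \<in> bm"
  unfolding coef_def by (intro I1.borel_measurable_lebesgue_integral) (simp add: split_beta')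
 then show ?thesis unfolding b_def by measurable
qed

text \<open>Noise is amplified at most by the inverse of the smallest eigenvalue in use.\<close>

lemma noise_le:
 assumes \<theta>: "norm \<theta> = 1"
 shows "ennreal (\<Sum>j\<le>n. (cmod (a \<theta> j - b \<theta> j))^2)
  <= ennreal (((2 * pi) ^ DIM('a) / cmod (ev n))^2) * (\<integral>\<^sup>+x. ennreal ((cmod (D ((r * x) *\<^sub>R \<theta>)))^2) * ind {-1..1} x \<partial>lborel)"
  (is "_ <= ennreal ?K * ?I")
proof (cases "?I = \<infinity>")
 case True
 have "0 < ?K" using ev_pos[of n] by simp
 then have "ennreal ?K * ?I = \<infinity>" unfolding True by (simp add: ennreal_mult_top ennreal_zero_less_divide)
 then show ?thesis by simp
next
 case False
 let ?P = "cor ((2 * pi) ^ DIM('a))"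
 let ?D = "\<lambda>x. D ((r * x) *\<^sub>R \<theta>)"
 have mD: "?D \<in> borel_measurable I1" by (rule measurable_I1) measurable
 have D2: "l2 ?D" unfolding l2_def proof
  have "(\<integral>\<^sup>+x. ennreal ((cmod (?D x))^2) \<partial>I1) = ?I" by (rule nn_integral_restrict_space) simp
  then show "integrable I1 (\<lambda>x. (cmod (?D x))^2)" using False mD by (intro integrableI_bounded) (auto simp: less_top)
 qed (rule mD)
 have V2: "l2 (\<lambda>x. V ((c * x) *\<^sub>R \<theta>))" by (rule l2_bounded[OF measurable_I1 V_bounded]) measurable
 have split: "?P * w ((r * x) *\<^sub>R \<theta>) = V ((c * x) *\<^sub>R \<theta>) - (- ?P) * ?D x" for x proof -
  have "V ((c * x) *\<^sub>R \<theta>) = ft v ((r * x) *\<^sub>R \<theta>)" unfolding V_def crs using \<sigma> by (simp add: field_simps)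
  moreover have "?P * cor (1 / (2 * pi) ^ DIM('a)) = 1" by (simp add: of_real_divide)
  then have "?P * ?D x = ?P * w ((r * x) *\<^sub>R \<theta>) - ft v ((r * x) *\<^sub>R \<theta>)"
   unfolding D_def right_diff_distrib mult.assoc[symmetric] by (simp only: mult_1_left)
  ultimately show ?thesis by simp
 qed
 have ab: "a \<theta> j - b \<theta> j = - (?P / ev j * coef ?D j)" for j proof -
  have "coef (\<lambda>x. ?P * w ((r * x) *\<^sub>R \<theta>)) j = ev j * a \<theta> j - (- ?P) * coef ?D j"
   unfolding split by (simp only: coef_diff[OF V2 l2_cmult[OF D2]] coef_V[OF \<theta>] coef_cmult)
  then have "b \<theta> j = 1 / ev j * (ev j * a \<theta> j + ?P * coef ?D j)" unfolding b_def by simp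
  also have "... = a \<theta> j + ?P / ev j * coef ?D j" using ev_pos[of j] by (simp add: distrib_left)
  finally show ?thesis by simp
 qed
 have "(\<Sum>j\<le>n. (cmod (a \<theta> j - b \<theta> j))^2) <= (\<Sum>j\<le>n. ?K * (cmod (coef ?D j))^2)" proof (rule sum_mono)
  fix j assume "j \<in> {..n}"
  then have "(2 * pi) ^ DIM('a) / cmod (ev j) <= (2 * pi) ^ DIM('a) / cmod (ev n)"
   using ev_pos[of n] ev_pos[of j] by (intro divide_left_mono ev_antimono) auto
  then have K: "((2 * pi) ^ DIM('a) / cmod (ev j))^2 <= ?K" using ev_pos[of j] by (intro power_mono) auto
  have "cmod (a \<theta> j - b \<theta> j) = (2 * pi) ^ DIM('a) / cmod (ev j) * cmod (coef ?D j)"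
   unfolding ab by (simp only: norm_minus_cancel norm_mult norm_divide norm_of_real) simp
  then have "(cmod (a \<theta> j - b \<theta> j))^2 = ((2 * pi) ^ DIM('a) / cmod (ev j))^2 * (cmod (coef ?D j))^2"
   by (simp only: power_mult_distrib)
  also have "... <= ?K * (cmod (coef ?D j))^2" by (rule mult_right_mono[OF K]) simp
  finally show "(cmod (a \<theta> j - b \<theta> j))^2 <= ?K * (cmod (coef ?D j))^2" .
 qed
 also have "... = ?K * (\<Sum>j<Suc n. (cmod (coef ?D j))^2)" by (simp only: sum_distrib_left lessThan_Suc_atMost)
 also have "... <= ?K * sq ?D" by (intro mult_left_mono bessel D2) simp
 finally have "ennreal (\<Sum>j\<le>n. (cmod (a \<theta> j - b \<theta> j))^2) <= ennreal (?K * sq ?D)" by (rule ennreal_leI)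
 also have "... = ennreal ?K * ?I" unfolding nn_integral_sq[OF D2] by (rule ennreal_mult) simp_all
 finally show ?thesis .
qed

definition W :: "nat => 'a => complex" where
 "W n p = V p - (\<Sum>j\<le>n. b (sgn p) j * G j (norm p))"

lemma W_measurable [measurable]: "W n \<in> bm"
proof -
 have [measurable]: "(\<lambda>p. b (sgn p) j) \<in> bm" for j by (rule measurable_compose[OF sgn_measurable b_measurable])
 show ?thesis unfolding W_def[abs_def] by measurable
qed

text \<open>
 The estimates on rays integrated over all directions. The first summand is the amplified noise, the
 second the truncation error at low frequencies, the third the part of $V$ at frequencies that are too
 high to be recovered.
\<close>

lemma integrated_error_le:
 assumes S: "0 <= S" and \<rho>: "0 <= \<rho>"
  "\<And>A s. finite A ==> A \<subseteq> {n<..} ==> \<bar>s\<bar> <= S ==> (\<Sum>j\<in>A. cmod (G j s)) <= \<rho>"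
  and Vm: "0 <= Vm" "\<And>p. cmod (V p) <= Vm"
 shows "ennreal (1 / DIM('a)) * (wint (\<lambda>q. ennreal ((cmod (W n q))^2)))
  <= ennreal (2 * pi) * (ennreal (((2 * pi) ^ DIM('a) / cmod (ev n))^2) * (ennreal (2 / (r * DIM('a))) *
     (wint (\<lambda>q. ind (cball 0 r) q * ennreal ((cmod (D q))^2))))
    + (emeasure lborel (cball (0::'a) 1) * ennreal ((2 * S * \<rho> * Vm)^2)
     + ennreal (2 / DIM('a)) *
     (wint (\<lambda>q. ind {q. S < norm q} q * ennreal ((cmod (V q))^2)))))"
  (is "?L <= ennreal (2 * pi) * (ennreal ?K * (_ * ?M1) + (_ + _ * ?M2))")
proof -
 let ?H1 = "\<lambda>q::'a. ind (cball 0 r) q * ennreal ((cmod (D q))^2)"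
 let ?H2 = "\<lambda>q::'a. ind {q. S < norm q} q * ennreal ((cmod (V q))^2)"
 let ?N = "\<lambda>\<theta>. \<integral>\<^sup>+s. ?H1 (s *\<^sub>R \<theta>) \<partial>lborel"
 let ?Q = "\<lambda>\<theta>. \<integral>\<^sup>+s. ?H2 (s *\<^sub>R \<theta>) \<partial>lborel"
 let ?X = "ennreal ((2 * S * \<rho> * Vm)^2)"
 have [measurable]: "{q::'a. S < norm q} \<in> sets borel" by measurable
 have H[measurable]: "?H1 \<in> bm" "?H2 \<in> bm" by measurable
 have [measurable]: "?N \<in> bm" "?Q \<in> bm" by measurable
 have ray: "(\<integral>\<^sup>+s. ind {0<..} s * ennreal ((cmod (W n (s *\<^sub>R \<theta>)))^2) \<partial>lborel)
   <= ennreal (2 * pi) * (ennreal ?K * (ennreal (1 / r) * ?N \<theta>) + (?X + ?Q \<theta>))" if \<theta>: "norm \<theta> = 1" for \<theta> :: 'a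
 proof -
  have "(\<integral>\<^sup>+s. ind {0<..} s * ennreal ((cmod (W n (s *\<^sub>R \<theta>)))^2) \<partial>lborel)
   <= (l2mass (\<lambda>s. V (s *\<^sub>R \<theta>) - (\<Sum>j\<le>n. b \<theta> j * G j s)))"
  proof (rule nn_integral_mono)
   fix s :: real
   show "ind {0<..} s * ennreal ((cmod (W n (s *\<^sub>R \<theta>)))^2) <= ennreal ((cmod (V (s *\<^sub>R \<theta>) - (\<Sum>j\<le>n. b \<theta> j * G j s)))^2)"
   proof (cases "0 < s")
    case True
    then have "sgn (s *\<^sub>R \<theta>) = \<theta>" "norm (s *\<^sub>R \<theta>) = s" using \<theta> by (simp_all add: sgn_div_norm)
    then show ?thesis using True by (simp add: W_def)
   qed simp
  qed
  also have "... <= ennreal (2 * pi) * (ennreal (\<Sum>j\<le>n. (cmod (a \<theta> j - b \<theta> j))^2) + (?X + ?Q \<theta>))"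
  proof (rule ray_error_le[OF \<theta>])
   fix A :: "nat set" assume A: "finite A" "A \<subseteq> {n<..}"
   have "(\<integral>\<^sup>+s. ind {s. S < \<bar>s\<bar>} s * ennreal ((cmod (V (- s *\<^sub>R \<theta>)))^2) \<partial>lborel) = (\<integral>\<^sup>+s. ?H2 ((0 + (-1) *\<^sub>R s) *\<^sub>R \<theta>) \<partial>lborel)"
    using \<theta> by (intro nn_integral_cong) (simp add: indicator_def)
   also have "... = ?Q \<theta>" by (subst (2) nn_integral_lborel_affine[of _ "-1" 0]) simp_all
   finally have Q: "(\<integral>\<^sup>+s. ind {s. S < \<bar>s\<bar>} s * ennreal ((cmod (V (- s *\<^sub>R \<theta>)))^2) \<partial>lborel) = ?Q \<theta>" .
   show "ennreal (\<Sum>j\<in>A. (cmod (a \<theta> j))^2) <= ?X + ?Q \<theta>"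
    using tail_coefficients_le[OF A(1) \<theta> S \<rho>(1) \<rho>(2)[OF A] Vm] unfolding Q .
  qed
  also have "ennreal (\<Sum>j\<le>n. (cmod (a \<theta> j - b \<theta> j))^2) <= ennreal ?K * (ennreal (1 / r) * ?N \<theta>)" proof -
   have "?N \<theta> = ennreal (\<bar>r\<bar> ^ DIM(real)) * (\<integral>\<^sup>+x. ?H1 ((0 + r *\<^sub>R x) *\<^sub>R \<theta>) \<partial>lborel)"
    by (rule nn_integral_lborel_affine) (use r in auto)
   also have "(\<integral>\<^sup>+x. ?H1 ((0 + r *\<^sub>R x) *\<^sub>R \<theta>) \<partial>lborel) = (\<integral>\<^sup>+x. ennreal ((cmod (D ((r * x) *\<^sub>R \<theta>)))^2) * ind {-1..1} x \<partial>lborel)"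
   proof (rule nn_integral_cong)
    fix x :: real
    have "norm ((0 + r *\<^sub>R x) *\<^sub>R \<theta>) = r * \<bar>x\<bar>" using \<theta> r by (simp add: abs_mult)
    moreover have "r * \<bar>x\<bar> <= r \<longleftrightarrow> x \<in> {-1..1}" using r by (auto simp: mult_le_cancel_left1)
    ultimately have "(0 + r *\<^sub>R x) *\<^sub>R \<theta> \<in> cball 0 r \<longleftrightarrow> x \<in> {-1..1}" by (simp only: mem_cball dist_0_norm)
    then have "ind (cball 0 r) ((0 + r *\<^sub>R x) *\<^sub>R \<theta>) = (ind {-1..1} x :: ennreal)" unfolding indicator_def by (simp only:)
    then show "?H1 ((0 + r *\<^sub>R x) *\<^sub>R \<theta>) = ennreal ((cmod (D ((r * x) *\<^sub>R \<theta>)))^2) * ind {-1..1} x"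
     by (simp only: add_0_left real_scaleR_def mult.commute)
   qed
   finally have N: "?N \<theta> = ennreal r * (\<integral>\<^sup>+x. ennreal ((cmod (D ((r * x) *\<^sub>R \<theta>)))^2) * ind {-1..1} x \<partial>lborel)"
    using r by simp
   have "ennreal (1 / r) * ?N \<theta> = (\<integral>\<^sup>+x. ennreal ((cmod (D ((r * x) *\<^sub>R \<theta>)))^2) * ind {-1..1} x \<partial>lborel)"
    unfolding N mult.assoc[symmetric] using r by (simp add: ennreal_mult[symmetric])
   then show ?thesis using noise_le[OF \<theta>, of n] by (simp only:)
  qed
  finally show ?thesis by (simp add: add_right_mono mult_left_mono)
 qed
 have "?L = dirint (\<lambda>\<theta>. \<integral>\<^sup>+s. ind {0<..} s * ennreal ((cmod (W n (s *\<^sub>R \<theta>)))^2) \<partial>lborel)"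
  by (rule polar_half_line[symmetric]) measurable
 also have "... <= dirint (\<lambda>\<theta>. ennreal (2 * pi) * (ennreal ?K * (ennreal (1 / r) * ?N \<theta>) + (?X + ?Q \<theta>)))"
  by (rule dirint_mono[OF ray])
 also have "... = ennreal (2 * pi) * (ennreal ?K * (ennreal (1 / r) * dirint ?N) + (dirint (\<lambda>\<theta>::'a. ?X) + dirint ?Q))"
  by (simp add: dirint_cmult dirint_add)
 also have "dirint ?N = ennreal (2 / DIM('a)) * ?M1" by (rule polar_line[OF H(1)])
 also have "dirint ?Q = ennreal (2 / DIM('a)) * ?M2" by (rule polar_line[OF H(2)])
 also have "dirint (\<lambda>\<theta>::'a. ?X) = emeasure lborel (cball (0::'a) 1) * ?X" by (rule dirint_const)
 also have "ennreal (1 / r) * (ennreal (2 / DIM('a)) * ?M1) = ennreal (2 / (r * DIM('a))) * ?M1"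
  using r by (simp add: mult.assoc[symmetric] ennreal_mult[symmetric])
 finally show ?thesis .
qed

end

section \<open>The choice of the cutoff\<close>

lemma mult_ln_strict_mono: "1 <= x ==> x < y ==> x * ln x < y * ln (y::real)"
proof -
 assume xy: "1 <= x" "x < y"
 have "x * ln x <= x * ln y" using xy by (intro mult_left_mono) auto
 also have "... < y * ln y" using xy by (intro mult_strict_right_mono) auto
 finally show ?thesis .
qed

text \<open>
 Existence by the intermediate value theorem, uniqueness by strict monotonicity of $x \ln x$.
\<close>

lemma cutoff_tau:
 assumes c: "0 < c" and \<alpha>: "0 < \<alpha>" and \<delta>: "0 < \<delta>" "\<delta> < 1"
 shows "1 <= cutoff_tau c \<alpha> \<delta>"
  and "exp 1 * c / 4 * (cutoff_tau c \<alpha> \<delta> * ln (cutoff_tau c \<alpha> \<delta>)) = \<alpha> * ln (1 / \<delta>)"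
proof -
 let ?A = "4 / (exp 1 * c) * \<alpha> * ln (1 / \<delta>)"
 have A: "0 <= ?A" using c \<alpha> \<delta> by simp
 let ?X = "exp 1 + ?A"
 have X: "exp 1 <= ?X" using A by linarith
 then have X1: "1 <= ?X" using one_le_exp_iff[of "1::real"] by linarith
 have "ln (exp 1) <= ln ?X" using X X1 by (subst ln_le_cancel_iff) auto
 then have "?X * 1 <= ?X * ln ?X" using X1 by (intro mult_left_mono) auto
 moreover have "?A <= ?X * 1" by simp
 ultimately have fX: "?A <= ?X * ln ?X" by (rule order_trans[rotated])
 have "\<exists>x\<ge>1. x <= ?X \<and> x * ln x = ?A" by (rule IVT') (use A fX X1 in \<open>auto intro!: continuous_intros\<close>)
 then obtain x where x: "1 <= x" "x * ln x = ?A" by blast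
 have "cutoff_tau c \<alpha> \<delta> \<ge> 1 \<and> cutoff_tau c \<alpha> \<delta> * ln (cutoff_tau c \<alpha> \<delta>) = ?A"
  unfolding cutoff_tau_def proof (rule theI[of _ x])
  show "1 <= x \<and> x * ln x = ?A" using x by blast
  fix y assume y: "1 <= y \<and> y * ln y = ?A"
  show "y = x" using mult_ln_strict_mono[of x y] mult_ln_strict_mono[of y x] x y by (cases x y rule: linorder_cases) auto
 qed
 then show "1 <= cutoff_tau c \<alpha> \<delta>"
  "exp 1 * c / 4 * (cutoff_tau c \<alpha> \<delta> * ln (cutoff_tau c \<alpha> \<delta>)) = \<alpha> * ln (1 / \<delta>)"
  using c by (auto simp: field_simps)
qed

lemma cutoff_index_bounds:
 assumes "0 < c" "0 < \<alpha>" "0 < \<delta>" "\<delta> < 1"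
 shows "3 <= cutoff_index c \<alpha> \<delta>"
  and "real (cutoff_index c \<alpha> \<delta>) <= 3 + cutoff_tau c \<alpha> \<delta> * (exp 1 * c / 4)"
  and "cutoff_tau c \<alpha> \<delta> * (exp 1 * c / 4) <= real (cutoff_index c \<alpha> \<delta>)"
proof -
 let ?t = "cutoff_tau c \<alpha> \<delta> * (exp 1 * c / 4)"
 have t: "0 <= ?t" using cutoff_tau(1)[OF assms] assms by simp
 have "3 <= \<lfloor>3 + ?t\<rfloor>" using t by (simp add: le_floor_iff)
 from nat_mono[OF this] show "3 <= cutoff_index c \<alpha> \<delta>" unfolding cutoff_index_def by (simp only: nat_numeral)
 have "real (cutoff_index c \<alpha> \<delta>) = of_int \<lfloor>3 + ?t\<rfloor>"
  unfolding cutoff_index_def using \<open>3 <= \<lfloor>3 + ?t\<rfloor>\<close> by simp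
 then show "real (cutoff_index c \<alpha> \<delta>) <= 3 + ?t" "?t <= real (cutoff_index c \<alpha> \<delta>)"
  using of_int_floor_le[of "3 + ?t"] floor_correct[of "3 + ?t"] by linarith+
qed

text \<open>
 The exponent \<open>\<alpha>\<close> is exactly what the growth of the inverse eigenvalues costs, up to terms
 that are linear in \<open>\<tau>\<close>; these are absorbed in the gap between \<open>\<beta>\<close> and \<open>1 - \<alpha>\<close>.
\<close>

lemma noise_asymptotics:
 fixes c \<alpha> \<beta> K :: real
 assumes c: "0 < c" and \<alpha>: "0 < \<alpha>" and \<beta>: "\<beta> < 1 - \<alpha>" and K: "1 <= K"
 obtains k where "0 < k" "\<And>\<delta>. 0 < \<delta> ==> \<delta> < 1 ==>
  \<delta> * (K ^ (cutoff_index c \<alpha> \<delta> + 1) * (real (cutoff_index c \<alpha> \<delta>) + 1) ^ cutoff_index c \<alpha> \<delta>) <= k * \<delta> powr \<beta>"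
proof -
 define B where "B = exp 1 * c / 4"
 have B: "0 < B" using c by (simp add: B_def)
 define E where "E = 4 + B"
 have E: "1 <= E" "0 <= ln E" using B by (auto simp: E_def)
 define M where "M = 3 + (3 + B) * ln E + E * ln K"
 have M: "0 <= M" using B E K by (simp add: M_def)
 (* The linear term M \<tau> is at most \<epsilon> \<tau> ln \<tau>, which is the remaining part of the exponent, once ln \<tau> exceeds M / \<epsilon>; before that, \<tau> is bounded. *)
 define \<epsilon> where "\<epsilon> = (1 - \<beta> - \<alpha>) * B / \<alpha>"
 have \<epsilon>: "0 < \<epsilon>" using B \<alpha> \<beta> by (simp add: \<epsilon>_def)
 define M' where "M' = M * exp (M / \<epsilon>)"
 show thesis proof (rule that[of "exp M'"])
  fix \<delta> :: real assume \<delta>: "0 < \<delta>" "\<delta> < 1"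
  define L where "L = ln (1 / \<delta>)"
  define \<tau> where "\<tau> = cutoff_tau c \<alpha> \<delta>"
  define n where "n = cutoff_index c \<alpha> \<delta>"
  have \<tau>: "1 <= \<tau>" "B * (\<tau> * ln \<tau>) = \<alpha> * L"
   using cutoff_tau[OF c \<alpha> \<delta>] by (auto simp: \<tau>_def L_def B_def)
  have lt: "0 <= ln \<tau>" "ln \<tau> <= \<tau>" using \<tau> ln_le_minus_one[of \<tau>] by auto
  have n: "3 <= n" "real n <= 3 + \<tau> * B" using cutoff_index_bounds[OF c \<alpha> \<delta>] by (auto simp: n_def \<tau>_def B_def)
  have nE: "real n + 1 <= E * \<tau>" using n \<tau> by (simp add: E_def algebra_simps)
  have "ln (real n + 1) <= ln (E * \<tau>)" using nE by (subst ln_le_cancel_iff) auto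
  also have "... = ln E + ln \<tau>" using E \<tau> by (subst ln_mult) auto
  finally have lnn: "ln (real n + 1) <= ln E + ln \<tau>" .
  have "real n * ln (real n + 1) <= (3 + \<tau> * B) * (ln E + ln \<tau>)" using n lnn B \<tau> by (intro mult_mono) auto
  also have "... = 3 * ln E + 3 * ln \<tau> + \<tau> * (B * ln E) + B * (\<tau> * ln \<tau>)" by (simp add: algebra_simps)
  also have "... <= 3 * (\<tau> * ln E) + 3 * \<tau> + \<tau> * (B * ln E) + \<alpha> * L"
   using \<tau> lt E mult_right_mono[of 1 \<tau> "ln E"] by simp
  finally have 1: "real n * ln (real n + 1) <= (3 + (3 + B) * ln E) * \<tau> + \<alpha> * L" by (simp add: algebra_simps)
  have "(real n + 1) * ln K <= (E * \<tau>) * ln K" using nE K by (intro mult_right_mono) auto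
  then have 2: "(real n + 1) * ln K + real n * ln (real n + 1) <= M * \<tau> + \<alpha> * L" using 1 by (simp add: M_def algebra_simps)
  have 3: "M * \<tau> <= (1 - \<beta> - \<alpha>) * L + M'" proof (cases "M / \<epsilon> <= ln \<tau>")
   case True
   have "M * \<tau> <= \<epsilon> * (\<tau> * ln \<tau>)"
    using True \<epsilon> \<tau> mult_right_mono[of M "\<epsilon> * ln \<tau>" \<tau>] by (simp add: field_simps)
   also have "... = (1 - \<beta> - \<alpha>) / \<alpha> * (B * (\<tau> * ln \<tau>))" by (simp add: \<epsilon>_def)
   also have "... = (1 - \<beta> - \<alpha>) * L" using \<tau>(2) \<alpha> by simp
   also have "... <= (1 - \<beta> - \<alpha>) * L + M'" using M by (simp add: M'_def)
   finally show ?thesis .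
  next
   case False
   then have "exp (ln \<tau>) <= exp (M / \<epsilon>)" by simp
   then have "\<tau> <= exp (M / \<epsilon>)" using \<tau> by simp
   then have "M * \<tau> <= M'" unfolding M'_def using M by (rule mult_left_mono)
   moreover have "0 <= (1 - \<beta> - \<alpha>) * L" using \<beta> \<delta> by (simp add: L_def)
   ultimately show ?thesis by linarith
  qed
  have L: "\<delta> = exp (- L)" using \<delta> by (simp add: L_def ln_div)
  have "K ^ (n + 1) = exp ((real n + 1) * ln K)" using K exp_of_nat_mult[of "n + 1" "ln K"] by (simp add: add.commute)
  moreover have "(real n + 1) ^ n = exp (real n * ln (real n + 1))" using exp_of_nat_mult[of n "ln (real n + 1)"] by simp
  ultimately have "\<delta> * (K ^ (n + 1) * (real n + 1) ^ n) = exp (- L + ((real n + 1) * ln K + real n * ln (real n + 1)))"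
   by (simp only: exp_add L[symmetric])
  also have "... <= exp (M' + - \<beta> * L)" proof -
   have "- L + ((real n + 1) * ln K + real n * ln (real n + 1)) <= M' + - \<beta> * L" using 2 3 by (simp add: algebra_simps)
   then show ?thesis by simp
  qed
  also have "... = exp M' * \<delta> powr \<beta>" using \<delta> by (simp only: exp_add) (simp add: powr_def L_def ln_div)
  finally show "\<delta> * (K ^ (cutoff_index c \<alpha> \<delta> + 1) * (real (cutoff_index c \<alpha> \<delta>) + 1) ^ cutoff_index c \<alpha> \<delta>) <= exp M' * \<delta> powr \<beta>"
   unfolding n_def .
 qed simp
qed

lemma powr_times_power_bounded:
 fixes q a :: real
 assumes q: "0 < q" "q < 1"
 obtains k where "0 < k" "\<And>n::nat. 1 <= n ==> real n powr a * q ^ n <= k"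
proof -
 define t where "t = - ln q"
 have t: "0 < t" using q by (simp add: t_def)
 define N where "N = nat \<lceil>\<bar>a\<bar>\<rceil>"
 have N: "a <= real N" unfolding N_def by linarith
 show thesis proof (rule that[of "fact N / t ^ N"])
  show "0 < fact N / t ^ N" using t by simp
  fix n :: nat assume n: "1 <= n"
  have "real n powr a <= real n powr real N" using n N by (intro powr_mono) auto
  also have "... = real n ^ N" using n by (simp add: powr_realpow)
  finally have 1: "real n powr a <= real n ^ N" .
  have "exp (real n * ln q) = q ^ n" using q exp_of_nat_mult[of n "ln q"] by simp
  then have q': "q ^ n = exp (- (t * n))" by (simp add: t_def mult.commute)
  have "(t * n) ^ N / fact N <= exp (t * n)" using t by (intro power_div_fact_le_exp) simp
  then have "(t * n) ^ N <= fact N * exp (t * n)" by (simp add: field_simps)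
  then have "(t * n) ^ N * exp (- (t * n)) <= fact N * exp (t * n) * exp (- (t * n))" by (rule mult_right_mono) simp
  also have "... = fact N" by (simp add: exp_minus)
  finally have "real n ^ N * q ^ n <= fact N / t ^ N" unfolding q' using t by (simp add: power_mult_distrib field_simps)
  moreover have "real n powr a * q ^ n <= real n ^ N * q ^ n" using 1 q by (intro mult_right_mono) auto
  ultimately show "real n powr a * q ^ n <= fact N / t ^ N" by linarith
 qed
qed

text \<open>
 With $\tau \ln \tau$ proportional to $\ln \delta^{-1}$, a power of $\tau$ slightly larger than one
 dominates $\tau \ln \tau$.
\<close>

lemma cutoff_index_powr_le:
 fixes c \<alpha> m \<mu> :: real
 assumes c: "0 < c" and \<alpha>: "0 < \<alpha>" and \<mu>: "0 < \<mu>" "\<mu> < m"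
 obtains k where "0 < k" "\<And>\<delta>. 0 < \<delta> ==> \<delta> < 1 ==>
  (real (cutoff_index c \<alpha> \<delta>) + 1) powr (- m) <= k * ln (1 / \<delta>) powr (- \<mu>)"
proof -
 define B where "B = exp 1 * c / 4"
 have B: "0 < B" using c by (simp add: B_def)
 define e where "e = m / \<mu> - 1"
 have e: "0 < e" using \<mu> by (simp add: e_def)
 define k where "k = B powr (- m) * (B / (\<alpha> * e)) powr \<mu>"
 show thesis proof (rule that[of k])
  show "0 < k" using B \<alpha> e by (simp add: k_def)
  fix \<delta> :: real assume \<delta>: "0 < \<delta>" "\<delta> < 1"
  define L where "L = ln (1 / \<delta>)"
  have L: "0 < L" using \<delta> by (simp add: L_def)
  define \<tau> where "\<tau> = cutoff_tau c \<alpha> \<delta>"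
  have \<tau>: "1 <= \<tau>" "B * (\<tau> * ln \<tau>) = \<alpha> * L"
   using cutoff_tau[OF c \<alpha> \<delta>] by (auto simp: \<tau>_def L_def B_def)
  have "L = B / \<alpha> * (\<tau> * ln \<tau>)" using \<tau>(2) \<alpha> by (simp add: field_simps)
  also have "... <= B / \<alpha> * (\<tau> * (\<tau> powr e / e))"
   using B \<alpha> \<tau> e ln_powr_bound[of \<tau> e] by (intro mult_left_mono) auto
  also have "... = (B / (\<alpha> * e)) * (\<tau> powr 1 * \<tau> powr e)" using \<tau> by simp
  also have "... = (B / (\<alpha> * e)) * \<tau> powr (m / \<mu>)" by (simp only: powr_add[symmetric]) (simp add: e_def)
  finally have Lle: "L <= (B / (\<alpha> * e)) * \<tau> powr (m / \<mu>)" .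
  have "L powr \<mu> <= ((B / (\<alpha> * e)) * \<tau> powr (m / \<mu>)) powr \<mu>" using Lle L \<mu> by (intro powr_mono2) auto
  also have "... = (B / (\<alpha> * e)) powr \<mu> * \<tau> powr m" using B \<alpha> e \<mu> by (subst powr_mult) (auto simp: powr_powr)
  finally have Lmu: "L powr \<mu> <= (B / (\<alpha> * e)) powr \<mu> * \<tau> powr m" .
  have "\<tau> powr (- m) = \<tau> powr (- m) * (L powr \<mu> * L powr (- \<mu>))" using L by (simp add: powr_add[symmetric])
  also have "... <= \<tau> powr (- m) * (((B / (\<alpha> * e)) powr \<mu> * \<tau> powr m) * L powr (- \<mu>))"
   using Lmu by (intro mult_left_mono mult_right_mono) auto
  also have "... = (\<tau> powr (- m) * \<tau> powr m) * ((B / (\<alpha> * e)) powr \<mu> * L powr (- \<mu>))" by (simp only: mult_ac)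
  also have "\<tau> powr (- m) * \<tau> powr m = 1" using \<tau> by (simp add: powr_add[symmetric])
  finally have tm: "\<tau> powr (- m) <= (B / (\<alpha> * e)) powr \<mu> * L powr (- \<mu>)" by simp
  have "\<tau> * B <= real (cutoff_index c \<alpha> \<delta>) + 1"
   using cutoff_index_bounds(3)[OF c \<alpha> \<delta>] by (simp add: \<tau>_def B_def)
  then have "(real (cutoff_index c \<alpha> \<delta>) + 1) powr (- m) <= (\<tau> * B) powr (- m)"
   using \<tau> B \<mu> by (intro powr_mono2') auto
  also have "... = B powr (- m) * \<tau> powr (- m)" using \<tau> B by (simp add: powr_mult mult.commute)
  also have "... <= B powr (- m) * ((B / (\<alpha> * e)) powr \<mu> * L powr (- \<mu>))" by (intro mult_left_mono tm) simp
  finally show "(real (cutoff_index c \<alpha> \<delta>) + 1) powr (- m) <= k * ln (1 / \<delta>) powr (- \<mu>)"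
   by (simp only: k_def L_def mult.assoc)
 qed
qed

section \<open>Extrapolation along rays\<close>

text \<open>
 The Taylor remainder of the exponential, as a function of $q$, is a bounded multiplier on twice the
 ball; hence it may be measured by the $L^2$ norm of the Fourier transform, which is the only norm of
 $v$ at hand.
\<close>

lemma ray_taylor_remainder:
 fixes \<sigma> :: real
 assumes \<sigma>: "0 < \<sigma>"
 obtains C where "0 <= C" "\<And>(v :: 'a::euclidean_space => complex) M J \<theta> s. ball_function v \<sigma> ==> 0 <= M ==>
  (l2mass (ft v)) <= ennreal (M^2) ==> norm \<theta> = 1 ==>
  cmod (ball_function.V v \<sigma> (s *\<^sub>R \<theta>) - (\<Sum>k<J. (\<i> * cor s) ^ k / fact k *
    (LINT q|lborel. v q * cor ((\<theta> \<bullet> q / \<sigma>) ^ k)))) <= C * M * (2 ^ J / fact J) * \<bar>s\<bar> ^ J"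
proof -
 show thesis proof (rule bounded_pairing_le[OF \<sigma>, where ?'a='a], goal_cases)
 case (1 C)
 note C = 1(1) and le = 1(2)
 show thesis proof (rule that[of "sqrt C"])
  show "0 <= sqrt C" using C by simp
  fix v :: "'a => complex" and M s :: real and J :: nat and \<theta> :: 'a
  assume B: "ball_function v \<sigma>" and M: "0 <= M" and Y: "(l2mass (ft v)) <= ennreal (M^2)"
   and \<theta>: "norm \<theta> = 1"
  interpret ball_function v \<sigma> by (rule B)
  define T where "T y = (\<Sum>k<J. (\<i> * cor s) ^ k / fact k * cor (y ^ k))" for y :: real
  define m where "m q = cis (s * (\<theta> \<bullet> q / \<sigma>)) - T (\<theta> \<bullet> q / \<sigma>)" for q
  have Tt: "T y = (\<Sum>k<J. (\<i> * cor (s * y)) ^ k / fact k)" for y unfolding T_def by (intro sum.cong refl) (simp add: power_mult_distrib)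
  have ic: "integrable lborel (\<lambda>q. v q * cis (s * (\<theta> \<bullet> q / \<sigma>)))"
   by (rule ridge_integrable[where h="\<lambda>y. cis (s * y)", OF _ \<theta>]) (intro continuous_intros)
  have ik: "integrable lborel (\<lambda>q. v q * cor ((\<theta> \<bullet> q / \<sigma>) ^ k))" for k
   by (rule ridge_integrable[where h="\<lambda>y. cor (y ^ k)", OF _ \<theta>]) (intro continuous_intros)
  have ik': "integrable lborel (\<lambda>q. (\<i> * cor s) ^ k / fact k * (v q * cor ((\<theta> \<bullet> q / \<sigma>) ^ k)))" for k
   by (rule integrable_mult_right[OF ik])
  have vT: "v q * T (\<theta> \<bullet> q / \<sigma>) = (\<Sum>k<J. (\<i> * cor s) ^ k / fact k * (v q * cor ((\<theta> \<bullet> q / \<sigma>) ^ k)))" for q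
   unfolding T_def sum_distrib_left by (simp only: mult.left_commute)
  have "(LINT q|lborel. v q * m q) = (LINT q|lborel. v q * cis (s * (\<theta> \<bullet> q / \<sigma>))
    - (\<Sum>k<J. (\<i> * cor s) ^ k / fact k * (v q * cor ((\<theta> \<bullet> q / \<sigma>) ^ k))))" unfolding m_def right_diff_distrib vT ..
  also have "... = V (s *\<^sub>R \<theta>) - (\<Sum>k<J. (\<i> * cor s) ^ k / fact k * (LINT q|lborel. v q * cor ((\<theta> \<bullet> q / \<sigma>) ^ k)))"
   unfolding V_ray by (subst L_integral_diff[OF ic L_integrable_sum[OF ik']])
    (simp only: L_integral_sum[OF ik'] integral_mult_right_zero)
  finally have I: "(LINT q|lborel. v q * m q) = ..." .
  let ?B = "(2 * \<bar>s\<bar>) ^ J / fact J"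
  have mB: "cmod (m q) <= ?B" if "q \<in> cball 0 (2 * \<sigma>)" for q proof -
   have "\<bar>\<theta> \<bullet> q\<bar> <= norm \<theta> * norm q" by (rule Cauchy_Schwarz_ineq2)
   also have "... <= 2 * \<sigma>" using that \<theta> by simp
   finally have "\<bar>\<theta> \<bullet> q / \<sigma>\<bar> <= 2" using \<sigma> by (simp add: pos_divide_le_eq)
   then have "\<bar>s\<bar> * \<bar>\<theta> \<bullet> q / \<sigma>\<bar> <= \<bar>s\<bar> * 2" by (rule mult_left_mono) simp
   then have le2: "\<bar>s * (\<theta> \<bullet> q / \<sigma>)\<bar> <= 2 * \<bar>s\<bar>" by (simp only: abs_mult mult.commute)
   have "cmod (m q) <= \<bar>s * (\<theta> \<bullet> q / \<sigma>)\<bar> ^ J / fact J" unfolding m_def Tt by (rule cis_taylor)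
   also have "... <= ?B" using le2 by (intro divide_right_mono power_mono) auto
   finally show ?thesis .
  qed
  have mc: "continuous_on UNIV m" unfolding m_def[abs_def] T_def using \<sigma> by (intro continuous_intros) auto
  have "ennreal ((cmod (LINT q|lborel. v q * m q))^2) <= ennreal (C * ?B^2) * ennreal (M^2)"
   by (rule order_trans[OF le[OF v supp mc mB]]) (use Y in \<open>auto intro: mult_left_mono\<close>)
  also have "... = ennreal ((sqrt C * ?B * M)^2)" proof -
   have "(sqrt C * ?B * M)^2 = (sqrt C)^2 * ?B^2 * M^2" by (simp only: power_mult_distrib)
   also have "... = C * ?B^2 * M^2" using C by simp
   finally have "ennreal ((sqrt C * ?B * M)^2) = ennreal (C * ?B^2 * M^2)" by (simp only:)
   also have "... = ennreal (C * ?B^2) * ennreal (M^2)" using C by (intro ennreal_mult) auto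
   finally show ?thesis by (rule sym)
  qed
  finally have "(cmod (LINT q|lborel. v q * m q))^2 <= (sqrt C * ?B * M)^2" by simp
  then have "cmod (LINT q|lborel. v q * m q) <= sqrt C * ?B * M" by (rule power2_le_imp_le) (use C M in simp)
  also have "... = sqrt C * M * (2 ^ J / fact J) * \<bar>s\<bar> ^ J" by (simp add: power_mult_distrib)
  finally show "cmod (V (s *\<^sub>R \<theta>) - (\<Sum>k<J. (\<i> * cor s) ^ k / fact k *
    (LINT q|lborel. v q * cor ((\<theta> \<bullet> q / \<sigma>) ^ k)))) <= sqrt C * M * (2 ^ J / fact J) * \<bar>s\<bar> ^ J" unfolding I .
 qed
 qed
qed

lemma weighted_scaling:
 fixes H :: "'a::euclidean_space => ennreal"
 assumes [measurable]: "H \<in> bm" and \<sigma>: "0 < \<sigma>"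
 shows "(wint H)
  = ennreal \<sigma> * (wint (\<lambda>p. H (\<sigma> *\<^sub>R p)))"
proof -
 have "(wint H)
  = ennreal (\<bar>\<sigma>\<bar> ^ DIM('a)) * (\<integral>\<^sup>+p. ennreal (norm (0 + \<sigma> *\<^sub>R p) powi (1 - int DIM('a))) * H (0 + \<sigma> *\<^sub>R p) \<partial>lborel)"
  by (rule nn_integral_lborel_affine) (use \<sigma> in auto)
 also have "... = (\<integral>\<^sup>+p. ennreal (\<bar>\<sigma>\<bar> ^ DIM('a)) * (ennreal (norm (0 + \<sigma> *\<^sub>R p) powi (1 - int DIM('a))) * H (0 + \<sigma> *\<^sub>R p)) \<partial>lborel)"
  by (rule nn_integral_cmult[symmetric]) measurable
 also have "... = (\<integral>\<^sup>+p. ennreal \<sigma> * (ennreal (norm p powi (1 - int DIM('a))) * H (\<sigma> *\<^sub>R p)) \<partial>lborel)"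
 proof (rule nn_integral_cong)
  fix p :: 'a
  have "\<bar>\<sigma>\<bar> ^ DIM('a) * (norm (0 + \<sigma> *\<^sub>R p) powi (1 - int DIM('a))) = \<sigma> * norm p powi (1 - int DIM('a))"
  proof -
   have "\<bar>\<sigma>\<bar> ^ DIM('a) = \<sigma> * \<sigma> ^ (DIM('a) - 1)"
    using \<sigma> power_minus_mult[of "DIM('a)" \<sigma>] by (simp add: mult.commute)
   then show ?thesis unfolding power_int_dim using \<sigma> by (simp add: power_mult_distrib)
  qed
  then have "ennreal (\<bar>\<sigma>\<bar> ^ DIM('a)) * ennreal (norm (0 + \<sigma> *\<^sub>R p) powi (1 - int DIM('a))) = ennreal \<sigma> * ennreal (norm p powi (1 - int DIM('a)))"
   using \<sigma> by (simp add: ennreal_mult[symmetric])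
  then show "ennreal (\<bar>\<sigma>\<bar> ^ DIM('a)) * (ennreal (norm (0 + \<sigma> *\<^sub>R p) powi (1 - int DIM('a))) * H (0 + \<sigma> *\<^sub>R p))
   = ennreal \<sigma> * (ennreal (norm p powi (1 - int DIM('a))) * H (\<sigma> *\<^sub>R p))" by (simp only: mult.assoc[symmetric] add_0_left)
 qed
 also have "... = ennreal \<sigma> * (wint (\<lambda>p. H (\<sigma> *\<^sub>R p)))" by (rule nn_integral_cmult) measurable
 finally show ?thesis .
qed

text \<open>Extrapolation on each ray from $(0,c]$ to $(0,S]$, then integration over directions.\<close>

lemma low_frequency_le:
 fixes r \<sigma> :: real
 assumes r: "0 < r" and \<sigma>: "0 < \<sigma>"
 obtains K A \<eta> where "1 <= K" "0 < A" "0 < \<eta>"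
  "\<And>(v :: 'a::euclidean_space => complex) M n. ball_function v \<sigma> ==> 0 <= M ==>
   (l2mass (ft v)) <= ennreal (M^2) ==>
   (wint (\<lambda>q. ind {q. norm q <= \<eta> * (real n + 1)} q * ennreal ((cmod (ball_function.V v \<sigma> q))^2)))
   <= ennreal A * (ennreal ((K ^ (n + 1) * (real n + 1) ^ n)^2) *
     (wint (\<lambda>p. ind (cball 0 r) p * ennreal ((cmod (ft v p))^2)))
    + ennreal (((real n + 1) * (1 / 2) ^ (n + 1) * M)^2))"
proof -
 define c where "c = r * \<sigma>"
 have c: "0 < c" using r \<sigma> by (simp add: c_def)
 show thesis proof (rule ray_taylor_remainder[OF \<sigma>, where ?'a='a], rule extrapolation_constants[OF c], goal_cases)
 case (1 C0 K C \<eta>)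
 note C0 = 1(1) and rem = 1(2) and K = 1(3) and C = 1(4) and \<eta> = 1(5) and amp = 1(6) and small = 1(7)
 define e where "e = measure lborel (cball (0::'a) 1)"
 have e: "emeasure lborel (cball (0::'a) 1) = ennreal e" "0 <= e"
  unfolding e_def using emeasure_lborel_cball_finite[of "0::'a" 1] by (auto intro!: emeasure_eq_ennreal_measure)
 define A where "A = \<sigma> + DIM('a) * (\<eta> * e * (2 * (C0 * C)^2))"
 show thesis proof (rule that[OF K _ \<eta>])
  show "0 < A" unfolding A_def using \<sigma> \<eta> e by (intro add_pos_nonneg) auto
  fix v :: "'a => complex" and M :: real and n :: nat
  assume B: "ball_function v \<sigma>" and M: "0 <= M" and Y: "(l2mass (ft v)) <= ennreal (M^2)"
  interpret ball_function v \<sigma> by (rule B)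
  define J where "J = n + 1"
  have J: "0 < J" "real J = real n + 1" "J - 1 = n" by (auto simp: J_def)
  define S where "S = \<eta> * real J"
  have S: "0 < S" using \<eta> J by (simp add: S_def)
  define \<Lambda> where "\<Lambda> = real J * ((2 * (S + c) * J / c) ^ (J - 1) / fact (J - 1))"
  have L0: "0 <= \<Lambda>" unfolding \<Lambda>_def using S c by simp
  define R where "R = C0 * M * (2 ^ J / fact J)"
  have R: "0 <= R" using C0 M by (simp add: R_def)
  let ?X = "R * (S ^ J + \<Lambda> * c ^ J)"
  let ?H1 = "\<lambda>q. ind (cball 0 c) q * ennreal ((cmod (V q))^2)"
  let ?H2 = "\<lambda>q. ind {q. norm q <= S} q * ennreal ((cmod (V q))^2)"
  let ?N = "\<lambda>\<theta>. \<integral>\<^sup>+s. ind {0<..} s * ?H1 (s *\<^sub>R \<theta>) \<partial>lborel"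
  let ?W = "\<lambda>H. wint H"
  have [measurable]: "{q::'a. norm q <= S} \<in> sets borel" by measurable
  have H[measurable]: "?H1 \<in> bm" "?H2 \<in> bm" by measurable
  have [measurable]: "?N \<in> bm" by measurable
  have X: "?X <= C0 * C * ((1 / 2) ^ J * M)" "0 <= ?X" proof -
   have "?X = C0 * M * (2 ^ J / fact J * (S ^ J + \<Lambda> * c ^ J))" by (simp only: R_def mult.assoc)
   also have "... <= C0 * M * (C * (1 / 2) ^ J)" using C0 M by (intro mult_left_mono small[OF J(1) S_def \<Lambda>_def]) auto
   finally show "?X <= C0 * C * ((1 / 2) ^ J * M)" by (simp only: mult_ac)
   show "0 <= ?X" using R S L0 c by simp
  qed
  have ray: "(\<integral>\<^sup>+s. ind {0<..} s * ?H2 (s *\<^sub>R \<theta>) \<partial>lborel)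
    <= ennreal S * (ennreal (2 * ?X^2) + ennreal (2 * \<Lambda>^2 / c) * ?N \<theta>)" if \<theta>: "norm \<theta> = 1" for \<theta> :: 'a
  proof -
   have N: "(\<integral>\<^sup>+x. ind {0<..c} x * ennreal ((cmod (V (x *\<^sub>R \<theta>)))^2) \<partial>lborel) = ?N \<theta>"
    using \<theta> by (intro nn_integral_cong) (auto simp: indicator_def)
   have "(\<integral>\<^sup>+s. ind {0<..} s * ?H2 (s *\<^sub>R \<theta>) \<partial>lborel)
    <= (\<integral>\<^sup>+s. (ennreal (2 * ?X^2) + ennreal (2 * \<Lambda>^2 / c) * ?N \<theta>) * ind {0<..S} s \<partial>lborel)"
   proof (rule nn_integral_mono)
    fix s :: real
    show "ind {0<..} s * ?H2 (s *\<^sub>R \<theta>) <= (ennreal (2 * ?X^2) + ennreal (2 * \<Lambda>^2 / c) * ?N \<theta>) * ind {0<..S} s"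
    proof (cases "0 < s \<and> s <= S")
     case True
     have "ennreal ((cmod (V (s *\<^sub>R \<theta>)))^2) <= ennreal (2 * ?X^2) + ennreal (2 * \<Lambda>^2 / c) * ?N \<theta>"
      unfolding N[symmetric] proof (rule square_extrapolation_le[OF c J(1) _ R _ _ \<Lambda>_def])
      show "\<bar>s\<bar> <= S" using True by simp
      show "(\<lambda>s. V (s *\<^sub>R \<theta>)) \<in> bm" by measurable
      show "cmod (V (u *\<^sub>R \<theta>) - (\<Sum>k<J. (\<i> * cor u) ^ k / fact k *
       (LINT q|lborel. v q * cor ((\<theta> \<bullet> q / \<sigma>) ^ k)))) <= R * \<bar>u\<bar> ^ J" for u
       unfolding R_def by (rule rem[OF B M Y \<theta>])
     qed
     then show ?thesis using True \<theta> by simp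
    next
     case False
     then show ?thesis using \<theta> by (auto simp: indicator_def)
    qed
   qed
   also have "... = ennreal S * (ennreal (2 * ?X^2) + ennreal (2 * \<Lambda>^2 / c) * ?N \<theta>)"
    using S by (subst nn_integral_cmult_indicator) (auto simp: mult.commute)
   finally show ?thesis .
  qed
  have "ennreal (1 / DIM('a)) * ?W ?H2 = dirint (\<lambda>\<theta>. \<integral>\<^sup>+s. ind {0<..} s * ?H2 (s *\<^sub>R \<theta>) \<partial>lborel)"
   by (rule polar_half_line[OF H(2), symmetric])
  also have "... <= dirint (\<lambda>\<theta>. ennreal S * (ennreal (2 * ?X^2) + ennreal (2 * \<Lambda>^2 / c) * ?N \<theta>))"
   by (rule dirint_mono[OF ray])
  also have "... = ennreal S * (dirint (\<lambda>\<theta>::'a. ennreal (2 * ?X^2)) + ennreal (2 * \<Lambda>^2 / c) * dirint ?N)"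
   by (simp add: dirint_cmult dirint_add)
  also have "dirint (\<lambda>\<theta>::'a. ennreal (2 * ?X^2)) = ennreal e * ennreal (2 * ?X^2)" by (simp only: dirint_const e)
  also have "dirint ?N = ennreal (1 / DIM('a)) * ?W ?H1" by (rule polar_half_line[OF H(1)])
  also have "?W ?H1 = ennreal \<sigma> * ?W (\<lambda>p. ind (cball 0 r) p * ennreal ((cmod (ft v p))^2))" (is "_ = _ * ?M1") proof -
   have "?H1 (\<sigma> *\<^sub>R p) = ind (cball 0 r) p * ennreal ((cmod (ft v p))^2)" for p proof -
    have "\<sigma> * norm p <= c \<longleftrightarrow> norm p <= r" unfolding c_def using \<sigma> by (simp add: mult.commute)
    then show ?thesis using \<sigma> by (simp add: V_def indicator_def)
   qed
   then show ?thesis by (subst weighted_scaling[OF H(1) \<sigma>]) (simp only:)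
  qed
  finally have *: "ennreal (1 / DIM('a)) * ?W ?H2 <= ennreal S * (ennreal e * ennreal (2 * ?X^2)
   + ennreal (2 * \<Lambda>^2 / c) * (ennreal (1 / DIM('a)) * (ennreal \<sigma> * ?M1)))" .
  have d: "ennreal DIM('a) * ennreal (1 / DIM('a)) = 1" by (simp add: ennreal_mult[symmetric])
  have "?W ?H2 = ennreal DIM('a) * (ennreal (1 / DIM('a)) * ?W ?H2)" by (simp only: mult.assoc[symmetric] d mult_1_left)
  also have "... <= ennreal DIM('a) * (ennreal S * (ennreal e * ennreal (2 * ?X^2)
   + ennreal (2 * \<Lambda>^2 / c) * (ennreal (1 / DIM('a)) * (ennreal \<sigma> * ?M1))))" by (rule mult_left_mono[OF *]) simp
  also have "... = ennreal DIM('a) * (ennreal S * (ennreal e * ennreal (2 * ?X^2)))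
   + ennreal \<sigma> * (ennreal S * ennreal (2 * \<Lambda>^2 / c)) * ?M1 * (ennreal DIM('a) * ennreal (1 / DIM('a)))"
   by (simp only: distrib_left mult_ac)
  also have "... = ennreal (DIM('a) * (S * (e * (2 * ?X^2)))) + ennreal (\<sigma> * (S * (2 * \<Lambda>^2 / c))) * ?M1"
   unfolding d using S e \<sigma> c by (simp add: ennreal_mult[symmetric])
  also have "... <= ennreal (A * ((real n + 1) * (1 / 2) ^ (n + 1) * M)^2) + ennreal (A * (K ^ (n + 1) * (real n + 1) ^ n)^2) * ?M1"
  proof (intro add_mono mult_right_mono ennreal_leI)
   have "\<sigma> * (S * (2 * \<Lambda>^2 / c)) <= A * (K ^ J * real J ^ (J - 1))^2"
   proof (rule mult_mono[OF _ amp[OF J(1) S_def \<Lambda>_def]])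
    show "\<sigma> <= A" using \<eta> e by (simp add: A_def)
    then show "0 <= A" using \<sigma> by simp
    show "0 <= S * (2 * \<Lambda>^2 / c)" using S c by simp
   qed
   then show "\<sigma> * (S * (2 * \<Lambda>^2 / c)) <= A * (K ^ (n + 1) * (real n + 1) ^ n)^2"
    unfolding J(2,3) by (simp only: J_def)
   have "DIM('a) * (S * (e * (2 * ?X^2))) <= DIM('a) * (S * (e * (2 * (C0 * C * ((1 / 2) ^ J * M))^2)))"
    using S e X by (intro mult_left_mono power_mono) auto
   also have "... = DIM('a) * (\<eta> * e * (2 * (C0 * C)^2)) * (real J * ((1 / 2) ^ J * M)^2)"
    by (simp only: S_def power_mult_distrib mult_ac)
   also have "... <= A * (real J * ((1 / 2) ^ J * M))^2" proof (rule mult_mono)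
    show "DIM('a) * (\<eta> * e * (2 * (C0 * C)^2)) <= A" using \<sigma> by (simp add: A_def)
    have "real J * 1 <= real J * real J" using J by (intro mult_left_mono) auto
    then have "real J <= (real J)^2" by (simp only: power2_eq_square mult_1_right)
    then show "real J * ((1 / 2) ^ J * M)^2 <= (real J * ((1 / 2) ^ J * M))^2"
     by (subst (2) power_mult_distrib) (rule mult_right_mono, auto)
    show "0 <= A" unfolding A_def using \<sigma> \<eta> e by (intro add_nonneg_nonneg) auto
   qed simp
   finally show "DIM('a) * (S * (e * (2 * ?X^2))) <= A * ((real n + 1) * (1 / 2) ^ (n + 1) * M)^2"
    unfolding J(2) by (simp only: J_def mult.assoc)
  qed simp
  also have "... = ennreal A * (ennreal ((K ^ (n + 1) * (real n + 1) ^ n)^2) * ?M1 + ennreal (((real n + 1) * (1 / 2) ^ (n + 1) * M)^2))"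
   using \<sigma> \<eta> e by (simp add: ennreal_mult A_def distrib_left mult.assoc add.commute)
  finally show "?W (\<lambda>q. ind {q. norm q <= \<eta> * (real n + 1)} q * ennreal ((cmod (V q))^2))
   <= ennreal A * (ennreal ((K ^ (n + 1) * (real n + 1) ^ n)^2) * ?M1 + ennreal (((real n + 1) * (1 / 2) ^ (n + 1) * M)^2))"
   unfolding S_def J(2) .
 qed
 qed
qed

section \<open>The error estimate in polar coordinates\<close>

text \<open>
 For $|p| > S / \sigma$ the weight $|p|^{1-d} = |p|^{-2m} |p|^{2\nu}$ is at most $(S / \sigma)^{-2m} (1
 + |p|^2)^\nu$.
\<close>

lemma (in ball_function) high_frequency_le:
 fixes \<nu> S M m :: real
 assumes S: "0 < S" and m: "m = \<nu> + (real DIM('a) - 1) / 2" "0 <= m" and \<nu>: "0 <= \<nu>"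
  and Y: "(hmass \<nu> (ft v)) <= ennreal (M^2)"
 shows "(wint (\<lambda>q. ind {q. S < norm q} q * ennreal ((cmod (V q))^2)))
  <= ennreal ((sqrt \<sigma> * (S / \<sigma>) powr (- m) * M)^2)"
proof -
 have [measurable]: "{q::'a. S < norm q} \<in> sets borel" by measurable
 let ?H = "\<lambda>q. ind {q. S < norm q} q * ennreal ((cmod (V q))^2)"
 let ?F = "\<lambda>p. (1 + (norm p)^2) powr \<nu> * (cmod (ft v p))^2"
 let ?k = "(S / \<sigma>) powr (- 2 * m)"
 have H: "?H \<in> bm" by measurable
 have S\<sigma>: "0 < S / \<sigma>" using S \<sigma> by simp
 have "(wint ?H)
  = ennreal \<sigma> * (wint (\<lambda>p. ?H (\<sigma> *\<^sub>R p)))" by (rule weighted_scaling[OF H \<sigma>])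
 also have "... <= ennreal \<sigma> * (\<integral>\<^sup>+p. ennreal ?k * ennreal (?F p) \<partial>lborel)"
 proof (intro mult_left_mono nn_integral_mono)
  fix p :: 'a
  show "ennreal (norm p powi (1 - int DIM('a))) * ?H (\<sigma> *\<^sub>R p) <= ennreal ?k * ennreal (?F p)"
  proof (cases "S < norm (\<sigma> *\<^sub>R p)")
   case True
   then have p: "S / \<sigma> < norm p" using \<sigma> by (simp add: pos_divide_less_eq mult.commute)
   then have p0: "0 < norm p" using S\<sigma> by linarith
   have "norm p powi (1 - int DIM('a)) = norm p powr (1 - real DIM('a))" using powr_real_of_int'[of "norm p" "1 - int DIM('a)"] p0 by simp
   also have "1 - real DIM('a) = - 2 * m + 2 * \<nu>" unfolding m(1) by (simp add: field_simps)
   also have "norm p powr (- 2 * m + 2 * \<nu>) = norm p powr (- 2 * m) * norm p powr (2 * \<nu>)" by (rule powr_add)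
   also have "norm p powr (2 * \<nu>) = ((norm p)^2) powr \<nu>" proof -
    have "((norm p)^2) powr \<nu> = (norm p powr 2) powr \<nu>" using p0 by simp
    then show ?thesis by (simp only: powr_powr)
   qed
   also have "norm p powr (- 2 * m) * ((norm p)^2) powr \<nu> <= ?k * (1 + (norm p)^2) powr \<nu>" proof (rule mult_mono)
    show "norm p powr (- 2 * m) <= ?k" using m(2) p S\<sigma> powr_mono2'[of "- 2 * m" "S / \<sigma>" "norm p"] by simp
    show "((norm p)^2) powr \<nu> <= (1 + (norm p)^2) powr \<nu>" using \<nu> by (intro powr_mono2) auto
   qed auto
   finally have "norm p powi (1 - int DIM('a)) * (cmod (ft v p))^2 <= ?k * (1 + (norm p)^2) powr \<nu> * (cmod (ft v p))^2"
    by (rule mult_right_mono) simp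
   then have "ennreal (norm p powi (1 - int DIM('a)) * (cmod (ft v p))^2) <= ennreal (?k * ?F p)"
    by (intro ennreal_leI) (simp only: mult.assoc)
   moreover have "V (\<sigma> *\<^sub>R p) = ft v p" using \<sigma> by (simp add: V_def)
   ultimately show ?thesis using True by (simp add: ennreal_mult)
  qed simp
 qed simp
 also have "(\<integral>\<^sup>+p. ennreal ?k * ennreal (?F p) \<partial>lborel) = ennreal ?k * (\<integral>\<^sup>+p. ennreal (?F p) \<partial>lborel)"
  by (rule nn_integral_cmult) measurable
 also have "ennreal \<sigma> * (ennreal ?k * (\<integral>\<^sup>+p. ennreal (?F p) \<partial>lborel)) <= ennreal \<sigma> * (ennreal ?k * ennreal (M^2))"
  by (intro mult_left_mono Y) auto
 also have "... = ennreal (\<sigma> * (?k * M^2))" using \<sigma> by (simp add: ennreal_mult[symmetric])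
 also have "\<sigma> * (?k * M^2) = (sqrt \<sigma> * (S / \<sigma>) powr (- m) * M)^2" proof -
  have "?k = ((S / \<sigma>) powr (- m))^2" using S\<sigma> by (simp add: power2_eq_square powr_add[symmetric])
  then show ?thesis using \<sigma> by (simp add: power_mult_distrib)
 qed
 finally show ?thesis .
qed

lemma (in ball_function) ft_mass_le:
 assumes \<nu>: "0 <= \<nu>" and Y: "(hmass \<nu> (ft v)) <= ennreal (M^2)"
 shows "(l2mass (ft v)) <= ennreal (M^2)"
proof (rule order_trans[OF nn_integral_mono Y])
 fix p :: 'a
 have "1 * (cmod (ft v p))^2 <= (1 + (norm p)^2) powr \<nu> * (cmod (ft v p))^2"
  by (intro mult_right_mono ge_one_powr_ge_zero \<nu>) auto
 then show "ennreal ((cmod (ft v p))^2) <= ennreal ((1 + (norm p)^2) powr \<nu> * (cmod (ft v p))^2)"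
  by (intro ennreal_leI) simp
qed

text \<open>
 The shape common to both error estimates; $\epsilon$ is the size of the noise and $M$ the Sobolev norm
 of $v$.
\<close>

definition error_bound :: "real => real => real => real => real => real => nat => real => real => real" where
 "error_bound K A \<eta> q \<sigma> m n \<epsilon> M = A * (K ^ (n + 1) * (real n + 1) ^ n * \<epsilon>
   + ((real n + 1) * q ^ (n + 1) + sqrt \<sigma> * (\<eta> * (real n + 1) / \<sigma>) powr (- m)) * M)"

lemma error_bound_nonneg:
 "1 <= K ==> 0 <= A ==> 0 <= q ==> 0 <= \<sigma> ==> 0 <= \<epsilon> ==> 0 <= M ==> 0 <= error_bound K A \<eta> q \<sigma> m n \<epsilon> M"
 unfolding error_bound_def by (intro mult_nonneg_nonneg add_nonneg_nonneg) auto

lemma sum_squares_le_error_bound: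
 assumes K: "1 <= K" and A: "1 <= A" and q: "0 <= q" and \<sigma>: "0 <= \<sigma>" and \<epsilon>: "0 <= \<epsilon>" and M: "0 <= M"
  and M1: "M1 <= ennreal (\<epsilon>^2)" and M2: "M2 <= ennreal ((sqrt \<sigma> * (\<eta> * (real n + 1) / \<sigma>) powr (- m) * M)^2)"
 shows "ennreal A * (ennreal ((K ^ (n + 1) * (real n + 1) ^ n)^2) * M1 + ennreal (((real n + 1) * q ^ (n + 1) * M)^2) + M2)
  <= ennreal ((error_bound K A \<eta> q \<sigma> m n \<epsilon> M)^2)"
proof -
 let ?a = "K ^ (n + 1) * (real n + 1) ^ n"
 let ?b = "(real n + 1) * q ^ (n + 1) * M"
 let ?c = "sqrt \<sigma> * (\<eta> * (real n + 1) / \<sigma>) powr (- m) * M"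
 have nn: "0 <= ?a" "0 <= ?b" "0 <= ?c" using K q M \<sigma> by auto
 have "ennreal A * (ennreal (?a^2) * M1 + ennreal (?b^2) + M2) <= ennreal A * (ennreal (?a^2) * ennreal (\<epsilon>^2) + ennreal (?b^2) + ennreal (?c^2))"
  by (intro mult_left_mono add_mono M1 M2 order_refl) auto
 also have "... = ennreal (A * ((?a * \<epsilon>)^2 + ?b^2 + ?c^2))" proof -
  have "ennreal (?a^2) * ennreal (\<epsilon>^2) = ennreal ((?a * \<epsilon>)^2)"
   by (simp only: power_mult_distrib[of ?a \<epsilon>] ennreal_mult zero_le_power2)
  then show ?thesis using A by (simp add: ennreal_plus[symmetric] ennreal_mult[symmetric] del: ennreal_plus)
 qed
 also have "... <= ennreal ((A * (?a * \<epsilon> + (?b + ?c)))^2)" proof (intro ennreal_leI)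
  have "(?a * \<epsilon>)^2 + ?b^2 + ?c^2 <= (?a * \<epsilon> + (?b + ?c))^2" proof -
   have "0 <= 2 * (?b * ?c)" "0 <= 2 * ((?a * \<epsilon>) * (?b + ?c))" using nn \<epsilon> by auto
   then show ?thesis unfolding power2_sum[of "?a * \<epsilon>"] power2_sum[of ?b] by linarith
  qed
  moreover have "A <= A^2" using A mult_left_mono[of 1 A A] by (simp add: power2_eq_square)
  ultimately have "A * ((?a * \<epsilon>)^2 + ?b^2 + ?c^2) <= A^2 * (?a * \<epsilon> + (?b + ?c))^2"
   using A by (intro mult_mono) auto
  then show "A * ((?a * \<epsilon>)^2 + ?b^2 + ?c^2) <= (A * (?a * \<epsilon> + (?b + ?c)))^2" by (simp only: power_mult_distrib[of A])
 qed
 also have "A * (?a * \<epsilon> + (?b + ?c)) = error_bound K A \<eta> q \<sigma> m n \<epsilon> M" unfolding error_bound_def distrib_right ..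
 finally show ?thesis .
qed

lemma stability_error_le:
 fixes r \<sigma> :: real
 assumes r: "0 < r" and \<sigma>: "0 < \<sigma>"
 obtains K A \<eta> where "1 <= K" "1 <= A" "0 < \<eta>"
  "\<And>(v :: 'a::euclidean_space => complex) \<nu> m n \<epsilon> M. ball_function v \<sigma> ==> 0 <= \<nu> ==> m = \<nu> + (real DIM('a) - 1) / 2 ==> 0 <= m ==> 0 <= \<epsilon> ==> 0 <= M ==>
   (hmass \<nu> (ft v)) <= ennreal (M^2) ==>
   (wint (\<lambda>p. ind (cball 0 r) p * ennreal ((cmod (ft v p))^2))) <= ennreal (\<epsilon>^2) ==>
   (wint (\<lambda>q. ennreal ((cmod (ball_function.V v \<sigma> q))^2)))
    <= ennreal ((error_bound K A \<eta> (1 / 2) \<sigma> m n \<epsilon> M)^2)"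
proof -
 show thesis proof (rule low_frequency_le[OF r \<sigma>, where ?'a='a], goal_cases)
 case (1 K A \<eta>)
 note K = 1(1) and A = 1(2) and \<eta> = 1(3) and low = 1(4)
 show thesis proof (rule that[OF K _ \<eta>])
  show "1 <= A + 1" using A by simp
  fix v :: "'a => complex" and \<nu> m \<epsilon> M :: real and n :: nat
  assume B: "ball_function v \<sigma>" and \<nu>: "0 <= \<nu>" and m: "m = \<nu> + (real DIM('a) - 1) / 2" "0 <= m" and \<epsilon>: "0 <= \<epsilon>" and M: "0 <= M"
   and Y: "(hmass \<nu> (ft v)) <= ennreal (M^2)"
   and M1: "(wint (\<lambda>p. ind (cball 0 r) p * ennreal ((cmod (ft v p))^2))) <= ennreal (\<epsilon>^2)" (is "?M1 <= _")
  interpret ball_function v \<sigma> by (rule B)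
  let ?S = "\<eta> * (real n + 1)"
  have S: "0 < ?S" using \<eta> by simp
  let ?w = "\<lambda>q::'a. ennreal (norm q powi (1 - int DIM('a)))"
  let ?Lo = "\<lambda>q. ?w q * (ind {q. norm q <= ?S} q * ennreal ((cmod (V q))^2))"
  let ?Hi = "\<lambda>q. ?w q * (ind {q. ?S < norm q} q * ennreal ((cmod (V q))^2))"
  let ?a = "ennreal ((K ^ (n + 1) * (real n + 1) ^ n)^2) * ?M1 + ennreal (((real n + 1) * (1 / 2) ^ (n + 1) * M)^2)"
  have "(\<integral>\<^sup>+q. ?w q * ennreal ((cmod (V q))^2) \<partial>lborel) = (\<integral>\<^sup>+q. ?Lo q + ?Hi q \<partial>lborel)"
   by (intro nn_integral_cong) (auto simp: indicator_def)
  also have "... = (\<integral>\<^sup>+q. ?Lo q \<partial>lborel) + (\<integral>\<^sup>+q. ?Hi q \<partial>lborel)"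
   by (rule nn_integral_add) measurable
  also have "... <= ennreal A * ?a + 1 * (\<integral>\<^sup>+q. ?Hi q \<partial>lborel)"
   using low[OF B M ft_mass_le[OF \<nu> Y], of n] by (intro add_mono) auto
  also have "... <= ennreal (A + 1) * ?a + ennreal (A + 1) * (\<integral>\<^sup>+q. ?Hi q \<partial>lborel)"
   using A by (intro add_mono mult_right_mono ennreal_leI) auto
  also have "... = ennreal (A + 1) * (?a + (\<integral>\<^sup>+q. ?Hi q \<partial>lborel))" by (rule distrib_left[symmetric])
  also have "... <= ennreal ((error_bound K (A + 1) \<eta> (1 / 2) \<sigma> m n \<epsilon> M)^2)"
   by (rule sum_squares_le_error_bound[OF K _ _ _ \<epsilon> M M1 high_frequency_le[OF S m \<nu> Y]]) (use A \<sigma> in auto)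
  finally show "(\<integral>\<^sup>+q. ?w q * ennreal ((cmod (V q))^2) \<partial>lborel) <= ennreal ((error_bound K (A + 1) \<eta> (1 / 2) \<sigma> m n \<epsilon> M)^2)" .
 qed
 qed
qed

lemma reconstruction_error_le:
 fixes r \<sigma> c :: real
 assumes r: "0 < r" and \<sigma>: "0 < \<sigma>" and crs: "c = r * \<sigma>"
 obtains K A \<eta> q where "1 <= K" "1 <= A" "0 < \<eta>" "0 < q" "q < 1"
  "\<And>\<psi> ev (v :: 'a::euclidean_space => complex) w \<nu> m n \<epsilon> M. ball_data c \<psi> ev v \<sigma> r w ==> 1 <= n ==>
   0 <= \<nu> ==> m = \<nu> + (real DIM('a) - 1) / 2 ==> 0 <= m ==> 0 <= \<epsilon> ==> 0 <= M ==>
   (hmass \<nu> (ft v)) <= ennreal (M^2) ==>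
   (wint (\<lambda>p. ind (cball 0 r) p * ennreal ((cmod (ball_data.D v w p))^2))) <= ennreal (\<epsilon>^2) ==>
   (wint (\<lambda>q. ennreal ((cmod (ball_data.W \<psi> ev v \<sigma> r w n q))^2)))
    <= ennreal ((error_bound K A \<eta> q \<sigma> m n \<epsilon> M)^2)"
proof -
 have c: "0 < c" using r \<sigma> crs by simp
 show thesis proof (rule pswf_G_decay[OF c], rule pswf_ev_lower[OF c], rule ft_sup_bound[OF \<sigma>, where ?'a='a], goal_cases)
 case (1 C \<eta> q K C0)
 note C = 1(1) and \<eta> = 1(2) and q = 1(3,4) and decay = 1(5) and K = 1(6) and lower = 1(7) and C0 = 1(8) and sup = 1(9)
 define e where "e = measure lborel (cball (0::'a) 1)"
 have e: "emeasure lborel (cball (0::'a) 1) = ennreal e" "0 <= e"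
  unfolding e_def using emeasure_lborel_cball_finite[of "0::'a" 1] by (auto intro!: emeasure_eq_ennreal_measure)
 let ?d = "real DIM('a)"
 (* The coefficients of noise, low frequencies and high frequencies. *)
 define A1 where "A1 = ((2 * pi) ^ DIM('a))^2 * (2 / (r * ?d))"
 define A2 where "A2 = e * (2 * \<eta> * (C / (1 - q)) * sqrt C0)^2"
 define A3 where "A3 = 2 / ?d"
 define A where "A = 1 + ?d * (2 * pi * (A1 + A2 + A3))"
 have An: "0 <= A1" "0 <= A2" "0 <= A3" using r e by (auto simp: A1_def A2_def A3_def)
 have A: "1 <= A" using An by (simp add: A_def)
 show thesis proof (rule that[OF K A \<eta> q])
  fix \<psi> ev and v :: "'a => complex" and w :: "'a => complex" and \<nu> m \<epsilon> M :: real and n :: nat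
  assume B: "ball_data c \<psi> ev v \<sigma> r w" and n: "1 <= n"
   and \<nu>: "0 <= \<nu>" and m: "m = \<nu> + (real DIM('a) - 1) / 2" "0 <= m" and \<epsilon>: "0 <= \<epsilon>" and M: "0 <= M"
   and Y: "(hmass \<nu> (ft v)) <= ennreal (M^2)"
   and M1: "(wint (\<lambda>p. ind (cball 0 r) p * ennreal ((cmod (ball_data.D v w p))^2))) <= ennreal (\<epsilon>^2)" (is "?M1 <= _")
  interpret ball_data c \<psi> ev v \<sigma> r w by (rule B)
  have P: "pswf c \<psi> ev" by unfold_locales
  let ?n = "real n + 1"
  let ?S = "\<eta> * ?n"
  let ?\<rho> = "C / (1 - q) * q ^ (n + 1)"
  let ?Vm = "sqrt C0 * M"
  let ?amp = "K ^ (n + 1) * ?n ^ n"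
  have S: "0 < ?S" using \<eta> by simp
  have Vm: "cmod (V p) <= ?Vm" for p proof -
   have "ennreal ((cmod (V p))^2) <= ennreal C0 * (l2mass (ft v))"
    unfolding V_def by (rule sup[OF v supp])
   also have "... <= ennreal C0 * ennreal (M^2)" by (intro mult_left_mono ft_mass_le[OF \<nu> Y]) simp
   also have "... = ennreal (?Vm^2)" using C0 by (simp add: ennreal_mult power_mult_distrib)
   finally have "(cmod (V p))^2 <= ?Vm^2" by simp
   then show ?thesis by (rule power2_le_imp_le) (use C0 M in simp)
  qed
  have \<rho>: "(\<Sum>j\<in>J. cmod (G j s)) <= ?\<rho>" if J: "finite J" "J \<subseteq> {n<..}" and s: "\<bar>s\<bar> <= ?S" for J s proof -
   have "(\<Sum>j\<in>J. cmod (G j s)) <= (\<Sum>j\<in>J. C * q ^ j)" proof (intro sum_mono decay[OF P])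
    fix j assume "j \<in> J"
    then have j: "n < j" using J by auto
    then show "2 <= j" using n by simp
    have "?S <= \<eta> * real j" using j \<eta> by (intro mult_left_mono) auto
    with s show "\<bar>s\<bar> <= \<eta> * real j" by simp
   qed
   also have "... = C * (\<Sum>j\<in>J. q ^ j)" by (simp only: sum_distrib_left)
   also have "(\<Sum>j\<in>J. q ^ j) <= q ^ (n + 1) / (1 - q)" proof -
    obtain N where N: "J \<subseteq> {..<N}" using J(1) finite_nat_iff_bounded by blast
    have "(\<Sum>j\<in>J. q ^ j) <= (\<Sum>j\<in>{n + 1..<n + 1 + N}. q ^ j)" proof (rule sum_mono2)
     show "J \<subseteq> {n + 1..<n + 1 + N}" proof
      fix j assume "j \<in> J"
      then have "j \<in> {n<..}" "j \<in> {..<N}" using J(2) N by blast+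
      then show "j \<in> {n + 1..<n + 1 + N}" by simp
     qed
    qed (use q in auto)
    also have "... = q ^ (n + 1) * (\<Sum>j<N. q ^ j)" using sum.shift_bounds_nat_ivl[of "\<lambda>j. q ^ j" 0 "n + 1" N]
     by (simp add: sum_distrib_left lessThan_atLeast0 power_add mult_ac add.commute)
    also have "... <= q ^ (n + 1) * (1 / (1 - q))" proof (intro mult_left_mono)
     have "(\<Sum>j<N. q ^ j) = (1 - q ^ N) / (1 - q)" using q by (intro sum_gp_strict[THEN trans]) simp
     also have "... <= 1 / (1 - q)" using q by (intro divide_right_mono) auto
     finally show "(\<Sum>j<N. q ^ j) <= 1 / (1 - q)" .
    qed (use q in simp)
    finally show ?thesis by simp
   qed
   finally show ?thesis using C by (simp add: mult_left_mono)
  qed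
  let ?W = "wint (\<lambda>q. ennreal ((cmod (W n q))^2))"
  let ?M2 = "wint (\<lambda>q. ind {q. ?S < norm q} q * ennreal ((cmod (V q))^2))"
  let ?b = "?n * q ^ (n + 1) * M"
  have r0: "0 <= ?\<rho>" using C q by simp
  have main: "ennreal (1 / ?d) * ?W <= ennreal (2 * pi) * (ennreal (((2 * pi) ^ DIM('a) / cmod (ev n))^2) * (ennreal (2 / (r * ?d)) * ?M1)
    + (emeasure lborel (cball (0::'a) 1) * ennreal ((2 * ?S * ?\<rho> * ?Vm)^2) + ennreal (2 / ?d) * ?M2))"
   by (rule integrated_error_le[OF less_imp_le[OF S] r0 \<rho> _ Vm]) (use C0 M in auto)
  have T1: "ennreal (((2 * pi) ^ DIM('a) / cmod (ev n))^2) * (ennreal (2 / (r * ?d)) * ?M1) <= ennreal (A1 + A2 + A3) * (ennreal (?amp^2) * ?M1)"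
  proof -
   have "((2 * pi) ^ DIM('a) / cmod (ev n))^2 = ((2 * pi) ^ DIM('a))^2 * (1 / cmod (ev n))^2" by (simp add: power_divide)
   also have "... <= ((2 * pi) ^ DIM('a))^2 * ?amp^2" by (intro mult_left_mono power_mono lower[OF P]) auto
   finally have "((2 * pi) ^ DIM('a) / cmod (ev n))^2 * (2 / (r * ?d)) <= ((2 * pi) ^ DIM('a))^2 * ?amp^2 * (2 / (r * ?d))"
    using r by (intro mult_right_mono) auto
   also have "... = A1 * ?amp^2" by (simp only: A1_def mult_ac)
   also have "... <= (A1 + A2 + A3) * ?amp^2" using An by (intro mult_right_mono) auto
   finally have "ennreal (((2 * pi) ^ DIM('a) / cmod (ev n))^2 * (2 / (r * ?d))) <= ennreal ((A1 + A2 + A3) * ?amp^2)" by (rule ennreal_leI)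
   then have "ennreal (((2 * pi) ^ DIM('a) / cmod (ev n))^2) * ennreal (2 / (r * ?d)) <= ennreal (A1 + A2 + A3) * ennreal (?amp^2)"
    using r An by (simp only: ennreal_mult[symmetric] zero_le_power2 add_nonneg_nonneg) (simp add: ennreal_mult'[symmetric] ennreal_mult''[symmetric])
   then have "(ennreal (((2 * pi) ^ DIM('a) / cmod (ev n))^2) * ennreal (2 / (r * ?d))) * ?M1 <= (ennreal (A1 + A2 + A3) * ennreal (?amp^2)) * ?M1"
    by (rule mult_right_mono) simp
   then show ?thesis by (simp only: mult.assoc)
  qed
  have T2: "emeasure lborel (cball (0::'a) 1) * ennreal ((2 * ?S * ?\<rho> * ?Vm)^2) <= ennreal (A1 + A2 + A3) * ennreal (?b^2)"
  proof -
   let ?k = "2 * \<eta> * (C / (1 - q)) * sqrt C0"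
   have k: "2 * ?S * ?\<rho> * ?Vm = ?k * ?b" by (simp only: mult_ac)
   have "e * (2 * ?S * ?\<rho> * ?Vm)^2 = e * (?k^2 * ?b^2)" unfolding k power_mult_distrib[of ?k ?b] ..
   also have "... = A2 * ?b^2" by (simp only: A2_def mult.assoc)
   also have "... <= (A1 + A2 + A3) * ?b^2" using An by (intro mult_right_mono) auto
   finally have "ennreal (e * (2 * ?S * ?\<rho> * ?Vm)^2) <= ennreal ((A1 + A2 + A3) * ?b^2)" by (rule ennreal_leI)
   moreover have "ennreal ((A1 + A2 + A3) * ?b^2) = ennreal (A1 + A2 + A3) * ennreal (?b^2)" using An by (intro ennreal_mult) auto
   moreover have "ennreal (e * (2 * ?S * ?\<rho> * ?Vm)^2) = ennreal e * ennreal ((2 * ?S * ?\<rho> * ?Vm)^2)" using e by (intro ennreal_mult) auto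
   ultimately show ?thesis unfolding e(1) by (simp only:)
  qed
  have T3: "ennreal (2 / ?d) * ?M2 <= ennreal (A1 + A2 + A3) * ?M2" using An by (intro mult_right_mono ennreal_leI) (auto simp: A3_def)
  let ?a = "ennreal (?amp^2) * ?M1 + ennreal (?b^2) + ?M2"
  have "ennreal (1 / ?d) * ?W <= ennreal (2 * pi) * (ennreal (A1 + A2 + A3) * ?a)" proof (rule order_trans[OF main mult_left_mono])
   show "ennreal (((2 * pi) ^ DIM('a) / cmod (ev n))^2) * (ennreal (2 / (r * ?d)) * ?M1)
    + (emeasure lborel (cball (0::'a) 1) * ennreal ((2 * ?S * ?\<rho> * ?Vm)^2) + ennreal (2 / ?d) * ?M2) <= ennreal (A1 + A2 + A3) * ?a"
   proof -
    have "ennreal (A1 + A2 + A3) * ?a = ennreal (A1 + A2 + A3) * (ennreal (?amp^2) * ?M1)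
      + (ennreal (A1 + A2 + A3) * ennreal (?b^2) + ennreal (A1 + A2 + A3) * ?M2)" by (simp only: distrib_left add.assoc)
    then show ?thesis by (simp only:) (intro add_mono T1 T2 T3)
   qed
  qed simp
  then have "ennreal ?d * (ennreal (1 / ?d) * ?W) <= ennreal ?d * (ennreal (2 * pi) * (ennreal (A1 + A2 + A3) * ?a))"
   by (rule mult_left_mono) simp
  also have "ennreal ?d * (ennreal (1 / ?d) * ?W) = ?W" proof -
   have d: "ennreal ?d * ennreal (1 / ?d) = 1" by (simp add: ennreal_mult[symmetric])
   show ?thesis by (simp only: mult.assoc[symmetric] d mult_1_left)
  qed
  also have "ennreal ?d * (ennreal (2 * pi) * (ennreal (A1 + A2 + A3) * ?a)) = ennreal (?d * (2 * pi * (A1 + A2 + A3))) * ?a" proof -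
   have "ennreal (?d * (2 * pi * (A1 + A2 + A3))) = ennreal ?d * (ennreal (2 * pi) * ennreal (A1 + A2 + A3))"
    using An by (subst ennreal_mult[symmetric], simp, simp)+ simp
   then show ?thesis by (simp only: mult.assoc)
  qed
  also have "... <= ennreal A * ?a" by (intro mult_right_mono ennreal_leI) (auto simp: A_def)
  also have "... <= ennreal ((error_bound K A \<eta> q \<sigma> m n \<epsilon> M)^2)"
   by (rule sum_squares_le_error_bound[OF K A _ _ \<epsilon> M M1 high_frequency_le[OF S m \<nu> Y]]) (use q \<sigma> in auto)
  finally show "?W <= ennreal ((error_bound K A \<eta> q \<sigma> m n \<epsilon> M)^2)" .
 qed
 qed
qed

text \<open>
 The first function depends on $\beta$ only and the second on $m$ and $\mu$ only, which is the
 dependence that the constants of the theorem may have.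
\<close>

lemma error_bound_asymptotics:
 fixes c \<sigma> \<alpha> \<eta> q :: real
 assumes c: "0 < c" and \<sigma>: "0 < \<sigma>" and \<alpha>: "0 < \<alpha>" and K: "1 <= K" and A: "1 <= A" and \<eta>: "0 < \<eta>" and q: "0 < q" "q < 1"
 obtains k1 :: "real => real" and k2 :: "real => real => real"
 where "\<And>\<beta>. 0 < k1 \<beta>" "\<And>m \<mu>. 0 < k2 m \<mu>"
  "\<And>\<beta> m \<mu> \<delta> N M. \<beta> < 1 - \<alpha> ==> 0 < \<mu> ==> \<mu> < m ==> 0 < \<delta> ==> \<delta> < 1 ==> 0 <= N ==> 0 <= M ==>
   error_bound K A \<eta> q \<sigma> m (cutoff_index c \<alpha> \<delta>) (\<delta> * N) M <= k1 \<beta> * N * \<delta> powr \<beta> + k2 m \<mu> * M * ln (1 / \<delta>) powr (- \<mu>)"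
proof -
 have "\<exists>k>0. \<forall>\<delta>. \<beta> < 1 - \<alpha> --> 0 < \<delta> --> \<delta> < 1 -->
   A * (\<delta> * (K ^ (cutoff_index c \<alpha> \<delta> + 1) * (real (cutoff_index c \<alpha> \<delta>) + 1) ^ cutoff_index c \<alpha> \<delta>)) <= k * \<delta> powr \<beta>" for \<beta>
 proof (cases "\<beta> < 1 - \<alpha>")
  case True
  then obtain k where k: "0 < k" "\<And>\<delta>. 0 < \<delta> ==> \<delta> < 1 ==>
   \<delta> * (K ^ (cutoff_index c \<alpha> \<delta> + 1) * (real (cutoff_index c \<alpha> \<delta>) + 1) ^ cutoff_index c \<alpha> \<delta>) <= k * \<delta> powr \<beta>"
   using noise_asymptotics[OF c \<alpha> _ K, of \<beta>] by blast
  show ?thesis by (rule exI[of _ "A * k"]) (use k A in \<open>auto simp: mult.assoc intro!: mult_left_mono\<close>)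
 qed (auto intro: exI[of _ 1])
 then obtain k1 where k1: "\<And>\<beta>. 0 < k1 \<beta>" "\<And>\<beta> \<delta>. \<beta> < 1 - \<alpha> ==> 0 < \<delta> ==> \<delta> < 1 ==>
   A * (\<delta> * (K ^ (cutoff_index c \<alpha> \<delta> + 1) * (real (cutoff_index c \<alpha> \<delta>) + 1) ^ cutoff_index c \<alpha> \<delta>)) <= k1 \<beta> * \<delta> powr \<beta>"
  by metis
 define P where "P m \<mu> k \<longleftrightarrow> 0 < k \<and> (\<forall>\<delta>. 0 < \<mu> --> \<mu> < m --> 0 < \<delta> --> \<delta> < 1 -->
   A * ((real (cutoff_index c \<alpha> \<delta>) + 1) * q ^ (cutoff_index c \<alpha> \<delta> + 1) + sqrt \<sigma> * (\<eta> * (real (cutoff_index c \<alpha> \<delta>) + 1) / \<sigma>) powr (- m))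
    <= k * ln (1 / \<delta>) powr (- \<mu>))" for m \<mu> k
 have ex: "\<exists>k. P m \<mu> k" for m \<mu> proof (cases "0 < \<mu> \<and> \<mu> < m")
  case True
  obtain p where p: "0 < p" "\<And>n::nat. 1 <= n ==> real n powr (1 + m) * q ^ n <= p"
   using powr_times_power_bounded[OF q, of "1 + m"] by blast
  obtain k where k: "0 < k" "\<And>\<delta>. 0 < \<delta> ==> \<delta> < 1 ==> (real (cutoff_index c \<alpha> \<delta>) + 1) powr (- m) <= k * ln (1 / \<delta>) powr (- \<mu>)"
   using cutoff_index_powr_le[OF c \<alpha>, of \<mu> m] True by blast
  define B where "B = p + sqrt \<sigma> * (\<eta> / \<sigma>) powr (- m)"
  have B: "0 < B" using p by (simp add: B_def add_pos_nonneg \<sigma> less_imp_le)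
  show ?thesis unfolding P_def proof (intro exI[of _ "A * (B * k)"] conjI allI impI)
   show "0 < A * (B * k)" using A B k by simp
   fix \<delta> :: real assume \<delta>: "0 < \<delta>" "\<delta> < 1"
   let ?n = "cutoff_index c \<alpha> \<delta>"
   have n: "0 < real ?n + 1" by simp
   have "(real ?n + 1) * q ^ (?n + 1) = real (?n + 1) powr (1 + m) * q ^ (?n + 1) * (real ?n + 1) powr (- m)" proof -
    have n1: "real (?n + 1) = real ?n + 1" by simp
    have e: "(real ?n + 1) powr (1 + m) * (real ?n + 1) powr (- m) = real ?n + 1" by (simp add: powr_add[symmetric])
    have "real (?n + 1) powr (1 + m) * q ^ (?n + 1) * (real ?n + 1) powr (- m)
     = ((real ?n + 1) powr (1 + m) * (real ?n + 1) powr (- m)) * q ^ (?n + 1)" unfolding n1 by (simp only: mult_ac)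
    then show ?thesis unfolding e by (rule sym)
   qed
   also have "... <= p * (real ?n + 1) powr (- m)" by (intro mult_right_mono p(2)) auto
   finally have 1: "(real ?n + 1) * q ^ (?n + 1) <= p * (real ?n + 1) powr (- m)" .
   have 2: "sqrt \<sigma> * (\<eta> * (real ?n + 1) / \<sigma>) powr (- m) = sqrt \<sigma> * (\<eta> / \<sigma>) powr (- m) * (real ?n + 1) powr (- m)"
   proof -
    have "(\<eta> * (real ?n + 1) / \<sigma>) powr (- m) = ((\<eta> / \<sigma>) * (real ?n + 1)) powr (- m)" by simp
    also have "... = (\<eta> / \<sigma>) powr (- m) * (real ?n + 1) powr (- m)" by (rule powr_mult)
    finally show ?thesis by (simp only: mult.assoc)
   qed
   have "(real ?n + 1) * q ^ (?n + 1) + sqrt \<sigma> * (\<eta> * (real ?n + 1) / \<sigma>) powr (- m) <= B * (real ?n + 1) powr (- m)" proof -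
    have "B * (real ?n + 1) powr (- m) = p * (real ?n + 1) powr (- m) + sqrt \<sigma> * (\<eta> / \<sigma>) powr (- m) * (real ?n + 1) powr (- m)"
     unfolding B_def by (rule distrib_right)
    with 1 2 show ?thesis by linarith
   qed
   also have "... <= B * (k * ln (1 / \<delta>) powr (- \<mu>))" using B k(2)[OF \<delta>] by (intro mult_left_mono) auto
   finally show "A * ((real ?n + 1) * q ^ (?n + 1) + sqrt \<sigma> * (\<eta> * (real ?n + 1) / \<sigma>) powr (- m)) <= A * (B * k) * ln (1 / \<delta>) powr (- \<mu>)"
    using A by (simp add: mult.assoc mult_left_mono)
  qed
 qed (auto simp: P_def intro: exI[of _ 1])
 define k2 where "k2 m \<mu> = (SOME k. P m \<mu> k)" for m \<mu>
 have "P m \<mu> (k2 m \<mu>)" for m \<mu> unfolding k2_def by (rule someI_ex[OF ex])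
 then have k2: "\<And>m \<mu>. 0 < k2 m \<mu>" "\<And>m \<mu> \<delta>. 0 < \<mu> ==> \<mu> < m ==> 0 < \<delta> ==> \<delta> < 1 ==>
   A * ((real (cutoff_index c \<alpha> \<delta>) + 1) * q ^ (cutoff_index c \<alpha> \<delta> + 1) + sqrt \<sigma> * (\<eta> * (real (cutoff_index c \<alpha> \<delta>) + 1) / \<sigma>) powr (- m))
    <= k2 m \<mu> * ln (1 / \<delta>) powr (- \<mu>)" unfolding P_def by blast+
 show thesis proof (rule that[of k1 k2])
  show "0 < k1 \<beta>" "0 < k2 m \<mu>" for \<beta> m \<mu> by (rule k1(1), rule k2(1))
  fix \<beta> m \<mu> \<delta> N M :: real
  assume \<beta>: "\<beta> < 1 - \<alpha>" and \<mu>: "0 < \<mu>" "\<mu> < m" and \<delta>: "0 < \<delta>" "\<delta> < 1" and N: "0 <= N" and M: "0 <= M"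
  let ?n = "cutoff_index c \<alpha> \<delta>"
  have "error_bound K A \<eta> q \<sigma> m ?n (\<delta> * N) M = A * (\<delta> * (K ^ (?n + 1) * (real ?n + 1) ^ ?n)) * N
   + A * ((real ?n + 1) * q ^ (?n + 1) + sqrt \<sigma> * (\<eta> * (real ?n + 1) / \<sigma>) powr (- m)) * M" proof -
   have "A * (a * (\<delta> * N) + s * M) = A * (\<delta> * a) * N + A * s * M" for a s by (simp add: algebra_simps)
   then show ?thesis unfolding error_bound_def .
  qed
  also have "... <= (k1 \<beta> * \<delta> powr \<beta>) * N + (k2 m \<mu> * ln (1 / \<delta>) powr (- \<mu>)) * M"
   by (intro add_mono mult_right_mono k1(2)[OF \<beta> \<delta>] k2(2)[OF \<mu> \<delta>] N M)
  finally show "error_bound K A \<eta> q \<sigma> m ?n (\<delta> * N) M <= k1 \<beta> * N * \<delta> powr \<beta> + k2 m \<mu> * M * ln (1 / \<delta>) powr (- \<mu>)"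
   by (simp only: mult_ac)
 qed
qed

section \<open>Borel representatives\<close>

lemma lebesgue_measurable_AE:
 fixes g g0 :: "'a::euclidean_space => 'b::topological_space"
 assumes g: "g \<in> borel_measurable lebesgue" and ae: "AE x in lebesgue. g0 x = g x"
 shows "g0 \<in> borel_measurable lebesgue"
proof (rule borel_measurableI)
 fix U :: "'b set" assume U: "open U"
 let ?D = "{x. g0 x \<noteq> g x}"
 obtain N where N: "{x \<in> space lebesgue. \<not> g0 x = g x} \<subseteq> N" "emeasure lebesgue N = 0" "N \<in> sets lebesgue"
  using ae by (rule AE_E)
 then have "negligible N" by (simp add: negligible_iff_null_sets null_setsI)
 moreover have "?D \<subseteq> N" using N(1) by auto
 ultimately have D: "A \<in> sets lebesgue" if "A \<subseteq> ?D" for A using that negligible_subset[of N A] by (auto simp: negligible_iff_null_sets)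
 have gU: "g -` U \<in> sets lebesgue" using measurable_sets[OF g borel_open[OF U]] by simp
 have "g0 -` U \<inter> space lebesgue = (g -` U - ?D) \<union> (g0 -` U \<inter> ?D)" by auto
 also have "... \<in> sets lebesgue" by (intro sets.Un sets.Diff gU D) auto
 finally show "g0 -` U \<inter> space lebesgue \<in> sets lebesgue" .
qed

text \<open>
 Null sets are invisible to integrals, and completeness makes every function that agrees almost
 everywhere with a Borel function measurable. All analysis can therefore be done with Borel functions
 and Borel measures.
\<close>

lemma lebesgue_on_borel:
 fixes f f0 :: "'a::euclidean_space => 'b::{banach, second_countable_topology}"
 assumes S[measurable]: "S \<in> sets borel" and f[measurable]: "f \<in> bm"
  and ae: "AE x in lborel. x \<in> S --> f0 x = f x"
 shows "f0 \<in> borel_measurable (lebesgue_on S)"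
  and "integrable (lebesgue_on S) f0 \<longleftrightarrow> integrable lborel (\<lambda>x. ind S x *\<^sub>R f x)"
  and "(LINT x|lebesgue_on S. f0 x) = (LINT x|lborel. ind S x *\<^sub>R f x)"
proof -
 let ?g = "\<lambda>x. ind S x *\<^sub>R f x" and ?h = "\<lambda>x. ind S x *\<^sub>R f0 x"
 have S': "S \<inter> space lebesgue \<in> sets lebesgue" using S by simp
 have g: "?g \<in> bm" by measurable
 then have gl: "?g \<in> borel_measurable lebesgue" by (intro measurable_completion) simp
 have ae': "AE x in lebesgue. ?h x = ?g x" using AE_completion[OF ae] by eventually_elim (auto simp: indicator_def)
 have g0: "?h \<in> borel_measurable lebesgue" by (rule lebesgue_measurable_AE[OF gl ae'])
 then show "f0 \<in> borel_measurable (lebesgue_on S)" by (simp add: borel_measurable_restrict_space_iff[OF S'])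
 have "integrable (lebesgue_on S) f0 \<longleftrightarrow> integrable lebesgue ?h" by (rule integrable_restrict_space[OF S'])
 also have "... \<longleftrightarrow> integrable lebesgue ?g" by (rule integrable_cong_AE[OF g0 gl ae'])
 also have "... \<longleftrightarrow> integrable lborel ?g" using g by (intro integrable_completion) simp
 finally show "integrable (lebesgue_on S) f0 \<longleftrightarrow> integrable lborel ?g" .
 have "(LINT x|lebesgue_on S. f0 x) = (LINT x|lebesgue. ?h x)" by (rule integral_restrict_space[OF S'])
 also have "... = (LINT x|lebesgue. ?g x)" by (rule integral_cong_AE[OF g0 gl ae'])
 also have "... = (LINT x|lborel. ?g x)" using g by (intro integral_completion) simp
 finally show "(LINT x|lebesgue_on S. f0 x) = (LINT x|lborel. ?g x)" .
qed

lemma lebesgue_borel: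
 fixes f f0 :: "'a::euclidean_space => 'b::{banach, second_countable_topology}"
 assumes f: "f \<in> bm" and ae: "AE x in lborel. f0 x = f x"
 shows "f0 \<in> borel_measurable lebesgue"
  and "integrable lebesgue f0 \<longleftrightarrow> integrable lborel f"
  and "(LINT x|lebesgue. f0 x) = (LINT x|lborel. f x)" using lebesgue_on_borel[of UNIV f f0] f ae by (simp_all add: lebesgue_on_UNIV_eq)

lemma AE_lebesgue_on_iff:
 assumes "S \<in> sets borel"
 shows "(AE x in lebesgue_on S. P x) \<longleftrightarrow> (AE x in lborel. x \<in> S --> P x)"
 using assms by (subst AE_restrict_space_iff) (auto simp: AE_completion_iff)

lemma lebesgue_on_ex_borel:
 fixes g0 :: "'a::euclidean_space => complex"
 assumes S: "S \<in> sets borel" and g0: "g0 \<in> borel_measurable (lebesgue_on S)"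
 obtains g where "g \<in> bm" "AE x in lborel. x \<in> S --> g0 x = g x"
proof -
 have "(\<lambda>x. ind S x *\<^sub>R g0 x) \<in> borel_measurable lebesgue" using g0 S by (subst (asm) borel_measurable_restrict_space_iff) auto
 then obtain g where g: "g \<in> bm" "AE x in lborel. ind S x *\<^sub>R g0 x = g x" by (rule lebesgue_ex_borel)
 show thesis by (rule that[OF g(1)]) (use g(2) in \<open>eventually_elim, auto\<close>)
qed

lemma lebesgue_on_I1:
 fixes f f0 :: "real => 'b::{banach, second_countable_topology}"
 assumes f: "f \<in> bm" and ae: "AE x in lborel. x \<in> {-1..1} --> f0 x = f x"
 shows "f0 \<in> borel_measurable (lebesgue_on {-1..1})"
  and "integrable (lebesgue_on {-1..1}) f0 \<longleftrightarrow> integrable I1 f"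
  and "(LINT x|lebesgue_on {-1..1}. f0 x) = (LINT x|I1. f x)"
proof -
 have "{-1..1::real} \<in> sets borel" by simp
 note * = lebesgue_on_borel[OF this f ae]
 show "f0 \<in> borel_measurable (lebesgue_on {-1..1})" by (rule *(1))
 show "integrable (lebesgue_on {-1..1}) f0 \<longleftrightarrow> integrable I1 f" unfolding *(2) by (rule integrable_restrict_space[symmetric]) simp
 show "(LINT x|lebesgue_on {-1..1}. f0 x) = (LINT x|I1. f x)" unfolding *(3) by (rule integral_restrict_space[symmetric]) simp
qed

text \<open>A nonempty open set is not negligible.\<close>

lemma continuous_AE_zero:
 fixes f :: "real => real"
 assumes f: "continuous_on UNIV f" and ae: "AE x in lborel. x \<in> {-1..1} --> f x = 0" and x: "x \<in> {-1..1}"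
 shows "f x = 0"
proof -
 have fc: "isCont f x" for x using f by (simp add: continuous_on_eq_continuous_at)
 let ?U = "{-1<..<1} \<inter> f -` (- {0})"
 have U: "open ?U" by (intro open_Int open_greaterThanLessThan continuous_open_vimage) (auto simp: fc)
 have "AE x in lebesgue. x \<notin> ?U" using AE_completion[OF ae] by eventually_elim auto
 then have "?U \<in> null_sets lebesgue" using U by (subst AE_iff_null_sets) (auto intro: borel_open)
 then have "?U = {}" using open_not_negligible[OF U] by (auto simp: negligible_iff_null_sets)
 then have "{-1<..<1} \<subseteq> f -` {0}" by auto
 moreover have "closed (f -` {0})" by (intro continuous_closed_vimage) (auto simp: fc)
 ultimately have "closure {-1<..<1} \<subseteq> f -` {0}" by (rule closure_minimal)
 moreover have "closure {-1<..<1::real} = {-1..1}" by (rule closure_greaterThanLessThan) simp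
 ultimately show ?thesis using x by auto
qed

lemma continuous_fourier_I1:
 fixes f :: "real => complex"
 assumes f: "integrable I1 f"
 shows "continuous_on UNIV (\<lambda>s. LINT y|I1. cis (s * y) * f y)"
proof (rule lipschitz_on_continuous_on)
 have [measurable]: "(\<lambda>y. y) \<in> borel_measurable I1" by (rule measurable_I1) simp
 have i: "integrable I1 (\<lambda>y. cis (s * y) * f y)" for s by (rule integrable_cis_mult(1)[OF f]) measurable
 show "(LINT y|I1. cmod (f y))-lipschitz_on UNIV (\<lambda>s. LINT y|I1. cis (s * y) * f y)" proof (rule lipschitz_onI)
  fix s t :: real
  have "(LINT y|I1. cis (s * y) * f y) - (LINT y|I1. cis (t * y) * f y) = (LINT y|I1. cis (s * y) * f y - cis (t * y) * f y)"
   by (rule L_integral_diff[symmetric, OF i i])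
  also have "cmod ... <= (LINT y|I1. \<bar>s - t\<bar> * cmod (f y))" proof (rule L_integral_norm_bound_integral)
   show "integrable I1 (\<lambda>y. cis (s * y) * f y - cis (t * y) * f y)" by (intro L_integrable_diff i)
   show "integrable I1 (\<lambda>y. \<bar>s - t\<bar> * cmod (f y))" using f by simp
   fix y assume "y \<in> space I1"
   then have y: "\<bar>y\<bar> <= 1" by auto
   have "cmod (cis (s * y) - cis (t * y)) <= \<bar>s * y - t * y\<bar>" by (rule cmod_cis_diff_le)
   also have "... = \<bar>s - t\<bar> * \<bar>y\<bar>" by (simp only: left_diff_distrib[symmetric] abs_mult)
   also have "... <= \<bar>s - t\<bar> * 1" using y by (intro mult_left_mono) auto
   finally show "norm (cis (s * y) * f y - cis (t * y) * f y) <= \<bar>s - t\<bar> * cmod (f y)"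
    by (simp add: left_diff_distrib[symmetric] norm_mult mult_right_mono)
  qed
  also have "... = (LINT y|I1. cmod (f y)) * \<bar>s - t\<bar>" by simp
  finally show "dist (LINT y|I1. cis (s * y) * f y) (LINT y|I1. cis (t * y) * f y) <= (LINT y|I1. cmod (f y)) * dist s t"
   by (simp only: dist_norm real_norm_def)
 qed (simp add: L_integral_nonneg)
qed

text \<open>
 The eigenvalue equation holds almost everywhere only, but its left hand side is continuous. Dividing by
 the eigenvalue gives a continuous representative, real valued because a continuous function that
 vanishes almost everywhere vanishes.
\<close>

lemma pswf_representative:
 fixes \<psi>0 :: "nat => real => real" and ev :: "nat => complex"
 assumes c: "0 < c" and sys: "pswf_system c \<psi>0 ev"
 obtains \<psi> where "pswf c \<psi> ev" "\<And>j. AE x in lborel. x \<in> {-1..1} --> \<psi>0 j x = \<psi> j x"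
proof -
 have S1: "square_integrable {-1..1} (\<lambda>x. cor (\<psi>0 j x))"
  and S2: "(LINT x|lebesgue_on {-1..1}. \<psi>0 j x * \<psi>0 k x) = (if j = k then 1 else 0)"
  and S3: "square_integrable {-1..1} f ==>
    (\<lambda>n. LINT x|lebesgue_on {-1..1}. (cmod (f x - (\<Sum>j<n.
      (LINT y|lebesgue_on {-1..1}. cor (\<psi>0 j y) * f y) * cor (\<psi>0 j x))))^2) \<longlonglongrightarrow> 0"
  and S4: "AE x in lebesgue_on {-1..1}. pswf_op c (\<lambda>y. cor (\<psi>0 j y)) x = ev j * cor (\<psi>0 j x)"
  and S5: "0 < cmod (ev (Suc j)) \<and> cmod (ev (Suc j)) < cmod (ev j)" for j k f using sys unfolding pswf_system_def by blast+
 have I: "{-1..1::real} \<in> sets borel" by simp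
 have "\<exists>g::real => real. g \<in> bm \<and> (AE x in lborel. x \<in> {-1..1} --> \<psi>0 j x = g x)" for j
 proof -
  obtain g where g: "g \<in> bm" "AE x in lborel. x \<in> {-1..1} --> cor (\<psi>0 j x) = g x"
   using lebesgue_on_ex_borel[OF I, of "\<lambda>x. cor (\<psi>0 j x)"] S1[of j] unfolding square_integrable_def by blast
  show ?thesis proof (intro exI conjI)
   show "(\<lambda>x. Re (g x)) \<in> bm" using g(1) by measurable
   show "AE x in lborel. x \<in> {-1..1} --> \<psi>0 j x = Re (g x)" using g(2) by eventually_elim (metis Re_complex_of_real)
  qed
 qed
 then have "\<exists>\<psi>1. \<forall>j. (\<psi>1 j :: real => real) \<in> bm \<and> (AE x in lborel. x \<in> {-1..1} --> \<psi>0 j x = \<psi>1 j x)"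
  by (intro choice allI)
 then obtain \<psi>1 :: "nat => real => real" where \<psi>1[measurable]: "\<And>j. \<psi>1 j \<in> bm"
  and ae1: "\<And>j. AE x in lborel. x \<in> {-1..1} --> \<psi>0 j x = \<psi>1 j x" by blast
 have l2: "l2 (\<lambda>x. cor (\<psi>1 j x))" for j proof -
  have "integrable (lebesgue_on {-1..1}) (\<lambda>x. (cmod (cor (\<psi>0 j x)))^2)" using S1[of j] unfolding square_integrable_def by blast
  moreover have "AE x in lborel. x \<in> {-1..1} --> (cmod (cor (\<psi>0 j x)))\<^sup>2 = (cmod (cor (\<psi>1 j x)))^2"
   using ae1[of j] by eventually_elim simp
  ultimately have "integrable I1 (\<lambda>x. (cmod (cor (\<psi>1 j x)))^2)"
   by (subst (asm) lebesgue_on_I1(2)[of "\<lambda>x. (cmod (cor (\<psi>1 j x)))^2"]) auto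
  then show ?thesis unfolding l2_def by (intro conjI measurable_I1) measurable
 qed
 define G1 where "G1 j s = (LINT y|I1. cis (s * y) * cor (\<psi>1 j y))" for j s
 have G1c: "continuous_on UNIV (G1 j)" for j unfolding G1_def by (rule continuous_fourier_I1[OF l2_integrable[OF l2]])
 have op: "pswf_op c (\<lambda>y. cor (\<psi>0 j y)) x = G1 j (c * x)" for j x unfolding pswf_op_def G1_def
  by (rule lebesgue_on_I1(3)) (measurable, use ae1[of j] in \<open>eventually_elim, simp\<close>)
 have ev0: "0 < cmod (ev j)" for j using S5[of j] norm_ge_zero[of "ev (Suc j)"] by linarith
 define E where "E j x = G1 j (c * x) / ev j" for j x
 have Ec: "continuous_on UNIV (E j)" for j proof -
  have "continuous_on UNIV (\<lambda>x. G1 j (c * x))" by (rule continuous_on_compose2[OF G1c]) (auto intro: continuous_intros)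
  then show ?thesis unfolding E_def[abs_def] using ev0[of j] by (intro continuous_intros) auto
 qed
 have aeE: "AE x in lborel. x \<in> {-1..1} --> E j x = cor (\<psi>0 j x)" for j
  using S4[of j] ev0[of j] unfolding AE_lebesgue_on_iff[OF I] op by (auto elim!: eventually_mono simp: E_def)
 define \<psi> where "\<psi> j x = Re (E j x)" for j x
 have \<psi>c: "continuous_on UNIV (\<psi> j)" for j unfolding \<psi>_def[abs_def] by (intro continuous_intros Ec)
 have [measurable]: "\<psi> j \<in> bm" for j by (rule borel_measurable_continuous_onI[OF \<psi>c])
 have ae: "AE x in lborel. x \<in> {-1..1} --> \<psi>0 j x = \<psi> j x" for j
  using aeE[of j] by eventually_elim (simp add: \<psi>_def)
 have E\<psi>: "E j x = cor (\<psi> j x)" if "x \<in> {-1..1}" for j x proof -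
  have "Im (E j x) = 0" proof (rule continuous_AE_zero[OF _ _ that])
   show "continuous_on UNIV (\<lambda>x. Im (E j x))" by (intro continuous_intros Ec)
   show "AE x in lborel. x \<in> {-1..1} --> Im (E j x) = 0" using aeE[of j] by eventually_elim simp
  qed
  then show ?thesis by (simp add: \<psi>_def complex_eq_iff)
 qed
 have aeall: "AE x in lborel. \<forall>j. x \<in> {-1..1} --> \<psi>0 j x = \<psi> j x" unfolding AE_all_countable using ae by blast
 have "pswf c \<psi> ev" proof
  show "0 < c" by (rule c)
  show "continuous_on UNIV (\<psi> j)" for j by (rule \<psi>c)
  show "0 < cmod (ev j)" for j by (rule ev0)
  show "cmod (ev (Suc j)) < cmod (ev j)" for j using S5 by blast
  show "(LINT x|I1. \<psi> j x * \<psi> k x) = (if j = k then 1 else 0)" for j k unfolding S2[symmetric]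
   by (rule lebesgue_on_I1(3)[symmetric]) (measurable, use aeall in \<open>eventually_elim, simp\<close>)
  show "(LINT y|I1. cis (c * x * y) * cor (\<psi> j y)) = ev j * cor (\<psi> j x)" if x: "x \<in> {-1..1}" for j x proof -
   have "(LINT y|I1. cis (c * x * y) * cor (\<psi> j y)) = pswf_op c (\<lambda>y. cor (\<psi>0 j y)) x" unfolding pswf_op_def
    by (rule lebesgue_on_I1(3)[symmetric]) (measurable, use ae[of j] in \<open>eventually_elim, simp\<close>)
   also have "... = ev j * E j x" unfolding op E_def using ev0[of j] by simp
   finally show ?thesis unfolding E\<psi>[OF x] .
  qed
  show "(\<lambda>n. sq (\<lambda>x. f x - (\<Sum>j<n. (LINT y|I1. cor (\<psi> j y) * f y) * cor (\<psi> j x)))) \<longlonglongrightarrow> 0"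
   if f: "l2 f" for f proof -
   define h where "h x = ind {-1..1} x *\<^sub>R f x" for x
   have [measurable]: "h \<in> bm"
    using l2_measurable[OF f] unfolding h_def[abs_def] by (subst (asm) borel_measurable_restrict_space_iff) auto
   have hf: "h x = f x" if "x \<in> space I1" for x using that by (simp add: h_def)
   have "integrable I1 (\<lambda>x. (cmod (h x))^2)" using l2_square_integrable[OF f] by (subst L_integrable_cong[OF refl]) (auto simp: hf)
   then have "square_integrable {-1..1} h"
    unfolding square_integrable_def using lebesgue_on_I1(1)[of h h] lebesgue_on_I1(2)[of "\<lambda>x. (cmod (h x))^2" "\<lambda>x. (cmod (h x))^2"] by simp
   from S3[OF this] have lim: "(\<lambda>n. LINT x|lebesgue_on {-1..1}. (cmod (h x - (\<Sum>j<n.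
      (LINT y|lebesgue_on {-1..1}. cor (\<psi>0 j y) * h y) * cor (\<psi>0 j x))))^2) \<longlonglongrightarrow> 0" .
   have cf: "(LINT y|lebesgue_on {-1..1}. cor (\<psi>0 j y) * h y) = (LINT y|I1. cor (\<psi> j y) * f y)" for j proof -
    have "(LINT y|lebesgue_on {-1..1}. cor (\<psi>0 j y) * h y) = (LINT y|I1. cor (\<psi> j y) * h y)"
     by (rule lebesgue_on_I1(3)) (measurable, use ae[of j] in \<open>eventually_elim, simp\<close>)
    also have "... = (LINT y|I1. cor (\<psi> j y) * f y)" by (intro L_integral_cong refl) (simp only: hf)
    finally show ?thesis .
   qed
   have "(LINT x|lebesgue_on {-1..1}. (cmod (h x - (\<Sum>j<n. (LINT y|I1. cor (\<psi> j y) * f y) * cor (\<psi>0 j x))))^2)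
    = sq (\<lambda>x. f x - (\<Sum>j<n. (LINT y|I1. cor (\<psi> j y) * f y) * cor (\<psi> j x)))" for n proof -
    have "(LINT x|lebesgue_on {-1..1}. (cmod (h x - (\<Sum>j<n. (LINT y|I1. cor (\<psi> j y) * f y) * cor (\<psi>0 j x))))^2)
     = (LINT x|I1. (cmod (h x - (\<Sum>j<n. (LINT y|I1. cor (\<psi> j y) * f y) * cor (\<psi> j x))))^2)"
     by (rule lebesgue_on_I1(3)) (measurable, use aeall in \<open>eventually_elim, simp\<close>)
    also have "... = sq (\<lambda>x. f x - (\<Sum>j<n. (LINT y|I1. cor (\<psi> j y) * f y) * cor (\<psi> j x)))"
     unfolding sq_def by (intro L_integral_cong refl) (simp only: hf)
    finally show ?thesis .
   qed
   with lim show ?thesis unfolding cf by (simp only:)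
  qed
 qed
 from that[OF this ae] show thesis .
qed

text \<open>
 Only countably many of the open null sets for $v$ are needed to cover the complement of the support
 (Lindelof).
\<close>

lemma ball_representative:
 fixes v0 :: "'a::euclidean_space => complex"
 assumes \<sigma>: "0 < \<sigma>" and sq: "square_integrable UNIV v0" and supp: "ess_support v0 \<subseteq> ball 0 \<sigma>"
 obtains v where "ball_function v \<sigma>" "AE x in lborel. v0 x = v x"
proof -
 have v0: "v0 \<in> borel_measurable lebesgue" "integrable lebesgue (\<lambda>x. (cmod (v0 x))^2)"
  using sq unfolding square_integrable_def lebesgue_on_UNIV_eq by auto
 obtain v1 where [measurable]: "v1 \<in> bm" and v1: "AE x in lborel. v0 x = v1 x" using lebesgue_ex_borel[OF v0(1)] by blast
 define v where "v x = ind (ball 0 \<sigma>) x *\<^sub>R v1 x" for x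
 have [measurable]: "v \<in> bm" unfolding v_def[abs_def] by measurable
 let ?F = "{U. open U \<and> (AE x in lebesgue. x \<in> U --> v0 x = 0)}"
 have "\<And>U. U \<in> ?F ==> open U" by simp
 then obtain F' where F': "F' \<subseteq> ?F" "countable F'" "\<Union>F' = \<Union>?F" using Lindelof[of ?F] by blast
 have "AE x in lebesgue. \<forall>U\<in>F'. x \<in> U --> v0 x = 0" unfolding AE_ball_countable[OF F'(2)] using F'(1) by blast
 then have "AE x in lborel. \<forall>U\<in>F'. x \<in> U --> v0 x = 0" by (simp only: AE_completion_iff)
 with v1 have ae: "AE x in lborel. v0 x = v x" proof eventually_elim
  case (elim x)
  show ?case proof (cases "x \<in> ball 0 \<sigma>")
   case False
   then have "x \<in> \<Union>F'" using supp unfolding ess_support_def F'(3) by blast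
   then have "v0 x = 0" using elim(2) by blast
   then show ?thesis using False by (simp add: v_def)
  qed (use elim(1) in \<open>simp add: v_def\<close>)
 qed
 have "AE x in lborel. (cmod (v0 x))^2 = (cmod (v x))^2" using ae by eventually_elim simp
 then have i2: "integrable lborel (\<lambda>x. (cmod (v x))^2)"
  using v0(2) by (subst (asm) lebesgue_borel(2)[of "\<lambda>x. (cmod (v x))^2"]) auto
 have "ball_function v \<sigma>" proof
  show "0 < \<sigma>" by (rule \<sigma>)
  show "(l2mass v) < \<infinity>" using i2 unfolding integrable_iff_bounded by simp
  show "v x = 0" if "x \<notin> ball 0 \<sigma>" for x using that by (simp add: v_def)
  have "integrable lborel (ind (ball 0 \<sigma>) :: 'a => real)"
   by (rule integrable_real_indicator) (auto simp: emeasure_lborel_ball_finite[unfolded infinity_ennreal_def])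
  then have "integrable lborel (\<lambda>x::'a. ind (ball 0 \<sigma>) x + (cmod (v x))^2)" using i2 by simp
  then show "integrable lborel v" proof (rule L_integrable_bound)
   have "a <= 1 + a^2" if "0 <= a" for a :: real using sum_squares_bound[of a 1] that by simp
   then show "AE x in lborel. norm (v x) <= norm (ind (ball 0 \<sigma>) x + (cmod (v x))^2 :: real)"
    by (intro AE_I2) (auto simp: v_def indicator_def)
  qed simp
 qed
 from that[OF this ae] show thesis .
qed

section \<open>Fourier transforms of distributions\<close>

lemma iter_deriv_add:
 fixes f h :: "'a::euclidean_space => complex"
 assumes f: "schwartz f" and h: "schwartz h" and bs: "set bs \<subseteq> Basis"
 shows "iter_deriv bs (\<lambda>x. f x + h x) = (\<lambda>x. iter_deriv bs f x + iter_deriv bs h x)" using bs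
proof (induction bs)
 case (Cons b bs)
 then have d: "(iter_deriv bs f has_derivative frechet_derivative (iter_deriv bs f) (at x)) (at x)"
  "(iter_deriv bs h has_derivative frechet_derivative (iter_deriv bs h) (at x)) (at x)" for x
  using schwartz_differentiable[OF schwartz_iter_deriv[OF f], of bs x] schwartz_differentiable[OF schwartz_iter_deriv[OF h], of bs x] by (auto simp: frechet_derivative_works)
 have "frechet_derivative (\<lambda>x. iter_deriv bs f x + iter_deriv bs h x) (at x) b
  = frechet_derivative (iter_deriv bs f) (at x) b + frechet_derivative (iter_deriv bs h) (at x) b" for x
  using fun_cong[OF frechet_derivative_at[OF has_derivative_add[OF d(1)[of x] d(2)[of x]]], of b] by simp
 with Cons show ?case by simp
qed simp

lemma iter_deriv_cmult:
 fixes f :: "'a::euclidean_space => complex"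
 assumes f: "schwartz f" and bs: "set bs \<subseteq> Basis"
 shows "iter_deriv bs (\<lambda>x. a * f x) = (\<lambda>x. a * iter_deriv bs f x)" using bs
proof (induction bs)
 case (Cons b bs)
 then have d: "(iter_deriv bs f has_derivative frechet_derivative (iter_deriv bs f) (at x)) (at x)" for x
  using schwartz_differentiable[OF schwartz_iter_deriv[OF f], of bs x] by (auto simp: frechet_derivative_works)
 have "frechet_derivative (\<lambda>x. a * iter_deriv bs f x) (at x) b = a * frechet_derivative (iter_deriv bs f) (at x) b" for x
  using fun_cong[OF frechet_derivative_at[OF has_derivative_mult_right[OF d[of x], of a]], of b] by simp
 with Cons show ?case by simp
qed simp

lemma schwartz_add:
 fixes f h :: "'a::euclidean_space => complex"
 assumes f: "schwartz f" and h: "schwartz h"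
 shows "schwartz (\<lambda>x. f x + h x)" unfolding schwartz_def
proof (intro allI impI conjI)
 fix bs :: "'a list" and k :: nat assume bs: "set bs \<subseteq> Basis"
 show "iter_deriv bs (\<lambda>x. f x + h x) differentiable_on UNIV"
  unfolding iter_deriv_add[OF f h bs] using f h bs unfolding schwartz_def by (intro differentiable_on_add) auto
 show "bounded (range (\<lambda>x. (1 + norm x) ^ k *\<^sub>R iter_deriv bs (\<lambda>x. f x + h x) x))"
  unfolding iter_deriv_add[OF f h bs] scaleR_add_right using f h bs unfolding schwartz_def by (intro bounded_plus_comp) auto
qed

lemma schwartz_cmult:
 fixes f :: "'a::euclidean_space => complex"
 assumes f: "schwartz f"
 shows "schwartz (\<lambda>x. a * f x)" unfolding schwartz_def
proof (intro allI impI conjI)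
 fix bs :: "'a list" and k :: nat assume bs: "set bs \<subseteq> Basis"
 show "iter_deriv bs (\<lambda>x. a * f x) differentiable_on UNIV"
  unfolding iter_deriv_cmult[OF f bs] using f bs unfolding schwartz_def by (intro differentiable_on_mult) auto
 have "bounded (range (\<lambda>x. (1 + norm x) ^ k *\<^sub>R iter_deriv bs f x))" using f bs unfolding schwartz_def by blast
 from bounded_linear_image[OF this bounded_linear_mult_right[of a]]
 show "bounded (range (\<lambda>x. (1 + norm x) ^ k *\<^sub>R iter_deriv bs (\<lambda>x. a * f x) x))"
  unfolding iter_deriv_cmult[OF f bs] by (simp add: image_image)
qed

lemma ft_multiplication:
 fixes f g :: "'a::euclidean_space => complex"
 assumes f: "integrable lborel f" and g: "integrable lborel g"
 shows "(LINT q|lborel. f q * ft g q) = (LINT p|lborel. ft f p * g p)"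
proof -
 have [measurable]: "f \<in> bm" "g \<in> bm" using f g by auto
 have int: "integrable (lborel \<Otimes>\<^sub>M lborel) (\<lambda>(q, p). f q * (cis (q \<bullet> p) * g p))"
  by (rule lborel_pair.integrable_product_bound[where g="\<lambda>q. cmod (f q)" and h="\<lambda>p. cmod (g p)"])
    (use f g in \<open>auto simp: norm_mult\<close>)
 have "(LINT q|lborel. f q * ft g q) = (LINT q|lborel. LINT p|lborel. f q * (cis (q \<bullet> p) * g p))" unfolding ft_def by simp
 also have "... = (LINT p|lborel. LINT q|lborel. f q * (cis (q \<bullet> p) * g p))" using lborel_pair.Fubini_integral[OF int] by simp
 also have "... = (LINT p|lborel. ft f p * g p)" proof (intro L_integral_cong refl)
  fix p
  have "(LINT q|lborel. f q * (cis (q \<bullet> p) * g p)) = (LINT q|lborel. (cis (p \<bullet> q) * f q) * g p)"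
   by (simp only: mult_ac inner_commute)
  then show "(LINT q|lborel. f q * (cis (q \<bullet> p) * g p)) = ft f p * g p" unfolding ft_def by simp
 qed
 finally show ?thesis .
qed

lemma ft_reflect:
 fixes h :: "'a::euclidean_space => complex"
 assumes [measurable]: "h \<in> bm"
 shows "ft h (- q) = ft (\<lambda>p. h (- p)) q" unfolding ft_def by (subst integral_lborel_affine[of _ "-1" 0]) simp_all

context ball_function
begin

abbreviation vhat :: "'a => complex" where
 "vhat p \<equiv> cor (1 / (2 * pi) ^ DIM('a)) * ft v p"

lemma fourier_AE:
 assumes "AE x in lborel. v0 x = v x"
 shows "fourier v0 p = vhat p"
proof -
 have "AE x in lborel. cis (p \<bullet> x) * v0 x = cis (p \<bullet> x) * v x" using assms by eventually_elim simp
 then have "(LINT q|lebesgue. cis (p \<bullet> q) * v0 q) = (LINT q|lborel. cis (p \<bullet> q) * v q)" by (intro lebesgue_borel(3)) measurable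
 then show ?thesis by (simp add: fourier_def ft_def)
qed

lemma dist_of_AE:
 assumes "AE x in lborel. v0 x = v x" and [measurable]: "\<phi> \<in> bm"
 shows "dist_of v0 \<phi> = (LINT q|lborel. v q * \<phi> q)"
proof -
 have "AE x in lborel. v0 x * \<phi> x = v x * \<phi> x" using assms(1) by eventually_elim simp
 then show ?thesis unfolding dist_of_def by (intro lebesgue_borel(3)) measurable
qed

lemma integrable_vhat_mult: 
 assumes h: "integrable lborel h"
 shows "integrable lborel (\<lambda>p. vhat p * h p)"
proof (rule L_integrable_bound)
 let ?B = "1 / (2 * pi) ^ DIM('a) * (LINT q|lborel. cmod (v q))"
 have [measurable]: "h \<in> bm" using h by auto
 show "integrable lborel (\<lambda>p. cor ?B * h p)" using h by simp
 show "(\<lambda>p. vhat p * h p) \<in> borel_measurable lborel" by measurable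
 show "AE p in lborel. norm (vhat p * h p) <= norm (cor ?B * h p)" proof (rule AE_I2)
  fix p
  have "cmod (vhat p) <= ?B" unfolding norm_mult norm_of_real using cmod_ft_le[OF v, of p] by (intro mult_mono) auto
  then have "cmod (vhat p) <= \<bar>?B\<bar>" by linarith
  then show "norm (vhat p * h p) <= norm (cor ?B * h p)" unfolding norm_mult[of _ "h p"] norm_of_real by (rule mult_right_mono) simp
 qed
qed

lemma dist_of_fourier:
 assumes ae: "AE x in lborel. v0 x = v x" and \<phi>: "integrable lborel \<phi>"
 shows "dist_of v0 (fourier \<phi>) = (LINT p|lborel. vhat p * \<phi> p)"
proof -
 let ?k = "cor (1 / (2 * pi) ^ DIM('a))"
 have [measurable]: "\<phi> \<in> bm" using \<phi> by auto
 have F: "fourier \<phi> = (\<lambda>p. ?k * ft \<phi> p)" by (rule ext) (rule fourier_eq_ft, measurable)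
 have "dist_of v0 (fourier \<phi>) = (LINT q|lborel. v q * (?k * ft \<phi> q))" unfolding F by (rule dist_of_AE[OF ae]) measurable
 also have "... = ?k * (LINT q|lborel. v q * ft \<phi> q)" by (simp only: mult.left_commute[of _ ?k] integral_mult_right_zero)
 also have "... = ?k * (LINT p|lborel. ft v p * \<phi> p)" by (simp only: ft_multiplication[OF v \<phi>])
 also have "... = (LINT p|lborel. vhat p * \<phi> p)" by (simp only: mult.assoc integral_mult_right_zero)
 finally show ?thesis .
qed

text \<open>Write the test function as a Fourier transform and apply the multiplication formula.\<close>

lemma dist_of_schwartz:
 assumes ae: "AE x in lborel. v0 x = v x" and \<phi>: "schwartz \<phi>"
 shows "dist_of v0 \<phi> = (LINT p|lborel. vhat p * ft \<phi> (- p))"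
proof -
 let ?k = "cor (1 / (2 * pi) ^ DIM('a))"
 have [measurable]: "\<phi> \<in> bm" by (rule schwartz_measurable[OF \<phi>])
 have F: "fourier \<phi> = (\<lambda>p. ?k * ft \<phi> p)" by (rule ext) (rule fourier_eq_ft, measurable)
 have [measurable]: "fourier \<phi> \<in> bm" unfolding F by measurable
 have \<phi>F: "\<phi> q = ft (\<lambda>p. ?k * ft \<phi> (- p)) q" for q proof -
  have "\<phi> q = inv_fourier (fourier \<phi>) q" by (rule inv_fourier_fourier[OF \<phi>, symmetric])
  also have "... = ft (fourier \<phi>) (- q)" by (rule inv_fourier_eq_ft) measurable
  also have "... = ft (\<lambda>p. fourier \<phi> (- p)) q" by (rule ft_reflect) measurable
  finally show ?thesis by (simp only: F)
 qed
 have i: "integrable lborel (\<lambda>p. ?k * ft \<phi> (- p))"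
  using integrable_lborel_affine[OF ft_schwartz_integrable[OF \<phi>], of "-1" 0] by simp
 have "dist_of v0 \<phi> = (LINT q|lborel. v q * \<phi> q)" by (rule dist_of_AE[OF ae]) measurable
 also have "... = (LINT q|lborel. v q * ft (\<lambda>p. ?k * ft \<phi> (- p)) q)" by (simp only: \<phi>F[symmetric])
 also have "... = (LINT p|lborel. ft v p * (?k * ft \<phi> (- p)))" by (rule ft_multiplication[OF v i])
 also have "... = (LINT p|lborel. vhat p * ft \<phi> (- p))" by (simp only: mult_ac)
 finally show ?thesis .
qed

lemma vhat_represents:
 assumes ae: "AE x in lborel. v0 x = v x"
 shows "represents vhat (fourier_dist (dist_of v0))" unfolding represents_def
proof (intro conjI allI impI)
 show "vhat \<in> borel_measurable lebesgue" by (rule lebesgue_borel(1)[of vhat]) auto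
 fix \<phi> :: "'a => complex" assume \<phi>: "schwartz \<phi>"
 have [measurable]: "\<phi> \<in> bm" by (rule schwartz_measurable[OF \<phi>])
 have m: "(\<lambda>p. vhat p * \<phi> p) \<in> bm" by measurable
 show "integrable lebesgue (\<lambda>p. vhat p * \<phi> p)"
  using integrable_vhat_mult[OF schwartz_integrable[OF \<phi>]] by (subst lebesgue_borel(2)[OF m]) auto
 show "fourier_dist (dist_of v0) \<phi> = dist_of vhat \<phi>" unfolding fourier_dist_def dist_of_fourier[OF ae schwartz_integrable[OF \<phi>]]
  unfolding dist_of_def by (rule lebesgue_borel(3)[OF m, symmetric]) simp
qed

end

lemma sobolev_norm_eq:
 fixes g :: "'a::euclidean_space => complex"
 assumes g: "represents g (fourier_dist T)" and [measurable]: "g \<in> bm"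
 shows "sobolev_norm \<eta> T = sqrt (LINT p|lborel. (1 + (norm p)^2) powr \<eta> * (cmod (g p))^2)"
proof -
 define g' where "g' = (SOME g. represents g (fourier_dist T))"
 have "represents g' (fourier_dist T)" unfolding g'_def by (rule someI[of _ g]) (rule g)
 from represents_unique[OF this g]
 have "AE p in lborel. (1 + (norm p)^2) powr \<eta> * (cmod (g' p))^2 = (1 + (norm p)^2) powr \<eta> * (cmod (g p))^2"
  by eventually_elim simp
 then have "(LINT p|lebesgue. (1 + (norm p)^2) powr \<eta> * (cmod (g' p))^2) = (LINT p|lborel. (1 + (norm p)^2) powr \<eta> * (cmod (g p))^2)"
  by (intro lebesgue_borel(3)) measurable
 then show ?thesis unfolding sobolev_norm_def g'_def[symmetric] Let_def by (simp only:)
qed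

lemma sobolev_space_integrable:
 fixes g :: "'a::euclidean_space => complex"
 assumes g: "represents g (fourier_dist T)" and [measurable]: "g \<in> bm" and T: "T \<in> sobolev_space \<eta>"
 shows "integrable lborel (\<lambda>p. (1 + (norm p)^2) powr \<eta> * (cmod (g p))^2)"
proof -
 obtain g' where g': "represents g' (fourier_dist T)" and i: "integrable lebesgue (\<lambda>p. (1 + (norm p)^2) powr \<eta> * (cmod (g' p))^2)"
  using T unfolding sobolev_space_def by blast
 from represents_unique[OF g' g]
 have "AE p in lborel. (1 + (norm p)^2) powr \<eta> * (cmod (g' p))^2 = (1 + (norm p)^2) powr \<eta> * (cmod (g p))^2"
  by eventually_elim simp
 then show ?thesis using i by (subst (asm) lebesgue_borel(2)[of "\<lambda>p. (1 + (norm p)^2) powr \<eta> * (cmod (g p))^2"]) auto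
qed

lemma (in ball_function) sobolev_mass:
 assumes ae: "AE x in lborel. v0 x = v x" and H: "dist_of v0 \<in> sobolev_space \<nu>"
 shows "(hmass \<nu> (ft v))
  <= ennreal (((2 * pi) ^ DIM('a) * sobolev_norm \<nu> (dist_of v0))^2)"
  and "0 <= sobolev_norm \<nu> (dist_of v0)"
proof -
 let ?c = "(2 * pi) ^ DIM('a)"
 let ?f = "\<lambda>p. (1 + (norm p)^2) powr \<nu> * (cmod (vhat p))^2"
 have m: "vhat \<in> bm" by measurable
 have N: "sobolev_norm \<nu> (dist_of v0) = sqrt (LINT p|lborel. ?f p)" by (rule sobolev_norm_eq[OF vhat_represents[OF ae] m])
 have i: "integrable lborel ?f" by (rule sobolev_space_integrable[OF vhat_represents[OF ae] m H])
 have I0: "0 <= (LINT p|lborel. ?f p)" by (intro L_integral_nonneg) simp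
 show "0 <= sobolev_norm \<nu> (dist_of v0)" unfolding N using I0 by simp
 have "(1 + (norm p)^2) powr \<nu> * (cmod (ft v p))^2 = ?c^2 * ?f p" for p proof -
  have "cmod (ft v p) = ?c * cmod (vhat p)" by (simp add: norm_mult norm_divide norm_power)
  then show ?thesis by (simp only: power_mult_distrib mult_ac)
 qed
 then have "(hmass \<nu> (ft v)) = (\<integral>\<^sup>+p. ennreal (?c^2 * ?f p) \<partial>lborel)"
  by (simp only:)
 also have "... = ennreal (LINT p|lborel. ?c^2 * ?f p)" by (rule nn_integral_eq_integral) (use i in auto)
 also have "(LINT p|lborel. ?c^2 * ?f p) = ?c^2 * (LINT p|lborel. ?f p)" by (rule integral_mult_right_zero)
 also have "... = (?c * sobolev_norm \<nu> (dist_of v0))^2" unfolding N power_mult_distrib[of ?c] using I0 by simp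
 finally show "(hmass \<nu> (ft v))
  <= ennreal ((?c * sobolev_norm \<nu> (dist_of v0))^2)" by simp
qed

text \<open>
 Split $|g h|$ by $2 a b \le a^2 / x + x b^2$ with $x = |p|^{d-1}$; the decay of $h$ makes the second
 term integrable.
\<close>

lemma weighted_pairing:
 fixes g h :: "'a::euclidean_space => complex"
 assumes [measurable]: "g \<in> bm" "h \<in> bm"
  and A: "0 <= A" "(wint (\<lambda>p. ennreal ((cmod (g p))^2))) <= ennreal A"
  and B: "\<And>p. (1 + norm p) ^ DIM('a) * cmod (h p) <= B"
 shows "integrable lborel (\<lambda>p. g p * h p)"
  and "cmod (LINT p|lborel. g p * h p) <= B * (A + (LINT p|lborel. decay (p::'a)))"
proof -
 let ?w = "\<lambda>p::'a. norm p powi (1 - int DIM('a))"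
 let ?f = "\<lambda>p. ?w p * (cmod (g p))^2"
 have w0: "0 <= ?w p" for p by simp
 have "cmod (h 0) <= B" using B[of 0] by simp
 then have B0: "0 <= B" by (rule order_trans[OF norm_ge_zero])
 have le: "(\<integral>\<^sup>+p. ennreal (?f p) \<partial>lborel) <= ennreal A" using A(2) by (simp add: ennreal_mult)
 have fi: "integrable lborel ?f" unfolding integrable_iff_bounded using le by (auto simp: abs_mult intro: le_less_trans)
 have fA: "(LINT p|lborel. ?f p) <= A" using le nn_integral_eq_integral[OF fi] A(1) by (simp add: ennreal_le_iff)
 have bound: "AE p in lborel. norm (g p * h p) <= B * (?f p + decay p)" using AE_lborel_singleton[of "0::'a"] proof eventually_elim
  case (elim p)
  let ?x = "norm p ^ (DIM('a) - 1)" and ?y = "1 + norm p"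
  let ?u = "inverse (?y ^ DIM('a))"
  have x: "0 < ?x" using elim by simp
  have y: "0 < ?y" by (simp add: add_pos_nonneg)
  have "cmod (h p) = ?u * (?y ^ DIM('a) * cmod (h p))" using y by simp
  also have "... <= ?u * B" using y by (intro mult_left_mono B) simp
  finally have hp: "cmod (h p) <= ?u * B" .
  have "cmod (g p) * ?u <= inverse ?x * (cmod (g p))^2 + ?x * ?u^2" proof -
   have sq: "inverse t * (a - t * u)^2 = inverse t * a^2 + t * u^2 - 2 * (a * u)" if "0 < t" for a t u :: real
    using that by (simp add: power2_eq_square field_simps)
   have "0 <= inverse ?x * (cmod (g p) - ?x * ?u)^2" using x by simp
   also have "... = inverse ?x * (cmod (g p))^2 + ?x * ?u^2 - 2 * (cmod (g p) * ?u)" by (rule sq[OF x])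
   finally have "2 * (cmod (g p) * ?u) <= inverse ?x * (cmod (g p))^2 + ?x * ?u^2" by simp
   moreover have "0 <= cmod (g p) * ?u" using y by simp
   ultimately show ?thesis by linarith
  qed
  also have "inverse ?x * (cmod (g p))^2 = ?f p" by (simp only: power_int_dim)
  also have "?x * ?u^2 <= decay p" proof -
   have d: "?y ^ (DIM('a) + 1) * ?y ^ (DIM('a) - 1) = ?y ^ DIM('a) * ?y ^ DIM('a)" by (simp only: power_add[symmetric]) (simp add: Suc_leI)
   have "?x <= ?y ^ (DIM('a) - 1)" by (intro power_mono) auto
   then have "?x * ?u^2 <= ?y ^ (DIM('a) - 1) * ?u^2" by (rule mult_right_mono) simp
   also have "... = decay p" proof -
    have "b * (inverse c)^2 = inverse a" if "a * b = c * c" "0 < a" "0 < c" for a b c :: real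
     using that by (simp add: power2_eq_square field_simps)
    from this[OF d] show ?thesis unfolding decay_def using y by (simp only: zero_less_power)
   qed
   finally show ?thesis .
  qed
  finally have "cmod (g p) * ?u <= ?f p + decay p" by simp
  then have "B * (cmod (g p) * ?u) <= B * (?f p + decay p)" using B0 by (rule mult_left_mono)
  moreover have "norm (g p * h p) <= cmod (g p) * (?u * B)" unfolding norm_mult using hp by (rule mult_left_mono) simp
  ultimately show ?case by (simp add: mult_ac)
 qed
 have i: "integrable lborel (\<lambda>p. B * (?f p + decay p))" by (intro integrable_mult_right L_integrable_add fi integrable_decay)
 show gh: "integrable lborel (\<lambda>p. g p * h p)" proof (rule L_integrable_bound[OF i])
  show "AE p in lborel. norm (g p * h p) <= norm (B * (?f p + decay p))" using bound by eventually_elim simp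
 qed measurable
 have "cmod (LINT p|lborel. g p * h p) <= (LINT p|lborel. norm (g p * h p))" by (rule integral_norm_bound)
 also have "... <= (LINT p|lborel. B * (?f p + decay p))" using gh i bound by (intro integral_mono_AE) auto
 also have "... = B * ((LINT p|lborel. ?f p) + (LINT p|lborel. decay (p::'a)))"
  by (simp only: integral_mult_right_zero L_integral_add[OF fi integrable_decay])
 also have "... <= B * (A + (LINT p|lborel. decay (p::'a)))" using fA B0 by (intro mult_left_mono add_right_mono) auto
 finally show "cmod (LINT p|lborel. g p * h p) <= B * (A + (LINT p|lborel. decay (p::'a)))" .
qed

text \<open>
 The weight $(1 + |p|^2)^{-(d-1)/2}$ is dominated by $|p|^{1-d}$, and the pairing with $g$ is continuous
 on Schwartz functions.
\<close>

lemma sobolev_spaceI: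
 fixes g :: "'a::euclidean_space => complex"
 assumes g[measurable]: "g \<in> bm"
  and B: "0 <= B" "(wint (\<lambda>p. ennreal ((cmod (g p))^2))) <= ennreal (B^2)"
  and T1: "\<And>\<phi>. schwartz \<phi> ==> integrable lborel (\<lambda>p. g p * ft \<phi> (- p)) ==> T \<phi> = (LINT p|lborel. g p * ft \<phi> (- p))"
  and T2: "\<And>\<phi>. schwartz \<phi> ==> integrable lborel (\<lambda>p. g p * \<phi> p) ==> T (fourier \<phi>) = (LINT p|lborel. g p * \<phi> p)"
 shows "T \<in> sobolev_space (- (real DIM('a) - 1) / 2)" and "sobolev_norm (- (real DIM('a) - 1) / 2) T <= B"
proof -
 let ?\<eta> = "- (real DIM('a) - 1) / 2"
 obtain C :: real where C: "0 <= C" and dec: "\<And>(f :: 'a => complex) p. schwartz f ==>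
  (1 + norm p) ^ DIM('a) * cmod (ft f p) <= C * schwartz_norm (max DIM('a) (DIM('a) + 1)) f"
  using ft_schwartz_decay[of "DIM('a)", where ?'a='a] by blast
 let ?k = "max DIM('a) (DIM('a) + 1)"
 have [measurable]: "ft \<phi> \<in> bm" "\<phi> \<in> bm" if "schwartz \<phi>" for \<phi> :: "'a => complex"
  using schwartz_measurable[OF that] by measurable
 have Bsq: "0 <= B^2" by simp
 have pair: "integrable lborel (\<lambda>p. g p * ft \<phi> (- p))"
  "cmod (LINT p|lborel. g p * ft \<phi> (- p)) <= C * schwartz_norm ?k \<phi> * (B^2 + (LINT p|lborel. decay (p::'a)))"
  if \<phi>: "schwartz \<phi>" for \<phi> :: "'a => complex" proof -
  have m: "(\<lambda>p. ft \<phi> (- p)) \<in> bm" using \<phi> by measurable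
  have b: "(1 + norm p) ^ DIM('a) * cmod (ft \<phi> (- p)) <= C * schwartz_norm ?k \<phi>" for p using dec[OF \<phi>, of "- p"] by simp
  show "integrable lborel (\<lambda>p. g p * ft \<phi> (- p))"
   "cmod (LINT p|lborel. g p * ft \<phi> (- p)) <= C * schwartz_norm ?k \<phi> * (B^2 + (LINT p|lborel. decay (p::'a)))"
   by (rule weighted_pairing[OF g m Bsq B(2) b])+
 qed
 have gi: "integrable lborel (\<lambda>p. g p * \<phi> p)" if \<phi>: "schwartz \<phi>" for \<phi> :: "'a => complex"
 proof (rule weighted_pairing(1)[OF g _ Bsq B(2)])
  show "\<phi> \<in> bm" by (rule schwartz_measurable[OF \<phi>])
  fix p :: 'a
  have "cmod (\<phi> p) <= schwartz_norm (DIM('a) + 1) \<phi> * decay p" using schwartz_le_decay[OF \<phi>, of "[]" "DIM('a) + 1" p] by simp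
  then have "(1 + norm p) ^ DIM('a) * cmod (\<phi> p) <= (1 + norm p) ^ DIM('a) * (schwartz_norm (DIM('a) + 1) \<phi> * decay p)"
   by (rule mult_left_mono) simp
  also have "... = schwartz_norm (DIM('a) + 1) \<phi> * ((1 + norm p) ^ DIM('a) * decay p)" by (rule mult.left_commute)
  also have "... <= schwartz_norm (DIM('a) + 1) \<phi> * 1" proof (rule mult_left_mono[OF _ schwartz_norm_nonneg[OF \<phi>]])
   have "(1 + norm p) ^ DIM('a) <= (1 + norm p) ^ (DIM('a) + 1)" by (intro power_increasing) auto
   then have "(1 + norm p) ^ DIM('a) * decay p <= (1 + norm p) ^ (DIM('a) + 1) * decay p" by (rule mult_right_mono) (rule decay_pos)
   also have "... = 1" unfolding decay_def by (rule right_inverse) (simp add: add_nonneg_eq_0_iff)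
   finally show "(1 + norm p) ^ DIM('a) * decay p <= 1" .
  qed
  finally show "(1 + norm p) ^ DIM('a) * cmod (\<phi> p) <= schwartz_norm (DIM('a) + 1) \<phi>" by simp
 qed
 note T1 = T1[OF _ pair(1)] and T2 = T2[OF _ gi]
 have lin: "schwartz f ==> schwartz h ==> schwartz (\<lambda>x. f x + h x)" "schwartz f ==> schwartz (\<lambda>x. a * f x)" for f h :: "'a => complex" and a
  by (fact schwartz_add, fact schwartz_cmult)
 have ft_add: "ft (\<lambda>x. f x + h x) p = ft f p + ft h p" if "schwartz f" "schwartz h" for f h :: "'a => complex" and p
  using integrable_cis_mult(1)[OF schwartz_integrable[OF that(1)], of "\<lambda>q. p \<bullet> q"] integrable_cis_mult(1)[OF schwartz_integrable[OF that(2)], of "\<lambda>q. p \<bullet> q"]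
  by (simp add: ft_def distrib_left)
 have ft_cmult: "ft (\<lambda>x. a * f x) p = a * ft f p" for f :: "'a => complex" and a p
  by (simp only: ft_def mult.left_commute[of _ a] integral_mult_right_zero)
 have temp: "tempered T" unfolding tempered_def proof (intro conjI allI impI exI)
  fix f h :: "'a => complex" assume fh: "schwartz f" "schwartz h"
  show "T (\<lambda>x. f x + h x) = T f + T h"
   unfolding T1[OF lin(1)[OF fh] lin(1)[OF fh]] T1[OF fh(1) fh(1)] T1[OF fh(2) fh(2)] ft_add[OF fh] distrib_left
   by (rule L_integral_add[OF pair(1)[OF fh(1)] pair(1)[OF fh(2)]])
 next
  fix a and f :: "'a => complex" assume f: "schwartz f"
  show "T (\<lambda>x. a * f x) = a * T f"
   unfolding T1[OF lin(2)[OF f] lin(2)[OF f]] T1[OF f f] ft_cmult by (simp only: mult.left_commute[of _ a] integral_mult_right_zero)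
 next
  fix f :: "'a => complex" assume f: "schwartz f"
  show "cmod (T f) <= C * (B^2 + (LINT p|lborel. decay (p::'a))) * schwartz_norm ?k f"
   using pair(2)[OF f] unfolding T1[OF f f] by (simp only: mult_ac)
 qed
 have rep: "represents g (fourier_dist T)" unfolding represents_def proof (intro conjI allI impI)
  show "g \<in> borel_measurable lebesgue" by (rule lebesgue_borel(1)[OF g]) simp
  fix \<phi> :: "'a => complex" assume \<phi>: "schwartz \<phi>"
  have m: "(\<lambda>p. g p * \<phi> p) \<in> bm" using schwartz_measurable[OF \<phi>] by measurable
  show "integrable lebesgue (\<lambda>p. g p * \<phi> p)" using gi[OF \<phi>] by (subst lebesgue_borel(2)[OF m]) auto
  show "fourier_dist T \<phi> = dist_of g \<phi>"
   unfolding fourier_dist_def T2[OF \<phi> \<phi>] dist_of_def by (rule lebesgue_borel(3)[OF m, symmetric]) simp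
 qed
 let ?f = "\<lambda>p. (1 + (norm p)^2) powr ?\<eta> * (cmod (g p))^2"
 have m: "?f \<in> bm" by measurable
 have "(\<integral>\<^sup>+p. ennreal (?f p) \<partial>lborel) <= (wint (\<lambda>p. ennreal ((cmod (g p))^2)))"
 proof (rule nn_integral_mono_AE)
  show "AE p in lborel. ennreal (?f p) <= ennreal (norm p powi (1 - int DIM('a))) * ennreal ((cmod (g p))^2)"
   using AE_lborel_singleton[of "0::'a"] proof eventually_elim
   case (elim p)
   then have p: "0 < norm p" by simp
   have "(1 + (norm p)^2) powr ?\<eta> <= ((norm p)^2) powr ?\<eta>" using p by (intro powr_mono2') (auto simp: divide_simps)
   also have "((norm p)^2) powr ?\<eta> = (norm p powr 2) powr ?\<eta>" using p by simp
   also have "... = norm p powr (1 - real DIM('a))"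
    unfolding powr_powr by (rule arg_cong[of _ _ "\<lambda>t. norm p powr t"]) (simp add: field_simps)
   also have "... = norm p powi (1 - int DIM('a))" using powr_real_of_int'[of "norm p" "1 - int DIM('a)"] p by simp
   finally have "?f p <= norm p powi (1 - int DIM('a)) * (cmod (g p))^2" by (rule mult_right_mono) simp
   then show ?case by (simp add: ennreal_mult[symmetric] ennreal_leI)
  qed
 qed
 also have "... <= ennreal (B^2)" by (rule B(2))
 finally have le: "(\<integral>\<^sup>+p. ennreal (?f p) \<partial>lborel) <= ennreal (B^2)" .
 have i: "integrable lborel ?f" unfolding integrable_iff_bounded using le m by (auto simp: abs_mult intro: le_less_trans)
 then have "integrable lebesgue ?f" by (subst lebesgue_borel(2)[OF m]) auto
 then show "T \<in> sobolev_space ?\<eta>" unfolding sobolev_space_def using temp rep by blast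
 have "(LINT p|lborel. ?f p) <= B^2" using le nn_integral_eq_integral[OF i] by (simp add: ennreal_le_iff)
 then show "sobolev_norm ?\<eta> T <= B" unfolding sobolev_norm_eq[OF rep g] using B(1) by (intro real_le_lsqrt) auto
qed

section \<open>The reconstruction in Fourier space\<close>

text \<open>
 A null set meets almost every ray in a null set. Polar coordinates give this for directions of points
 of the unit ball, and once more for all points, since the set of bad directions is a cone.
\<close>

lemma AE_on_rays:
 assumes ae: "AE q in lborel. P (q::'a::euclidean_space)" and r: "r \<noteq> (0::real)"
 shows "AE p in lborel. AE x in lborel. P ((r * x) *\<^sub>R sgn (p::'a))"
proof -
 obtain N where N: "{q \<in> space lborel. \<not> P q} \<subseteq> N" "emeasure lborel N = 0" "N \<in> sets lborel" using ae by (rule AE_E)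
 have [measurable]: "N \<in> sets borel" using N(3) by simp
 have N0: "AE q in lborel. q \<notin> N" using N by (intro AE_not_in) (auto simp: null_sets_def)
 define \<Phi> where "\<Phi> \<theta> = (\<integral>\<^sup>+x. ind N ((r * x) *\<^sub>R \<theta>) \<partial>lborel)" for \<theta> :: 'a
 have [measurable]: "\<Phi> \<in> bm" unfolding \<Phi>_def[abs_def] by measurable
 have iN: "(ind N :: 'a => ennreal) \<in> bm" by measurable
 have "(wint (\<lambda>q. ind N q)) = 0" by (subst nn_integral_0_iff_AE) (measurable, use N0 in \<open>eventually_elim, simp\<close>)
 then have d0: "dirint (\<lambda>\<theta>::'a. \<integral>\<^sup>+s. ind N (s *\<^sub>R \<theta>) \<partial>lborel) = 0"
  unfolding polar_line[OF iN] by simp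
 have "(\<integral>\<^sup>+s. ind N (s *\<^sub>R \<theta>) \<partial>lborel) = ennreal \<bar>r\<bar> * \<Phi> \<theta>" for \<theta> :: 'a
  unfolding \<Phi>_def using r by (subst nn_integral_lborel_affine[of _ r 0]) simp_all
 with d0 have "dirint (\<lambda>\<theta>::'a. ennreal \<bar>r\<bar> * \<Phi> \<theta>) = 0" by simp
 then have "dirint \<Phi> = 0" using r by (subst (asm) dirint_cmult) auto
 then have ball: "AE p in lborel. ind (cball 0 1) p * \<Phi> (sgn p) = 0" unfolding dirint_def by (subst (asm) nn_integral_0_iff_AE) measurable
 (* The cone of all points whose ray meets N in a set of positive length. *)
 define Z where "Z = {p. \<Phi> (sgn p) \<noteq> 0}"
 have "{p \<in> space borel. \<Phi> (sgn p) \<noteq> 0} \<in> sets borel" by measurable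
 then have [measurable]: "Z \<in> sets borel" unfolding Z_def by simp
 have iZ: "(ind Z :: 'a => ennreal) \<in> bm" by measurable
 have "dirint (\<lambda>\<theta>::'a. \<integral>\<^sup>+s. ind {0<..} s * ind Z (s *\<^sub>R \<theta>) \<partial>lborel) = 0" unfolding dirint_def
 proof (subst nn_integral_0_iff_AE)
  show "AE p in lborel. ind (cball 0 1) p * (\<integral>\<^sup>+s. ind {0<..} s * ind Z (s *\<^sub>R sgn p) \<partial>lborel) = (0::ennreal)"
   using ball AE_lborel_singleton[of "0::'a"] proof eventually_elim
   case (elim p)
   show ?case proof (cases "p \<in> cball 0 1")
    case True
    have "ind {0<..} s * ind Z (s *\<^sub>R sgn p) = (0::ennreal)" for s :: real proof (cases "0 < s")
     case s: True
     then have "sgn (s *\<^sub>R sgn p) = sgn p" using elim(2) by (simp add: sgn_scaleR sgn_div_norm[of "sgn p"] norm_sgn)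
     then show ?thesis using elim(1) True by (simp add: Z_def)
    qed simp
    then show ?thesis by (simp only: nn_integral_const mult_zero_left mult_zero_right)
   qed simp
  qed
 qed measurable
 then have "(wint (\<lambda>q. ind Z q)) = 0" unfolding polar_half_line[OF iZ] by simp
 then have "AE q in lborel. ennreal (norm q powi (1 - int DIM('a))) * ind Z q = 0" by (subst (asm) nn_integral_0_iff_AE) measurable
 then show ?thesis using AE_lborel_singleton[of "0::'a"] proof eventually_elim
  case (elim p)
  have "0 < norm p powi (1 - int DIM('a))" using elim(2) by (simp add: power_int_dim)
  then have "\<Phi> (sgn p) = 0" using elim(1) by (auto simp: Z_def indicator_def split: if_splits)
  then have "AE x in lborel. ind N ((r * x) *\<^sub>R sgn p) = (0::ennreal)" unfolding \<Phi>_def by (subst (asm) nn_integral_0_iff_AE) measurable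
  then show ?case proof eventually_elim
   case (elim x)
   then have "(r * x) *\<^sub>R sgn p \<notin> N" by (auto simp: indicator_def split: if_splits)
   then show ?case using N(1) by auto
  qed
 qed
qed

context ball_data
begin

lemma pswf_inv_ray_data:
 assumes ae\<psi>: "\<And>j. AE x in lborel. x \<in> {-1..1} --> \<psi>0 j x = \<psi> j x"
  and \<theta>: "AE x in lborel. x \<in> {-1..1} --> w0 ((r * x) *\<^sub>R \<theta>) = w ((r * x) *\<^sub>R \<theta>)"
 shows "pswf_inv \<psi>0 ev n (ray_data r \<sigma> w0 \<theta>) y
  = (\<Sum>j\<le>n. cor (1 / \<sigma> ^ DIM('a)) * b \<theta> j * cor (\<psi>0 j y))"
proof -
 let ?s = "cor (1 / \<sigma> ^ DIM('a))" and ?P = "cor ((2 * pi) ^ DIM('a))"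
 have "(LINT x|lebesgue_on {-1..1}. cor (\<psi>0 j x) * ray_data r \<sigma> w0 \<theta> x)
  = ?s * coef (\<lambda>x. ?P * w ((r * x) *\<^sub>R \<theta>)) j" for j proof -
  have "(LINT x|lebesgue_on {-1..1}. cor (\<psi>0 j x) * ray_data r \<sigma> w0 \<theta> x)
   = (LINT x|I1. ?s * (cor (\<psi> j x) * (?P * w ((r * x) *\<^sub>R \<theta>))))" proof (rule lebesgue_on_I1(3))
   show "AE x in lborel. x \<in> {-1..1} --> cor (\<psi>0 j x) * ray_data r \<sigma> w0 \<theta> x
    = ?s * (cor (\<psi> j x) * (?P * w ((r * x) *\<^sub>R \<theta>)))" using ae\<psi>[of j] \<theta> proof eventually_elim
    case (elim x)
    have "cor ((2 * pi / \<sigma>) ^ DIM('a)) = ?s * ?P" by (simp add: power_divide)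
    then show ?case using elim by (simp add: ray_data_def mult_ac)
   qed
  qed measurable
  also have "... = ?s * coef (\<lambda>x. ?P * w ((r * x) *\<^sub>R \<theta>)) j" unfolding coef_def by (rule integral_mult_right_zero)
  finally show ?thesis .
 qed
 then show ?thesis unfolding pswf_inv_def b_def by (simp only: mult_ac)
qed

text \<open>
 The transform of a combination of eigenfunctions truncated to $[-1,1]$ is the combination of their
 transforms.
\<close>

lemma radial_fourier_radon_approx:
 assumes ae\<psi>: "\<And>j. AE x in lborel. x \<in> {-1..1} --> \<psi>0 j x = \<psi> j x"
  and \<theta>: "AE x in lborel. x \<in> {-1..1} --> w0 ((r * x) *\<^sub>R \<theta>) = w ((r * x) *\<^sub>R \<theta>)"
 shows "radial_fourier (radon_approx \<psi>0 ev r \<sigma> \<alpha> \<delta> w0) s \<theta>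
  = cor (1 / (2 * pi)) * (cor (1 / \<sigma> ^ DIM('a)) * (\<Sum>j\<le>cutoff_index c \<alpha> \<delta>. b \<theta> j * G j s))"
proof -
 let ?s = "cor (1 / \<sigma> ^ DIM('a))" and ?n = "cutoff_index c \<alpha> \<delta>"
 let ?f = "\<lambda>t. \<Sum>j\<le>?n. (?s * b \<theta> j) * (cis (s * t) * cor (\<psi> j t))"
 have aeall: "AE x in lborel. \<forall>j. x \<in> {-1..1} --> \<psi>0 j x = \<psi> j x"
  unfolding AE_all_countable using ae\<psi> by blast
 have "AE t in lborel. cis (s * t) * radon_approx \<psi>0 ev r \<sigma> \<alpha> \<delta> w0 t \<theta> = ind {-1..1} t *\<^sub>R ?f t" using aeall
 proof eventually_elim
  case (elim t)
  show ?case proof (cases "t \<in> {-1..1}")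
   case True
   then have "radon_approx \<psi>0 ev r \<sigma> \<alpha> \<delta> w0 t \<theta> = (\<Sum>j\<le>?n. ?s * b \<theta> j * cor (\<psi> j t))"
    using elim unfolding radon_approx_def pswf_inv_ray_data[OF ae\<psi> \<theta>] crs by simp
   then have "cis (s * t) * radon_approx \<psi>0 ev r \<sigma> \<alpha> \<delta> w0 t \<theta> = ?f t"
    by (simp only: sum_distrib_left mult.left_commute)
   then show ?thesis using True by simp
  qed (auto simp: radon_approx_def)
 qed
 then have "(LINT t|lebesgue. cis (s * t) * radon_approx \<psi>0 ev r \<sigma> \<alpha> \<delta> w0 t \<theta>) = (LINT t|lborel. ind {-1..1} t *\<^sub>R ?f t)"
  by (intro lebesgue_borel(3)) measurable
 also have "... = (LINT t|I1. ?f t)" by (rule integral_restrict_space[symmetric]) simp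
 also have "... = (\<Sum>j\<le>?n. (LINT t|I1. (?s * b \<theta> j) * (cis (s * t) * cor (\<psi> j t))))"
  by (intro L_integral_sum integrable_mult_right l2_integrable_mult l2_psi l2_bounded[of _ 1] measurable_I1) auto
 also have "... = (\<Sum>j\<le>?n. (?s * b \<theta> j) * G j s)" unfolding G_def by (simp only: integral_mult_right_zero)
 also have "... = ?s * (\<Sum>j\<le>?n. b \<theta> j * G j s)" by (simp only: sum_distrib_left mult.assoc)
 finally show ?thesis unfolding radial_fourier_def by (simp only:)
qed

text \<open>
 All normalising factors $2 \pi$ and $\sigma$ cancel; the directions in which the data are exceptional
 form a null set.
\<close>

lemma reconstruction_eq:
 assumes ae\<psi>: "\<And>j. AE x in lborel. x \<in> {-1..1} --> \<psi>0 j x = \<psi> j x"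
  and aew: "AE p in lborel. p \<in> ball 0 r --> w0 p = w p"
  and [measurable]: "\<phi> \<in> bm"
 shows "reconstruction \<psi>0 ev r \<sigma> \<alpha> \<delta> w0 \<phi>
  = (LINT p|lborel. (vhat p - cor (1 / (2 * pi) ^ DIM('a)) * W (cutoff_index c \<alpha> \<delta>) (\<sigma> *\<^sub>R p)) * ft \<phi> (- p))"
proof -
 let ?d = "DIM('a)" and ?n = "cutoff_index c \<alpha> \<delta>"
 let ?k = "cor (1 / (2 * pi) ^ ?d)" and ?s = "cor (1 / \<sigma> ^ ?d)"
 define U where "U p = (\<Sum>j\<le>?n. b (sgn p) j * G j (norm p))" for p
 have bm: "(\<lambda>p. b (sgn p) j) \<in> bm" for j by (rule measurable_compose[OF sgn_measurable b_measurable])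
 have [measurable]: "U \<in> bm" unfolding U_def[abs_def] by (intro borel_measurable_sum borel_measurable_times bm) measurable
 let ?F = "\<lambda>p. cor (1 / (2 * pi) ^ (?d - 1)) * radial_fourier (radon_approx \<psi>0 ev r \<sigma> \<alpha> \<delta> w0) (norm p) (p /\<^sub>R norm p)"
 have good: "AE p in lborel. AE x in lborel. x \<in> {-1..1} --> w0 ((r * x) *\<^sub>R sgn p) = w ((r * x) *\<^sub>R sgn p)" proof -
  have "AE p in lborel. AE x in lborel. (r * x) *\<^sub>R sgn p \<in> ball 0 r --> w0 ((r * x) *\<^sub>R sgn p) = w ((r * x) *\<^sub>R sgn p)"
   by (rule AE_on_rays[OF aew]) (use r in simp)
  then show ?thesis proof eventually_elim
   case (elim p)
   show ?case using elim AE_lborel_singleton[of "1::real"] AE_lborel_singleton[of "-1::real"] proof eventually_elim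
    case (elim x)
    show ?case proof
     assume "x \<in> {-1..1}"
     then have "\<bar>x\<bar> < 1" using elim by auto
     then have "r * \<bar>x\<bar> < r * 1" using r by (intro mult_strict_left_mono)
     moreover have "norm ((r * x) *\<^sub>R sgn p) <= r * \<bar>x\<bar> * 1"
      unfolding norm_scaleR abs_mult using r by (intro mult_mono) (auto simp: norm_sgn)
     ultimately show "w0 ((r * x) *\<^sub>R sgn p) = w ((r * x) *\<^sub>R sgn p)" using elim by simp
    qed
   qed
  qed
 qed
 have aeF: "AE p in lborel. ?F p = ?k * ?s * U p" using good proof eventually_elim
  case (elim p)
  have "1 / (2 * pi) ^ (?d - 1) * (1 / (2 * pi)) = 1 / (2 * pi) ^ ?d" using power_minus_mult[of ?d "2 * pi"] by (simp add: mult.commute)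
  then have "cor (1 / (2 * pi) ^ (?d - 1)) * cor (1 / (2 * pi)) = ?k" by (simp only: of_real_mult[symmetric])
  moreover have "radial_fourier (radon_approx \<psi>0 ev r \<sigma> \<alpha> \<delta> w0) (norm p) (sgn p)
   = cor (1 / (2 * pi)) * (?s * U p)" unfolding U_def by (rule radial_fourier_radon_approx[OF ae\<psi> elim])
  ultimately show ?case unfolding sgn_div_norm[symmetric] by (simp only: mult.assoc[symmetric])
 qed
 have inv: "inv_fourier (\<lambda>q. \<phi> (\<sigma> *\<^sub>R q)) p = ?s * ft \<phi> (- (p /\<^sub>R \<sigma>))" for p proof -
  have "ft \<phi> (- (p /\<^sub>R \<sigma>)) = \<bar>\<sigma>\<bar> ^ ?d *\<^sub>R (LINT q|lborel. cis (- (p /\<^sub>R \<sigma>) \<bullet> (0 + \<sigma> *\<^sub>R q)) * \<phi> (0 + \<sigma> *\<^sub>R q))"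
   unfolding ft_def by (rule integral_lborel_affine) (use \<sigma> in auto)
  also have "(LINT q|lborel. cis (- (p /\<^sub>R \<sigma>) \<bullet> (0 + \<sigma> *\<^sub>R q)) * \<phi> (0 + \<sigma> *\<^sub>R q)) = inv_fourier (\<lambda>q. \<phi> (\<sigma> *\<^sub>R q)) p"
   unfolding inv_fourier_eq_ft[of "\<lambda>q. \<phi> (\<sigma> *\<^sub>R q)", simplified] ft_def using \<sigma> by (simp add: mult.assoc[symmetric])
  finally show ?thesis using \<sigma> by (simp add: scaleR_conv_of_real)
 qed
 have "reconstruction \<psi>0 ev r \<sigma> \<alpha> \<delta> w0 \<phi> = cor (\<sigma> ^ ?d) * (LINT p|lebesgue. ?F p * inv_fourier (\<lambda>q. \<phi> (\<sigma> *\<^sub>R q)) p)"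
  unfolding reconstruction_def dilate_dist_def inv_radon_def inv_fourier_dist_def dist_of_def ..
 also have "(LINT p|lebesgue. ?F p * inv_fourier (\<lambda>q. \<phi> (\<sigma> *\<^sub>R q)) p) = (LINT p|lborel. (?k * ?s * U p) * (?s * ft \<phi> (- (p /\<^sub>R \<sigma>))))"
  unfolding inv by (rule lebesgue_borel(3)) (measurable, use aeF in \<open>eventually_elim, simp\<close>)
 also have "... = \<bar>\<sigma>\<bar> ^ ?d *\<^sub>R (LINT p|lborel. (?k * ?s * U (0 + \<sigma> *\<^sub>R p)) * (?s * ft \<phi> (- ((0 + \<sigma> *\<^sub>R p) /\<^sub>R \<sigma>))))"
  by (rule integral_lborel_affine) (use \<sigma> in auto)
 also have "... = \<bar>\<sigma>\<bar> ^ ?d *\<^sub>R (LINT p|lborel. (?s * ?s) * ((?k * U (\<sigma> *\<^sub>R p)) * ft \<phi> (- p)))"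
  using \<sigma> by (simp add: mult_ac)
 also have "... = \<bar>\<sigma>\<bar> ^ ?d *\<^sub>R ((?s * ?s) * (LINT p|lborel. (?k * U (\<sigma> *\<^sub>R p)) * ft \<phi> (- p)))"
  by (simp only: integral_mult_right_zero)
 also have "cor (\<sigma> ^ ?d) * ... = (LINT p|lborel. (?k * U (\<sigma> *\<^sub>R p)) * ft \<phi> (- p))"
  using \<sigma> by (simp add: scaleR_conv_of_real)
 also have "... = (LINT p|lborel. (vhat p - ?k * W ?n (\<sigma> *\<^sub>R p)) * ft \<phi> (- p))" proof (intro L_integral_cong refl)
  fix p
  have "V (\<sigma> *\<^sub>R p) = ft v p" using \<sigma> by (simp add: V_def)
  then have "?k * U (\<sigma> *\<^sub>R p) = vhat p - ?k * W ?n (\<sigma> *\<^sub>R p)" by (simp only: W_def U_def right_diff_distrib) simp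
  then show "(?k * U (\<sigma> *\<^sub>R p)) * ft \<phi> (- p) = (vhat p - ?k * W ?n (\<sigma> *\<^sub>R p)) * ft \<phi> (- p)" by (simp only:)
 qed
 finally show ?thesis .
qed

end

lemma weighted_dilation_le:
 fixes H :: "'a::euclidean_space => complex"
 assumes [measurable]: "H \<in> bm" and \<sigma>: "0 < \<sigma>" and E: "0 <= E"
  and le: "(wint (\<lambda>q. ennreal ((cmod (H q))^2))) <= ennreal (E^2)"
 shows "(wint (\<lambda>p. ennreal ((cmod (cor (1 / (2 * pi) ^ DIM('a)) * H (\<sigma> *\<^sub>R p)))^2)))
  <= ennreal ((1 / ((2 * pi) ^ DIM('a) * sqrt \<sigma>) * E)^2)"
proof -
 let ?k = "1 / (2 * pi) ^ DIM('a)"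
 let ?w = "\<lambda>p::'a. ennreal (norm p powi (1 - int DIM('a)))"
 let ?Y = "\<integral>\<^sup>+p. ?w p * ennreal ((cmod (H (\<sigma> *\<^sub>R p)))^2) \<partial>lborel"
 have "(\<lambda>q. ennreal ((cmod (H q))^2)) \<in> bm" by measurable
 from weighted_scaling[OF this \<sigma>] le have Y: "ennreal \<sigma> * ?Y <= ennreal (E^2)" by (simp only:)
 have "?w p * ennreal ((cmod (cor ?k * H (\<sigma> *\<^sub>R p)))^2) = ennreal (?k^2 / \<sigma>) * (ennreal \<sigma> * (?w p * ennreal ((cmod (H (\<sigma> *\<^sub>R p)))^2)))" for p
 proof -
  have "(cmod (cor ?k * H (\<sigma> *\<^sub>R p)))^2 = (?k^2 / \<sigma> * \<sigma>) * (cmod (H (\<sigma> *\<^sub>R p)))^2"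
   using \<sigma> by (simp add: norm_mult norm_divide norm_power power_mult_distrib power_divide)
  also have "ennreal ... = ennreal (?k^2 / \<sigma>) * ennreal \<sigma> * ennreal ((cmod (H (\<sigma> *\<^sub>R p)))^2)"
   using \<sigma> by (simp add: ennreal_mult del: times_divide_eq_left nonzero_divide_eq_eq)
  finally show ?thesis by (simp only: mult_ac)
 qed
 then have "(\<integral>\<^sup>+p. ?w p * ennreal ((cmod (cor ?k * H (\<sigma> *\<^sub>R p)))^2) \<partial>lborel)
  = (\<integral>\<^sup>+p. ennreal (?k^2 / \<sigma>) * (ennreal \<sigma> * (?w p * ennreal ((cmod (H (\<sigma> *\<^sub>R p)))^2))) \<partial>lborel)"
  by (simp only:)
 also have "... = ennreal (?k^2 / \<sigma>) * (\<integral>\<^sup>+p. ennreal \<sigma> * (?w p * ennreal ((cmod (H (\<sigma> *\<^sub>R p)))^2)) \<partial>lborel)"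
  by (rule nn_integral_cmult) measurable
 also have "(\<integral>\<^sup>+p. ennreal \<sigma> * (?w p * ennreal ((cmod (H (\<sigma> *\<^sub>R p)))^2)) \<partial>lborel) = ennreal \<sigma> * ?Y"
  by (rule nn_integral_cmult) measurable
 also have "ennreal (?k^2 / \<sigma>) * (ennreal \<sigma> * ?Y) <= ennreal (?k^2 / \<sigma>) * ennreal (E^2)"
  by (rule mult_left_mono[OF Y]) simp
 also have "... = ennreal (?k^2 / \<sigma> * E^2)" using \<sigma> by (intro ennreal_mult[symmetric]) auto
 also have "?k^2 / \<sigma> * E^2 = (1 / ((2 * pi) ^ DIM('a) * sqrt \<sigma>) * E)^2"
  using \<sigma> by (simp add: power_mult_distrib power_divide)
 finally show ?thesis .
qed

lemma (in ball_data) reconstruction_sobolev: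
 assumes ae: "AE x in lborel. v0 x = v x"
  and ae\<psi>: "\<And>j. AE x in lborel. x \<in> {-1..1} --> \<psi>0 j x = \<psi> j x"
  and aew: "AE p in lborel. p \<in> ball 0 r --> w0 p = w p"
  and E: "0 <= E" "(wint (\<lambda>q. ennreal ((cmod (W (cutoff_index c \<alpha> \<delta>) q))^2))) <= ennreal (E^2)"
 defines "T \<equiv> \<lambda>\<phi>. dist_of v0 \<phi> - reconstruction \<psi>0 ev r \<sigma> \<alpha> \<delta> w0 \<phi>"
 shows "T \<in> sobolev_space (- (real DIM('a) - 1) / 2)"
  and "sobolev_norm (- (real DIM('a) - 1) / 2) T <= 1 / ((2 * pi) ^ DIM('a) * sqrt \<sigma>) * E"
proof -
 let ?k = "cor (1 / (2 * pi) ^ DIM('a))"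
 define g where "g p = ?k * W (cutoff_index c \<alpha> \<delta>) (\<sigma> *\<^sub>R p)" for p
 have g[measurable]: "g \<in> bm" unfolding g_def[abs_def] by measurable
 have B0: "0 <= 1 / ((2 * pi) ^ DIM('a) * sqrt \<sigma>) * E" using E \<sigma> by simp
 have B: "(wint (\<lambda>p. ennreal ((cmod (g p))^2)))
  <= ennreal ((1 / ((2 * pi) ^ DIM('a) * sqrt \<sigma>) * E)^2)" unfolding g_def by (rule weighted_dilation_le[OF W_measurable \<sigma> E])
 have eq: "(LINT p|lborel. vhat p * h p) - (LINT p|lborel. (vhat p - g p) * h p) = (LINT p|lborel. g p * h p)"
  if h: "integrable lborel h" "integrable lborel (\<lambda>p. g p * h p)" for h unfolding left_diff_distrib
  by (subst L_integral_diff[OF integrable_vhat_mult[OF h(1)] h(2)]) simp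
 have R: "reconstruction \<psi>0 ev r \<sigma> \<alpha> \<delta> w0 \<phi> = (LINT p|lborel. (vhat p - g p) * ft \<phi> (- p))"
  if "\<phi> \<in> bm" for \<phi> unfolding g_def by (rule reconstruction_eq[OF ae\<psi> aew that])
 have T1: "T \<phi> = (LINT p|lborel. g p * ft \<phi> (- p))" if \<phi>: "schwartz \<phi>" and i: "integrable lborel (\<lambda>p. g p * ft \<phi> (- p))" for \<phi>
 proof -
  have "integrable lborel (\<lambda>p. ft \<phi> (- p))" using integrable_lborel_affine[OF ft_schwartz_integrable[OF \<phi>], of "-1" 0] by simp
  from eq[OF this i] show ?thesis unfolding T_def dist_of_schwartz[OF ae \<phi>] R[OF schwartz_measurable[OF \<phi>]] .
 qed
 have T2: "T (fourier \<phi>) = (LINT p|lborel. g p * \<phi> p)" if \<phi>: "schwartz \<phi>" and i: "integrable lborel (\<lambda>p. g p * \<phi> p)" for \<phi>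
 proof -
  have [measurable]: "\<phi> \<in> bm" by (rule schwartz_measurable[OF \<phi>])
  have "fourier \<phi> = (\<lambda>p. ?k * ft \<phi> p)" by (rule ext) (rule fourier_eq_ft, measurable)
  then have m: "fourier \<phi> \<in> bm" by simp
  have "ft (fourier \<phi>) (- p) = \<phi> p" for p using inv_fourier_eq_ft[OF m] inv_fourier_fourier[OF \<phi>] by metis
  then have "reconstruction \<psi>0 ev r \<sigma> \<alpha> \<delta> w0 (fourier \<phi>) = (LINT p|lborel. (vhat p - g p) * \<phi> p)"
   unfolding R[OF m] by (simp only:)
  with eq[OF schwartz_integrable[OF \<phi>] i] show ?thesis unfolding T_def dist_of_fourier[OF ae schwartz_integrable[OF \<phi>]] by (simp only:)
 qed
 show "T \<in> sobolev_space (- (real DIM('a) - 1) / 2)"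
  "sobolev_norm (- (real DIM('a) - 1) / 2) T <= 1 / ((2 * pi) ^ DIM('a) * sqrt \<sigma>) * E"
  by (rule sobolev_spaceI[OF g B0 B T1 T2]; assumption)+
qed

lemma (in ball_function) stability_sobolev:
 assumes ae: "AE x in lborel. v0 x = v x"
  and E: "0 <= E" "(wint (\<lambda>q. ennreal ((cmod (V q))^2))) <= ennreal (E^2)"
 shows "dist_of v0 \<in> sobolev_space (- (real DIM('a) - 1) / 2)"
  and "sobolev_norm (- (real DIM('a) - 1) / 2) (dist_of v0) <= 1 / ((2 * pi) ^ DIM('a) * sqrt \<sigma>) * E"
proof -
 have g: "vhat \<in> bm" by measurable
 have B0: "0 <= 1 / ((2 * pi) ^ DIM('a) * sqrt \<sigma>) * E" using E \<sigma> by simp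
 have V: "V (\<sigma> *\<^sub>R p) = ft v p" for p using \<sigma> by (simp add: V_def)
 have B: "(wint (\<lambda>p. ennreal ((cmod (vhat p))^2)))
  <= ennreal ((1 / ((2 * pi) ^ DIM('a) * sqrt \<sigma>) * E)^2)" using weighted_dilation_le[OF V_measurable \<sigma> E] unfolding V .
 show "dist_of v0 \<in> sobolev_space (- (real DIM('a) - 1) / 2)"
  "sobolev_norm (- (real DIM('a) - 1) / 2) (dist_of v0) <= 1 / ((2 * pi) ^ DIM('a) * sqrt \<sigma>) * E"
  by (rule sobolev_spaceI[OF g B0 B dist_of_schwartz[OF ae] dist_of_fourier[OF ae schwartz_integrable]]; assumption)+
qed

section \<open>The data norm\<close>

text \<open>In polar coordinates this is the length $r$ of a segment.\<close>

lemma integrable_weight_ball: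
 fixes r :: real
 assumes r: "0 < r"
 shows "integrable lborel (\<lambda>p::'a::euclidean_space. ind (ball 0 r) p *\<^sub>R norm p powi (1 - int DIM('a)))"
proof -
 have m: "(ind (ball 0 r) :: 'a => ennreal) \<in> bm" by measurable
 let ?X = "wint (\<lambda>q. ind (ball (0::'a) r) q)"
 have "ennreal (1 / DIM('a)) * ?X = dirint (\<lambda>\<theta>::'a. \<integral>\<^sup>+s. ind {0<..} s * ind (ball 0 r) (s *\<^sub>R \<theta>) \<partial>lborel)"
  by (rule polar_half_line[OF m, symmetric])
 also have "... <= dirint (\<lambda>\<theta>::'a. ennreal r)" proof (rule dirint_mono)
  fix \<theta> :: 'a assume "norm \<theta> = 1"
  then have "(\<integral>\<^sup>+s. ind {0<..} s * ind (ball 0 r) (s *\<^sub>R \<theta>) \<partial>lborel) <= (\<integral>\<^sup>+s. ind {0..r} s \<partial>lborel)"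
   by (intro nn_integral_mono) (auto simp: indicator_def)
  also have "... = ennreal r" using r by simp
  finally show "(\<integral>\<^sup>+s. ind {0<..} s * ind (ball 0 r) (s *\<^sub>R \<theta>) \<partial>lborel) <= ennreal r" .
 qed
 also have "... < \<infinity>" unfolding dirint_const using emeasure_lborel_cball_finite[of "0::'a" 1] by (auto simp: ennreal_mult_less_top)
 finally have "ennreal (1 / DIM('a)) * ?X < \<infinity>" .
 then have X: "?X < \<infinity>" by (auto simp: ennreal_mult_less_top)
 have "ennreal (norm (ind (ball 0 r) p *\<^sub>R norm p powi (1 - int DIM('a)))) = ennreal (norm p powi (1 - int DIM('a))) * ind (ball 0 r) p" for p :: 'a
  by (auto simp: indicator_def)
 with X show ?thesis unfolding integrable_iff_bounded by (simp only:) simp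
qed

text \<open>
 The data norm is a Bochner integral, which bounds the square integral only once integrability is known:
 $\hat v$ is bounded and the weight is locally integrable.
\<close>

lemma (in ball_function) data_norm_bound:
 fixes r E :: real
 assumes r: "0 < r" and E: "0 <= E" and [measurable]: "w \<in> bm"
  and wi: "integrable lborel (\<lambda>p. ind (ball 0 r) p *\<^sub>R (norm p powi (1 - int DIM('a)) * (cmod (w p))^2))"
  and ae: "AE p in lborel. p \<in> ball 0 r --> cmod (e0 p) = cmod (w p - vhat p)"
  and le: "data_norm r e0 <= E"
 shows "(wint (\<lambda>p. ind (cball 0 r) p * ennreal ((cmod (w p - vhat p))^2))) <= ennreal (E^2)"
proof -
 let ?w = "\<lambda>p::'a. norm p powi (1 - int DIM('a))"
 let ?f = "\<lambda>p. ind (ball 0 r) p *\<^sub>R (?w p * (cmod (w p - vhat p))^2)"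
 define M where "M = cmod (cor (1 / (2 * pi) ^ DIM('a))) * (LINT q|lborel. cmod (v q))"
 have M: "cmod (vhat p) <= M" for p unfolding M_def norm_mult by (intro mult_left_mono cmod_ft_le v) auto
 have fi: "integrable lborel ?f" proof (rule L_integrable_bound)
  show "integrable lborel (\<lambda>p. 2 * (ind (ball 0 r) p *\<^sub>R (?w p * (cmod (w p))^2)) + 2 * M^2 * (ind (ball 0 r) p *\<^sub>R ?w p))"
   by (intro L_integrable_add integrable_mult_right wi integrable_weight_ball r)
  show "AE p in lborel. norm (?f p) <= norm (2 * (ind (ball 0 r) p *\<^sub>R (?w p * (cmod (w p))^2)) + 2 * M^2 * (ind (ball 0 r) p *\<^sub>R ?w p))"
  proof (rule AE_I2)
   fix p :: 'a
   have "(cmod (w p - vhat p))^2 <= (cmod (w p) + M)^2"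
    using norm_triangle_ineq4[of "w p" "vhat p"] M[of p] by (intro power_mono) auto
   also have "... <= 2 * (cmod (w p))^2 + 2 * M^2" using sum_squares_bound[of "cmod (w p)" M] by (simp add: power2_sum)
   finally have "?w p * (cmod (w p - vhat p))^2 <= ?w p * (2 * (cmod (w p))^2 + 2 * M^2)" by (rule mult_left_mono) simp
   then have "norm (?w p * (cmod (w p - vhat p))^2) <= norm (2 * (?w p * (cmod (w p))^2) + 2 * M^2 * ?w p)"
    by (simp add: distrib_left mult_ac)
   then show "norm (?f p) <= norm (2 * (ind (ball 0 r) p *\<^sub>R (?w p * (cmod (w p))^2)) + 2 * M^2 * (ind (ball 0 r) p *\<^sub>R ?w p))"
    by (cases "p \<in> ball 0 r") (simp_all del: real_norm_def)
  qed
 qed measurable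
 have b: "ball (0::'a) r \<in> sets borel" by simp
 have m: "(\<lambda>p. ?w p * (cmod (w p - vhat p))^2) \<in> bm" by measurable
 have ae2: "AE p in lborel. p \<in> ball 0 r --> ?w p * (cmod (e0 p))^2 = ?w p * (cmod (w p - vhat p))^2"
  using ae by eventually_elim simp
 have "data_norm r e0 = sqrt (LINT p|lborel. ?f p)" unfolding data_norm_def lebesgue_on_borel(3)[OF b m ae2] ..
 with le have "sqrt (LINT p|lborel. ?f p) <= E" by simp
 then have int: "(LINT p|lborel. ?f p) <= E^2" by (rule sqrt_le_D)
 have "sphere (0::'a) r \<in> null_sets lebesgue" using negligible_sphere[of "0::'a" r] by (simp add: negligible_iff_null_sets)
 then have "AE p in lebesgue. p \<notin> sphere (0::'a) r" by (rule AE_not_in)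
 then have "AE p in lborel. p \<notin> sphere (0::'a) r" by (simp only: AE_completion_iff)
 then have "AE p in lborel. ennreal (?w p) * (ind (cball 0 r) p * ennreal ((cmod (w p - vhat p))^2)) = ennreal (?f p)" proof eventually_elim
  case (elim p)
  then have "p \<in> cball 0 r \<longleftrightarrow> p \<in> ball 0 r" by auto
  then show ?case by (cases "p \<in> ball 0 r") (simp_all add: ennreal_mult indicator_def)
 qed
 then have "(\<integral>\<^sup>+p. ennreal (?w p) * (ind (cball 0 r) p * ennreal ((cmod (w p - vhat p))^2)) \<partial>lborel) = (\<integral>\<^sup>+p. ennreal (?f p) \<partial>lborel)"
  by (rule nn_integral_cong_AE)
 also have "... = ennreal (LINT p|lborel. ?f p)" by (rule nn_integral_eq_integral[OF fi]) simp
 also have "... <= ennreal (E^2)" using int by (rule ennreal_leI)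
 finally show ?thesis .
qed

section \<open>The two estimates\<close>

text \<open>
 The constants are functions of the remaining parameters so that they can be chosen once for each triple
 $r$, $\sigma$, $\alpha$.
\<close>

definition valid_constants :: "'a::euclidean_space itself => real => real => real => (real => real) => (real => real => real) => bool" where
 "valid_constants _ r \<sigma> \<alpha> k1 k2 \<longleftrightarrow> (\<forall>\<beta>. 0 < k1 \<beta>) \<and> (\<forall>m \<mu>. 0 < k2 m \<mu>) \<and>
  (\<forall>\<beta> \<nu> \<mu>. \<beta> < 1 - \<alpha> --> 0 <= \<nu> --> 0 < \<mu> --> \<mu> < \<nu> + (real DIM('a) - 1) / 2 -->
   (\<forall>\<psi> ev. pswf_system (r * \<sigma>) \<psi> ev -->
    (\<forall>(v :: 'a => complex) \<delta> N w.
     square_integrable UNIV v --> dist_of v \<in> sobolev_space \<nu> --> ess_support v \<subseteq> ball 0 \<sigma> -->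
     0 < \<delta> --> \<delta> < 1 --> 0 < N --> w \<in> data_space r --> data_norm r (\<lambda>p. w p - fourier v p) <= \<delta> * N -->
      (\<lambda>\<phi>. dist_of v \<phi> - reconstruction \<psi> ev r \<sigma> \<alpha> \<delta> w \<phi>) \<in> sobolev_space (- (real DIM('a) - 1) / 2) \<and>
      sobolev_norm (- (real DIM('a) - 1) / 2) (\<lambda>\<phi>. dist_of v \<phi> - reconstruction \<psi> ev r \<sigma> \<alpha> \<delta> w \<phi>)
       <= k1 \<beta> * N * \<delta> powr \<beta> + k2 (\<nu> + (real DIM('a) - 1) / 2) \<mu> * sobolev_norm \<nu> (dist_of v) * ln (1 / \<delta>) powr (- \<mu>))) \<and>
   (\<forall>(v :: 'a => complex) \<delta> N.
     square_integrable UNIV v --> ess_support v \<subseteq> ball 0 \<sigma> --> dist_of v \<in> sobolev_space \<nu> -->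
     0 < \<delta> --> \<delta> < 1 --> 0 < N --> data_norm r (fourier v) <= \<delta> * N -->
      dist_of v \<in> sobolev_space (- (real DIM('a) - 1) / 2) \<and>
      sobolev_norm (- (real DIM('a) - 1) / 2) (dist_of v)
       <= k1 \<beta> * N * \<delta> powr \<beta> + k2 (\<nu> + (real DIM('a) - 1) / 2) \<mu> * sobolev_norm \<nu> (dist_of v) * ln (1 / \<delta>) powr (- \<mu>)))"

text \<open>
 Each of the two estimates yields constants; their sum serves both. The factor $(2 \pi)^d$ is the
 difference between the two normalisations of the Fourier transform.
\<close>

lemma valid_constants_exist:
 assumes r: "0 < r" and \<sigma>: "0 < \<sigma>" and \<alpha>: "0 < \<alpha>"
 shows "\<exists>k1 k2. valid_constants TYPE('a::euclidean_space) r \<sigma> \<alpha> k1 k2"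
proof -
 define c where "c = r * \<sigma>"
 have c: "0 < c" using r \<sigma> by (simp add: c_def)
 let ?h = "(2 * pi) ^ DIM('a)"
 (* The square root of \<sigma> stems from rescaling V to the Fourier transform of v. *)
 define k0 where "k0 = 1 / (?h * sqrt \<sigma>)"
 have k0: "0 < k0" using \<sigma> by (simp add: k0_def)
 have h0: "0 < ?h" by simp
 have half: "0 < (1 / 2 :: real)" "(1 / 2 :: real) < 1" by simp_all
 show ?thesis
 proof (rule reconstruction_error_le[OF r \<sigma> c_def, where ?'a='a], rule stability_error_le[OF r \<sigma>, where ?'a='a], goal_cases)
 case (1 K A \<eta> q K' A' \<eta>')
 note KA = 1(1-5) and rec = 1(6) and KA' = 1(7-9) and stab = 1(10)
 show ?case
 proof (rule error_bound_asymptotics[OF c \<sigma> \<alpha> KA], rule error_bound_asymptotics[OF c \<sigma> \<alpha> KA' half], goal_cases)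
 case (1 a1 a2 b1 b2)
 note a = 1(1,2) and aa = 1(3) and b = 1(4,5) and bb = 1(6)
 define k1 where "k1 \<beta> = k0 * (a1 \<beta> + b1 \<beta> * ?h)" for \<beta>
 define k2 where "k2 m \<mu> = k0 * ((a2 m \<mu> + b2 m \<mu>) * ?h)" for m \<mu>
 have final: "k0 * E <= k1 \<beta> * N * \<delta> powr \<beta> + k2 m \<mu> * s * ln (1 / \<delta>) powr (- \<mu>)"
  if "E <= a1 \<beta> * N * \<delta> powr \<beta> + a2 m \<mu> * (?h * s) * ln (1 / \<delta>) powr (- \<mu>)
   \<or> E <= b1 \<beta> * (?h * N) * \<delta> powr \<beta> + b2 m \<mu> * (?h * s) * ln (1 / \<delta>) powr (- \<mu>)"
   and N: "0 <= N" and s: "0 <= s" for E \<beta> N \<delta> m \<mu> s proof -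
  let ?x = "N * \<delta> powr \<beta>" and ?y = "?h * (s * ln (1 / \<delta>) powr (- \<mu>))"
  have nn: "0 <= a1 \<beta> * ?x" "0 <= b1 \<beta> * ?h * ?x" "0 <= a2 m \<mu> * ?y" "0 <= b2 m \<mu> * ?y"
   using a(1)[of \<beta>] a(2)[of m \<mu>] b(1)[of \<beta>] b(2)[of m \<mu>] N s h0 by (auto intro!: mult_nonneg_nonneg)
  have "E <= a1 \<beta> * ?x + a2 m \<mu> * ?y \<or> E <= b1 \<beta> * ?h * ?x + b2 m \<mu> * ?y" using that(1) by (simp only: mult_ac)
  then have "E <= (a1 \<beta> * ?x + b1 \<beta> * ?h * ?x) + (a2 m \<mu> * ?y + b2 m \<mu> * ?y)" using nn by linarith
  then have "k0 * E <= k0 * ((a1 \<beta> * ?x + b1 \<beta> * ?h * ?x) + (a2 m \<mu> * ?y + b2 m \<mu> * ?y))"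
   using k0 by (intro mult_left_mono) auto
  also have "... = k1 \<beta> * N * \<delta> powr \<beta> + k2 m \<mu> * s * ln (1 / \<delta>) powr (- \<mu>)"
   by (simp add: k1_def k2_def algebra_simps)
  finally show ?thesis .
 qed
 have "valid_constants TYPE('a) r \<sigma> \<alpha> k1 k2" unfolding valid_constants_def proof (intro conjI allI impI)
  show "0 < k1 \<beta>" for \<beta> unfolding k1_def using a(1)[of \<beta>] b(1)[of \<beta>] k0 h0 by (intro mult_pos_pos add_pos_pos)
  show "0 < k2 m \<mu>" for m \<mu> unfolding k2_def using a(2)[of m \<mu>] b(2)[of m \<mu>] k0 h0 by (intro mult_pos_pos add_pos_pos)
 next
  fix \<beta> \<nu> \<mu> :: real and \<psi>0 :: "nat => real => real" and ev and v0 w0 :: "'a => complex" and \<delta> N :: real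
  assume \<beta>: "\<beta> < 1 - \<alpha>" and \<nu>: "0 <= \<nu>" and \<mu>: "0 < \<mu>" "\<mu> < \<nu> + (real DIM('a) - 1) / 2"
   and sys: "pswf_system (r * \<sigma>) \<psi>0 ev" and v0: "square_integrable UNIV v0" and H: "dist_of v0 \<in> sobolev_space \<nu>"
   and supp: "ess_support v0 \<subseteq> ball 0 \<sigma>" and \<delta>: "0 < \<delta>" "\<delta> < 1" and N: "0 < N"
   and w0: "w0 \<in> data_space r" and noise: "data_norm r (\<lambda>p. w0 p - fourier v0 p) <= \<delta> * N"
  let ?m = "\<nu> + (real DIM('a) - 1) / 2" and ?n = "cutoff_index c \<alpha> \<delta>"
  have m0: "0 <= ?m" using \<mu> by linarith
  obtain \<psi> where P: "pswf c \<psi> ev" and ae\<psi>: "\<And>j. AE x in lborel. x \<in> {-1..1} --> \<psi>0 j x = \<psi> j x"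
   using pswf_representative[OF c sys[folded c_def]] by blast
  obtain v where B: "ball_function v \<sigma>" and ae: "AE x in lborel. v0 x = v x" using ball_representative[OF \<sigma> v0 supp] by blast
  have ball: "ball (0::'a) r \<in> sets borel" by simp
  obtain w where w[measurable]: "w \<in> bm" and aew: "AE p in lborel. p \<in> ball 0 r --> w0 p = w p"
   using lebesgue_on_ex_borel[OF ball, of w0] w0 unfolding data_space_def square_integrable_def by blast
  interpret pswf c \<psi> ev by (rule P)
  interpret ball_function v \<sigma> by (rule B)
  interpret ball_data c \<psi> ev v \<sigma> r w by unfold_locales (use r c_def in auto)
  have wi: "integrable lborel (\<lambda>p. ind (ball 0 r) p *\<^sub>R (norm p powi (1 - int DIM('a)) * (cmod (w p))^2))" proof -
   have "integrable (lebesgue_on (ball 0 r)) (\<lambda>p. norm p powi (1 - int DIM('a)) * (cmod (w0 p))^2)"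
    using w0 unfolding data_space_def by blast
   moreover have "AE p in lborel. p \<in> ball 0 r --> norm p powi (1 - int DIM('a)) * (cmod (w0 p))^2 = norm p powi (1 - int DIM('a)) * (cmod (w p))^2"
    using aew by eventually_elim simp
   ultimately show ?thesis
    by (subst (asm) lebesgue_on_borel(2)[OF ball, of "\<lambda>p. norm p powi (1 - int DIM('a)) * (cmod (w p))^2"]) auto
  qed
  let ?s = "sobolev_norm \<nu> (dist_of v0)"
  note mass = sobolev_mass[OF ae H]
  have M0: "0 <= ?h * ?s" using mass(2) by simp
  have \<epsilon>0: "0 <= \<delta> * N" using \<delta> N by simp
  have aeD: "AE p in lborel. p \<in> ball 0 r --> cmod (w0 p - fourier v0 p) = cmod (w p - vhat p)"
   using aew by eventually_elim (auto simp: fourier_AE[OF ae])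
  have M1: "(wint (\<lambda>p. ind (cball 0 r) p * ennreal ((cmod (D p))^2))) <= ennreal ((\<delta> * N)^2)"
   unfolding D_def by (rule data_norm_bound[OF r \<epsilon>0 w wi aeD noise])
  have BD: "ball_data c \<psi> ev v \<sigma> r w" by unfold_locales
  have n1: "1 <= ?n" using cutoff_index_bounds(1)[OF c \<alpha> \<delta>] by linarith
  let ?E = "error_bound K A \<eta> q \<sigma> ?m ?n (\<delta> * N) (?h * ?s)"
  have E0: "0 <= ?E" by (rule error_bound_nonneg) (use KA \<sigma> \<epsilon>0 M0 in auto)
  have E: "(wint (\<lambda>q. ennreal ((cmod (W ?n q))^2))) <= ennreal (?E^2)"
   by (rule rec[OF BD n1 \<nu> refl m0 \<epsilon>0 M0 mass(1) M1])
  note res = reconstruction_sobolev[OF ae ae\<psi> aew E0 E]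
  show "(\<lambda>\<phi>. dist_of v0 \<phi> - reconstruction \<psi>0 ev r \<sigma> \<alpha> \<delta> w0 \<phi>) \<in> sobolev_space (- (real DIM('a) - 1) / 2)"
   by (rule res(1))
  have "?E <= a1 \<beta> * N * \<delta> powr \<beta> + a2 ?m \<mu> * (?h * ?s) * ln (1 / \<delta>) powr (- \<mu>)"
   by (rule aa[OF \<beta> \<mu> \<delta> less_imp_le[OF N] M0])
  then have "k0 * ?E <= k1 \<beta> * N * \<delta> powr \<beta> + k2 ?m \<mu> * ?s * ln (1 / \<delta>) powr (- \<mu>)"
   using N mass(2) by (intro final) auto
  with res(2) show "sobolev_norm (- (real DIM('a) - 1) / 2) (\<lambda>\<phi>. dist_of v0 \<phi> - reconstruction \<psi>0 ev r \<sigma> \<alpha> \<delta> w0 \<phi>)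
   <= k1 \<beta> * N * \<delta> powr \<beta> + k2 ?m \<mu> * ?s * ln (1 / \<delta>) powr (- \<mu>)" unfolding k0_def by (rule order_trans)
 next
  fix \<beta> \<nu> \<mu> :: real and v0 :: "'a => complex" and \<delta> N :: real
  assume \<beta>: "\<beta> < 1 - \<alpha>" and \<nu>: "0 <= \<nu>" and \<mu>: "0 < \<mu>" "\<mu> < \<nu> + (real DIM('a) - 1) / 2"
   and v0: "square_integrable UNIV v0" and supp: "ess_support v0 \<subseteq> ball 0 \<sigma>" and H: "dist_of v0 \<in> sobolev_space \<nu>"
   and \<delta>: "0 < \<delta>" "\<delta> < 1" and N: "0 < N" and noise: "data_norm r (fourier v0) <= \<delta> * N"
  let ?m = "\<nu> + (real DIM('a) - 1) / 2" and ?n = "cutoff_index c \<alpha> \<delta>"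
  have m0: "0 <= ?m" using \<mu> by linarith
  obtain v where B: "ball_function v \<sigma>" and ae: "AE x in lborel. v0 x = v x" using ball_representative[OF \<sigma> v0 supp] by blast
  interpret ball_function v \<sigma> by (rule B)
  let ?s = "sobolev_norm \<nu> (dist_of v0)"
  note mass = sobolev_mass[OF ae H]
  have M0: "0 <= ?h * ?s" using mass(2) by simp
  have \<epsilon>0: "0 <= \<delta> * N" "0 <= \<delta> * (?h * N)" using \<delta> N by simp_all
  have hN: "0 <= ?h * N" using N by simp
  let ?w = "\<lambda>p::'a. ennreal (norm p powi (1 - int DIM('a)))"
  have "(\<integral>\<^sup>+p. ?w p * (ind (cball 0 r) p * ennreal ((cmod (0 - vhat p))^2)) \<partial>lborel) <= ennreal ((\<delta> * N)^2)"
  proof (rule data_norm_bound[OF r \<epsilon>0(1) _ _ _ noise])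
   show "AE p in lborel. p \<in> ball 0 r --> cmod (fourier v0 p) = cmod (0 - vhat p)" unfolding fourier_AE[OF ae] by simp
  qed simp_all
  then have "ennreal (?h^2) * (\<integral>\<^sup>+p. ?w p * (ind (cball 0 r) p * ennreal ((cmod (0 - vhat p))^2)) \<partial>lborel) <= ennreal (?h^2) * ennreal ((\<delta> * N)^2)"
   by (rule mult_left_mono) simp
  also have "... = ennreal ((\<delta> * (?h * N))^2)" proof -
   have "(\<delta> * (?h * N))^2 = ?h^2 * (\<delta> * N)^2" by (simp only: power_mult_distrib mult_ac)
   then show ?thesis by (simp only: ennreal_mult zero_le_power2)
  qed
  also have "ennreal (?h^2) * (\<integral>\<^sup>+p. ?w p * (ind (cball 0 r) p * ennreal ((cmod (0 - vhat p))^2)) \<partial>lborel)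
   = (\<integral>\<^sup>+p. ennreal (?h^2) * (?w p * (ind (cball 0 r) p * ennreal ((cmod (0 - vhat p))^2))) \<partial>lborel)"
   by (rule nn_integral_cmult[symmetric]) measurable
  also have "... = (\<integral>\<^sup>+p. ?w p * (ind (cball 0 r) p * ennreal ((cmod (ft v p))^2)) \<partial>lborel)"
  proof (rule nn_integral_cong)
   fix p :: 'a
   have e: "cmod (ft v p) = ?h * cmod (0 - vhat p)" by (simp add: norm_mult norm_divide norm_power)
   have "ennreal ((cmod (ft v p))^2) = ennreal (?h^2) * ennreal ((cmod (0 - vhat p))^2)"
    by (simp only: e power_mult_distrib[of ?h "cmod (0 - vhat p)"] ennreal_mult zero_le_power2)
   then show "ennreal (?h^2) * (?w p * (ind (cball 0 r) p * ennreal ((cmod (0 - vhat p))^2)))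
    = ?w p * (ind (cball 0 r) p * ennreal ((cmod (ft v p))^2))" by (simp only: mult_ac)
  qed
  finally have M1: "(\<integral>\<^sup>+p. ?w p * (ind (cball 0 r) p * ennreal ((cmod (ft v p))^2)) \<partial>lborel) <= ennreal ((\<delta> * (?h * N))^2)" .
  let ?E = "error_bound K' A' \<eta>' (1 / 2) \<sigma> ?m ?n (\<delta> * (?h * N)) (?h * ?s)"
  have E0: "0 <= ?E" by (rule error_bound_nonneg) (use KA' \<sigma> \<epsilon>0 M0 in auto)
  have E: "(\<integral>\<^sup>+q. ?w q * ennreal ((cmod (V q))^2) \<partial>lborel) <= ennreal (?E^2)"
   by (rule stab[OF B \<nu> refl m0 \<epsilon>0(2) M0 mass(1) M1])
  note res = stability_sobolev[OF ae E0 E]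
  show "dist_of v0 \<in> sobolev_space (- (real DIM('a) - 1) / 2)" by (rule res(1))
  have "?E <= b1 \<beta> * (?h * N) * \<delta> powr \<beta> + b2 ?m \<mu> * (?h * ?s) * ln (1 / \<delta>) powr (- \<mu>)"
   by (rule bb[OF \<beta> \<mu> \<delta> hN M0])
  then have "k0 * ?E <= k1 \<beta> * N * \<delta> powr \<beta> + k2 ?m \<mu> * ?s * ln (1 / \<delta>) powr (- \<mu>)"
   using N mass(2) by (intro final) auto
  with res(2) show "sobolev_norm (- (real DIM('a) - 1) / 2) (dist_of v0)
   <= k1 \<beta> * N * \<delta> powr \<beta> + k2 ?m \<mu> * ?s * ln (1 / \<delta>) powr (- \<mu>)" unfolding k0_def by (rule order_trans)
 qed
 then show ?case by blast
 qed
 qed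
qed

theorem corollary1p5:
  shows "\<exists>(\<kappa>\<^sub>1 :: real \<Rightarrow> real \<Rightarrow> real \<Rightarrow> real \<Rightarrow> real \<Rightarrow> real)
          (\<kappa>\<^sub>2 :: real \<Rightarrow> real \<Rightarrow> real \<Rightarrow> real \<Rightarrow> real \<Rightarrow> real \<Rightarrow> real).
    \<forall>r \<sigma> c \<alpha> \<beta> \<nu> \<mu>.
      0 < r \<longrightarrow> 0 < \<sigma> \<longrightarrow> c = r * \<sigma> \<longrightarrow>
      0 \<le> \<nu> \<longrightarrow> (DIM('a::euclidean_space) = 1 \<longrightarrow> 0 < \<nu>) \<longrightarrow>
      0 < \<alpha> \<longrightarrow> \<alpha> < 1 \<longrightarrow>
      0 < \<beta> \<longrightarrow> \<beta> < 1 - \<alpha> \<longrightarrow>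
      0 < \<mu> \<longrightarrow> \<mu> < \<nu> + (real DIM('a) - 1) / 2 \<longrightarrow>
        0 < \<kappa>\<^sub>1 c r \<sigma> \<alpha> \<beta> \<and> 0 < \<kappa>\<^sub>2 c r \<sigma> \<alpha> \<nu> \<mu> \<and>
        (\<forall>\<psi> ev. pswf_system c \<psi> ev \<longrightarrow>
          (\<forall>(v :: 'a \<Rightarrow> complex) \<delta> N w.
            square_integrable UNIV v \<longrightarrow>
            dist_of v \<in> sobolev_space \<nu> \<longrightarrow>
            ess_support v \<subseteq> ball 0 \<sigma> \<longrightarrow>
            0 < \<delta> \<longrightarrow> \<delta> < 1 \<longrightarrow> 0 < N \<longrightarrow>
            w \<in> data_space r \<longrightarrow>
            data_norm r (\<lambda>p. w p - fourier v p) \<le> \<delta> * N \<longrightarrow>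
              (\<lambda>\<phi>. dist_of v \<phi> - reconstruction \<psi> ev r \<sigma> \<alpha> \<delta> w \<phi>)
                \<in> sobolev_space (- (real DIM('a) - 1) / 2) \<and>
              sobolev_norm (- (real DIM('a) - 1) / 2)
                  (\<lambda>\<phi>. dist_of v \<phi> - reconstruction \<psi> ev r \<sigma> \<alpha> \<delta> w \<phi>)
                \<le> \<kappa>\<^sub>1 c r \<sigma> \<alpha> \<beta> * N * \<delta> powr \<beta>
                  + \<kappa>\<^sub>2 c r \<sigma> \<alpha> \<nu> \<mu> * sobolev_norm \<nu> (dist_of v) * ln (1 / \<delta>) powr (- \<mu>))) \<and>
        (\<forall>(v\<^sub>1 :: 'a \<Rightarrow> complex) (v\<^sub>2 :: 'a \<Rightarrow> complex) \<delta> N.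
          square_integrable UNIV (\<lambda>q. v\<^sub>1 q - v\<^sub>2 q) \<longrightarrow>
          ess_support (\<lambda>q. v\<^sub>1 q - v\<^sub>2 q) \<subseteq> ball 0 \<sigma> \<longrightarrow>
          dist_of (\<lambda>q. v\<^sub>1 q - v\<^sub>2 q) \<in> sobolev_space \<nu> \<longrightarrow>
          0 < \<delta> \<longrightarrow> \<delta> < 1 \<longrightarrow> 0 < N \<longrightarrow>
          data_norm r (fourier (\<lambda>q. v\<^sub>1 q - v\<^sub>2 q)) \<le> \<delta> * N \<longrightarrow>
            dist_of (\<lambda>q. v\<^sub>1 q - v\<^sub>2 q) \<in> sobolev_space (- (real DIM('a) - 1) / 2) \<and>
            sobolev_norm (- (real DIM('a) - 1) / 2) (dist_of (\<lambda>q. v\<^sub>1 q - v\<^sub>2 q))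
              \<le> \<kappa>\<^sub>1 c r \<sigma> \<alpha> \<beta> * N * \<delta> powr \<beta>
                + \<kappa>\<^sub>2 c r \<sigma> \<alpha> \<nu> \<mu> * sobolev_norm \<nu> (dist_of (\<lambda>q. v\<^sub>1 q - v\<^sub>2 q))
                    * ln (1 / \<delta>) powr (- \<mu>))"
proof -
 have "\<exists>k. 0 < r --> 0 < \<sigma> --> 0 < \<alpha> --> valid_constants TYPE('a) r \<sigma> \<alpha> (fst k) (snd k)" for r \<sigma> \<alpha>
  using valid_constants_exist[of r \<sigma> \<alpha>, where ?'a='a] by (metis fst_conv snd_conv)
 then obtain k where k: "\<And>r \<sigma> \<alpha>. 0 < r ==> 0 < \<sigma> ==> 0 < \<alpha> ==>
   valid_constants TYPE('a) r \<sigma> \<alpha> (fst (k r \<sigma> \<alpha>)) (snd (k r \<sigma> \<alpha>))" by metis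
 show ?thesis
 proof (rule exI[of _ "\<lambda>c r \<sigma> \<alpha> \<beta>. fst (k r \<sigma> \<alpha>) \<beta>"], rule exI[of _ "\<lambda>c r \<sigma> \<alpha> \<nu> \<mu>. snd (k r \<sigma> \<alpha>) (\<nu> + (real DIM('a) - 1) / 2) \<mu>"],
   intro allI impI, goal_cases)
  case (1 r \<sigma> c \<alpha> \<beta> \<nu> \<mu>)
  note V = k[OF 1(1,2,6), unfolded valid_constants_def]
  note V3 = V[THEN conjunct2, THEN conjunct2, THEN spec[of _ \<beta>], THEN spec[of _ \<nu>], THEN spec[of _ \<mu>],
    THEN mp, OF 1(9), THEN mp, OF 1(4), THEN mp, OF 1(10), THEN mp, OF 1(11)]
  show ?case unfolding 1(3) by (intro conjI V[THEN conjunct1, THEN spec] V[THEN conjunct2, THEN conjunct1, THEN spec, THEN spec]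
     V3[THEN conjunct1] allI V3[THEN conjunct2, THEN spec])
 qed
qed

end
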